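(* Let $\pi:Q\to M=Q/G$ be a right principal $G$-bundle equipped with a horizontal distribution $\mathrm{H}Q\subset \mathrm{T}Q$ and a smooth Lagrangian $L:\mathrm{T}Q\to\mathbb{R}$. Assume that the constraints $\mathrm HQ$ are $G$-invariant, i.e. $(R_g)_*\widetilde X_q=\widetilde X_{q\cdot g}$ for any $g\in G$ and $X\in\mathrm T_{\pi(q)}M$. Then $\mathcal B\equiv0$, and thus, for a horizontal admissible path $\widetilde X(t)\in\mathrm H_{q(t)}Q$: (i) The standard admissible variation $\delta_{\xi}\widetilde X$ generated by $\xi(t)=\widetilde Y(t)+\widetilde b(t)$, with $\widetilde Y(t)\in\mathrm H_{q(t)}Q$ and $b(t)\in\mathfrak g$, is vakonomic if and only if $\dot b(t)+\mathcal R(q(t))(X(t),Y(t))=0$. (ii) If $\widetilde X(t)$ is a nonholonomic extremal, it is an unconstrained extremal if and only if $\frac{\mathrm d}{\mathrm dt}\mathrm FL(\widetilde X(t))=\mathrm HL(\widetilde X(t))$ for every $t\in[t_0,t_1]$. (iii) If $\widetilde X(t)$ is a vakonomic extremal associated with a Lagrange multiplier $\lambda(t)\in\mathfrak g^*$, then $\lambda(t)$ is a solution of the equation $\frac{\mathrm d}{\mathrm dt}\big(\mathrm FL(\widetilde X(t))-\lambda(t)\big)=\mathrm HL(\widetilde X(t))$.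
   Context: Everything is $C^\infty$; $I=[t_0,t_1]$ is a fixed interval; $R_g(q)=q\cdot g$. Variations. $\kappa_Q:\mathrm{TT}Q\to\mathrm{TT}Q$ is the canonical flip, $(q^a,\dot q^b,q'^c,\dot q'^d)\mapsto(q^a,q'^b,\dot q^c,\dot q'^d)$ in induced coordinates. If $\gamma(t)\in\mathrm{T}Q$ is the tangent lift of a curve $q(t)\in Q$ and $\xi(t)\in\mathrm{T}_{q(t)}Q$ is a curve (generator), the standard admissible variation generated by $\xi$ is $\delta_{\xi}\gamma(t)=\kappa_Q(\mathrm{T}_t\xi(t))\in\mathrm{T}_{\gamma(t)}\mathrm{T}Q$, where $\mathrm{T}_t\xi(t)\in\mathrm{TT}Q$ is the tangent lift of the curve $\xi$. The variation of the action is $\langle \mathrm{d}S_L(\gamma),\delta\gamma\rangle=\int_I\langle \mathrm{d}L(\gamma(t)),\delta\gamma(t)\rangle\,\mathrm{d}t$ (for a time-dependent Lagrangian, differentiate in the $\mathrm{T}Q$ variable). Chaplygin system. $\mathrm{V}Q=\ker\pi_*$; a horizontal distribution is a smooth distribution with $\mathrm{T}_qQ=\mathrm{H}_qQ\oplus\mathrm{V}_qQ$ for all $q$. A horizontal admissible path is a curve $\widetilde X(t)\in\mathrm{H}_{q(t)}Q$ which is the tangent lift of a curve $q(t)$. A variation $\delta_\xi\widetilde X$ is vakonomic if $\delta_{\xi}\widetilde X(t)\in\mathrm{T}_{\widetilde X(t)}\mathrm{H}Q$ for all $t$. A horizontal admissible path is an unconstrained extremal (for a possibly time-dependent Lagrangian)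 if $\langle\mathrm{d}S_L(\widetilde X),\delta_\xi\widetilde X\rangle=0$ for all generators $\xi(t)\in\mathrm{T}_{q(t)}Q$ with $\xi(t_0)=\xi(t_1)=0$; a nonholonomic extremal if this holds for all such $\xi$ with $\xi(t)\in\mathrm{H}_{q(t)}Q$; a vakonomic extremal associated with a multiplier $\lambda:I\to\mathfrak g^*$ if it is an unconstrained extremal for $\widetilde L(Z,t)=L(Z)-\langle\lambda(t),\omega(Z)\rangle$. Notation. $\mathfrak g=\mathrm{T}_eG$ carries the left Lie algebra structure. For $a\in\mathfrak g$, $\widetilde a$ is the fundamental vector field on $Q$, with flow $q\mapsto q\cdot\exp(ta)$; this identifies $\mathrm{V}Q\approx Q\times\mathfrak g$; $\widetilde b(t)$ denotes the fundamental field of $b(t)$ at $q(t)$. $\omega:\mathrm{T}Q\to\mathfrak g$ is the projection onto the $\mathfrak g$-part in $\mathrm{T}Q=\mathrm{H}Q\oplus_Q(Q\times\mathfrak g)$. For $X\in\mathrm{T}_xM$ and $q\in\pi^{-1}(x)$, $\widetilde X_q\in\mathrm{H}_qQ$ is the horizontal lift. $X(t)=\pi_*\widetilde X(t)$, $Y(t)=\pi_*\widetilde Y(t)$. Maps (tensorial, so defined by extending $X,Y$ to vector fields on $M$): curvature $\mathcal R(q)(X,Y)=\omega([\widetilde X,\widetilde Y]-\widetilde{[X,Y]})(q)$, and $\mathcal B(q)(X,a)=\omega([\widetilde X,\widetilde a])(q)$. Derivatives of $L$: $\mathrm{F}L,\mathrm{H}L:\mathrm{H}Q\to\mathfrak g^*$,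 $\langle\mathrm{F}L(\widetilde X_q),b\rangle=\frac{\mathrm d}{\mathrm dt}\big|_0L(\widetilde X_q+t\,\widetilde b_q)$ and $\langle\mathrm{H}L(\widetilde X_q),b\rangle=\frac{\mathrm d}{\mathrm dt}\big|_0L(\widetilde X_{q\cdot\exp(tb)})$, where $\widetilde X_{q\cdot \exp(tb)}$ is the horizontal lift of the same $X$ to the point $q\cdot\exp(tb)$. *)

theory Defs
  imports "HOL-Analysis.Analysis" "HOL-Algebra.Group"
begin

section \<open>Smooth maps between normed spaces\<close>

text \<open>
  Derivatives are taken within the domain. This is only used for open sets and for (relatively
  open subsets of) nondegenerate real intervals, where the derivative within the set is unique;
  at an end point of an interval it is the one-sided derivative. On finite-dimensional spaces
  continuity of all iterated directional derivatives is continuity of the iterated derivatives.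
\<close>

primrec Ck_on :: "nat \<Rightarrow> 'a::real_normed_vector set \<Rightarrow> ('a \<Rightarrow> 'b::real_normed_vector) \<Rightarrow> bool" where
  "Ck_on 0 S f \<longleftrightarrow> continuous_on S f"
| "Ck_on (Suc k) S f \<longleftrightarrow> (\<forall>x\<in>S. f differentiable (at x within S)) \<and>
     (\<forall>v. Ck_on k S (\<lambda>x. frechet_derivative f (at x within S) v))"

definition smooth_on :: "'a::real_normed_vector set \<Rightarrow> ('a \<Rightarrow> 'b::real_normed_vector) \<Rightarrow> bool" where
  "smooth_on S f \<longleftrightarrow> (\<forall>k. Ck_on k S f)"


section \<open>Manifolds\<close>

text \<open>
  A manifold lives on a whole type \<open>'q\<close> and is modelled on a normed space \<open>'e\<close>, required below to
  be finite-dimensional; \<open>'e\<close> may be the zero space, which class \<open>euclidean_space\<close> would exclude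
  (class \<open>banach\<close> is no restriction in finite dimension). A chart is a pair of its domain and its
  coordinate map. The field \<open>chart_at\<close> selects a preferred chart of the atlas around each point. The
  selection is arbitrary and serves only to represent tangent vectors: the tangent space at \<open>x\<close> is
  \<open>'e\<close>, a vector being given by its components in the chart \<open>chart_at A x\<close>.
\<close>

type_synonym ('q, 'e) chart = "'q set \<times> ('q \<Rightarrow> 'e)"

abbreviation chart_inv :: "('q, 'e) chart \<Rightarrow> 'e \<Rightarrow> 'q" where
  "chart_inv c \<equiv> inv_into (fst c) (snd c)"

record ('q, 'e) manifold =
  atlas :: "('q, 'e) chart set"
  chart_at :: "'q \<Rightarrow> ('q, 'e) chart"

definition mtop :: "('q, 'e::topological_space) manifold \<Rightarrow> 'q topology" where
  "mtop A = topology (\<lambda>U. \<forall>c\<in>atlas A. open (snd c ` (U \<inter> fst c)))"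

definition smooth_manifold :: "('q, 'e::banach) manifold \<Rightarrow> bool" where
  "smooth_manifold A \<longleftrightarrow>
     (\<exists>B::'e set. finite B \<and> span B = UNIV) \<and>
     (\<forall>c\<in>atlas A. inj_on (snd c) (fst c)) \<and>
     (\<forall>c\<in>atlas A. \<forall>d\<in>atlas A. open (snd c ` (fst c \<inter> fst d)) \<and>
        smooth_on (snd c ` (fst c \<inter> fst d)) (snd d \<circ> chart_inv c)) \<and>
     (\<forall>x. chart_at A x \<in> atlas A \<and> x \<in> fst (chart_at A x)) \<and>
     Hausdorff_space (mtop A) \<and> second_countable (mtop A)"

text \<open>
  The domain \<open>S\<close> is an open set or, in the flat manifold \<open>real\<close>, an interval. Since
  \<open>V\<close> is open, the condition includes continuity.
\<close>

definition smooth_map ::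
  "('q, 'e::real_normed_vector) manifold \<Rightarrow> 'q set \<Rightarrow> ('r, 'f::real_normed_vector) manifold \<Rightarrow>
   ('q \<Rightarrow> 'r) \<Rightarrow> bool" where
  "smooth_map A S B f \<longleftrightarrow>
     (\<forall>x\<in>S. \<exists>c\<in>atlas A. \<exists>d\<in>atlas B. \<exists>V. openin (mtop A) V \<and> x \<in> V \<and> V \<subseteq> fst c \<and>
        f ` (V \<inter> S) \<subseteq> fst d \<and> smooth_on (snd c ` (V \<inter> S)) (snd d \<circ> f \<circ> chart_inv c))"

definition flat :: "('v, 'v) manifold" where
  "flat = \<lparr>atlas = {(UNIV, id)}, chart_at = (\<lambda>_. (UNIV, id))\<rparr>"

definition prod_manifold ::
  "('q, 'e) manifold \<Rightarrow> ('r, 'f) manifold \<Rightarrow> ('q \<times> 'r, 'e \<times> 'f) manifold" where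
  "prod_manifold A B =
     (let pc = (\<lambda>c d. (fst c \<times> fst d, map_prod (snd c) (snd d))) in
      \<lparr>atlas = {pc c d |c d. c \<in> atlas A \<and> d \<in> atlas B},
       chart_at = (\<lambda>(x, y). pc (chart_at A x) (chart_at B y))\<rparr>)"

definition diffeo ::
  "('q, 'e::real_normed_vector) manifold \<Rightarrow> 'q set \<Rightarrow> ('r, 'f::real_normed_vector) manifold \<Rightarrow>
   'r set \<Rightarrow> ('q \<Rightarrow> 'r) \<Rightarrow> bool" where
  "diffeo A S B T f \<longleftrightarrow> bij_betw f S T \<and> smooth_map A S B f \<and> smooth_map B T A (inv_into S f)"


section \<open>Tangent vectors\<close>

definition differential ::
  "('q, 'e::real_normed_vector) manifold \<Rightarrow> ('r, 'f::real_normed_vector) manifold \<Rightarrow>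
   ('q \<Rightarrow> 'r) \<Rightarrow> 'q \<Rightarrow> 'e \<Rightarrow> 'f" where
  "differential A B f x = frechet_derivative
     (snd (chart_at B (f x)) \<circ> f \<circ> chart_inv (chart_at A x)) (at (snd (chart_at A x) x))"

text \<open>
  A point of the tangent bundle is \<open>(q, v)\<close> with \<open>v\<close> in the tangent space at \<open>q\<close>. The chart \<open>c\<close>
  induces the chart sending \<open>(q, v)\<close> to the coordinates of \<open>q\<close> and the components of the vector in
  \<open>c\<close>, obtained from those in \<open>chart_at A q\<close> by the derivative of the transition map.
  If \<open>c = chart_at A q\<close> then the components of \<open>(q, v)\<close> are \<open>v\<close> itself.
\<close>

definition tangent_chart ::
  "('q, 'e::real_normed_vector) manifold \<Rightarrow> ('q, 'e) chart \<Rightarrow> ('q \<times> 'e, 'e \<times> 'e) chart" where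
  "tangent_chart A c =
     (fst c \<times> UNIV,
      \<lambda>(q, v). (snd c q, frechet_derivative (snd c \<circ> chart_inv (chart_at A q))
                           (at (snd (chart_at A q) q)) v))"

definition tangent_bundle ::
  "('q, 'e::real_normed_vector) manifold \<Rightarrow> ('q \<times> 'e, 'e \<times> 'e) manifold" where
  "tangent_bundle A = \<lparr>atlas = tangent_chart A ` atlas A,
                       chart_at = (\<lambda>(q, v). tangent_chart A (chart_at A q))\<rparr>"

definition tangent_lift ::
  "('q, 'e::real_normed_vector) manifold \<Rightarrow> real set \<Rightarrow> (real \<Rightarrow> 'q) \<Rightarrow> real \<Rightarrow> 'q \<times> 'e" where
  "tangent_lift A I c t =
     (c t, vector_derivative (snd (chart_at A (c t)) \<circ> c) (at t within I))"

text \<open>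
  An element \<open>((q, v), (w, z))\<close> of the double tangent bundle has the coordinates
  \<open>(q, v, w, z)\<close> in the chart induced by \<open>chart_at A q\<close>, so the coordinate expression of the flip
  is as follows.
\<close>

definition canonical_flip :: "('q \<times> 'e) \<times> ('e \<times> 'e) \<Rightarrow> ('q \<times> 'e) \<times> ('e \<times> 'e)" where
  "canonical_flip = (\<lambda>((q, v), (w, z)). ((q, w), (v, z)))"

text \<open>
  Tangent space at \<open>x\<close> of an embedded submanifold \<open>S\<close>: velocities of curves contained in \<open>S\<close>.
\<close>

definition tangent_space_of ::
  "('q, 'e::real_normed_vector) manifold \<Rightarrow> 'q set \<Rightarrow> 'q \<Rightarrow> ('q \<times> 'e) set" where
  "tangent_space_of A S x =
     {tangent_lift A {-\<epsilon><..<\<epsilon>} c 0 |\<epsilon> c.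
        \<epsilon> > 0 \<and> smooth_map flat {-\<epsilon><..<\<epsilon>} A c \<and> c ` {-\<epsilon><..<\<epsilon>} \<subseteq> S \<and> c 0 = x}"

definition smooth_vector_field ::
  "('q, 'e::real_normed_vector) manifold \<Rightarrow> 'q set \<Rightarrow> ('q \<Rightarrow> 'e) \<Rightarrow> bool" where
  "smooth_vector_field A U X \<longleftrightarrow> smooth_map A U (tangent_bundle A) (\<lambda>q. (q, X q))"

text \<open>
  Components of a vector field in the chart \<open>c\<close>, as a function of the coordinates.
\<close>

definition local_rep ::
  "('q, 'e::real_normed_vector) manifold \<Rightarrow> ('q, 'e) chart \<Rightarrow> ('q \<Rightarrow> 'e) \<Rightarrow> 'e \<Rightarrow> 'e" where
  "local_rep A c X x = (let p = chart_inv c x in snd (snd (tangent_chart A c) (p, X p)))"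

definition lie_bracket ::
  "('q, 'e::real_normed_vector) manifold \<Rightarrow> ('q \<Rightarrow> 'e) \<Rightarrow> ('q \<Rightarrow> 'e) \<Rightarrow> 'q \<Rightarrow> 'e" where
  "lie_bracket A X Y q =
     (let c = chart_at A q; x = snd c q; X' = local_rep A c X; Y' = local_rep A c Y in
      frechet_derivative Y' (at x) (X' x) - frechet_derivative X' (at x) (Y' x))"


section \<open>Principal bundles\<close>

definition lie_group :: "('g, 'h::banach) manifold \<Rightarrow> 'g monoid \<Rightarrow> bool" where
  "lie_group \<G> G \<longleftrightarrow>
     smooth_manifold \<G> \<and> group G \<and> carrier G = UNIV \<and>
     smooth_map (prod_manifold \<G> \<G>) UNIV \<G> (\<lambda>(g, h). g \<otimes>\<^bsub>G\<^esub> h) \<and>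
     smooth_map \<G> UNIV \<G> (\<lambda>g. inv\<^bsub>G\<^esub> g)"

text \<open>
  The Lie algebra is the tangent space at the identity, so it is represented by the model space \<open>'h\<close>.
\<close>

definition one_param_subgroup ::
  "('g, 'h::banach) manifold \<Rightarrow> 'g monoid \<Rightarrow> 'h \<Rightarrow> (real \<Rightarrow> 'g) \<Rightarrow> bool" where
  "one_param_subgroup \<G> G a \<gamma> \<longleftrightarrow>
     smooth_map flat UNIV \<G> \<gamma> \<and> (\<forall>s t. \<gamma> (s + t) = \<gamma> s \<otimes>\<^bsub>G\<^esub> \<gamma> t) \<and>
     tangent_lift \<G> UNIV \<gamma> 0 = (\<one>\<^bsub>G\<^esub>, a)"

definition lie_exp :: "('g, 'h::banach) manifold \<Rightarrow> 'g monoid \<Rightarrow> 'h \<Rightarrow> 'g" where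
  "lie_exp \<G> G a = (THE \<gamma>. one_param_subgroup \<G> G a \<gamma>) 1"

record ('q, 'e, 'm, 'f, 'g, 'h) bundle_data =
  total :: "('q, 'e) manifold"
  base :: "('m, 'f) manifold"
  struct_mfd :: "('g, 'h) manifold"
  struct_grp :: "'g monoid"
  proj :: "'q \<Rightarrow> 'm"
  act :: "'q \<Rightarrow> 'g \<Rightarrow> 'q"

definition principal_bundle ::
  "('q, 'e::banach, 'm, 'f::banach, 'g, 'h::banach) bundle_data \<Rightarrow> bool" where
  "principal_bundle P \<longleftrightarrow>
     smooth_manifold (total P) \<and> smooth_manifold (base P) \<and>
     lie_group (struct_mfd P) (struct_grp P) \<and>
     smooth_map (total P) UNIV (base P) (proj P) \<and> surj (proj P) \<and>
     smooth_map (prod_manifold (total P) (struct_mfd P)) UNIV (total P) (\<lambda>(q, g). act P q g) \<and>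
     (\<forall>q. act P q \<one>\<^bsub>struct_grp P\<^esub> = q) \<and>
     (\<forall>q g h. act P (act P q g) h = act P q (g \<otimes>\<^bsub>struct_grp P\<^esub> h)) \<and>
     (\<forall>q p. proj P q = proj P p \<longleftrightarrow> (\<exists>g. p = act P q g)) \<and>
     (\<forall>x. \<exists>U \<tau>. openin (mtop (base P)) U \<and> x \<in> U \<and>
        diffeo (total P) (proj P -` U) (prod_manifold (base P) (struct_mfd P)) (U \<times> UNIV)
          (\<lambda>q. (proj P q, \<tau> q)) \<and>
        (\<forall>q \<in> proj P -` U. \<forall>g. \<tau> (act P q g) = \<tau> q \<otimes>\<^bsub>struct_grp P\<^esub> g))"

definition exponential ::
  "('q, 'e, 'm, 'f, 'g, 'h::banach) bundle_data \<Rightarrow> 'h \<Rightarrow> 'g" where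
  "exponential P = lie_exp (struct_mfd P) (struct_grp P)"

abbreviation TQ ::
  "('q, 'e::banach, 'm, 'f, 'g, 'h) bundle_data \<Rightarrow> ('q \<times> 'e, 'e \<times> 'e) manifold" where
  "TQ P \<equiv> tangent_bundle (total P)"

definition pi_star ::
  "('q, 'e::banach, 'm, 'f::banach, 'g, 'h) bundle_data \<Rightarrow> 'q \<Rightarrow> 'e \<Rightarrow> 'f" where
  "pi_star P q = differential (total P) (base P) (proj P) q"

definition vertical ::
  "('q, 'e::banach, 'm, 'f::banach, 'g, 'h) bundle_data \<Rightarrow> 'q \<Rightarrow> 'e set" where
  "vertical P q = {v. pi_star P q v = 0}"

definition fundamental ::
  "('q, 'e::banach, 'm, 'f, 'g, 'h::banach) bundle_data \<Rightarrow> 'h \<Rightarrow> 'q \<Rightarrow> 'e" where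
  "fundamental P a q = snd (tangent_lift (total P) UNIV (\<lambda>t. act P q (exponential P (t *\<^sub>R a))) 0)"


section \<open>Horizontal distributions\<close>

abbreviation fiber :: "('q \<times> 'e) set \<Rightarrow> 'q \<Rightarrow> 'e set" where
  "fiber H q \<equiv> {v. (q, v) \<in> H}"

definition smooth_distribution ::
  "('q, 'e::real_normed_vector) manifold \<Rightarrow> ('q \<times> 'e) set \<Rightarrow> bool" where
  "smooth_distribution A H \<longleftrightarrow>
     (\<forall>q. \<exists>W (n::nat) X. openin (mtop A) W \<and> q \<in> W \<and>
        (\<forall>i<n. smooth_vector_field A W (X i)) \<and>
        (\<forall>p\<in>W. inj_on (\<lambda>i. X i p) {..<n} \<and> independent ((\<lambda>i. X i p) ` {..<n}) \<and>
           span ((\<lambda>i. X i p) ` {..<n}) = fiber H p))"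

definition horizontal_distribution ::
  "('q, 'e::banach, 'm, 'f::banach, 'g, 'h) bundle_data \<Rightarrow> ('q \<times> 'e) set \<Rightarrow> bool" where
  "horizontal_distribution P H \<longleftrightarrow>
     smooth_distribution (total P) H \<and>
     (\<forall>q. fiber H q \<inter> vertical P q = {0} \<and>
          {h + v |h v. h \<in> fiber H q \<and> v \<in> vertical P q} = UNIV)"

definition hlift ::
  "('q, 'e::banach, 'm, 'f::banach, 'g, 'h) bundle_data \<Rightarrow> ('q \<times> 'e) set \<Rightarrow> 'q \<Rightarrow> 'f \<Rightarrow> 'e" where
  "hlift P H q X = (THE v. v \<in> fiber H q \<and> pi_star P q v = X)"

definition hlift_field ::
  "('q, 'e::banach, 'm, 'f::banach, 'g, 'h) bundle_data \<Rightarrow> ('q \<times> 'e) set \<Rightarrow> ('m \<Rightarrow> 'f) \<Rightarrow> 'q \<Rightarrow> 'e" where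
  "hlift_field P H X q = hlift P H q (X (proj P q))"

definition connection ::
  "('q, 'e::banach, 'm, 'f, 'g, 'h::banach) bundle_data \<Rightarrow> ('q \<times> 'e) set \<Rightarrow> 'q \<times> 'e \<Rightarrow> 'h" where
  "connection P H = (\<lambda>(q, v). THE a. v - fundamental P a q \<in> fiber H q)"

definition G_invariant ::
  "('q, 'e::banach, 'm, 'f::banach, 'g, 'h) bundle_data \<Rightarrow> ('q \<times> 'e) set \<Rightarrow> bool" where
  "G_invariant P H \<longleftrightarrow>
     (\<forall>q g X. differential (total P) (total P) (\<lambda>p. act P p g) q (hlift P H q X)
              = hlift P H (act P q g) X)"

text \<open>
  The value \<open>r\<close> is the common one for all smooth extensions of the given vectors to (global or
  local) vector fields on \<open>M\<close>; brackets are local, so the fields need only be defined near \<open>\<pi>(q)\<close>.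
\<close>

definition curvature ::
  "('q, 'e::banach, 'm, 'f::banach, 'g, 'h::banach) bundle_data \<Rightarrow> ('q \<times> 'e) set \<Rightarrow>
   'q \<Rightarrow> 'f \<Rightarrow> 'f \<Rightarrow> 'h" where
  "curvature P H q X Y =
     (THE r. \<forall>U X' Y'. openin (mtop (base P)) U \<and> proj P q \<in> U \<and>
        smooth_vector_field (base P) U X' \<and> smooth_vector_field (base P) U Y' \<and>
        X' (proj P q) = X \<and> Y' (proj P q) = Y \<longrightarrow>
        r = connection P H (q, lie_bracket (total P) (hlift_field P H X') (hlift_field P H Y') q
                               - hlift_field P H (lie_bracket (base P) X' Y') q))"

definition tensor_B ::
  "('q, 'e::banach, 'm, 'f::banach, 'g, 'h::banach) bundle_data \<Rightarrow> ('q \<times> 'e) set \<Rightarrow>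
   'q \<Rightarrow> 'f \<Rightarrow> 'h \<Rightarrow> 'h" where
  "tensor_B P H q X a =
     (THE r. \<forall>U X'. openin (mtop (base P)) U \<and> proj P q \<in> U \<and>
        smooth_vector_field (base P) U X' \<and> X' (proj P q) = X \<longrightarrow>
        r = connection P H (q, lie_bracket (total P) (hlift_field P H X') (fundamental P a) q))"


section \<open>Derivatives of the Lagrangian\<close>

text \<open>
  The dual of the Lie algebra is the space of bounded, hence of all, linear functionals on \<open>'h\<close>.
\<close>

definition FL ::
  "('q, 'e::banach, 'm, 'f, 'g, 'h::banach) bundle_data \<Rightarrow> ('q \<times> 'e \<Rightarrow> real) \<Rightarrow> 'q \<times> 'e \<Rightarrow>
   'h \<Rightarrow>\<^sub>L real" where
  "FL P L = (\<lambda>(q, v). Blinfun (\<lambda>b. deriv (\<lambda>t. L (q, v + t *\<^sub>R fundamental P b q)) 0))"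

definition HL ::
  "('q, 'e::banach, 'm, 'f::banach, 'g, 'h::banach) bundle_data \<Rightarrow> ('q \<times> 'e) set \<Rightarrow>
   ('q \<times> 'e \<Rightarrow> real) \<Rightarrow> 'q \<times> 'e \<Rightarrow> 'h \<Rightarrow>\<^sub>L real" where
  "HL P H L = (\<lambda>(q, v). Blinfun (\<lambda>b. deriv (\<lambda>t.
     let p = act P q (exponential P (t *\<^sub>R b)) in L (p, hlift P H p (pi_star P q v))) 0))"


section \<open>Variations and extremals\<close>

definition admissible_path ::
  "('q, 'e::banach) manifold \<Rightarrow> real set \<Rightarrow> (real \<Rightarrow> 'q \<times> 'e) \<Rightarrow> bool" where
  "admissible_path A I \<gamma> \<longleftrightarrow>
     smooth_map flat I A (fst \<circ> \<gamma>) \<and> (\<forall>t\<in>I. \<gamma> t = tangent_lift A I (fst \<circ> \<gamma>) t)"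

definition horizontal_path ::
  "('q, 'e::banach, 'm, 'f, 'g, 'h) bundle_data \<Rightarrow> ('q \<times> 'e) set \<Rightarrow> real set \<Rightarrow>
   (real \<Rightarrow> 'q \<times> 'e) \<Rightarrow> bool" where
  "horizontal_path P H I \<gamma> \<longleftrightarrow> admissible_path (total P) I \<gamma> \<and> (\<forall>t\<in>I. \<gamma> t \<in> H)"

definition generator ::
  "('q, 'e::banach) manifold \<Rightarrow> real set \<Rightarrow> (real \<Rightarrow> 'q) \<Rightarrow> (real \<Rightarrow> 'q \<times> 'e) \<Rightarrow> bool" where
  "generator A I q \<xi> \<longleftrightarrow> smooth_map flat I (tangent_bundle A) \<xi> \<and> (\<forall>t\<in>I. fst (\<xi> t) = q t)"

definition variation ::
  "('q, 'e::banach) manifold \<Rightarrow> real set \<Rightarrow> (real \<Rightarrow> 'q \<times> 'e) \<Rightarrow> real \<Rightarrow>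
   ('q \<times> 'e) \<times> ('e \<times> 'e)" where
  "variation A I \<xi> t = canonical_flip (tangent_lift (tangent_bundle A) I \<xi> t)"

definition vakonomic_variation ::
  "('q, 'e::banach, 'm, 'f, 'g, 'h) bundle_data \<Rightarrow> ('q \<times> 'e) set \<Rightarrow> real set \<Rightarrow>
   (real \<Rightarrow> 'q \<times> 'e) \<Rightarrow> (real \<Rightarrow> 'q \<times> 'e) \<Rightarrow> bool" where
  "vakonomic_variation P H I \<gamma> \<xi> \<longleftrightarrow>
     (\<forall>t\<in>I. variation (total P) I \<xi> t \<in> tangent_space_of (TQ P) H (\<gamma> t))"

text \<open>The Lagrangian \<open>L Z t\<close> may depend on time.\<close>

definition action_variation ::
  "('q, 'e::banach) manifold \<Rightarrow> real set \<Rightarrow> ('q \<times> 'e \<Rightarrow> real \<Rightarrow> real) \<Rightarrow>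
   (real \<Rightarrow> ('q \<times> 'e) \<times> ('e \<times> 'e)) \<Rightarrow> real" where
  "action_variation A I L \<delta>\<gamma> = integral I (\<lambda>t.
     differential (tangent_bundle A) flat (\<lambda>Z. L Z t) (fst (\<delta>\<gamma> t)) (snd (\<delta>\<gamma> t)))"

definition unconstrained_extremal ::
  "('q, 'e::banach) manifold \<Rightarrow> real \<Rightarrow> real \<Rightarrow> ('q \<times> 'e \<Rightarrow> real \<Rightarrow> real) \<Rightarrow>
   (real \<Rightarrow> 'q \<times> 'e) \<Rightarrow> bool" where
  "unconstrained_extremal A t0 t1 L \<gamma> \<longleftrightarrow>
     (\<forall>\<xi>. generator A {t0..t1} (fst \<circ> \<gamma>) \<xi> \<and> snd (\<xi> t0) = 0 \<and> snd (\<xi> t1) = 0 \<longrightarrow>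
        action_variation A {t0..t1} L (variation A {t0..t1} \<xi>) = 0)"

definition nonholonomic_extremal ::
  "('q, 'e::banach) manifold \<Rightarrow> ('q \<times> 'e) set \<Rightarrow> real \<Rightarrow> real \<Rightarrow>
   ('q \<times> 'e \<Rightarrow> real \<Rightarrow> real) \<Rightarrow> (real \<Rightarrow> 'q \<times> 'e) \<Rightarrow> bool" where
  "nonholonomic_extremal A H t0 t1 L \<gamma> \<longleftrightarrow>
     (\<forall>\<xi>. generator A {t0..t1} (fst \<circ> \<gamma>) \<xi> \<and> (\<forall>t\<in>{t0..t1}. \<xi> t \<in> H) \<and>
        snd (\<xi> t0) = 0 \<and> snd (\<xi> t1) = 0 \<longrightarrow>
        action_variation A {t0..t1} L (variation A {t0..t1} \<xi>) = 0)"

definition vakonomic_extremal ::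
  "('q, 'e::banach, 'm, 'f, 'g, 'h::banach) bundle_data \<Rightarrow> ('q \<times> 'e) set \<Rightarrow> real \<Rightarrow> real \<Rightarrow>
   ('q \<times> 'e \<Rightarrow> real) \<Rightarrow> (real \<Rightarrow> 'h \<Rightarrow>\<^sub>L real) \<Rightarrow> (real \<Rightarrow> 'q \<times> 'e) \<Rightarrow> bool" where
  "vakonomic_extremal P H t0 t1 L lam \<gamma> \<longleftrightarrow>
     unconstrained_extremal (total P) t0 t1
       (\<lambda>Z t. L Z - blinfun_apply (lam t) (connection P H Z)) \<gamma>"

end

theory Submission
  imports Defs
begin

text \<open>Write the connection in a chart as a family of linear maps \<open>\<omega>\<^sub>x\<close> depending smoothly on the
  coordinates \<open>x\<close>. Differentiating \<open>\<omega>\<close> on horizontal fields identifies the curvature with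
  \<open>- d\<omega>\<close>, so tangency of a variation to the horizontal distribution, which is the vanishing of the
  derivative of \<open>\<omega>\<close> along the variation, reads \<open>b' + R(X, Y) = 0\<close>. Invariance says that horizontal
  lifts are carried to horizontal lifts by the flow of a fundamental field; by the symmetry of second
  derivatives of the action the two fields commute, whence \<open>B = 0\<close>. The same symmetry shows that
  adding the vertical generator \<open>b\<close> changes the variation of the action by the integral of
  \<open>\<langle>HL, b\<rangle> + \<langle>FL, b'\<rangle>\<close>, so both Euler-Lagrange equations are instances of the lemma of du
  Bois-Reymond. One-parameter subgroups come from the Picard iteration near the unit, extended to all
  times by the group law.\<close>

section \<open>Finite-dimensional normed spaces\<close>

text \<open>Three features of the setting shape the work. A model space may be zero, hence not of
  class \<open>euclidean_space\<close>, so finite-dimensional linear algebra is rebuilt from bounded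
  coordinate functionals. Derivatives are also taken on closed time intervals, so the calculus is
  developed on sets within which derivatives are unique. And a tangent vector is stored in the
  preferred chart of its base point, which may jump along a curve; computations therefore pass to
  components in one fixed chart before differentiating. Exponential, curvature and
  \<open>tensor_B\<close> are defined by \<open>THE\<close>, so admissible choices must be shown to
  exist and to agree. The curvature enters through the canonical flip: it interchanges the two
  arguments of the derivative of \<omega>, so that the derivative of \<omega> along a generator and
  along its variation differ by an antisymmetric term. On horizontal vectors this term is the
  curvature, and invariance makes it vanish when one of the two is vertical.\<close>

definition finite_dim :: "'a::real_vector itself \<Rightarrow> bool" where
  "finite_dim T \<longleftrightarrow> (\<exists>B::'a set. finite B \<and> span B = UNIV)"

text \<open>Induction on \<open>B\<close>. The bound for \<open>B\<close> makes the coefficients of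
  a convergent sequence in \<open>span B\<close> Cauchy, so this span is closed; a further
  independent vector \<open>a\<close> then has positive distance from it, which controls its
  coefficient.\<close>

lemma independent_coefficient_bound:
  fixes B :: "'a::real_normed_vector set"
  assumes "finite B" "independent B"
  shows "\<exists>C>0. \<forall>c. (\<Sum>b\<in>B. \<bar>c b\<bar>) \<le> C * norm (\<Sum>b\<in>B. c b *\<^sub>R b)"
  using assms
proof (induction B rule: finite_induct)
  case empty
  then show ?case by (intro exI[of _ 1]) auto
next
  case (insert a B)
  have indB: "independent B" and aB: "a \<notin> span B"
    using insert by (auto simp: independent_insert)
  then obtain C where C: "C > 0" "\<And>c. (\<Sum>b\<in>B. \<bar>c b\<bar>) \<le> C * norm (\<Sum>b\<in>B. c b *\<^sub>R b)"
    using insert.IH by blast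
  have "closed (span B)"
    unfolding closed_sequential_limits
  proof (intro allI impI, elim conjE)
    fix y l assume y: "\<forall>n. y n \<in> span B" and l: "y \<longlonglongrightarrow> l"
    have "\<forall>n. \<exists>c. y n = (\<Sum>b\<in>B. c b *\<^sub>R b)"
      using y insert.hyps(1) by (auto simp: span_finite)
    then obtain c where c: "\<And>n. y n = (\<Sum>b\<in>B. c n b *\<^sub>R b)" by metis
    have "convergent (\<lambda>n. c n b)" if b: "b \<in> B" for b
    proof (rule Cauchy_convergent, rule metric_CauchyI)
      fix e :: real assume e: "e > 0"
      have "Cauchy y" using l LIMSEQ_imp_Cauchy by blast
      then obtain N where N: "\<And>m n. m \<ge> N \<Longrightarrow> n \<ge> N \<Longrightarrow> dist (y m) (y n) < e / C"
        using e C(1) by (meson divide_pos_pos metric_CauchyD)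
      have "dist (c m b) (c n b) < e" if "m \<ge> N" "n \<ge> N" for m n
      proof -
        have "dist (c m b) (c n b) \<le> (\<Sum>b\<in>B. \<bar>c m b - c n b\<bar>)"
          unfolding dist_real_def
          using member_le_sum[OF b, of "\<lambda>b. \<bar>c m b - c n b\<bar>"] insert.hyps(1) by simp
        also have "\<dots> \<le> C * norm (\<Sum>b\<in>B. (c m b - c n b) *\<^sub>R b)" by (rule C(2))
        also have "(\<Sum>b\<in>B. (c m b - c n b) *\<^sub>R b) = y m - y n"
          by (simp add: c scaleR_diff_left sum_subtractf)
        also have "C * norm (y m - y n) < e"
          using N[OF that] C(1) by (simp add: dist_norm pos_less_divide_eq mult.commute)
        finally show ?thesis .
      qed
      then show "\<exists>M. \<forall>m\<ge>M. \<forall>n\<ge>M. dist (c m b) (c n b) < e" by blast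
    qed
    then have "\<forall>b\<in>B. \<exists>k. (\<lambda>n. c n b) \<longlonglongrightarrow> k" by (auto simp: convergent_def)
    then obtain k where k: "\<And>b. b \<in> B \<Longrightarrow> (\<lambda>n. c n b) \<longlonglongrightarrow> k b" by metis
    have "y \<longlonglongrightarrow> (\<Sum>b\<in>B. k b *\<^sub>R b)"
      unfolding c using k by (auto intro!: tendsto_intros)
    then have "l = (\<Sum>b\<in>B. k b *\<^sub>R b)" using l LIMSEQ_unique by blast
    then show "l \<in> span B" by (auto intro: span_sum span_scale span_base)
  qed
  then obtain d where d: "d > 0" "\<And>y. y \<in> span B \<Longrightarrow> norm (a - y) \<ge> d"
  proof -
    have "open (- span B)" using \<open>closed (span B)\<close> by blast
    then obtain d where "d > 0" "ball a d \<subseteq> - span B"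
      using aB open_contains_ball by (metis ComplI)
    then show ?thesis
      by (intro that[of d]) (auto simp: dist_norm subset_iff not_less[symmetric])
  qed
  \<comment> \<open>The new coefficient is at most \<open>norm v / d\<close>; the others combine to
    \<open>v - c a *\<^sub>R a\<close>, so the old bound costs \<open>C * (1 + norm a / d)\<close>.
    \<open>K\<close> is the sum of the two factors.\<close>
  define K where "K = C + (C * norm a + 1) / d"
  have "K > 0" unfolding K_def using C(1) d(1) by (intro add_pos_nonneg) auto
  moreover have "(\<Sum>b\<in>insert a B. \<bar>c b\<bar>) \<le> K * norm (\<Sum>b\<in>insert a B. c b *\<^sub>R b)" for c
  proof -
    define w where "w = (\<Sum>b\<in>B. c b *\<^sub>R b)"
    define v where "v = c a *\<^sub>R a + w"
    have w: "w \<in> span B" unfolding w_def by (auto intro: span_sum span_scale span_base)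
    have ca: "\<bar>c a\<bar> * d \<le> norm v"
    proof (cases "c a = 0")
      case False
      have "v = c a *\<^sub>R (a - (- (1 / c a)) *\<^sub>R w)"
        using False by (simp add: v_def scaleR_right_distrib)
      then have "norm v = \<bar>c a\<bar> * norm (a - (- (1 / c a)) *\<^sub>R w)" by (metis norm_scaleR)
      moreover have "d \<le> norm (a - (- (1 / c a)) *\<^sub>R w)"
        by (rule d(2)) (intro span_scale w)
      ultimately show ?thesis by (simp add: mult_left_mono)
    qed auto
    then have ca': "\<bar>c a\<bar> \<le> norm v / d" using d(1) by (simp add: field_simps)
    have "(\<Sum>b\<in>B. \<bar>c b\<bar>) \<le> C * norm w" unfolding w_def by (rule C(2))
    also have "norm w \<le> norm v + \<bar>c a\<bar> * norm a"
    proof -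
      have "w = v - c a *\<^sub>R a" by (simp add: v_def)
      then show ?thesis using norm_triangle_ineq4[of v "c a *\<^sub>R a"] by simp
    qed
    also have "\<bar>c a\<bar> * norm a \<le> norm v / d * norm a" by (rule mult_right_mono[OF ca' norm_ge_zero])
    finally have "(\<Sum>b\<in>B. \<bar>c b\<bar>) \<le> C * (norm v + norm v / d * norm a)" using C(1) by simp
    then have "\<bar>c a\<bar> + (\<Sum>b\<in>B. \<bar>c b\<bar>) \<le> norm v / d + C * (norm v + norm v / d * norm a)"
      using ca' by simp
    also have "\<dots> = K * norm v" unfolding K_def using d(1) by (simp add: field_simps)
    finally show ?thesis using insert.hyps by (simp add: v_def w_def)
  qed
  ultimately show ?case by blast
qed

text \<open>The form in which finite dimension is used below: bounded coordinate functionals reduce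
  a statement about operators to finitely many basis vectors. An empty basis is allowed.\<close>

lemma finite_dim_coordinates:
  assumes "finite_dim TYPE('a::real_normed_vector)"
  obtains B :: "'a::real_normed_vector set" and \<beta> where "finite B" "\<And>b. b \<in> B \<Longrightarrow> bounded_linear (\<beta> b)"
    "\<And>v. v = (\<Sum>b\<in>B. \<beta> b v *\<^sub>R b)"
proof -
  obtain B0 :: "'a set" where B0: "finite B0" "span B0 = UNIV"
    using assms unfolding finite_dim_def by auto
  obtain B where B: "B \<subseteq> B0" "independent B" "B0 \<subseteq> span B"
    using maximal_independent_subset by blast
  have fin: "finite B" using B(1) B0(1) finite_subset by blast
  have span: "span B = UNIV"
    using span_mono[OF B(3)] B0(2) by (simp add: span_span top.extremum_unique)
  obtain C where C: "C > 0" "\<And>c. (\<Sum>b\<in>B. \<bar>c b\<bar>) \<le> C * norm (\<Sum>b\<in>B. c b *\<^sub>R b)"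
    using independent_coefficient_bound[OF fin B(2)] by blast
  have eq: "v = (\<Sum>b\<in>B. representation B v b *\<^sub>R b)" for v
    using sum_representation_eq[OF B(2) _ fin order_refl, of v] span by simp
  have "bounded_linear (\<lambda>v. representation B v b)" if b: "b \<in> B" for b
  proof (rule bounded_linear_intro[where K = C])
    show "representation B (x + y) b = representation B x b + representation B y b" for x y
      using representation_add[OF B(2)] span by simp
    show "representation B (r *\<^sub>R x) b = r *\<^sub>R representation B x b" for r x
      using representation_scale[OF B(2)] span by simp
    fix x
    have "norm (representation B x b) \<le> (\<Sum>b\<in>B. \<bar>representation B x b\<bar>)"
      using member_le_sum[OF b, of "\<lambda>b. \<bar>representation B x b\<bar>"] fin by simp
    also have "\<dots> \<le> C * norm x" using C(2)[of "representation B x"] eq[of x] by simp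
    finally show "norm (representation B x b) \<le> norm x * C" by (simp add: mult.commute)
  qed
  with fin eq show ?thesis using that[of B "\<lambda>b v. representation B v b"] by blast
qed

lemma finite_dim_linear_bounded:
  fixes f :: "'a::real_normed_vector \<Rightarrow> 'b::real_normed_vector"
  assumes "finite_dim TYPE('a)" "linear f"
  shows "bounded_linear f"
proof -
  obtain B :: "'a set" and \<beta> where B: "finite B" "\<And>b. b \<in> B \<Longrightarrow> bounded_linear (\<beta> b)"
    "\<And>v. v = (\<Sum>b\<in>B. \<beta> b v *\<^sub>R b)" using finite_dim_coordinates[OF assms(1)] by blast
  have "bounded_linear (\<lambda>v. \<Sum>b\<in>B. \<beta> b v *\<^sub>R f b)"
    by (intro bounded_linear_sum bounded_linear_compose[OF bounded_linear_scaleR_left] B)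
  moreover have "f v = (\<Sum>b\<in>B. \<beta> b v *\<^sub>R f b)" for v
    by (subst B(3)[of v]) (simp add: linear_sum[OF assms(2)] linear_scale[OF assms(2)])
  ultimately show ?thesis by (metis (no_types, lifting) ext)
qed

lemma finite_dim_real: "finite_dim TYPE(real)"
  unfolding finite_dim_def by (intro exI[of _ "{1}"]) (auto simp: span_singleton)

lemma finite_dim_prod:
  assumes "finite_dim TYPE('a::real_vector)" "finite_dim TYPE('b::real_vector)"
  shows "finite_dim TYPE('a \<times> 'b)"
proof -
  obtain A :: "'a set" where A: "finite A" "span A = UNIV" using assms(1) finite_dim_def by blast
  obtain B :: "'b set" where B: "finite B" "span B = UNIV" using assms(2) finite_dim_def by blast
  have "span ((\<lambda>a. (a, 0::'b)) ` A \<union> (\<lambda>b. (0::'a, b)) ` B) = UNIV" (is "span ?S = _")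
  proof -
    have "(x, y) \<in> span ?S" for x :: 'a and y :: 'b
    proof -
      have "linear (\<lambda>a::'a. (a, 0::'b))" "linear (\<lambda>b::'b. (0::'a, b))"
        by (auto intro!: linearI)
      then have "span ((\<lambda>a. (a, 0::'b)) ` A) = (\<lambda>a. (a, 0)) ` UNIV"
        "span ((\<lambda>b. (0::'a, b)) ` B) = (\<lambda>b. (0, b)) ` UNIV"
        by (simp_all add: linear_span_image A B)
      then have "(x, 0) \<in> span ?S" "(0, y) \<in> span ?S"
        by (metis (no_types, lifting) UNIV_I Un_upper1 Un_upper2 imageI span_mono subsetD)+
      then show ?thesis using span_add by fastforce
    qed
    then show ?thesis by auto
  qed
  then show ?thesis unfolding finite_dim_def
    by (intro exI[of _ ?S]) (use A B in auto)
qed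

section \<open>Calculus of \<open>Ck_on\<close> and \<open>smooth_on\<close>\<close>

text \<open>Approachability in enough directions makes derivatives within the set unique.\<close>

definition thick :: "'a::real_normed_vector set \<Rightarrow> bool" where
  "thick S \<longleftrightarrow> (\<forall>x\<in>S. \<exists>B. span B = UNIV \<and>
     (\<forall>v\<in>B. \<forall>e>0. \<exists>d. 0 < \<bar>d\<bar> \<and> \<bar>d\<bar> < e \<and> x + d *\<^sub>R v \<in> S))"

lemma thick_open:
  assumes "open S" shows "thick S"
  unfolding thick_def
proof (intro ballI exI[of _ UNIV] conjI allI impI)
  fix x v :: 'a and e :: real assume x: "x \<in> S" and e: "e > 0"
  obtain r where r: "r > 0" "ball x r \<subseteq> S" using assms x open_contains_ball by blast
  \<comment> \<open>The \<open>+ 1\<close> keeps \<open>d\<close> positive when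
    \<open>v = 0\<close>.\<close>
  define d where "d = min (e/2) (r / (2 * (norm v + 1)))"
  have d0: "d > 0" using e r by (auto simp: d_def add_nonneg_pos)
  have "2 * (norm v + 1) > 0" by (simp add: add_nonneg_pos)
  moreover have "d \<le> r / (2 * (norm v + 1))" by (simp add: d_def)
  ultimately have "d * (2 * (norm v + 1)) \<le> r" by (simp only: pos_le_divide_eq)
  then have "d * norm v < r" using d0 mult_nonneg_nonneg[of d "norm v"] by (simp add: algebra_simps del: mult_nonneg_nonneg)
  then have "x + d *\<^sub>R v \<in> S" using r d0 by (auto simp: dist_norm subset_iff)
  moreover have "d < e" using e by (auto simp: d_def)
  ultimately show "\<exists>d. 0 < \<bar>d\<bar> \<and> \<bar>d\<bar> < e \<and> x + d *\<^sub>R v \<in> S" using d0 by (intro exI[of _ d]) auto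
qed (auto simp: span_UNIV)

lemma thick_Int_open:
  assumes "thick S" "open T" shows "thick (S \<inter> T)"
  unfolding thick_def
proof
  fix x assume x: "x \<in> S \<inter> T"
  obtain B where B: "span B = UNIV"
    "\<And>v e. v\<in>B \<Longrightarrow> e>0 \<Longrightarrow> \<exists>d. 0 < \<bar>d\<bar> \<and> \<bar>d\<bar> < e \<and> x + d *\<^sub>R v \<in> S"
    using assms(1) x unfolding thick_def by blast
  obtain r where r: "r > 0" "ball x r \<subseteq> T" using assms(2) x open_contains_ball by blast
  have "\<exists>d. 0 < \<bar>d\<bar> \<and> \<bar>d\<bar> < e \<and> x + d *\<^sub>R v \<in> S \<inter> T" if v: "v \<in> B" and e: "e > 0" for v e
  proof -
    have "min e (r / (norm v + 1)) > 0" using e r by (auto simp: add_nonneg_pos)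
    then obtain d where d: "0 < \<bar>d\<bar>" "\<bar>d\<bar> < min e (r / (norm v + 1))" "x + d *\<^sub>R v \<in> S"
      using B(2)[OF v] by blast
    have "\<bar>d\<bar> * (norm v + 1) < r"
      using d(2) by (simp add: pos_less_divide_eq add_nonneg_pos)
    then have "\<bar>d\<bar> * norm v < r" by (simp add: distrib_left)
    then have "x + d *\<^sub>R v \<in> T" using r by (auto simp: dist_norm subset_iff)
    then show ?thesis using d by auto
  qed
  then show "\<exists>B. span B = UNIV \<and>
     (\<forall>v\<in>B. \<forall>e>0. \<exists>d. 0 < \<bar>d\<bar> \<and> \<bar>d\<bar> < e \<and> x + d *\<^sub>R v \<in> S \<inter> T)" using B(1) by blast
qed

lemma thick_interval:
  fixes a b :: real assumes "a < b" shows "thick {a..b}"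
  unfolding thick_def
proof (intro ballI exI[of _ "{1}"] conjI allI impI)
  show "span {1} = (UNIV::real set)" by (auto simp: span_singleton)
  fix x v e :: real assume x: "x \<in> {a..b}" and v: "v \<in> {1}" and e: "e > 0"
  show "\<exists>d. 0 < \<bar>d\<bar> \<and> \<bar>d\<bar> < e \<and> x + d *\<^sub>R v \<in> {a..b}"
  proof (cases "x < b")
    case True
    then show ?thesis using x v e by (intro exI[of _ "min (e/2) (b - x)"]) auto
  next
    case False
    \<comment> \<open>At the right end point the interval is approached from the left, which is why
      \<open>d\<close> in \<open>thick\<close> may be negative.\<close>
    then show ?thesis using x v e assms by (intro exI[of _ "- min (e/2) (b - a)"]) auto
  qed
qed

text \<open>The difference \<open>g\<close> of two derivatives is a derivative of the zero function.
  Being homogeneous, it cannot be small relative to \<open>d *\<^sub>R v\<close> for arbitrarily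
  small \<open>d\<close> unless \<open>g v = 0\<close>, and the directions available in a thick set
  span the space.\<close>

lemma thick_has_derivative_unique:
  assumes S: "thick S" "x \<in> S"
    and 1: "(f has_derivative f') (at x within S)" and 2: "(f has_derivative f'') (at x within S)"
  shows "f' = f''"
proof -
  obtain B where B: "span B = UNIV"
    "\<And>v e. v\<in>B \<Longrightarrow> e>0 \<Longrightarrow> \<exists>d. 0 < \<bar>d\<bar> \<and> \<bar>d\<bar> < e \<and> x + d *\<^sub>R v \<in> S"
    using S unfolding thick_def by blast
  define g where "g = (\<lambda>v. f' v - f'' v)"
  have g: "((\<lambda>x. 0) has_derivative g) (at x within S)"
    using has_derivative_diff[OF 1 2] by (simp add: g_def)
  then have blg: "bounded_linear g" by (rule has_derivative_bounded_linear)
  have "g v = 0" if v: "v \<in> B" for v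
  proof (rule ccontr)
    assume g0: "g v \<noteq> 0"
    then have v0: "v \<noteq> 0" using blg linear_simps(3) by blast
    define e where "e = norm (g v) / norm v"
    have e: "e > 0" using g0 v0 by (simp add: e_def)
    have "\<forall>e>0. \<exists>d>0. \<forall>y\<in>S. norm (y - x) < d \<longrightarrow> norm (g (y - x)) \<le> e * norm (y - x)"
      using g unfolding has_derivative_within_alt by simp
    then obtain d where d: "d > 0" "\<And>y. y \<in> S \<Longrightarrow> norm (y - x) < d \<Longrightarrow> norm (g (y - x)) \<le> e/2 * norm (y - x)"
      using e by (meson half_gt_zero)
    have "d / norm v > 0" using d v0 by simp
    then obtain r where r: "0 < \<bar>r\<bar>" "\<bar>r\<bar> < d / norm v" "x + r *\<^sub>R v \<in> S" using B(2)[OF v] by blast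
    have "norm (x + r *\<^sub>R v - x) < d" using r v0 by (simp add: field_simps)
    from d(2)[OF r(3) this] have "\<bar>r\<bar> * norm (g v) \<le> e/2 * (\<bar>r\<bar> * norm v)"
      using blg by (simp add: linear_simps)
    then have "norm (g v) \<le> e/2 * norm v" using r(1) by (simp add: field_simps)
    then show False using v0 g0 by (simp add: e_def)
  qed
  then have "g v = 0" for v
    using linear_eq_0_on_span[of g B v] bounded_linear.linear[OF blg] B(1) by simp
  then show ?thesis unfolding g_def by (auto simp: fun_eq_iff)
qed

lemma thick_frechet_derivative:
  assumes "thick S" "x \<in> S" "(f has_derivative f') (at x within S)"
  shows "frechet_derivative f (at x within S) = f'"
proof -
  have "f differentiable (at x within S)" using assms(3) unfolding differentiable_def by blast
  then show ?thesis
    using thick_has_derivative_unique[OF assms(1,2) _ assms(3)] frechet_derivative_works by blast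
qed

lemma has_derivative_within_cong:
  assumes "x \<in> S" "\<And>y. y \<in> S \<Longrightarrow> f y = g y"
  shows "(f has_derivative f') (at x within S) \<longleftrightarrow> (g has_derivative f') (at x within S)"
  using has_derivative_transform[of x S g f f'] has_derivative_transform[of x S f g f'] assms by auto

lemma frechet_derivative_within_cong:
  assumes "x \<in> S" "\<And>y. y \<in> S \<Longrightarrow> f y = g y"
  shows "frechet_derivative f (at x within S) = frechet_derivative g (at x within S)"
proof -
  have "(f has_derivative f') (at x within S) \<longleftrightarrow> (g has_derivative f') (at x within S)" for f'
    by (rule has_derivative_within_cong[OF assms])
  then show ?thesis unfolding frechet_derivative_def by simp
qed

section \<open>Stability properties of finitely often differentiable maps\<close>

declare Ck_on.simps(2) [simp del]

lemma Ck_on_cong: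
  assumes "\<And>x. x \<in> S \<Longrightarrow> f x = g x" shows "Ck_on k S f \<longleftrightarrow> Ck_on k S g"
  using assms
proof (induction k arbitrary: f g)
  case 0
  then show ?case using continuous_on_cong by fastforce
next
  case (Suc k)
  have "f differentiable (at x within S) \<longleftrightarrow> g differentiable (at x within S)" if "x \<in> S" for x
    unfolding differentiable_def using has_derivative_within_cong[OF that, of f g] Suc.prems by simp
  moreover have "Ck_on k S (\<lambda>x. frechet_derivative f (at x within S) v) \<longleftrightarrow>
      Ck_on k S (\<lambda>x. frechet_derivative g (at x within S) v)" for v
  proof (rule Suc.IH)
    fix x assume "x \<in> S"
    then show "frechet_derivative f (at x within S) v = frechet_derivative g (at x within S) v"
      using frechet_derivative_within_cong[of x S f g] Suc.prems by simp
  qed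
  ultimately show ?case by (simp add: Ck_on.simps(2))
qed

lemma Ck_onE:
  assumes "Ck_on (Suc k) S f"
  obtains f' where "\<And>x. x \<in> S \<Longrightarrow> (f has_derivative f' x) (at x within S)"
    "\<And>v. Ck_on k S (\<lambda>x. f' x v)"
  using assms frechet_derivative_works unfolding Ck_on.simps by (intro that) blast+

text \<open>The recursion asks for \<open>frechet_derivative\<close>; by uniqueness of derivatives
  on a thick set, any explicit family of derivatives may be supplied instead.\<close>

lemma Ck_onI:
  assumes "thick S" "\<And>x. x \<in> S \<Longrightarrow> (f has_derivative f' x) (at x within S)"
    "\<And>v. Ck_on k S (\<lambda>x. f' x v)"
  shows "Ck_on (Suc k) S f"
proof -
  have "frechet_derivative f (at x within S) = f' x" if "x \<in> S" for x
    using thick_frechet_derivative assms that by blast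
  then have "Ck_on k S (\<lambda>x. frechet_derivative f (at x within S) v)" for v
    using assms(3)[of v] Ck_on_cong[of S "\<lambda>x. frechet_derivative f (at x within S) v" "\<lambda>x. f' x v"] by simp
  then show ?thesis using assms(2) by (auto simp: differentiable_def Ck_on.simps(2))
qed

lemma Ck_on_Suc_imp: "Ck_on (Suc k) S f \<Longrightarrow> Ck_on k S f"
proof (induction k arbitrary: f)
  case 0
  then show ?case by (simp add: Ck_on.simps(2) differentiable_imp_continuous_on differentiable_on_def)
next
  case (Suc k)
  then show ?case by (metis Ck_on.simps(2))
qed

lemma Ck_on_imp_continuous: "Ck_on k S f \<Longrightarrow> continuous_on S f"
  by (induction k) (auto intro: Ck_on_Suc_imp)

lemma Ck_on_const: "thick S \<Longrightarrow> Ck_on k S (\<lambda>x. c)"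
proof (induction k arbitrary: c)
  case (Suc k)
  show ?case by (rule Ck_onI[where f'="\<lambda>_ _. 0"]) (use Suc in auto)
qed auto

lemma Ck_on_bounded_linear:
  assumes "thick S" "bounded_linear T" "Ck_on k S f"
  shows "Ck_on k S (\<lambda>x. T (f x))"
  using assms(3)
proof (induction k arbitrary: f)
  case 0
  then show ?case using bounded_linear.continuous_on[OF assms(2)] by auto
next
  case (Suc k)
  then obtain f' where f': "\<And>x. x \<in> S \<Longrightarrow> (f has_derivative f' x) (at x within S)"
    "\<And>v. Ck_on k S (\<lambda>x. f' x v)" by (elim Ck_onE) blast
  show ?case
    by (rule Ck_onI[OF assms(1), where f'="\<lambda>x v. T (f' x v)"])
      (use f' Suc.IH in \<open>auto intro: bounded_linear.has_derivative[OF assms(2)]\<close>)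
qed

lemma Ck_on_add:
  assumes "thick S" "Ck_on k S f" "Ck_on k S g"
  shows "Ck_on k S (\<lambda>x. f x + g x)"
  using assms(2,3)
proof (induction k arbitrary: f g)
  case 0
  then show ?case by (auto intro: continuous_intros)
next
  case (Suc k)
  obtain f' where f': "\<And>x. x \<in> S \<Longrightarrow> (f has_derivative f' x) (at x within S)"
    "\<And>v. Ck_on k S (\<lambda>x. f' x v)" by (rule Ck_onE[OF Suc.prems(1)]) blast
  obtain g' where g': "\<And>x. x \<in> S \<Longrightarrow> (g has_derivative g' x) (at x within S)"
    "\<And>v. Ck_on k S (\<lambda>x. g' x v)" by (rule Ck_onE[OF Suc.prems(2)]) blast
  show ?case
    by (rule Ck_onI[OF assms(1), where f'="\<lambda>x v. f' x v + g' x v"])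
      (use f' g' Suc.IH in \<open>auto intro: has_derivative_add\<close>)
qed

lemma Ck_on_bilinear:
  assumes "thick S" "bounded_bilinear B" "Ck_on k S f" "Ck_on k S g"
  shows "Ck_on k S (\<lambda>x. B (f x) (g x))"
proof -
  show ?thesis using assms(3,4)
  proof (induction k arbitrary: f g)
    case 0
    then show ?case using bounded_bilinear.continuous_on[OF assms(2)] by auto
  next
    case (Suc k)
    obtain f' where f': "\<And>x. x \<in> S \<Longrightarrow> (f has_derivative f' x) (at x within S)"
      "\<And>v. Ck_on k S (\<lambda>x. f' x v)" by (rule Ck_onE[OF Suc.prems(1)]) blast
    obtain g' where g': "\<And>x. x \<in> S \<Longrightarrow> (g has_derivative g' x) (at x within S)"
      "\<And>v. Ck_on k S (\<lambda>x. g' x v)" by (rule Ck_onE[OF Suc.prems(2)]) blast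
    show ?case
      by (rule Ck_onI[OF assms(1), where f'="\<lambda>x v. B (f x) (g' x v) + B (f' x v) (g x)"])
        (use f' g' Suc.IH Suc.prems[THEN Ck_on_Suc_imp] in
          \<open>auto intro!: bounded_bilinear.FDERIV[OF assms(2)] Ck_on_add[OF assms(1)]\<close>)
  qed
qed

lemma Ck_on_sum:
  assumes "thick S" "\<And>i. i \<in> I \<Longrightarrow> Ck_on k S (f i)"
  shows "Ck_on k S (\<lambda>x. \<Sum>i\<in>I. f i x)"
  using assms(2)
  by (induction I rule: infinite_finite_induct) (auto intro: Ck_on_const Ck_on_add assms(1))

lemma Ck_on_Pair:
  assumes "thick S" "Ck_on k S f" "Ck_on k S g"
  shows "Ck_on k S (\<lambda>x. (f x, g x))"
proof -
  have "Ck_on k S (\<lambda>x. (f x, 0) + (0, g x))"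
    using assms(2,3)
    by (intro Ck_on_add[OF assms(1)] Ck_on_bounded_linear[OF assms(1), of "\<lambda>x. (x, 0)" k f]
        Ck_on_bounded_linear[OF assms(1), of "\<lambda>x. (0, x)" k g]
        bounded_linear_Pair bounded_linear_zero bounded_linear_ident)
  then show ?thesis by simp
qed

lemma Ck_on_id: "thick S \<Longrightarrow> Ck_on k S (\<lambda>x. x)"
  by (cases k) (auto intro!: Ck_onI[where f'="\<lambda>x v. v"] Ck_on_const)

text \<open>Regularity of the operators is only known at each fixed vector. Expanding
  \<open>w x\<close> in a basis turns the moving argument into a finite sum of scalar functions
  times \<open>A x b\<close>.\<close>

lemma Ck_on_linear_apply:
  fixes A :: "'a::real_normed_vector \<Rightarrow> 'b::real_normed_vector \<Rightarrow> 'c::real_normed_vector"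
  assumes "thick S" "finite_dim TYPE('b)" "\<And>x. x \<in> S \<Longrightarrow> linear (A x)"
    "\<And>v. Ck_on k S (\<lambda>x. A x v)" "Ck_on k S w"
  shows "Ck_on k S (\<lambda>x. A x (w x))"
proof -
  obtain B :: "'b set" and \<beta> where B: "finite B" "\<And>b. b \<in> B \<Longrightarrow> bounded_linear (\<beta> b)"
    "\<And>v. v = (\<Sum>b\<in>B. \<beta> b v *\<^sub>R b)" using finite_dim_coordinates[OF assms(2)] by blast
  have "Ck_on k S (\<lambda>x. \<Sum>b\<in>B. \<beta> b (w x) *\<^sub>R A x b)"
    by (rule Ck_on_sum[OF assms(1)], rule Ck_on_bilinear[OF assms(1) bounded_bilinear_scaleR
        Ck_on_bounded_linear[OF assms(1) B(2) assms(5)] assms(4)])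
  moreover have "A x (w x) = (\<Sum>b\<in>B. \<beta> b (w x) *\<^sub>R A x b)" if "x \<in> S" for x
  proof -
    have "A x (w x) = A x (\<Sum>b\<in>B. \<beta> b (w x) *\<^sub>R b)" using B(3)[of "w x"] by simp
    also have "\<dots> = (\<Sum>b\<in>B. \<beta> b (w x) *\<^sub>R A x b)"
      by (simp add: linear_sum[OF assms(3)[OF that]] linear_scale[OF assms(3)[OF that]])
    finally show ?thesis .
  qed
  ultimately show ?thesis using Ck_on_cong[of S "\<lambda>x. A x (w x)"] by simp
qed

text \<open>In the derivative \<open>f' (g x) (g' x v)\<close> both the operator and its argument
  move with \<open>x\<close>, so the induction goes through \<open>Ck_on_linear_apply\<close>, and
  the intermediate space has to be finite-dimensional.\<close>

lemma Ck_on_compose: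
  fixes f :: "'b::real_normed_vector \<Rightarrow> 'c::real_normed_vector"
  assumes "thick S" "finite_dim TYPE('b)" "Ck_on k S g" "Ck_on k T f" "g ` S \<subseteq> T"
  shows "Ck_on k S (\<lambda>x. f (g x))"
  using assms(3,4)
proof (induction k arbitrary: f)
  case 0
  then show ?case using assms(5) by (auto intro: continuous_on_compose2)
next
  case (Suc k)
  obtain g' where g': "\<And>x. x \<in> S \<Longrightarrow> (g has_derivative g' x) (at x within S)"
    "\<And>v. Ck_on k S (\<lambda>x. g' x v)" by (rule Ck_onE[OF Suc.prems(1)]) blast
  obtain f' where f': "\<And>x. x \<in> T \<Longrightarrow> (f has_derivative f' x) (at x within T)"
    "\<And>v. Ck_on k T (\<lambda>x. f' x v)" by (rule Ck_onE[OF Suc.prems(2)]) blast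
  show ?case
  proof (rule Ck_onI[OF assms(1), where f'="\<lambda>x v. f' (g x) (g' x v)"])
    fix x assume x: "x \<in> S"
    show "((\<lambda>x. f (g x)) has_derivative (\<lambda>v. f' (g x) (g' x v))) (at x within S)"
      by (rule has_derivative_in_compose2[OF f'(1) assms(5) x g'(1)[OF x]])
  next
    fix v
    show "Ck_on k S (\<lambda>x. f' (g x) (g' x v))"
    proof (rule Ck_on_linear_apply[OF assms(1,2), where A="\<lambda>x. f' (g x)"])
      show "linear (f' (g x))" if "x \<in> S" for x
        using f'(1) assms(5) that has_derivative_linear by blast
      show "Ck_on k S (\<lambda>x. f' (g x) v)" for v
        using Suc.IH[OF _ f'(2)] Suc.prems(1) Ck_on_Suc_imp by blast
    qed (rule g')
  qed
qed

lemma Ck_on_subset: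
  assumes "finite_dim TYPE('a::real_normed_vector)" "thick S" "Ck_on k T f" "S \<subseteq> (T::'a::real_normed_vector set)"
  shows "Ck_on k S f"
  using Ck_on_compose[OF assms(2,1) Ck_on_id[OF assms(2)] assms(3)] assms(4) by simp

lemma at_within_Int_open: "x \<in> O' \<Longrightarrow> open O' \<Longrightarrow> at x within (S \<inter> O') = at x within S"
  by (rule at_within_nhd[of x O']) auto

lemma Ck_on_locally:
  assumes "\<And>x. x \<in> S \<Longrightarrow> \<exists>U. open U \<and> x \<in> U \<and> Ck_on k (S \<inter> U) f"
  shows "Ck_on k S f"
  using assms
proof (induction k arbitrary: f)
  case 0
  show ?case unfolding Ck_on.simps(1) continuous_on_eq_continuous_within
  proof
    fix x assume "x \<in> S"
    then obtain U where U: "open U" "x \<in> U" "continuous_on (S \<inter> U) f" using 0 by auto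
    then have "continuous (at x within (S \<inter> U)) f"
      using \<open>x \<in> S\<close> by (auto simp: continuous_on_eq_continuous_within)
    then show "continuous (at x within S) f" by (simp add: at_within_Int_open U)
  qed
next
  case (Suc k)
  have at: "at x within (S \<inter> U) = at x within S" if "x \<in> S \<inter> U" "open U" for x U
    using that by (auto simp: at_within_Int_open)
  have "f differentiable (at x within S)" if x: "x \<in> S" for x
  proof -
    obtain U where U: "open U" "x \<in> U" "Ck_on (Suc k) (S \<inter> U) f" using Suc.prems[OF x] by blast
    then have "f differentiable (at x within (S \<inter> U))" using that unfolding Ck_on.simps(2) by blast
    then show ?thesis using at[of x U] U that by simp
  qed
  moreover have "Ck_on k S (\<lambda>x. frechet_derivative f (at x within S) v)" for v
  proof (rule Suc.IH)
    fix x assume "x \<in> S"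
    then obtain U where U: "open U" "x \<in> U" "Ck_on (Suc k) (S \<inter> U) f" using Suc.prems by blast
    then have "Ck_on k (S \<inter> U) (\<lambda>x. frechet_derivative f (at x within (S \<inter> U)) v)"
      unfolding Ck_on.simps(2) by blast
    moreover have "Ck_on k (S \<inter> U) (\<lambda>x. frechet_derivative f (at x within (S \<inter> U)) v) \<longleftrightarrow>
       Ck_on k (S \<inter> U) (\<lambda>x. frechet_derivative f (at x within S) v)"
      by (rule Ck_on_cong) (simp only: at[OF _ U(1)])
    ultimately have "Ck_on k (S \<inter> U) (\<lambda>x. frechet_derivative f (at x within S) v)" by (simp only:)
    then show "\<exists>U. open U \<and> x \<in> U \<and> Ck_on k (S \<inter> U) (\<lambda>x. frechet_derivative f (at x within S) v)"
      using U(1,2) by blast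
  qed
  ultimately show ?case by (simp add: Ck_on.simps(2))
qed

lemma linear_two_sided_inverse:
  assumes "linear A" "\<And>v. B (A v) = v" "\<And>w. A (B w) = w"
  shows "linear B"
proof (rule linearI)
  fix x y r
  have "B (x + y) = B (A (B x + B y))" by (simp add: linear_add[OF assms(1)] assms(3))
  then show "B (x + y) = B x + B y" by (simp add: assms(2))
  have "B (r *\<^sub>R x) = B (A (r *\<^sub>R B x))" by (simp add: linear_scale[OF assms(1)] assms(3))
  then show "B (r *\<^sub>R x) = r *\<^sub>R B x" by (simp add: assms(2))
qed

text \<open>The derivative of an inverse family of operators, \<open>D(A\<inverse>) = - A\<inverse> DA A\<inverse>\<close>, expresses the
  derivative through the family itself, so its regularity can be bootstrapped.\<close>

lemma inverse_family_bounded: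
  fixes A :: "'a::real_normed_vector \<Rightarrow> 'b::real_normed_vector \<Rightarrow> 'c::real_normed_vector"
  assumes fd: "finite_dim TYPE('b)" "finite_dim TYPE('c)" 
    and lin: "\<And>x. x \<in> S \<Longrightarrow> linear (A x)"
    and cont: "\<And>v. continuous_on S (\<lambda>x. A x v)"
    and inv: "\<And>x v. x \<in> S \<Longrightarrow> B x (A x v) = v" "\<And>x w. x \<in> S \<Longrightarrow> A x (B x w) = w"
    and y: "y \<in> S"
  shows "\<exists>K. \<exists>d>0. \<forall>x\<in>S. dist x y < d \<longrightarrow> (\<forall>w. norm (B x w) \<le> K * norm w)"
proof -
  obtain E :: "'b set" and \<beta> where E: "finite E" "\<And>b. b \<in> E \<Longrightarrow> bounded_linear (\<beta> b)"
    "\<And>v. v = (\<Sum>b\<in>E. \<beta> b v *\<^sub>R b)" using finite_dim_coordinates[OF fd(1)] by blast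
  have linB: "linear (B x)" if "x \<in> S" for x
    by (rule linear_two_sided_inverse[OF lin[OF that]]) (use inv that in auto)
  obtain K where K: "K > 0" "\<And>w. norm (B y w) \<le> norm w * K"
    using bounded_linear.pos_bounded[OF finite_dim_linear_bounded[OF fd(2) linB[OF y]]] by blast
  have "\<forall>b\<in>E. \<exists>M>0. \<forall>v. norm (\<beta> b v) \<le> norm v * M"
    using bounded_linear.pos_bounded[OF E(2)] by blast
  then obtain M where M: "\<And>b. b \<in> E \<Longrightarrow> M b > 0" "\<And>b v. b \<in> E \<Longrightarrow> norm (\<beta> b v) \<le> norm v * M b" by metis
  \<comment> \<open>\<open>s x\<close> dominates the operator norm of \<open>A x - A y\<close>. Once
    it is below \<open>1 / (2 * K)\<close>, the perturbation is absorbed into the left-hand side at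
    the price of doubling \<open>K\<close>.\<close>
  define s where "s = (\<lambda>x. \<Sum>b\<in>E. M b * norm (A x b - A y b))"
  have "continuous_on S s" unfolding s_def by (intro continuous_intros cont)
  moreover have "s y = 0" by (simp add: s_def)
  ultimately obtain d where d: "d > 0" "\<And>x. x \<in> S \<Longrightarrow> dist x y < d \<Longrightarrow> \<bar>s x\<bar> < 1 / (2 * K)"
  proof -
    have "1 / (2 * K) > 0" using K(1) by simp
    with \<open>continuous_on S s\<close> y obtain d where "d > 0" "\<And>x. x \<in> S \<Longrightarrow> dist x y < d \<Longrightarrow> dist (s x) (s y) < 1 / (2 * K)"
      unfolding continuous_on_iff by blast
    then show ?thesis using that[of d] \<open>s y = 0\<close> by simp
  qed
  have "norm (B x w) \<le> (2 * K) * norm w" if x: "x \<in> S" "dist x y < d" for x w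
  proof -
    define v where "v = B x w"
    have "norm (A x v - A y v) \<le> s x * norm v"
    proof -
      have "A x v - A y v = (\<Sum>b\<in>E. \<beta> b v *\<^sub>R (A x b - A y b))"
        by (subst (1 2) E(3)[of v]) (simp add: linear_sum[OF lin[OF x(1)]] linear_scale[OF lin[OF x(1)]]
           linear_sum[OF lin[OF y]] linear_scale[OF lin[OF y]] sum_subtractf scaleR_right_diff_distrib)
      also have "norm \<dots> \<le> (\<Sum>b\<in>E. (norm v * M b) * norm (A x b - A y b))"
        using M(2) by (intro sum_norm_le) (auto intro: mult_right_mono)
      finally show ?thesis by (simp add: s_def sum_distrib_left sum_distrib_right mult_ac)
    qed
    also have "\<dots> \<le> 1 / (2 * K) * norm v" using d(2)[OF x] by (intro mult_right_mono) auto
    finally have *: "norm (A x v - A y v) \<le> 1 / (2 * K) * norm v" .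
    have "norm v = norm (B y (A y v))" using inv y by simp
    also have "\<dots> \<le> norm (A y v) * K" by (rule K)
    also have "norm (A y v) \<le> norm (A x v) + norm (A x v - A y v)"
      using norm_triangle_ineq4[of "A x v" "A x v - A y v"] by simp
    finally have "norm v \<le> (norm (A x v) + 1 / (2 * K) * norm v) * K" using * K(1)
      by (smt (verit) mult_right_mono)
    then have "norm v \<le> 2 * K * norm (A x v)" using K(1) by (simp add: field_simps)
    then show ?thesis using inv x by (simp add: v_def)
  qed
  then show ?thesis using d(1) by blast
qed

lemma Ck_on_inverse_family:
  fixes A :: "'a::real_normed_vector \<Rightarrow> 'b::real_normed_vector \<Rightarrow> 'c::real_normed_vector"
  assumes S: "thick S" and fd: "finite_dim TYPE('b)" "finite_dim TYPE('c)"
    and lin: "\<And>x. x \<in> S \<Longrightarrow> linear (A x)"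
    and A: "\<And>v. Ck_on k S (\<lambda>x. A x v)"
    and inv: "\<And>x v. x \<in> S \<Longrightarrow> B x (A x v) = v" "\<And>x w. x \<in> S \<Longrightarrow> A x (B x w) = w"
  shows "Ck_on k S (\<lambda>x. B x w)"
  using A
proof (induction k arbitrary: w)
  case 0
  have cont: "continuous_on S (\<lambda>x. A x v)" for v using 0 by simp
  show ?case unfolding Ck_on.simps(1) continuous_on_def
  proof
    fix y assume y: "y \<in> S"
    obtain K d where K: "d > 0" "\<And>x w. x \<in> S \<Longrightarrow> dist x y < d \<Longrightarrow> norm (B x w) \<le> K * norm w"
      using inverse_family_bounded[OF fd lin cont inv y] by blast
    \<comment> \<open>The resolvent identity. As \<open>B x\<close> is bounded near
      \<open>y\<close>, only the continuity of \<open>A\<close> at the fixed vector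
      \<open>B y w\<close> is needed.\<close>
    have diff: "B x w - B y w = B x (A y (B y w) - A x (B y w))" if "x \<in> S" for x
    proof -
      have "A x (B x w - B y w) = A y (B y w) - A x (B y w)"
        using that y inv(2) by (simp add: linear_diff[OF lin[OF that]])
      then show ?thesis using inv(1)[OF that, of "B x w - B y w"] by simp
    qed
    have "((\<lambda>x. B x w - B y w) \<longlongrightarrow> 0) (at y within S)"
    proof (rule Lim_null_comparison)
      show "\<forall>\<^sub>F x in at y within S. norm (B x w - B y w) \<le> K * norm (A y (B y w) - A x (B y w))"
        unfolding eventually_at using K diff by (intro exI[of _ d]) auto
      have "((\<lambda>x. A x (B y w)) \<longlongrightarrow> A y (B y w)) (at y within S)"
        using cont y by (auto simp: continuous_on_def)
      from tendsto_mult_left[OF tendsto_norm_zero[OF tendsto_diff[OF tendsto_const[of "A y (B y w)"] this, simplified]], of K]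
      show "((\<lambda>x. K * norm (A y (B y w) - A x (B y w))) \<longlongrightarrow> 0) (at y within S)" by simp
    qed
    then show "((\<lambda>x. B x w) \<longlongrightarrow> B y w) (at y within S)" by (simp add: LIM_zero_iff)
  qed
next
  case (Suc k)
  have "\<forall>v. \<exists>A'. (\<forall>x\<in>S. ((\<lambda>x. A x v) has_derivative A' x) (at x within S)) \<and> (\<forall>u. Ck_on k S (\<lambda>x. A' x u))"
  proof
    fix v
    obtain A' where "\<And>x. x \<in> S \<Longrightarrow> ((\<lambda>x. A x v) has_derivative A' x) (at x within S)"
      "\<And>u. Ck_on k S (\<lambda>x. A' x u)" by (rule Ck_onE[OF Suc.prems[of v]]) blast
    then show "\<exists>A'. (\<forall>x\<in>S. ((\<lambda>x. A x v) has_derivative A' x) (at x within S)) \<and> (\<forall>u. Ck_on k S (\<lambda>x. A' x u))"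
      by blast
  qed
  then obtain A' where A': "\<And>v x. x\<in>S \<Longrightarrow> ((\<lambda>x. A x v) has_derivative A' v x) (at x within S)"
    "\<And>v u. Ck_on k S (\<lambda>x. A' v x u)" by metis
  have linB: "linear (B x)" if "x \<in> S" for x
    by (rule linear_two_sided_inverse[OF lin[OF that]]) (use inv that in auto)
  \<comment> \<open>Linearity in the vector \<open>v\<close> on which the family acts, not in the
    direction \<open>u\<close>; it follows from uniqueness of derivatives.\<close>
  have linA': "linear (\<lambda>v. A' v x u)" if "x \<in> S" for x u
  proof (rule linearI)
    fix v1 v2
    have "((\<lambda>x. A x (v1 + v2)) has_derivative (\<lambda>u. A' v1 x u + A' v2 x u)) (at x within S)"
      using has_derivative_within_cong[OF that, of "\<lambda>x. A x (v1 + v2)" "\<lambda>x. A x v1 + A x v2"]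
        has_derivative_add[OF A'(1)[OF that] A'(1)[OF that], of v1 v2]
      by (simp add: linear_add[OF lin])
    from thick_has_derivative_unique[OF S that A'(1)[OF that] this]
    show "A' (v1 + v2) x u = A' v1 x u + A' v2 x u" by simp
  next
    fix r v
    have "((\<lambda>x. A x (r *\<^sub>R v)) has_derivative (\<lambda>u. r *\<^sub>R A' v x u)) (at x within S)"
      using has_derivative_within_cong[OF that, of "\<lambda>x. A x (r *\<^sub>R v)" "\<lambda>x. r *\<^sub>R A x v"]
        has_derivative_scaleR_right[OF A'(1)[OF that], of r v]
      by (simp add: linear_scale[OF lin])
    from thick_has_derivative_unique[OF S that A'(1)[OF that] this]
    show "A' (r *\<^sub>R v) x u = r *\<^sub>R A' v x u" by simp
  qed
  have IH: "Ck_on k S (\<lambda>x. B x w)" for w using Suc.IH Suc.prems Ck_on_Suc_imp by blast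
  have contB: "((\<lambda>x. B x w) \<longlongrightarrow> B y w) (at y within S)" if "y \<in> S" for w y
    using Ck_on_imp_continuous[OF IH] that by (auto simp: continuous_on_def)
  show ?case
  proof (rule Ck_onI[OF S, where f'="\<lambda>x u. - B x (A' (B x w) x u)"])
    fix y assume y: "y \<in> S"
    have contA: "continuous_on S (\<lambda>x. A x v)" for v using Ck_on_imp_continuous Suc.prems by blast
    obtain K d where K: "d > 0" "\<And>x w. x \<in> S \<Longrightarrow> dist x y < d \<Longrightarrow> norm (B x w) \<le> K * norm w"
      using inverse_family_bounded[OF fd lin contA inv y] by blast
    define v where "v = B y w"
    have diff: "B x w - B y w = - B x (A x v - A y v)" if "x \<in> S" for x
    proof -
      have "A x (B x w - B y w) = - (A x v - A y v)"
        using that y inv(2) by (simp add: v_def linear_diff[OF lin[OF that]])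
      then show ?thesis using inv(1)[OF that, of "B x w - B y w"] by (simp add: linear_neg[OF linB[OF that]] linear_diff[OF linB[OF that]])
    qed
    have blA: "bounded_linear (A' v y)" using A'(1)[OF y] has_derivative_bounded_linear by blast
    have blB: "bounded_linear (B y)" using finite_dim_linear_bounded[OF fd(2) linB[OF y]] .
    obtain E :: "'c set" and \<beta> where E: "finite E" "\<And>b. b \<in> E \<Longrightarrow> bounded_linear (\<beta> b)"
      "\<And>v. v = (\<Sum>b\<in>E. \<beta> b v *\<^sub>R b)" using finite_dim_coordinates[OF fd(2)] by blast
    have "\<forall>b\<in>E. \<exists>M>0. \<forall>v. norm (\<beta> b v) \<le> norm v * M"
      using bounded_linear.pos_bounded[OF E(2)] by blast
    then obtain M where M: "\<And>b. b \<in> E \<Longrightarrow> M b > 0" "\<And>b v. b \<in> E \<Longrightarrow> norm (\<beta> b v) \<le> norm v * M b" by metis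
    obtain N where N: "N > 0" "\<And>u. norm (A' v y u) \<le> norm u * N"
      using bounded_linear.pos_bounded[OF blA] by blast
    show "((\<lambda>x. B x w) has_derivative (\<lambda>u. - B y (A' (B y w) y u))) (at y within S)"
      unfolding v_def[symmetric]
    proof (rule has_derivativeI_sandwich[OF K(1)])
      show "bounded_linear (\<lambda>u. - B y (A' v y u))"
        by (intro bounded_linear_minus bounded_linear_compose[OF blB blA])
      \<comment> \<open>The error splits in two: the remainder of \<open>A\<close> at
        \<open>y\<close>, seen through the bounded \<open>B x\<close>, and \<open>B y - B x\<close>
        applied to the increment \<open>A' v y (x - y)\<close>. \<open>R\<close> controls the first
        part, \<open>Q\<close> the operator norm in the second.\<close>
      define R where "R = (\<lambda>x. norm (A x v - A y v - A' v y (x - y)) / norm (x - y))"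
      define Q where "Q = (\<lambda>x. \<Sum>b\<in>E. M b * norm (B y b - B x b))"
      have R: "(R \<longlongrightarrow> 0) (at y within S)"
        using A'(1)[OF y, of v] unfolding has_derivative_iff_norm R_def by simp
      have "((\<lambda>x. B y b - B x b) \<longlongrightarrow> 0) (at y within S)" for b
        using tendsto_diff[OF tendsto_const[of "B y b"] contB[OF y, of b]] by simp
      then have Q: "(Q \<longlongrightarrow> 0) (at y within S)"
        unfolding Q_def
        by (intro tendsto_null_sum) (auto intro!: tendsto_mult_right_zero tendsto_norm_zero)
      show "((\<lambda>x. K * R x + N * Q x) \<longlongrightarrow> 0) (at y within S)"
        using tendsto_add[OF tendsto_mult_left[OF R, of K] tendsto_mult_left[OF Q, of N]] by simp
      fix x assume x: "x \<in> S" "x \<noteq> y" "dist x y < d"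
      have "B x w - B y w - - B y (A' v y (x - y)) =
        - B x (A x v - A y v - A' v y (x - y)) + (B y (A' v y (x - y)) - B x (A' v y (x - y)))"
        using diff[OF x(1)] by (simp add: linear_diff[OF linB[OF x(1)]])
      also have "norm \<dots> \<le> K * norm (A x v - A y v - A' v y (x - y)) +
          norm (B y (A' v y (x - y)) - B x (A' v y (x - y)))"
        using norm_triangle_ineq[of "- B x (A x v - A y v - A' v y (x - y))"] K(2)[OF x(1,3)]
        by (smt (verit, best) norm_minus_cancel)
      also have "norm (B y (A' v y (x - y)) - B x (A' v y (x - y))) \<le> Q x * norm (A' v y (x - y))"
      proof -
        define z where "z = A' v y (x - y)"
        have "B y z - B x z = (\<Sum>b\<in>E. \<beta> b z *\<^sub>R (B y b - B x b))"
          by (subst (1 2) E(3)[of z]) (simp add: linear_sum[OF linB[OF x(1)]] linear_scale[OF linB[OF x(1)]]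
             linear_sum[OF linB[OF y]] linear_scale[OF linB[OF y]] sum_subtractf scaleR_right_diff_distrib)
        also have "norm \<dots> \<le> (\<Sum>b\<in>E. (norm z * M b) * norm (B y b - B x b))"
          using M(2) by (intro sum_norm_le) (auto intro: mult_right_mono)
        finally show ?thesis by (simp add: Q_def z_def[symmetric] sum_distrib_left sum_distrib_right mult_ac)
      qed
      also have "Q x * norm (A' v y (x - y)) \<le> Q x * (norm (x - y) * N)"
        using N(2) M(1) by (intro mult_left_mono) (auto simp: Q_def less_imp_le intro!: sum_nonneg mult_nonneg_nonneg)
      finally have "norm (B x w - B y w - - B y (A' v y (x - y))) \<le>
         K * norm (A x v - A y v - A' v y (x - y)) + Q x * (norm (x - y) * N)" by simp
      then show "norm (B x w - B y w - - B y (A' v y (x - y))) / norm (x - y) \<le> K * R x + N * Q x"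
        using x(2) by (simp add: R_def field_simps)
    qed
  next
    fix u
    have 1: "Ck_on k S (\<lambda>x. A' (B x w) x u)"
      by (rule Ck_on_linear_apply[OF S fd(1), where A="\<lambda>x v. A' v x u"]) (use linA' A' IH in auto)
    have "Ck_on k S (\<lambda>x. B x (A' (B x w) x u))"
      by (rule Ck_on_linear_apply[OF S fd(2) linB IH 1])
    from Ck_on_bounded_linear[OF S bounded_linear_minus[OF bounded_linear_ident] this]
    show "Ck_on k S (\<lambda>x. - B x (A' (B x w) x u))" .
  qed
qed

section \<open>Smooth maps on thick sets\<close>

lemma smooth_on_cong: "(\<And>x. x \<in> S \<Longrightarrow> f x = g x) \<Longrightarrow> smooth_on S f \<longleftrightarrow> smooth_on S g"
  unfolding smooth_on_def using Ck_on_cong[of S f g] by simp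

lemma smooth_on_imp_continuous: "smooth_on S f \<Longrightarrow> continuous_on S f"
  unfolding smooth_on_def using Ck_on_imp_continuous by blast

lemma smooth_on_const: "thick S \<Longrightarrow> smooth_on S (\<lambda>x. c)"
  unfolding smooth_on_def using Ck_on_const by blast

lemma smooth_on_id: "thick S \<Longrightarrow> smooth_on S (\<lambda>x. x)"
  unfolding smooth_on_def using Ck_on_id by blast

lemma smooth_on_add: "thick S \<Longrightarrow> smooth_on S f \<Longrightarrow> smooth_on S g \<Longrightarrow> smooth_on S (\<lambda>x. f x + g x)"
  unfolding smooth_on_def using Ck_on_add by blast

lemma smooth_on_bounded_linear:
  "thick S \<Longrightarrow> bounded_linear T \<Longrightarrow> smooth_on S f \<Longrightarrow> smooth_on S (\<lambda>x. T (f x))"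
  unfolding smooth_on_def using Ck_on_bounded_linear by blast

lemma smooth_on_bilinear:
  "thick S \<Longrightarrow> bounded_bilinear B \<Longrightarrow> smooth_on S f \<Longrightarrow> smooth_on S g \<Longrightarrow> smooth_on S (\<lambda>x. B (f x) (g x))"
  unfolding smooth_on_def using Ck_on_bilinear by blast

lemma smooth_on_diff: "thick S \<Longrightarrow> smooth_on S f \<Longrightarrow> smooth_on S g \<Longrightarrow> smooth_on S (\<lambda>x. f x - g x)"
  using smooth_on_add[of S f "\<lambda>x. - g x"]
    smooth_on_bounded_linear[OF _ bounded_linear_minus[OF bounded_linear_ident], of S g] by simp

lemma smooth_on_sum:
  "thick S \<Longrightarrow> (\<And>i. i \<in> I \<Longrightarrow> smooth_on S (f i)) \<Longrightarrow> smooth_on S (\<lambda>x. \<Sum>i\<in>I. f i x)"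
  unfolding smooth_on_def using Ck_on_sum[of S I _ f] by blast

lemma smooth_on_Pair: "thick S \<Longrightarrow> smooth_on S f \<Longrightarrow> smooth_on S g \<Longrightarrow> smooth_on S (\<lambda>x. (f x, g x))"
  unfolding smooth_on_def using Ck_on_Pair by blast

lemma smooth_on_linear_apply:
  fixes A :: "'a::real_normed_vector \<Rightarrow> 'b::real_normed_vector \<Rightarrow> 'c::real_normed_vector"
  assumes "thick S" "finite_dim TYPE('b)" "\<And>x. x \<in> S \<Longrightarrow> linear (A x)"
    "\<And>v. smooth_on S (\<lambda>x. A x v)" "smooth_on S w"
  shows "smooth_on S (\<lambda>x. A x (w x))"
  using assms Ck_on_linear_apply[of S A] unfolding smooth_on_def by blast

lemma smooth_on_compose:
  fixes f :: "'b::real_normed_vector \<Rightarrow> 'c::real_normed_vector"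
  assumes "thick S" "finite_dim TYPE('b)" "smooth_on S g" "smooth_on T f" "g ` S \<subseteq> T"
  shows "smooth_on S (\<lambda>x. f (g x))"
  using assms Ck_on_compose[of S _ g T f] unfolding smooth_on_def by blast

lemma smooth_on_subset:
  assumes "finite_dim TYPE('a::real_normed_vector)" "thick S" "smooth_on T f" "S \<subseteq> (T::'a::real_normed_vector set)"
  shows "smooth_on S f"
  using assms Ck_on_subset[of S _ T f] unfolding smooth_on_def by blast

lemma smooth_on_locally:
  assumes "\<And>x. x \<in> S \<Longrightarrow> \<exists>U. open U \<and> x \<in> U \<and> smooth_on (S \<inter> U) f"
  shows "smooth_on S f"
  unfolding smooth_on_def
proof
  fix k show "Ck_on k S f"
    by (rule Ck_on_locally) (use assms in \<open>unfold smooth_on_def, blast\<close>)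
qed

lemma smooth_on_inverse_family:
  fixes A :: "'a::real_normed_vector \<Rightarrow> 'b::real_normed_vector \<Rightarrow> 'c::real_normed_vector"
  assumes "thick S" "finite_dim TYPE('b)" "finite_dim TYPE('c)"
    and "\<And>x. x \<in> S \<Longrightarrow> linear (A x)" "\<And>v. smooth_on S (\<lambda>x. A x v)"
    and "\<And>x v. x \<in> S \<Longrightarrow> B x (A x v) = v" "\<And>x w. x \<in> S \<Longrightarrow> A x (B x w) = w"
  shows "smooth_on S (\<lambda>x. B x w)"
  unfolding smooth_on_def
proof
  fix k show "Ck_on k S (\<lambda>x. B x w)"
    by (rule Ck_on_inverse_family[where A = A]) (use assms in \<open>auto simp: smooth_on_def\<close>)
qed

lemma smooth_on_derivative:
  assumes "thick S" "smooth_on S f" "\<And>x. x \<in> S \<Longrightarrow> (f has_derivative f' x) (at x within S)"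
  shows "smooth_on S (\<lambda>x. f' x v)"
  unfolding smooth_on_def
proof
  fix k
  have "Ck_on (Suc k) S f" using assms(2) unfolding smooth_on_def by blast
  then have "Ck_on k S (\<lambda>x. frechet_derivative f (at x within S) v)" by (simp add: Ck_on.simps(2))
  moreover have "frechet_derivative f (at x within S) = f' x" if "x \<in> S" for x
    using thick_frechet_derivative assms(1,3) that by blast
  ultimately show "Ck_on k S (\<lambda>x. f' x v)"
    using Ck_on_cong[of S "\<lambda>x. frechet_derivative f (at x within S) v" "\<lambda>x. f' x v"] by simp
qed

lemma smooth_on_has_derivative_within:
  assumes "smooth_on S f" "x \<in> S"
  shows "(f has_derivative frechet_derivative f (at x within S)) (at x within S)"
proof -
  have "Ck_on (Suc 0) S f" using assms(1) unfolding smooth_on_def by blast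
  then have "f differentiable (at x within S)" using assms(2) unfolding Ck_on.simps(2) by blast
  then show ?thesis using frechet_derivative_works by blast
qed

lemma smooth_on_has_derivative:
  assumes "open S" "smooth_on S f" "x \<in> S"
  shows "(f has_derivative frechet_derivative f (at x)) (at x)"
  using smooth_on_has_derivative_within[OF assms(2,3)] at_within_open[OF assms(3,1)] by simp

lemma smooth_on_frechet_derivative:
  assumes "open S" "smooth_on S f"
  shows "smooth_on S (\<lambda>x. frechet_derivative f (at x) v)"
  by (rule smooth_on_derivative[OF thick_open[OF assms(1)] assms(2)])
    (use smooth_on_has_derivative[OF assms] assms(1) in \<open>simp add: at_within_open_NO_MATCH\<close>)

lemma smooth_on_frechet_apply:
  fixes f :: "'a::real_normed_vector \<Rightarrow> 'b::real_normed_vector"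
  assumes "finite_dim TYPE('a)" "open S" "smooth_on S f" "thick T" "smooth_on T z" "z ` T \<subseteq> S" "smooth_on T w"
  shows "smooth_on T (\<lambda>t. frechet_derivative f (at (z t)) (w t))"
proof (rule smooth_on_linear_apply[OF assms(4,1) _ _ assms(7)])
  show "linear (frechet_derivative f (at (z x)))" if "x \<in> T" for x
    using smooth_on_has_derivative[OF assms(2,3)] assms(6) that has_derivative_linear by blast
  show "smooth_on T (\<lambda>x. frechet_derivative f (at (z x)) v)" for v
    by (rule smooth_on_compose[OF assms(4,1,5) smooth_on_frechet_derivative[OF assms(2,3)] assms(6)])
qed

section \<open>Vector derivatives and product rules\<close>

lemma smooth_on_has_vector_derivative:
  assumes "smooth_on S f" "x \<in> S"
  shows "(f has_vector_derivative vector_derivative f (at x within S)) (at x within S)"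
  using smooth_on_has_derivative_within[OF assms] vector_derivative_works differentiable_def by blast

lemma smooth_on_vector_derivative:
  assumes "thick S" "smooth_on S f"
  shows "smooth_on S (\<lambda>x. vector_derivative f (at x within S))"
  using smooth_on_derivative[OF assms, of "\<lambda>x r. r *\<^sub>R vector_derivative f (at x within S)" 1]
    smooth_on_has_vector_derivative[OF assms(2)] unfolding has_vector_derivative_def by simp

lemma thick_real_at_nontrivial:
  assumes "thick S" "(x::real) \<in> S" shows "at x within S \<noteq> bot"
proof -
  obtain B where B: "span B = (UNIV::real set)"
    "\<And>v e. v\<in>B \<Longrightarrow> e>0 \<Longrightarrow> \<exists>d. 0 < \<bar>d\<bar> \<and> \<bar>d\<bar> < e \<and> x + d *\<^sub>R v \<in> S"
    using assms unfolding thick_def by blast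
  obtain v where v: "v \<in> B" "v \<noteq> 0"
  proof -
    have "\<not> B \<subseteq> {0}"
    proof
      assume "B \<subseteq> {0}"
      then have "span B \<subseteq> span (insert 0 {})" by (rule span_mono)
      then have "(1::real) \<in> {0}" using B(1) unfolding span_insert_0 span_empty by blast
      then show False by simp
    qed
    then show ?thesis using that by blast
  qed
  have "x islimpt S" unfolding islimpt_approachable
  proof (intro allI impI)
    fix e :: real assume "e > 0"
    then obtain d where d: "0 < \<bar>d\<bar>" "\<bar>d\<bar> < e / \<bar>v\<bar>" "x + d *\<^sub>R v \<in> S" using B(2)[OF v(1), of "e / \<bar>v\<bar>"] v(2) by auto
    then show "\<exists>x'\<in>S. x' \<noteq> x \<and> dist x' x < e"
      using v(2) by (intro bexI[of _ "x + d *\<^sub>R v"]) (auto simp: dist_real_def pos_less_divide_eq abs_mult)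
  qed
  then show ?thesis by (simp add: trivial_limit_within)
qed

lemma thick_vector_derivative:
  assumes "thick S" "x \<in> S" "(f has_vector_derivative f') (at x within S)"
  shows "vector_derivative f (at x within S) = f'"
  using vector_derivative_within[OF thick_real_at_nontrivial[OF assms(1,2)] assms(3)] .

lemma thick_vector_derivative_unique:
  assumes "thick S" "x \<in> S" "(f has_vector_derivative a) (at x within S)" "(f has_vector_derivative b) (at x within S)"
  shows "a = b"
  using thick_vector_derivative[OF assms(1-3)] thick_vector_derivative[OF assms(1,2,4)] by simp

text \<open>The map \<open>(x, w) \<mapsto> A x w\<close> is jointly differentiable, being a finite
  sum of coordinates of \<open>w\<close> times \<open>A x b\<close>. Its derivative \<open>D\<close>
  is then recognised on each factor separately, and the chain rule applies.\<close>

lemma linear_family_product_rule: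
  fixes A :: "'a::real_normed_vector \<Rightarrow> 'b::real_normed_vector \<Rightarrow> 'c::real_normed_vector"
  assumes fd: "finite_dim TYPE('b)" and U: "open U" and lin: "\<And>x. x \<in> U \<Longrightarrow> linear (A x)"
    and A: "\<And>w. smooth_on U (\<lambda>x. A x w)"
    and x: "(x has_derivative x') (at t within I)" and w: "(w has_derivative w') (at t within I)" and xt: "x t \<in> U"
  shows "((\<lambda>s. A (x s) (w s)) has_derivative
    (\<lambda>h. frechet_derivative (\<lambda>x. A x (w t)) (at (x t)) (x' h) + A (x t) (w' h))) (at t within I)"
proof -
  have op: "open (U \<times> (UNIV :: 'b set))" by (intro open_Times U open_UNIV)
  have th: "thick (U \<times> (UNIV :: 'b set))" using thick_open[OF op] .
  define f where "f = (\<lambda>z. A (fst z) (snd z))"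
  define D where "D = frechet_derivative f (at (x t, w t))"
  obtain B :: "'b set" and \<beta> where B: "finite B" "\<And>b. b \<in> B \<Longrightarrow> bounded_linear (\<beta> b)"
    "\<And>v. v = (\<Sum>b\<in>B. \<beta> b v *\<^sub>R b)" using finite_dim_coordinates[OF fd] by blast
  have "(f has_derivative (\<lambda>h. \<Sum>b\<in>B. \<beta> b (w t) *\<^sub>R frechet_derivative (\<lambda>x. A x b) (at (x t)) (fst h) + \<beta> b (snd h) *\<^sub>R A (x t) b)) (at (x t, w t))"
  proof (rule has_derivative_transform_within_open[OF _ op])
    show "((\<lambda>z. \<Sum>b\<in>B. \<beta> b (snd z) *\<^sub>R A (fst z) b) has_derivative
       (\<lambda>h. \<Sum>b\<in>B. \<beta> b (w t) *\<^sub>R frechet_derivative (\<lambda>x. A x b) (at (x t)) (fst h) + \<beta> b (snd h) *\<^sub>R A (x t) b)) (at (x t, w t))"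
    proof (rule has_derivative_sum)
      fix b assume b: "b \<in> B"
      have 1: "((\<lambda>z. \<beta> b (snd z)) has_derivative (\<lambda>h. \<beta> b (snd h))) (at (x t, w t))"
        by (rule bounded_linear_imp_has_derivative[OF bounded_linear_compose[OF B(2)[OF b] bounded_linear_snd]])
      have 2: "((\<lambda>z. A (fst z) b) has_derivative (\<lambda>h. frechet_derivative (\<lambda>x. A x b) (at (x t)) (fst h))) (at (x t, w t))"
        by (rule has_derivative_compose[where f = fst and g = "\<lambda>x. A x b"])
          (use smooth_on_has_derivative[OF U A xt] in \<open>auto intro!: derivative_eq_intros\<close>)
      show "((\<lambda>z. \<beta> b (snd z) *\<^sub>R A (fst z) b) has_derivative
          (\<lambda>h. \<beta> b (w t) *\<^sub>R frechet_derivative (\<lambda>x. A x b) (at (x t)) (fst h) + \<beta> b (snd h) *\<^sub>R A (x t) b)) (at (x t, w t))"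
        using has_derivative_scaleR[OF 1 2] by simp
    qed
    show "(x t, w t) \<in> U \<times> UNIV" using xt by simp
    fix z :: "'a \<times> 'b" assume "z \<in> U \<times> UNIV"
    then have l: "linear (A (fst z))" using lin by auto
    have "A (fst z) (snd z) = A (fst z) (\<Sum>b\<in>B. \<beta> b (snd z) *\<^sub>R b)" using B(3)[of "snd z"] by simp
    then show "(\<Sum>b\<in>B. \<beta> b (snd z) *\<^sub>R A (fst z) b) = f z"
      by (simp add: f_def linear_sum[OF l] linear_scale[OF l])
  qed
  then have D: "(f has_derivative D) (at (x t, w t))"
    unfolding D_def using frechet_derivative_works differentiable_def by blast
  have "((\<lambda>y. (y, w t)) has_derivative (\<lambda>u. (u, 0))) (at (x t))" by (auto intro!: derivative_eq_intros)
  from has_derivative_compose[OF this D] have d1: "((\<lambda>y. A y (w t)) has_derivative (\<lambda>u. D (u, 0))) (at (x t))"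
    by (simp add: f_def)
  have 1: "D (u, 0) = frechet_derivative (\<lambda>x. A x (w t)) (at (x t)) u" for u
    using fun_cong[OF has_derivative_unique[OF d1 smooth_on_has_derivative[OF U A xt]], of u] .
  have "((\<lambda>v. (x t, v)) has_derivative (\<lambda>u. (0, u))) (at (w t))" by (auto intro!: derivative_eq_intros)
  from has_derivative_compose[OF this D] have d2: "(A (x t) has_derivative (\<lambda>u. D (0, u))) (at (w t))"
    by (simp add: f_def)
  have d3: "(A (x t) has_derivative A (x t)) (at (w t))"
    by (rule bounded_linear_imp_has_derivative[OF finite_dim_linear_bounded[OF fd lin[OF xt]]])
  have 2: "D (0, u) = A (x t) u" for u using fun_cong[OF has_derivative_unique[OF d2 d3], of u] .
  have "D (u, v) = frechet_derivative (\<lambda>x. A x (w t)) (at (x t)) u + A (x t) v" for u v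
    using linear_add[OF has_derivative_linear[OF D], of "(u, 0)" "(0, v)"] 1 2 by simp
  then show ?thesis using has_derivative_compose[OF has_derivative_Pair[OF x w] D] by (simp add: f_def)
qed

lemma linear_family_vector_product_rule:
  fixes A :: "'a::real_normed_vector \<Rightarrow> 'b::real_normed_vector \<Rightarrow> 'c::real_normed_vector"
  assumes "finite_dim TYPE('b)" "open U" "\<And>x. x \<in> U \<Longrightarrow> linear (A x)" "\<And>w. smooth_on U (\<lambda>x. A x w)"
    and x: "(x has_vector_derivative x') (at t within I)" and w: "(w has_vector_derivative w') (at t within I)" and xt: "x t \<in> U"
  shows "((\<lambda>s. A (x s) (w s)) has_vector_derivative
    (frechet_derivative (\<lambda>x. A x (w t)) (at (x t)) x' + A (x t) w')) (at t within I)"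
  using linear_family_product_rule[OF assms(1-4) x[unfolded has_vector_derivative_def] w[unfolded has_vector_derivative_def] xt]
    linear_scale[OF has_derivative_linear[OF smooth_on_has_derivative[OF assms(2,4) xt]]] linear_scale[OF assms(3)[OF xt]]
  by (simp add: has_vector_derivative_def scaleR_add_right)

text \<open>Each functional is the combination of the fixed functionals
  \<open>Blinfun (\<beta> b)\<close> with its values on the basis as coefficients, so pointwise
  derivatives give a derivative in norm.\<close>

lemma blinfun_has_vector_derivativeI:
  fixes C :: "real \<Rightarrow> 'h::real_normed_vector \<Rightarrow>\<^sub>L real"
  assumes fd: "finite_dim TYPE('h)"
    and "\<And>e. ((\<lambda>s. blinfun_apply (C s) e) has_vector_derivative blinfun_apply A e) (at t within I)"
  shows "(C has_vector_derivative A) (at t within I)"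
proof -
  obtain B :: "'h set" and \<beta> where B: "finite B" "\<And>b. b \<in> B \<Longrightarrow> bounded_linear (\<beta> b)"
    "\<And>v. v = (\<Sum>b\<in>B. \<beta> b v *\<^sub>R b)" using finite_dim_coordinates[OF fd] by blast
  have exp: "D = (\<Sum>b\<in>B. blinfun_apply D b *\<^sub>R Blinfun (\<beta> b))" for D :: "'h \<Rightarrow>\<^sub>L real"
  proof (rule blinfun_eqI)
    fix v
    have "blinfun_apply D v = blinfun_apply D (\<Sum>b\<in>B. \<beta> b v *\<^sub>R b)" using B(3)[of v] by simp
    also have "\<dots> = (\<Sum>b\<in>B. \<beta> b v * blinfun_apply D b)" by (simp add: blinfun.sum_right blinfun.scaleR_right)
    also have "\<dots> = blinfun_apply (\<Sum>b\<in>B. blinfun_apply D b *\<^sub>R Blinfun (\<beta> b)) v"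
      by (simp add: blinfun.sum_left blinfun.scaleR_left bounded_linear_Blinfun_apply[OF B(2)] mult.commute)
    finally show "blinfun_apply D v = blinfun_apply (\<Sum>b\<in>B. blinfun_apply D b *\<^sub>R Blinfun (\<beta> b)) v" .
  qed
  have "((\<lambda>s. \<Sum>b\<in>B. blinfun_apply (C s) b *\<^sub>R Blinfun (\<beta> b)) has_vector_derivative
      (\<Sum>b\<in>B. blinfun_apply A b *\<^sub>R Blinfun (\<beta> b))) (at t within I)"
    using assms(2)
    by (intro has_vector_derivative_sum bounded_linear.has_vector_derivative[OF bounded_linear_scaleR_left])
  then show ?thesis unfolding exp[symmetric] .
qed

text \<open>The second difference \<open>f (x + h v + h w) - f (x + h v) - f (x + h w) + f x\<close> is symmetric
  in \<open>v\<close>, \<open>w\<close> and approximates \<open>h\<^sup>2\<close> times the iterated derivative.\<close>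

lemma second_difference_bound:
  fixes f :: "'a::real_normed_vector \<Rightarrow> 'b::real_normed_vector"
  assumes "r > 0" and f: "\<And>y. y \<in> ball x r \<Longrightarrow> (f has_derivative f' y) (at y)"
    and G: "((\<lambda>y. f' y v) has_derivative G') (at x)" and "e > 0"
  shows "\<exists>d>0. \<forall>h. 0 < h \<and> h < d \<longrightarrow>
    norm (f (x + h *\<^sub>R v + h *\<^sub>R w) - f (x + h *\<^sub>R v) - f (x + h *\<^sub>R w) + f x - (h * h) *\<^sub>R G' w) \<le> e * (h * h)"
proof -
  \<comment> \<open>\<open>h * K\<close> bounds every displacement occurring in the second
    difference; the \<open>+ 1\<close> makes \<open>K\<close> positive when both directions
    vanish.\<close>
  define K where "K = norm v + norm w + 1"
  have K: "K > 0" by (simp add: K_def add_nonneg_pos)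
  interpret G': bounded_linear G' using G has_derivative_bounded_linear by blast
  have "e / (2 * K) > 0" using K assms(4) by simp
  then obtain d where d: "d > 0"
    "\<And>y. norm (y - x) < d \<Longrightarrow> norm (f' y v - f' x v - G' (y - x)) \<le> e / (2 * K) * norm (y - x)"
    using G unfolding has_derivative_at_alt by blast
  have "norm (f (x + h *\<^sub>R v + h *\<^sub>R w) - f (x + h *\<^sub>R v) - f (x + h *\<^sub>R w) + f x - (h * h) *\<^sub>R G' w) \<le> e * (h * h)"
    if h: "0 < h" "h < min d r / K" for h
  proof -
    have hK: "h * K < d" "h * K < r" using h K by (auto simp: pos_less_divide_eq)
    \<comment> \<open>The increment of \<open>f\<close> over the step \<open>h *\<^sub>R w\<close>,
      as a function of the displacement along \<open>v\<close>, minus its expected linear growth.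
      Its derivative is a difference of two remainders of \<open>f'\<close>, each at most
      \<open>e * h / 2\<close>, and the mean value inequality over length \<open>h\<close> gives
      \<open>e * (h * h)\<close>.\<close>
    define \<phi> where "\<phi> = (\<lambda>s. f (x + h *\<^sub>R w + s *\<^sub>R v) - f (x + s *\<^sub>R v) - s *\<^sub>R (h *\<^sub>R G' w))"
    have bnd: "norm (h *\<^sub>R w + s *\<^sub>R v) \<le> h * K" "norm (s *\<^sub>R v) \<le> h * K" if s: "s \<in> {0..h}" for s
    proof -
      have "norm (h *\<^sub>R w + s *\<^sub>R v) \<le> h * norm w + s * norm v"
        using norm_triangle_ineq[of "h *\<^sub>R w" "s *\<^sub>R v"] h s by simp
      moreover have "s * norm v \<le> h * norm v" using s by (auto intro: mult_right_mono)
      ultimately show "norm (h *\<^sub>R w + s *\<^sub>R v) \<le> h * K" using h by (simp add: K_def algebra_simps)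
      have "h * norm w \<ge> 0" using h by simp
      moreover have "norm (s *\<^sub>R v) = s * norm v" using s by simp
      ultimately show "norm (s *\<^sub>R v) \<le> h * K"
        using \<open>s * norm v \<le> h * norm v\<close> h(1) unfolding K_def distrib_left by linarith
    qed
    define \<phi>' where "\<phi>' = (\<lambda>s. f' (x + h *\<^sub>R w + s *\<^sub>R v) v - f' (x + s *\<^sub>R v) v - h *\<^sub>R G' w)"
    have d1: "(\<phi> has_derivative (\<lambda>u. u *\<^sub>R \<phi>' s)) (at s within {0..h})" if s: "s \<in> {0..h}" for s
    proof -
      have y: "x + h *\<^sub>R w + s *\<^sub>R v \<in> ball x r" "x + s *\<^sub>R v \<in> ball x r"
      proof -
        have ball: "x + z \<in> ball x r" if "norm z \<le> h * K" for z
          using that hK by (simp add: dist_norm)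
        from ball[OF bnd(1)[OF s]] show "x + h *\<^sub>R w + s *\<^sub>R v \<in> ball x r" by (simp only: add.assoc)
        from ball[OF bnd(2)[OF s]] show "x + s *\<^sub>R v \<in> ball x r" .
      qed
      have l: "f' y (u *\<^sub>R v) = u *\<^sub>R f' y v" if "y \<in> ball x r" for y u
        using has_derivative_linear[OF f[OF that]] by (rule linear_scale)
      have "(\<phi> has_derivative (\<lambda>u. f' (x + h *\<^sub>R w + s *\<^sub>R v) (u *\<^sub>R v) - f' (x + s *\<^sub>R v) (u *\<^sub>R v) - u *\<^sub>R (h *\<^sub>R G' w))) (at s within {0..h})"
      proof -
        have 1: "((\<lambda>s. f (x + h *\<^sub>R w + s *\<^sub>R v)) has_derivative (\<lambda>u. f' (x + h *\<^sub>R w + s *\<^sub>R v) (u *\<^sub>R v))) (at s within {0..h})"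
          by (rule has_derivative_compose[where f="\<lambda>s. x + h *\<^sub>R w + s *\<^sub>R v" and g=f, OF _ f[OF y(1)]])
            (auto intro!: derivative_eq_intros)
        have 2: "((\<lambda>s. f (x + s *\<^sub>R v)) has_derivative (\<lambda>u. f' (x + s *\<^sub>R v) (u *\<^sub>R v))) (at s within {0..h})"
          by (rule has_derivative_compose[where f="\<lambda>s. x + s *\<^sub>R v" and g=f, OF _ f[OF y(2)]])
            (auto intro!: derivative_eq_intros)
        have 3: "((\<lambda>s. s *\<^sub>R (h *\<^sub>R G' w)) has_derivative (\<lambda>u. u *\<^sub>R (h *\<^sub>R G' w))) (at s within {0..h})"
          by (auto intro!: derivative_eq_intros)
        show ?thesis unfolding \<phi>_def by (rule has_derivative_diff[OF has_derivative_diff[OF 1 2] 3])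
      qed
      then show ?thesis by (simp add: l[OF y(1)] l[OF y(2)] \<phi>'_def scaleR_diff_right)
    qed
    have d2: "norm (\<phi>' s) \<le> e * h" if s: "s \<in> {0..h}" for s
    proof -
      let ?y = "h *\<^sub>R w + s *\<^sub>R v" and ?z = "s *\<^sub>R v"
      have 1: "norm (f' (x + ?y) v - f' x v - G' ?y) \<le> e / (2 * K) * norm ?y"
        using d(2)[of "x + ?y"] bnd[OF s] hK by (simp del: times_divide_eq_left)
      have 2: "norm (f' (x + ?z) v - f' x v - G' ?z) \<le> e / (2 * K) * norm ?z"
        using d(2)[of "x + ?z"] bnd[OF s] hK by (simp del: times_divide_eq_left)
      have "\<phi>' s = (f' (x + ?y) v - f' x v - G' ?y) - (f' (x + ?z) v - f' x v - G' ?z)"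
        by (simp add: \<phi>'_def G'.add G'.scaleR add.assoc)
      then have "norm (\<phi>' s) \<le> e / (2 * K) * norm ?y + e / (2 * K) * norm ?z"
        using 1 2 norm_triangle_ineq4 by (smt (verit))
      also have "\<dots> \<le> e / (2 * K) * (h * K) + e / (2 * K) * (h * K)"
        using bnd[OF s] K assms(4) by (intro add_mono mult_left_mono) auto
      also have "\<dots> = e * h" using K by (simp add: field_simps)
      finally show ?thesis .
    qed
    have "norm (\<phi> h - \<phi> 0) \<le> (e * h) * norm (h - 0)"
    proof (rule differentiable_bound[where f' = "\<lambda>s u. u *\<^sub>R \<phi>' s" and S = "{0..h}"])
      show "onorm (\<lambda>u. u *\<^sub>R \<phi>' s) \<le> e * h" if "s \<in> {0..h}" for s
        using d2[OF that] onorm_scaleR_left[OF bounded_linear_ident, of "\<phi>' s"] by (simp add: onorm_id)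
    qed (use d1 h in auto)
    moreover have "\<phi> h - \<phi> 0 = f (x + h *\<^sub>R v + h *\<^sub>R w) - f (x + h *\<^sub>R v) - f (x + h *\<^sub>R w) + f x - (h * h) *\<^sub>R G' w"
      by (simp add: \<phi>_def algebra_simps)
    ultimately show ?thesis using h by (simp add: mult.assoc)
  qed
  moreover have "min d r / K > 0" using d assms(1) K by simp
  ultimately show ?thesis by blast
qed

lemma symmetric_second_derivative:
  fixes f :: "'a::real_normed_vector \<Rightarrow> 'b::real_normed_vector"
  assumes "open S" "x \<in> S" "\<And>y. y \<in> S \<Longrightarrow> (f has_derivative f' y) (at y)"
    and v: "((\<lambda>y. f' y v) has_derivative V) (at x)" and w: "((\<lambda>y. f' y w) has_derivative W) (at x)"
  shows "V w = W v"
proof (rule ccontr)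
  assume ne: "V w \<noteq> W v"
  \<comment> \<open>A quarter, so that the two approximations together leave at most half of
    \<open>norm (V w - W v)\<close>.\<close>
  define e where "e = norm (V w - W v) / 4"
  have e: "e > 0" using ne by (simp add: e_def)
  obtain r where r: "r > 0" "ball x r \<subseteq> S" using assms(1,2) open_contains_ball by blast
  have f: "\<And>y. y \<in> ball x r \<Longrightarrow> (f has_derivative f' y) (at y)" using assms(3) r(2) by blast
  let ?D = "\<lambda>h. f (x + h *\<^sub>R v + h *\<^sub>R w) - f (x + h *\<^sub>R v) - f (x + h *\<^sub>R w) + f x"
  obtain d1 where d1: "d1 > 0" "\<And>h. 0 < h \<Longrightarrow> h < d1 \<Longrightarrow> norm (?D h - (h * h) *\<^sub>R V w) \<le> e * (h * h)"
    using second_difference_bound[OF r(1) f v e, where w = w] by blast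
  obtain d2 where d2: "d2 > 0" "\<And>h. 0 < h \<Longrightarrow> h < d2 \<Longrightarrow>
      norm (f (x + h *\<^sub>R w + h *\<^sub>R v) - f (x + h *\<^sub>R w) - f (x + h *\<^sub>R v) + f x - (h * h) *\<^sub>R W v) \<le> e * (h * h)"
    using second_difference_bound[OF r(1) f w e, where w = v] by blast
  define h where "h = min d1 d2 / 2"
  have h: "0 < h" "h < d1" "h < d2" using d1 d2 by (auto simp: h_def)
  have sw: "f (x + h *\<^sub>R w + h *\<^sub>R v) - f (x + h *\<^sub>R w) - f (x + h *\<^sub>R v) + f x = ?D h"
    by (simp add: algebra_simps)
  have "norm ((h * h) *\<^sub>R (V w - W v)) = norm ((?D h - (h * h) *\<^sub>R W v) - (?D h - (h * h) *\<^sub>R V w))"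
    by (simp add: scaleR_diff_right)
  also have "\<dots> \<le> e * (h * h) + e * (h * h)"
    using d1(2)[OF h(1,2)] d2(2)[OF h(1,3)] norm_triangle_ineq4[of "?D h - (h * h) *\<^sub>R W v" "?D h - (h * h) *\<^sub>R V w"]
    unfolding sw by linarith
  finally have "(h * h) * norm (V w - W v) \<le> (h * h) * (2 * e)" by (simp add: mult_ac)
  then have "norm (V w - W v) \<le> 2 * e" using h(1) mult_le_cancel_left_pos[of "h * h"] by simp
  then show False using e ne unfolding e_def by simp
qed

lemma smooth_on_transform: "smooth_on S f \<Longrightarrow> (\<And>x. x \<in> S \<Longrightarrow> f x = g x) \<Longrightarrow> smooth_on S g"
  using smooth_on_cong by blast

section \<open>Manifolds in charts\<close>

text \<open>The calculus of charts alone. Finite-dimensional \<open>flat\<close> manifolds belong to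
  this class, and it is stable under products and tangent bundles.\<close>

definition premanifold :: "('q, 'e::real_normed_vector) manifold \<Rightarrow> bool" where
  "premanifold A \<longleftrightarrow> finite_dim TYPE('e) \<and>
     (\<forall>c\<in>atlas A. inj_on (snd c) (fst c)) \<and>
     (\<forall>c\<in>atlas A. \<forall>d\<in>atlas A. open (snd c ` (fst c \<inter> fst d)) \<and>
        smooth_on (snd c ` (fst c \<inter> fst d)) (snd d \<circ> chart_inv c)) \<and>
     (\<forall>x. chart_at A x \<in> atlas A \<and> x \<in> fst (chart_at A x))"

text \<open>Covers both kinds of domains that occur, open sets of a manifold and time intervals in
  the flat line.\<close>

definition mthick :: "('q, 'e::real_normed_vector) manifold \<Rightarrow> 'q set \<Rightarrow> bool" where
  "mthick A S \<longleftrightarrow> (\<forall>c\<in>atlas A. thick (snd c ` (S \<inter> fst c)))"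

text \<open>Vectors are stored in the preferred chart of their base point, which need not vary
  continuously. This map re-expresses them in one chart \<open>c\<close>, where vectors at nearby
  points can be compared.\<close>

abbreviation components :: "('q, 'e::real_normed_vector) manifold \<Rightarrow> ('q, 'e) chart \<Rightarrow> 'q \<Rightarrow> 'e \<Rightarrow> 'e" where
  "components A c q \<equiv> frechet_derivative (snd c \<circ> chart_inv (chart_at A q)) (at (snd (chart_at A q) q))"

lemma smooth_manifold_premanifold: "smooth_manifold A \<Longrightarrow> premanifold A"
  unfolding smooth_manifold_def premanifold_def finite_dim_def by blast

context
  fixes A :: "('q, 'e::real_normed_vector) manifold"
  assumes A: "premanifold A"
begin

lemma premanifold_finite_dim: "finite_dim TYPE('e)"
  using A unfolding premanifold_def by blast

lemma chart_at_atlas: "chart_at A x \<in> atlas A" and chart_at_mem: "x \<in> fst (chart_at A x)"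
  using A unfolding premanifold_def by blast+

lemma chart_inj: "c \<in> atlas A \<Longrightarrow> inj_on (snd c) (fst c)"
  using A unfolding premanifold_def by blast

lemma chart_inv_chart: "c \<in> atlas A \<Longrightarrow> x \<in> fst c \<Longrightarrow> chart_inv c (snd c x) = x"
  using chart_inj by (simp add: inv_into_f_f)

lemma transition_open: "c \<in> atlas A \<Longrightarrow> d \<in> atlas A \<Longrightarrow> open (snd c ` (fst c \<inter> fst d))"
  using A unfolding premanifold_def by blast

lemma transition_smooth:
  "c \<in> atlas A \<Longrightarrow> d \<in> atlas A \<Longrightarrow> smooth_on (snd c ` (fst c \<inter> fst d)) (snd d \<circ> chart_inv c)"
  using A unfolding premanifold_def by blast

lemma chart_open: "c \<in> atlas A \<Longrightarrow> open (snd c ` fst c)"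
  using transition_open[of c c] by simp

lemma chart_image_Int:
  "c \<in> atlas A \<Longrightarrow> S \<subseteq> fst c \<Longrightarrow> T \<subseteq> fst c \<Longrightarrow> snd c ` (S \<inter> T) = snd c ` S \<inter> snd c ` T"
  using inj_on_image_Int[OF chart_inj] by blast

text \<open>The constructor \<open>topology\<close> returns the given predicate only if it is a
  topology. Stability under intersection rests on the injectivity of the charts.\<close>

lemma openin_mtop: "openin (mtop A) V \<longleftrightarrow> (\<forall>c\<in>atlas A. open (snd c ` (V \<inter> fst c)))"
proof -
  have "istopology (\<lambda>U. \<forall>c\<in>atlas A. open (snd c ` (U \<inter> fst c)))"
    unfolding istopology_def
  proof (intro conjI allI impI ballI)
    fix S T c assume "\<forall>c\<in>atlas A. open (snd c ` (S \<inter> fst c))" "\<forall>c\<in>atlas A. open (snd c ` (T \<inter> fst c))"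
      and c: "c \<in> atlas A"
    moreover have "snd c ` (S \<inter> T \<inter> fst c) = snd c ` (S \<inter> fst c) \<inter> snd c ` (T \<inter> fst c)"
      using chart_image_Int[OF c, of "S \<inter> fst c" "T \<inter> fst c"] by (simp add: Int_ac)
    ultimately show "open (snd c ` (S \<inter> T \<inter> fst c))" by (simp add: open_Int)
  next
    fix K c assume K: "\<forall>S\<in>K. \<forall>c\<in>atlas A. open (snd c ` (S \<inter> fst c))" and c: "c \<in> atlas A"
    have "snd c ` (\<Union> K \<inter> fst c) = (\<Union>S\<in>K. snd c ` (S \<inter> fst c))" by blast
    then show "open (snd c ` (\<Union> K \<inter> fst c))" using K c by auto
  qed
  then show ?thesis unfolding mtop_def by (simp add: topology_inverse')
qed

lemma openin_UNIV_mtop: "openin (mtop A) UNIV"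
  unfolding openin_mtop using chart_open by simp

lemma openin_chart_preimage:
  assumes c: "c \<in> atlas A" and W: "open W"
  shows "openin (mtop A) {x \<in> fst c. snd c x \<in> W}"
  unfolding openin_mtop
proof
  fix d assume d: "d \<in> atlas A"
  have "snd d ` ({x \<in> fst c. snd c x \<in> W} \<inter> fst d) =
      (snd d ` (fst d \<inter> fst c)) \<inter> (snd c \<circ> chart_inv d) -` W" (is "?L = ?R")
    using chart_inv_chart[OF d] by auto
  moreover have "open ?R"
    by (rule continuous_open_preimage[OF smooth_on_imp_continuous[OF transition_smooth[OF d c]] transition_open[OF d c] W])
  ultimately show "open ?L" by simp
qed

lemma openin_chart: "c \<in> atlas A \<Longrightarrow> openin (mtop A) (fst c)"
  using openin_chart_preimage[of c UNIV] by simp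

lemma openin_mthick: "openin (mtop A) S \<Longrightarrow> mthick A S"
  unfolding mthick_def openin_mtop using thick_open by blast

lemma mthick_UNIV: "mthick A UNIV"
  using openin_mthick openin_UNIV_mtop by blast

lemma smooth_mapI:
  assumes "\<And>x. x \<in> S \<Longrightarrow> \<exists>c\<in>atlas A. \<exists>d\<in>atlas B. \<exists>W. x \<in> fst c \<and> open W \<and> snd c x \<in> W \<and>
      (\<forall>y\<in>S \<inter> fst c. snd c y \<in> W \<longrightarrow> f y \<in> fst d) \<and>
      smooth_on (snd c ` (S \<inter> fst c) \<inter> W) (snd d \<circ> f \<circ> chart_inv c)"
  shows "smooth_map A S B f"
  unfolding smooth_map_def
proof
  fix x assume "x \<in> S"
  then obtain c d W where c: "c \<in> atlas A" and d: "d \<in> atlas B" and W: "x \<in> fst c" "open W" "snd c x \<in> W"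
      "\<forall>y\<in>S \<inter> fst c. snd c y \<in> W \<longrightarrow> f y \<in> fst d"
      "smooth_on (snd c ` (S \<inter> fst c) \<inter> W) (snd d \<circ> f \<circ> chart_inv c)" using assms by blast
  define V where "V = {y \<in> fst c. snd c y \<in> W}"
  have "snd c ` (V \<inter> S) = snd c ` (S \<inter> fst c) \<inter> W" by (auto simp: V_def)
  then show "\<exists>c\<in>atlas A. \<exists>d\<in>atlas B. \<exists>V. openin (mtop A) V \<and> x \<in> V \<and> V \<subseteq> fst c \<and>
      f ` (V \<inter> S) \<subseteq> fst d \<and> smooth_on (snd c ` (V \<inter> S)) (snd d \<circ> f \<circ> chart_inv c)"
    using c d W openin_chart_preimage[OF c W(2)]
    by (intro bexI[OF _ c] bexI[OF _ d] exI[of _ V]) (auto simp: V_def)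
qed

text \<open>Smoothness provides some pair of charts \<open>c'\<close>, \<open>d'\<close>. The
  representation in a prescribed pair is obtained by the detour through them, composing with a
  transition map on each side, on a neighbourhood \<open>W\<close> small enough for the detour to be
  defined.\<close>

lemma smooth_map_chart:
  fixes B :: "('r, 'f::real_normed_vector) manifold"
  assumes B: "premanifold B" and S: "mthick A S" and f: "smooth_map A S B f" and x: "x \<in> S"
    and c: "c \<in> atlas A" "x \<in> fst c" and d: "d \<in> atlas B" "f x \<in> fst d"
  obtains W where "open W" "snd c x \<in> W" "\<And>y. y \<in> S \<Longrightarrow> y \<in> fst c \<Longrightarrow> snd c y \<in> W \<Longrightarrow> f y \<in> fst d"
    "smooth_on (snd c ` (S \<inter> fst c) \<inter> W) (snd d \<circ> f \<circ> chart_inv c)"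
proof -
  obtain c' d' V where c': "c' \<in> atlas A" and d': "d' \<in> atlas B" and V: "openin (mtop A) V" "x \<in> V" "V \<subseteq> fst c'"
     and fV: "f ` (V \<inter> S) \<subseteq> fst d'" and sm: "smooth_on (snd c' ` (V \<inter> S)) (snd d' \<circ> f \<circ> chart_inv c')"
    using f x unfolding smooth_map_def by blast
  note invA = chart_inv_chart and invB = inv_into_f_f
  have injB: "inj_on (snd d) (fst d)" "inj_on (snd d') (fst d')" using B d(1) d' unfolding premanifold_def by blast+
  define S' where "S' = snd c' ` (V \<inter> S)"
  define h where "h = snd d' \<circ> f \<circ> chart_inv c'"
  define D where "D = snd d' ` (fst d' \<inter> fst d)"
  have D: "open D" "smooth_on D (snd d \<circ> chart_inv d')"
    using B d(1) d' unfolding premanifold_def D_def by blast+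
  have "continuous_on S' h" using sm smooth_on_imp_continuous unfolding S'_def h_def by blast
  \<comment> \<open>\<open>h\<close> is continuous only on \<open>S'\<close>, so the preimage of
    \<open>D\<close> is open relative to \<open>S'\<close>; \<open>O1\<close> is an open set that
    cuts it out.\<close>
  then obtain O1 where O1: "open O1" "O1 \<inter> S' = h -` D \<inter> S'"
    using D(1) unfolding continuous_on_open_invariant by blast
  have hval: "h (snd c' y) = snd d' (f y)" if "y \<in> V" for y
    using that V(3) invA[OF c'] by (auto simp: h_def)
  define W0 where "W0 = V \<inter> fst c \<inter> {y \<in> fst c'. snd c' y \<in> O1}"
  have W0: "openin (mtop A) W0"
    unfolding W0_def by (intro openin_Int V(1) openin_chart c(1) openin_chart_preimage c' O1)
  define W where "W = snd c ` W0"
  have W0c: "W0 \<subseteq> fst c" "W0 \<subseteq> V" by (auto simp: W0_def)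
  then have "open W" using W0 c(1) unfolding openin_mtop W_def by (metis Int_absorb2)
  have xW: "x \<in> W0"
  proof -
    have "h (snd c' x) \<in> D" using hval[OF V(2)] fV x V(2) d(2) by (auto simp: D_def)
    moreover have "snd c' x \<in> S'" using V(2) x by (simp add: S'_def)
    ultimately have "snd c' x \<in> O1" using O1(2) by blast
    then show ?thesis using V c by (auto simp: W0_def)
  qed
  have memW0: "y \<in> W0" if y: "y \<in> fst c" "snd c y \<in> W" for y
  proof -
    obtain y' where "y' \<in> W0" "snd c y = snd c y'" using y(2) unfolding W_def by blast
    then show ?thesis using inj_onD[OF chart_inj[OF c(1)], of y y'] y(1) W0c by auto
  qed
  have fW0: "f y \<in> fst d \<inter> fst d'" "h (snd c' y) \<in> D" if "y \<in> W0" "y \<in> S" for y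
  proof -
    have "snd c' y \<in> O1 \<inter> S'" using that by (auto simp: W0_def S'_def)
    then show hD: "h (snd c' y) \<in> D" using O1(2) by blast
    then have "snd d' (f y) \<in> D" using hval that W0c by auto
    moreover have "f y \<in> fst d'" using fV that W0c by blast
    ultimately show "f y \<in> fst d \<inter> fst d'"
      unfolding D_def using injB(2) by (auto dest: inj_onD)
  qed
  show ?thesis
  proof (rule that[of W])
    show "open W" by fact
    show "snd c x \<in> W" using xW by (simp add: W_def)
    show "f y \<in> fst d" if "y \<in> S" "y \<in> fst c" "snd c y \<in> W" for y using fW0 memW0 that by blast
    define T where "T = snd c ` (S \<inter> fst c) \<inter> W"
    have thT: "thick T" unfolding T_def
      using S c(1) \<open>open W\<close> thick_Int_open unfolding mthick_def by blast
    have TE: "\<exists>y. z = snd c y \<and> y \<in> S \<and> y \<in> fst c \<and> y \<in> W0" if "z \<in> T" for z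
      using that memW0 unfolding T_def by blast
    have W0c': "W0 \<subseteq> fst c'" by (auto simp: W0_def)
    have g: "smooth_on T (snd c' \<circ> chart_inv c)"
      by (rule smooth_on_subset[OF premanifold_finite_dim thT transition_smooth[OF c(1) c']]) (use TE W0c' in fastforce)
    have gT: "(snd c' \<circ> chart_inv c) ` T \<subseteq> S'"
    proof
      fix w assume "w \<in> (snd c' \<circ> chart_inv c) ` T"
      then obtain y where "w = (snd c' \<circ> chart_inv c) (snd c y)" "y \<in> S" "y \<in> fst c" "y \<in> W0" using TE by blast
      then show "w \<in> S'" using invA[OF c(1)] W0c by (auto simp: S'_def)
    qed
    have hg: "smooth_on T (\<lambda>z. h ((snd c' \<circ> chart_inv c) z))"
      by (rule smooth_on_compose[OF thT premanifold_finite_dim g _ gT]) (use sm in \<open>simp add: S'_def h_def comp_def\<close>)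
    have fdB: "finite_dim TYPE('f)" using B unfolding premanifold_def by blast
    have "smooth_on T (\<lambda>z. (snd d \<circ> chart_inv d') (h ((snd c' \<circ> chart_inv c) z)))"
    proof (rule smooth_on_compose[OF thT fdB hg D(2)])
      show "(\<lambda>z. h ((snd c' \<circ> chart_inv c) z)) ` T \<subseteq> D"
        using TE fW0 invA[OF c(1)] by fastforce
    qed
    moreover have "(snd d \<circ> chart_inv d') (h ((snd c' \<circ> chart_inv c) z)) = (snd d \<circ> f \<circ> chart_inv c) z" if "z \<in> T" for z
    proof -
      obtain y where y: "z = snd c y" "y \<in> S" "y \<in> fst c" "y \<in> W0" using TE \<open>z \<in> T\<close> by blast
      then have "h ((snd c' \<circ> chart_inv c) z) = snd d' (f y)" using hval[of y] invA[OF c(1)] W0c by auto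
      moreover have "f y \<in> fst d'" using fW0(1)[OF y(4,2)] by blast
      ultimately show ?thesis using y invA[OF c(1)] inv_into_f_f[OF injB(2)] by simp
    qed
    ultimately show "smooth_on (snd c ` (S \<inter> fst c) \<inter> W) (snd d \<circ> f \<circ> chart_inv c)"
      unfolding T_def[symmetric] by (rule smooth_on_transform)
  qed
qed

end

lemma smooth_map_compose:
  assumes A: "premanifold A" and B: "premanifold B" and C: "premanifold C"
    and S: "mthick A S" and T: "mthick B T" and f: "smooth_map A S B f" and g: "smooth_map B T C g"
    and fST: "f ` S \<subseteq> T"
  shows "smooth_map A S C (\<lambda>x. g (f x))"
proof (rule smooth_mapI[OF A])
  fix x assume x: "x \<in> S"
  define c d e where "c = chart_at A x" and "d = chart_at B (f x)" and "e = chart_at C (g (f x))"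
  have c: "c \<in> atlas A" "x \<in> fst c" and d: "d \<in> atlas B" "f x \<in> fst d" and e: "e \<in> atlas C" "g (f x) \<in> fst e"
    unfolding c_def d_def e_def using A B C by (auto simp: chart_at_atlas chart_at_mem)
  obtain W1 where W1: "open W1" "snd c x \<in> W1" "\<And>y. y \<in> S \<Longrightarrow> y \<in> fst c \<Longrightarrow> snd c y \<in> W1 \<Longrightarrow> f y \<in> fst d"
    "smooth_on (snd c ` (S \<inter> fst c) \<inter> W1) (snd d \<circ> f \<circ> chart_inv c)"
    using smooth_map_chart[OF A B S f x c d] by blast
  have fx: "f x \<in> T" using fST x by blast
  obtain W2 where W2: "open W2" "snd d (f x) \<in> W2" "\<And>y. y \<in> T \<Longrightarrow> y \<in> fst d \<Longrightarrow> snd d y \<in> W2 \<Longrightarrow> g y \<in> fst e"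
    "smooth_on (snd d ` (T \<inter> fst d) \<inter> W2) (snd e \<circ> g \<circ> chart_inv d)"
    using smooth_map_chart[OF B C T g fx d e] by blast
  define R where "R = snd c ` (S \<inter> fst c) \<inter> W1"
  have "continuous_on R (snd d \<circ> f \<circ> chart_inv c)" using W1(4) smooth_on_imp_continuous R_def by blast
  then obtain O1 where O1: "open O1" "O1 \<inter> R = (snd d \<circ> f \<circ> chart_inv c) -` W2 \<inter> R"
    using W2(1) unfolding continuous_on_open_invariant by blast
  have RE: "\<exists>y. z = snd c y \<and> y \<in> S \<and> y \<in> fst c \<and> (snd d \<circ> f \<circ> chart_inv c) z = snd d (f y) \<and> f y \<in> fst d
      \<and> chart_inv c z = y"
    if "z \<in> R" for z
    using that chart_inv_chart[OF A c(1)] W1(3) unfolding R_def by fastforce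
  have xR: "snd c x \<in> R" using x c W1 by (auto simp: R_def)
  have xO: "snd c x \<in> O1" using O1(2) xR W2(2) chart_inv_chart[OF A c] by fastforce
  show "\<exists>c\<in>atlas A. \<exists>d\<in>atlas C. \<exists>W. x \<in> fst c \<and> open W \<and> snd c x \<in> W \<and>
      (\<forall>y\<in>S \<inter> fst c. snd c y \<in> W \<longrightarrow> g (f y) \<in> fst d) \<and>
      smooth_on (snd c ` (S \<inter> fst c) \<inter> W) (snd d \<circ> (\<lambda>x. g (f x)) \<circ> chart_inv c)"
  proof (intro bexI[OF _ c(1)] bexI[OF _ e(1)] exI[of _ "W1 \<inter> O1"] conjI ballI impI)
    show "x \<in> fst c" "open (W1 \<inter> O1)" "snd c x \<in> W1 \<inter> O1" using c W1 O1 xO by auto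
    show "g (f y) \<in> fst e" if y: "y \<in> S \<inter> fst c" "snd c y \<in> W1 \<inter> O1" for y
    proof -
      have "snd c y \<in> O1 \<inter> R" using y by (auto simp: R_def)
      then have "(snd d \<circ> f \<circ> chart_inv c) (snd c y) \<in> W2" using O1(2) by blast
      then have "snd d (f y) \<in> W2" using chart_inv_chart[OF A c(1)] y by auto
      then show ?thesis using W2(3) W1(3) fST y by blast
    qed
    have eq: "snd c ` (S \<inter> fst c) \<inter> (W1 \<inter> O1) = R \<inter> O1" by (auto simp: R_def)
    have th: "thick (R \<inter> O1)"
      unfolding R_def using S c(1) W1(1) O1(1) thick_Int_open unfolding mthick_def by blast
    have 1: "smooth_on (R \<inter> O1) (snd d \<circ> f \<circ> chart_inv c)"
      by (rule smooth_on_subset[OF premanifold_finite_dim[OF A] th]) (use W1(4) R_def in auto)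
    have "smooth_on (R \<inter> O1) (\<lambda>z. (snd e \<circ> g \<circ> chart_inv d) ((snd d \<circ> f \<circ> chart_inv c) z))"
    proof (rule smooth_on_compose[OF th premanifold_finite_dim[OF B] 1 W2(4)])
      show "(snd d \<circ> f \<circ> chart_inv c) ` (R \<inter> O1) \<subseteq> snd d ` (T \<inter> fst d) \<inter> W2"
      proof
        fix w assume "w \<in> (snd d \<circ> f \<circ> chart_inv c) ` (R \<inter> O1)"
        then obtain z where z: "w = (snd d \<circ> f \<circ> chart_inv c) z" "z \<in> O1 \<inter> R" by blast
        then have "w \<in> W2" using O1(2) by blast
        moreover have "w \<in> snd d ` (T \<inter> fst d)" using RE[of z] z fST by auto
        ultimately show "w \<in> snd d ` (T \<inter> fst d) \<inter> W2" by blast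
      qed
    qed
    moreover have "(snd e \<circ> g \<circ> chart_inv d) ((snd d \<circ> f \<circ> chart_inv c) z) = (snd e \<circ> (\<lambda>x. g (f x)) \<circ> chart_inv c) z"
      if "z \<in> R \<inter> O1" for z
      using RE[of z] that chart_inv_chart[OF B d(1)] by auto
    ultimately show "smooth_on (snd c ` (S \<inter> fst c) \<inter> (W1 \<inter> O1)) (snd e \<circ> (\<lambda>x. g (f x)) \<circ> chart_inv c)"
      unfolding eq by (rule smooth_on_transform)
  qed
qed

lemma smooth_map_id: "premanifold A \<Longrightarrow> mthick A S \<Longrightarrow> smooth_map A S A (\<lambda>x. x)"
proof (rule smooth_mapI, assumption)
  fix x assume A: "premanifold A" and S: "mthick A S" and x: "x \<in> S"
  define c where "c = chart_at A x"
  have c: "c \<in> atlas A" "x \<in> fst c" unfolding c_def using A by (auto simp: chart_at_atlas chart_at_mem)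
  have th: "thick (snd c ` (S \<inter> fst c) \<inter> UNIV)" using S c unfolding mthick_def by simp
  have "smooth_on (snd c ` (S \<inter> fst c) \<inter> UNIV) (snd c \<circ> (\<lambda>x. x) \<circ> chart_inv c)"
    using smooth_on_id[OF th] by (subst smooth_on_cong[where g="\<lambda>x. x"]) (auto simp: chart_inv_chart[OF A c(1)])
  then show "\<exists>c\<in>atlas A. \<exists>d\<in>atlas A. \<exists>W. x \<in> fst c \<and> open W \<and> snd c x \<in> W \<and>
      (\<forall>y\<in>S \<inter> fst c. snd c y \<in> W \<longrightarrow> y \<in> fst d) \<and>
      smooth_on (snd c ` (S \<inter> fst c) \<inter> W) (snd d \<circ> (\<lambda>x. x) \<circ> chart_inv c)"
    using c by (intro bexI[OF _ c(1)] exI[of _ UNIV]) auto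
qed

lemma smooth_map_const:
  assumes A: "premanifold A" and B: "premanifold B" and S: "mthick A S"
  shows "smooth_map A S B (\<lambda>x. b)"
proof (rule smooth_mapI[OF A])
  fix x assume x: "x \<in> S"
  define c d where "c = chart_at A x" and "d = chart_at B b"
  have c: "c \<in> atlas A" "x \<in> fst c" and d: "d \<in> atlas B" "b \<in> fst d"
    unfolding c_def d_def using A B by (auto simp: chart_at_atlas chart_at_mem)
  have th: "thick (snd c ` (S \<inter> fst c) \<inter> UNIV)" using S c unfolding mthick_def by simp
  show "\<exists>c\<in>atlas A. \<exists>d\<in>atlas B. \<exists>W. x \<in> fst c \<and> open W \<and> snd c x \<in> W \<and>
      (\<forall>y\<in>S \<inter> fst c. snd c y \<in> W \<longrightarrow> b \<in> fst d) \<and>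
      smooth_on (snd c ` (S \<inter> fst c) \<inter> W) (snd d \<circ> (\<lambda>x. b) \<circ> chart_inv c)"
    using c d smooth_on_const[OF th, of "snd d b"]
    by (intro bexI[OF _ c(1)] bexI[OF _ d(1)] exI[of _ UNIV]) (auto simp: comp_def)
qed

lemma smooth_map_subset:
  assumes "premanifold A" "premanifold B" "mthick A S" "mthick A T" "smooth_map A T B f" "S \<subseteq> T"
  shows "smooth_map A S B f"
  using smooth_map_compose[OF assms(1,1,2,3,4) smooth_map_id[OF assms(1,3)] assms(5)] assms(6) by auto

lemma smooth_map_cong:
  assumes A: "premanifold A" and eq: "\<And>x. x \<in> S \<Longrightarrow> f x = g x" and f: "smooth_map A S B f"
  shows "smooth_map A S B g"
  unfolding smooth_map_def
proof
  fix x assume "x \<in> S"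
  then obtain c d V where *: "c\<in>atlas A" "d\<in>atlas B" "openin (mtop A) V" "x \<in> V" "V \<subseteq> fst c"
        "f ` (V \<inter> S) \<subseteq> fst d" "smooth_on (snd c ` (V \<inter> S)) (snd d \<circ> f \<circ> chart_inv c)"
    using f unfolding smooth_map_def by blast
  have "smooth_on (snd c ` (V \<inter> S)) (snd d \<circ> g \<circ> chart_inv c)"
    by (rule smooth_on_cong[THEN iffD1, OF _ *(7)])
      (use eq *(5) in \<open>auto simp: chart_inv_chart[OF A *(1)] subset_iff\<close>)
  moreover have "g ` (V \<inter> S) \<subseteq> fst d" using *(6) eq by auto
  ultimately show "\<exists>c\<in>atlas A. \<exists>d\<in>atlas B. \<exists>V. openin (mtop A) V \<and> x \<in> V \<and> V \<subseteq> fst c \<and>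
        g ` (V \<inter> S) \<subseteq> fst d \<and> smooth_on (snd c ` (V \<inter> S)) (snd d \<circ> g \<circ> chart_inv c)"
    using *(1-5) by blast
qed

section \<open>Flat manifolds\<close>

lemma flat_simps [simp]: "atlas flat = {(UNIV, id)}" "chart_at flat x = (UNIV, id)"
  by (simp_all add: flat_def)

lemma inv_into_UNIV_id [simp]: "inv_into UNIV id = id"
  by (simp add: inv_equality fun_eq_iff)

lemma premanifold_flat:
  assumes "finite_dim TYPE('v::real_normed_vector)"
  shows "premanifold (flat :: ('v, 'v) manifold)"
proof -
  have "smooth_on UNIV (id :: 'v \<Rightarrow> 'v)" using smooth_on_id[OF thick_open[OF open_UNIV]] by (simp add: id_def)
  then show ?thesis using assms by (simp add: premanifold_def)
qed

lemma mthick_flat: "mthick flat S \<longleftrightarrow> thick S"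
  by (simp add: mthick_def)

lemma smooth_map_flat_chart:
  assumes fd: "finite_dim TYPE('v::real_normed_vector)" and B: "premanifold B" and S: "thick S"
    and f: "smooth_map (flat :: ('v, 'v) manifold) S B f" and x: "x \<in> S" and d: "d \<in> atlas B" "f x \<in> fst d"
  obtains W where "open W" "x \<in> W" "\<And>y. y \<in> S \<Longrightarrow> y \<in> W \<Longrightarrow> f y \<in> fst d" "smooth_on (S \<inter> W) (\<lambda>y. snd d (f y))"
proof -
  obtain W where W: "open W" "snd (UNIV, id) x \<in> W" "\<And>y. y \<in> S \<Longrightarrow> y \<in> fst (UNIV, id) \<Longrightarrow> snd (UNIV, id) y \<in> W \<Longrightarrow> f y \<in> fst d"
    "smooth_on (snd (UNIV, id) ` (S \<inter> fst (UNIV, id)) \<inter> W) (snd d \<circ> f \<circ> chart_inv (UNIV, id))"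
    using smooth_map_chart[OF premanifold_flat[OF fd] B _ f x, of "(UNIV, id)" d] S d by (auto simp: mthick_flat)
  then show ?thesis using that[of W] by (simp add: comp_def)
qed

lemma smooth_map_flatI:
  assumes fd: "finite_dim TYPE('v::real_normed_vector)"
    and "\<And>x. x \<in> S \<Longrightarrow> \<exists>d\<in>atlas B. \<exists>W. open W \<and> x \<in> W \<and> (\<forall>y\<in>S \<inter> W. f y \<in> fst d) \<and>
      smooth_on (S \<inter> W) (\<lambda>y. snd d (f y))"
  shows "smooth_map (flat :: ('v, 'v) manifold) S B f"
proof (rule smooth_mapI[OF premanifold_flat[OF fd]])
  fix x assume "x \<in> S"
  then obtain d W where "d\<in>atlas B" "open W" "x \<in> W" "\<forall>y\<in>S \<inter> W. f y \<in> fst d" "smooth_on (S \<inter> W) (\<lambda>y. snd d (f y))"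
    using assms(2) by blast
  then show "\<exists>c\<in>atlas flat. \<exists>d\<in>atlas B. \<exists>W. x \<in> fst c \<and> open W \<and> snd c x \<in> W \<and>
      (\<forall>y\<in>S \<inter> fst c. snd c y \<in> W \<longrightarrow> f y \<in> fst d) \<and>
      smooth_on (snd c ` (S \<inter> fst c) \<inter> W) (snd d \<circ> f \<circ> chart_inv c)"
    by (intro bexI[of _ "(UNIV, id)"] bexI[of _ d] exI[of _ W]) (auto simp: comp_def)
qed

lemma smooth_map_flat_flat:
  assumes "finite_dim TYPE('v::real_normed_vector)" "finite_dim TYPE('w::real_normed_vector)" "thick S"
  shows "smooth_map (flat :: ('v,'v) manifold) S (flat :: ('w,'w) manifold) f \<longleftrightarrow> smooth_on S f" (is "?L \<longleftrightarrow> ?R")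
proof
  assume L: ?L
  show ?R
  proof (rule smooth_on_locally)
    fix x assume "x \<in> S"
    then obtain W where "open W" "x \<in> W" "smooth_on (S \<inter> W) (\<lambda>y. snd (UNIV, id) (f y))"
      using smooth_map_flat_chart[OF assms(1) premanifold_flat[OF assms(2)] assms(3) L, of x "(UNIV, id)"] by auto
    then show "\<exists>U. open U \<and> x \<in> U \<and> smooth_on (S \<inter> U) f" by auto
  qed
next
  assume ?R
  then show ?L by (intro smooth_map_flatI[OF assms(1)]) (auto intro!: exI[of _ UNIV])
qed

section \<open>Differentials\<close>

lemma smooth_map_rep_has_derivative:
  assumes A: "premanifold A" and B: "premanifold B" and S: "openin (mtop A) S" and f: "smooth_map A S B f" and x: "x \<in> S"
    and c: "c \<in> atlas A" "x \<in> fst c" and d: "d \<in> atlas B" "f x \<in> fst d"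
  shows "((snd d \<circ> f \<circ> chart_inv c) has_derivative frechet_derivative (snd d \<circ> f \<circ> chart_inv c) (at (snd c x))) (at (snd c x))"
proof -
  obtain W where W: "open W" "snd c x \<in> W" "\<And>y. y \<in> S \<Longrightarrow> y \<in> fst c \<Longrightarrow> snd c y \<in> W \<Longrightarrow> f y \<in> fst d"
    "smooth_on (snd c ` (S \<inter> fst c) \<inter> W) (snd d \<circ> f \<circ> chart_inv c)"
    using smooth_map_chart[OF A B openin_mthick[OF A S] f x c d] by blast
  have "open (snd c ` (S \<inter> fst c) \<inter> W)" using S c(1) W(1) openin_mtop[OF A] by blast
  then show ?thesis using smooth_on_has_derivative[OF _ W(4)] x c W(2) by blast
qed

lemma transition_has_derivative:
  assumes A: "premanifold A" and c: "c \<in> atlas A" "x \<in> fst c" and d: "d \<in> atlas A" "x \<in> fst d"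
  shows "((snd d \<circ> chart_inv c) has_derivative frechet_derivative (snd d \<circ> chart_inv c) (at (snd c x))) (at (snd c x))"
  using smooth_on_has_derivative[OF transition_open[OF A c(1) d(1)] transition_smooth[OF A c(1) d(1)]] c d by blast

lemma rep_compose_has_derivative:
  assumes A: "premanifold A" and B: "premanifold B"
    and S: "openin (mtop A) S" and x: "x \<in> S" and c: "c \<in> atlas A" "x \<in> fst c" and d: "d \<in> atlas B"
    and fS: "\<And>y. y \<in> S \<Longrightarrow> y \<in> fst c \<Longrightarrow> f y \<in> fst d"
    and D: "((snd d \<circ> f \<circ> chart_inv c) has_derivative D) (at (snd c x))"
    and E: "((snd e \<circ> g \<circ> chart_inv d) has_derivative E) (at (snd d (f x)))"
  shows "((snd e \<circ> (\<lambda>x. g (f x)) \<circ> chart_inv c) has_derivative (\<lambda>v. E (D v))) (at (snd c x))"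
proof -
  have "((\<lambda>z. (snd e \<circ> g \<circ> chart_inv d) ((snd d \<circ> f \<circ> chart_inv c) z)) has_derivative (\<lambda>v. E (D v))) (at (snd c x))"
    by (rule has_derivative_compose[OF D]) (use E chart_inv_chart[OF A c] in \<open>simp add: comp_def\<close>)
  moreover have "open (snd c ` (S \<inter> fst c))" using S c(1) openin_mtop[OF A] by blast
  moreover have "snd c x \<in> snd c ` (S \<inter> fst c)" using x c by blast
  moreover have "(snd e \<circ> g \<circ> chart_inv d) ((snd d \<circ> f \<circ> chart_inv c) z) = (snd e \<circ> (\<lambda>x. g (f x)) \<circ> chart_inv c) z"
    if "z \<in> snd c ` (S \<inter> fst c)" for z
    using that fS chart_inv_chart[OF A c(1)] chart_inv_chart[OF B d] by auto
  ultimately show ?thesis by (rule has_derivative_transform_within_open)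
qed

lemma components_transition:
  assumes A: "premanifold A" and c: "c \<in> atlas A" "x \<in> fst c" and d: "d \<in> atlas A" "x \<in> fst d"
  shows "frechet_derivative (snd d \<circ> chart_inv c) (at (snd c x)) (components A c x v) = components A d x v"
proof -
  let ?e = "chart_at A x"
  have e: "?e \<in> atlas A" "x \<in> fst ?e" using A by (auto simp: chart_at_atlas chart_at_mem)
  \<comment> \<open>The identity is written as a composite so that the chain rule for
    representations applies with \<open>c\<close> as the intermediate chart.\<close>
  have "((snd d \<circ> (\<lambda>x. id (id x)) \<circ> chart_inv ?e) has_derivative
     (\<lambda>v. frechet_derivative (snd d \<circ> chart_inv c) (at (snd c x)) (components A c x v))) (at (snd ?e x))"
    by (rule rep_compose_has_derivative[where D="components A c x", OF A A openin_chart[OF A c(1)] c(2) e c(1)])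
      (use transition_has_derivative[OF A e c] transition_has_derivative[OF A c d] in \<open>auto simp: comp_def\<close>)
  then have "((snd d \<circ> chart_inv ?e) has_derivative
     (\<lambda>v. frechet_derivative (snd d \<circ> chart_inv c) (at (snd c x)) (components A c x v))) (at (snd ?e x))"
    by (simp add: comp_def)
  from frechet_derivative_at[OF this] show ?thesis by metis
qed

lemma components_chart_at:
  assumes A: "premanifold A"
  shows "components A (chart_at A x) x v = v"
proof -
  let ?e = "chart_at A x"
  have e: "?e \<in> atlas A" "x \<in> fst ?e" using A by (auto simp: chart_at_atlas chart_at_mem)
  have "((snd ?e \<circ> chart_inv ?e) has_derivative (\<lambda>v. v)) (at (snd ?e x))"
    by (rule has_derivative_transform_within_open[OF has_derivative_ident chart_open[OF A e(1)]])
      (use e chart_inv_chart[OF A e(1)] in auto)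
  from frechet_derivative_at[OF this] show ?thesis by metis
qed

lemma components_linear:
  assumes A: "premanifold A" and c: "c \<in> atlas A" "x \<in> fst c"
  shows "linear (components A c x)"
  using transition_has_derivative[OF A chart_at_atlas[OF A] chart_at_mem[OF A] c] has_derivative_linear by blast

lemma components_inverse:
  assumes A: "premanifold A" and c: "c \<in> atlas A" "x \<in> fst c"
  defines "E \<equiv> frechet_derivative (snd (chart_at A x) \<circ> chart_inv c) (at (snd c x))"
  shows "E (components A c x v) = v" "components A c x (E v) = v" "linear E"
proof -
  let ?e = "chart_at A x"
  have e: "?e \<in> atlas A" "x \<in> fst ?e" using A by (auto simp: chart_at_atlas chart_at_mem)
  show "E (components A c x v) = v"
    unfolding E_def using components_transition[OF A c e] components_chart_at[OF A] by metis
  have "((snd c \<circ> (\<lambda>x. id (id x)) \<circ> chart_inv c) has_derivative (\<lambda>v. components A c x (E v))) (at (snd c x))"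
    by (rule rep_compose_has_derivative[where D=E and E="components A c x", OF A A openin_chart[OF A e(1)] e(2) c e(1)])
      (use transition_has_derivative[OF A c e] transition_has_derivative[OF A e c] in \<open>auto simp: E_def comp_def\<close>)
  moreover have "((snd c \<circ> (\<lambda>x. id (id x)) \<circ> chart_inv c) has_derivative (\<lambda>v. v)) (at (snd c x))"
    by (rule has_derivative_transform_within_open[OF has_derivative_ident chart_open[OF A c(1)]])
      (use c chart_inv_chart[OF A c(1)] in auto)
  ultimately show "components A c x (E v) = v" using has_derivative_unique by metis
  show "linear E" unfolding E_def using transition_has_derivative[OF A c e] has_derivative_linear by blast
qed

lemma components_eq_iff:
  assumes A: "premanifold A" and c: "c \<in> atlas A" "x \<in> fst c"
  shows "components A c x v = components A c x w \<longleftrightarrow> v = w"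
  using components_inverse(1)[OF assms] by metis

text \<open>\<open>differential\<close> is computed in preferred charts. Composing with transition
  maps on both sides turns it into the derivative of the representation in arbitrary charts.\<close>

lemma differential_chart:
  assumes A: "premanifold A" and B: "premanifold B" and S: "openin (mtop A) S" and f: "smooth_map A S B f" and x: "x \<in> S"
    and c: "c \<in> atlas A" "x \<in> fst c" and d: "d \<in> atlas B" "f x \<in> fst d"
  shows "((snd d \<circ> f \<circ> chart_inv c) has_derivative
    (\<lambda>v. components B d (f x) (differential A B f x
        (frechet_derivative (snd (chart_at A x) \<circ> chart_inv c) (at (snd c x)) v)))) (at (snd c x))"
    and "frechet_derivative (snd d \<circ> f \<circ> chart_inv c) (at (snd c x)) (components A c x v) =
      components B d (f x) (differential A B f x v)"
proof -
  let ?c = "chart_at A x" and ?d = "chart_at B (f x)"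
  let ?E = "frechet_derivative (snd ?c \<circ> chart_inv c) (at (snd c x))"
  have c0: "?c \<in> atlas A" "x \<in> fst ?c" and d0: "?d \<in> atlas B" "f x \<in> fst ?d"
    using A B by (auto simp: chart_at_atlas chart_at_mem)
  have D0: "((snd ?d \<circ> f \<circ> chart_inv ?c) has_derivative differential A B f x) (at (snd ?c x))"
    using smooth_map_rep_has_derivative[OF A B S f x c0 d0] by (simp add: differential_def)
  obtain W where W: "open W" "snd ?c x \<in> W" "\<And>y. y \<in> S \<Longrightarrow> y \<in> fst ?c \<Longrightarrow> snd ?c y \<in> W \<Longrightarrow> f y \<in> fst ?d"
    using smooth_map_chart[OF A B openin_mthick[OF A S] f x c0 d0] by blast
  define S' where "S' = S \<inter> {y \<in> fst ?c. snd ?c y \<in> W}"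
  have S': "openin (mtop A) S'" "x \<in> S'" "\<And>y. y \<in> S' \<Longrightarrow> f y \<in> fst ?d"
    unfolding S'_def using S openin_chart_preimage[OF A c0(1) W(1)] x c0 W by auto
  have 1: "((snd d \<circ> (\<lambda>x. id (f x)) \<circ> chart_inv ?c) has_derivative (\<lambda>v. components B d (f x) (differential A B f x v))) (at (snd ?c x))"
    by (rule rep_compose_has_derivative[where D="differential A B f x", OF A B S'(1,2) c0 d0(1)])
      (use S'(3) D0 transition_has_derivative[OF B d0 d] in \<open>auto simp: comp_def\<close>)
  have 2: "((snd d \<circ> (\<lambda>x. f (id x)) \<circ> chart_inv c) has_derivative (\<lambda>v. components B d (f x) (differential A B f x (?E v)))) (at (snd c x))"
    by (rule rep_compose_has_derivative[where D="?E", OF A A openin_chart[OF A c0(1)] c0(2) c c0(1)])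
      (use 1 transition_has_derivative[OF A c c0] in \<open>auto simp: comp_def\<close>)
  then show *: "((snd d \<circ> f \<circ> chart_inv c) has_derivative
    (\<lambda>v. components B d (f x) (differential A B f x (?E v)))) (at (snd c x))" by simp
  show "frechet_derivative (snd d \<circ> f \<circ> chart_inv c) (at (snd c x)) (components A c x v) =
      components B d (f x) (differential A B f x v)"
    using frechet_derivative_at[OF *] components_inverse(1)[OF A c] by metis
qed

lemma differential_linear:
  assumes "premanifold A" "premanifold B" "openin (mtop A) S" "smooth_map A S B f" "x \<in> S"
  shows "linear (differential A B f x)"
  unfolding differential_def
  using smooth_map_rep_has_derivative[OF assms chart_at_atlas[OF assms(1)] chart_at_mem[OF assms(1)]
    chart_at_atlas[OF assms(2)] chart_at_mem[OF assms(2)]] has_derivative_linear by blast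

lemma differential_compose:
  assumes A: "premanifold A" and B: "premanifold B" and C: "premanifold C"
    and S: "openin (mtop A) S" and f: "smooth_map A S B f" and x: "x \<in> S"
    and T: "openin (mtop B) T" and g: "smooth_map B T C g" and fx: "f x \<in> T"
  shows "differential A C (\<lambda>x. g (f x)) x v = differential B C g (f x) (differential A B f x v)"
proof -
  let ?c = "chart_at A x" and ?d = "chart_at B (f x)" and ?e = "chart_at C (g (f x))"
  have c0: "?c \<in> atlas A" "x \<in> fst ?c" and d0: "?d \<in> atlas B" "f x \<in> fst ?d" and e0: "?e \<in> atlas C" "g (f x) \<in> fst ?e"
    using A B C by (auto simp: chart_at_atlas chart_at_mem)
  have D0: "((snd ?d \<circ> f \<circ> chart_inv ?c) has_derivative differential A B f x) (at (snd ?c x))"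
    using smooth_map_rep_has_derivative[OF A B S f x c0 d0] by (simp add: differential_def)
  have E0: "((snd ?e \<circ> g \<circ> chart_inv ?d) has_derivative differential B C g (f x)) (at (snd ?d (f x)))"
    using smooth_map_rep_has_derivative[OF B C T g fx d0 e0] by (simp add: differential_def)
  obtain W where W: "open W" "snd ?c x \<in> W" "\<And>y. y \<in> S \<Longrightarrow> y \<in> fst ?c \<Longrightarrow> snd ?c y \<in> W \<Longrightarrow> f y \<in> fst ?d"
    using smooth_map_chart[OF A B openin_mthick[OF A S] f x c0 d0] by blast
  define S' where "S' = S \<inter> {y \<in> fst ?c. snd ?c y \<in> W}"
  have S': "openin (mtop A) S'" "x \<in> S'" "\<And>y. y \<in> S' \<Longrightarrow> f y \<in> fst ?d"
    unfolding S'_def using S openin_chart_preimage[OF A c0(1) W(1)] x c0 W by auto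
  have "((snd ?e \<circ> (\<lambda>x. g (f x)) \<circ> chart_inv ?c) has_derivative (\<lambda>v. differential B C g (f x) (differential A B f x v))) (at (snd ?c x))"
    by (rule rep_compose_has_derivative[OF A B S'(1,2) c0 d0(1) _ D0 E0]) (use S'(3) in auto)
  from frechet_derivative_at[OF this] show ?thesis unfolding differential_def[of A C] by metis
qed

lemma differential_id:
  assumes A: "premanifold A" shows "differential A A (\<lambda>x. x) x v = v"
  using components_chart_at[OF A, of x v] by (simp add: differential_def comp_def)

lemma differential_cong:
  assumes A: "premanifold A" and S: "openin (mtop A) S" "x \<in> S" and eq: "\<And>y. y \<in> S \<Longrightarrow> f y = g y"
  shows "differential A B f x = differential A B g x"
proof -
  let ?c = "chart_at A x"
  have c: "?c \<in> atlas A" "x \<in> fst ?c" using A by (auto simp: chart_at_atlas chart_at_mem)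
  have o: "open (snd ?c ` (S \<inter> fst ?c))" using S c(1) openin_mtop[OF A] by blast
  have m: "snd ?c x \<in> snd ?c ` (S \<inter> fst ?c)" using S c by blast
  have e: "(snd (chart_at B (f x)) \<circ> f \<circ> chart_inv ?c) z = (snd (chart_at B (g x)) \<circ> g \<circ> chart_inv ?c) z"
    if "z \<in> snd ?c ` (S \<inter> fst ?c)" for z
    using that eq S(2) chart_inv_chart[OF A c(1)] by auto
  have "((snd (chart_at B (f x)) \<circ> f \<circ> chart_inv ?c) has_derivative D) (at (snd ?c x)) \<longleftrightarrow>
     ((snd (chart_at B (g x)) \<circ> g \<circ> chart_inv ?c) has_derivative D) (at (snd ?c x))" for D
  proof
    assume "((snd (chart_at B (f x)) \<circ> f \<circ> chart_inv ?c) has_derivative D) (at (snd ?c x))"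
    from has_derivative_transform_within_open[OF this o m e]
    show "((snd (chart_at B (g x)) \<circ> g \<circ> chart_inv ?c) has_derivative D) (at (snd ?c x))" .
  next
    assume "((snd (chart_at B (g x)) \<circ> g \<circ> chart_inv ?c) has_derivative D) (at (snd ?c x))"
    from has_derivative_transform_within_open[OF this o m e[symmetric]]
    show "((snd (chart_at B (f x)) \<circ> f \<circ> chart_inv ?c) has_derivative D) (at (snd ?c x))" .
  qed
  then show ?thesis unfolding differential_def frechet_derivative_def by simp
qed

lemma differential_bij:
  assumes A: "premanifold A" and B: "premanifold B"
    and S: "openin (mtop A) S" and T: "openin (mtop B) T"
    and f: "smooth_map A S B f" and g: "smooth_map B T A g"
    and fg: "\<And>x. x \<in> S \<Longrightarrow> f x \<in> T \<and> g (f x) = x" "\<And>y. y \<in> T \<Longrightarrow> g y \<in> S \<and> f (g y) = y" and x: "x \<in> S"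
  shows "bij (differential A B f x)"
proof (rule o_bij)
  show "differential B A g (f x) \<circ> differential A B f x = id"
  proof
    fix v
    have "differential B A g (f x) (differential A B f x v) = differential A A (\<lambda>x. g (f x)) x v"
      using differential_compose[OF A B A S f x T g] fg x by simp
    also have "\<dots> = v" using differential_cong[OF A S x, of "\<lambda>x. g (f x)" "\<lambda>x. x" A] fg differential_id[OF A] by simp
    finally show "(differential B A g (f x) \<circ> differential A B f x) v = id v" by simp
  qed
  show "differential A B f x \<circ> differential B A g (f x) = id"
  proof
    fix v
    have fx: "f x \<in> T" using fg x by blast
    have "differential A B f (g (f x)) (differential B A g (f x) v) = differential B B (\<lambda>y. f (g y)) (f x) v"
      using differential_compose[OF B A B T g fx S f, of v] fg x by simp
    also have "\<dots> = v" using differential_cong[OF B T fx, of "\<lambda>y. f (g y)" "\<lambda>x. x" B] fg differential_id[OF B] by simp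
    finally show "(differential A B f x \<circ> differential B A g (f x)) v = id v" using fg x by simp
  qed
qed

section \<open>Curves\<close>

text \<open>The velocity is defined through the preferred chart at \<open>c t\<close>; the
  transition map from there to \<open>d\<close> carries it over by the chain rule, near
  \<open>t\<close> only.\<close>

lemma tangent_lift_chart:
  assumes A: "premanifold A" and I: "thick I" and c: "smooth_map flat I A c" and t: "t \<in> I"
    and d: "d \<in> atlas A" "c t \<in> fst d"
  shows "((\<lambda>s. snd d (c s)) has_vector_derivative components A d (c t) (snd (tangent_lift A I c t))) (at t within I)"
proof -
  let ?e = "chart_at A (c t)"
  have e: "?e \<in> atlas A" "c t \<in> fst ?e" using A by (auto simp: chart_at_atlas chart_at_mem)
  obtain W where W: "open W" "t \<in> W" "\<And>s. s \<in> I \<Longrightarrow> s \<in> W \<Longrightarrow> c s \<in> fst ?e" "smooth_on (I \<inter> W) (\<lambda>s. snd ?e (c s))"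
    using smooth_map_flat_chart[OF finite_dim_real A I c t e] by blast
  have "((\<lambda>s. snd ?e (c s)) has_vector_derivative vector_derivative (\<lambda>s. snd ?e (c s)) (at t within (I \<inter> W))) (at t within (I \<inter> W))"
    using smooth_on_has_vector_derivative[OF W(4)] t W by blast
  then have 1: "((\<lambda>s. snd ?e (c s)) has_vector_derivative snd (tangent_lift A I c t)) (at t within I)"
    using at_within_Int_open[OF W(2,1), of I] by (simp add: tangent_lift_def comp_def)
  have "((\<lambda>s. (snd d \<circ> chart_inv ?e) (snd ?e (c s))) has_derivative
       (\<lambda>u. components A d (c t) (u *\<^sub>R snd (tangent_lift A I c t)))) (at t within I)"
    by (rule has_derivative_compose[OF 1[unfolded has_vector_derivative_def] transition_has_derivative[OF A e d]])
  then have 2: "((\<lambda>s. (snd d \<circ> chart_inv ?e) (snd ?e (c s))) has_vector_derivative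
        components A d (c t) (snd (tangent_lift A I c t))) (at t within I)"
    by (simp add: has_vector_derivative_def linear_scale[OF components_linear[OF A d]])
  obtain \<delta> where \<delta>: "\<delta> > 0" "ball t \<delta> \<subseteq> W" using W open_contains_ball by blast
  show ?thesis
    by (rule has_vector_derivative_transform_within[OF 2 \<delta>(1) t])
      (use \<delta>(2) W(3) chart_inv_chart[OF A e(1)] in \<open>auto simp: dist_commute subset_iff\<close>)
qed

lemma tangent_lift_eqI:
  assumes A: "premanifold A" and I: "thick I" and c: "smooth_map flat I A c" and t: "t \<in> I"
    and d: "d \<in> atlas A" "c t \<in> fst d"
    and v: "((\<lambda>s. snd d (c s)) has_vector_derivative components A d (c t) v) (at t within I)"
  shows "tangent_lift A I c t = (c t, v)"
proof -
  have "components A d (c t) v = components A d (c t) (snd (tangent_lift A I c t))"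
    using thick_vector_derivative[OF I t] tangent_lift_chart[OF A I c t d] v by metis
  then show ?thesis using components_eq_iff[OF A d] by (simp add: tangent_lift_def)
qed

lemma tangent_lift_compose:
  assumes A: "premanifold A" and B: "premanifold B" and I: "thick I" and c: "smooth_map flat I A c" and t: "t \<in> I"
    and S: "openin (mtop A) S" and f: "smooth_map A S B f" and cS: "c ` I \<subseteq> S"
  shows "tangent_lift B I (\<lambda>s. f (c s)) t = (f (c t), differential A B f (c t) (snd (tangent_lift A I c t)))"
proof -
  let ?d = "chart_at A (c t)" and ?e = "chart_at B (f (c t))"
  have d: "?d \<in> atlas A" "c t \<in> fst ?d" and e: "?e \<in> atlas B" "f (c t) \<in> fst ?e" using A B by (auto simp: chart_at_atlas chart_at_mem)
  have ct: "c t \<in> S" using cS t by blast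
  have sm: "smooth_map flat I B (\<lambda>s. f (c s))"
    using smooth_map_compose[OF premanifold_flat[OF finite_dim_real] A B _ openin_mthick[OF A S] c f cS] I by (simp add: mthick_flat)
  have 1: "((\<lambda>s. snd ?d (c s)) has_vector_derivative snd (tangent_lift A I c t)) (at t within I)"
    using tangent_lift_chart[OF A I c t d] by (simp add: components_chart_at[OF A])
  have "((\<lambda>s. (snd ?e \<circ> f \<circ> chart_inv ?d) (snd ?d (c s))) has_derivative
      (\<lambda>u. differential A B f (c t) (u *\<^sub>R snd (tangent_lift A I c t)))) (at t within I)"
    by (rule has_derivative_compose[OF 1[unfolded has_vector_derivative_def]])
      (use smooth_map_rep_has_derivative[OF A B S f ct d e] in \<open>simp add: differential_def comp_def\<close>)
  then have 2: "((\<lambda>s. (snd ?e \<circ> f \<circ> chart_inv ?d) (snd ?d (c s))) has_vector_derivative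
      differential A B f (c t) (snd (tangent_lift A I c t))) (at t within I)"
    by (simp add: has_vector_derivative_def linear_scale[OF differential_linear[OF A B S f ct]])
  obtain W where W: "open W" "t \<in> W" "\<And>s. s \<in> I \<Longrightarrow> s \<in> W \<Longrightarrow> c s \<in> fst ?d"
    using smooth_map_flat_chart[OF finite_dim_real A I c t d] by blast
  obtain \<delta> where \<delta>: "\<delta> > 0" "ball t \<delta> \<subseteq> W" using W open_contains_ball by blast
  have "((\<lambda>s. snd ?e (f (c s))) has_vector_derivative
      differential A B f (c t) (snd (tangent_lift A I c t))) (at t within I)"
    by (rule has_vector_derivative_transform_within[OF 2 \<delta>(1) t])
      (use \<delta>(2) W(3) chart_inv_chart[OF A d(1)] in \<open>auto simp: dist_commute subset_iff\<close>)
  then show ?thesis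
    by (intro tangent_lift_eqI[OF B I sm t e]) (simp add: components_chart_at[OF B])
qed

section \<open>Products and tangent bundles\<close>

abbreviation prod_chart :: "('q, 'e) chart \<Rightarrow> ('r, 'f) chart \<Rightarrow> ('q \<times> 'r, 'e \<times> 'f) chart" where
  "prod_chart c d \<equiv> (fst c \<times> fst d, map_prod (snd c) (snd d))"

lemma prod_manifold_simps:
  "atlas (prod_manifold A B) = {prod_chart c d |c d. c \<in> atlas A \<and> d \<in> atlas B}"
  "chart_at (prod_manifold A B) (x, y) = prod_chart (chart_at A x) (chart_at B y)"
  by (simp_all add: prod_manifold_def Let_def)

lemma prod_chart_inj:
  assumes "premanifold A" "premanifold B" "c \<in> atlas A" "d \<in> atlas B"
  shows "inj_on (map_prod (snd c) (snd d)) (fst c \<times> fst d)"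
  by (rule map_prod_inj_on[OF chart_inj[OF assms(1,3)] chart_inj[OF assms(2,4)]])

lemma prod_chart_inv:
  assumes "premanifold A" "premanifold B" "c \<in> atlas A" "d \<in> atlas B"
    and "x \<in> snd c ` fst c" "y \<in> snd d ` fst d"
  shows "chart_inv (prod_chart c d) (x, y) = (chart_inv c x, chart_inv d y)"
proof -
  have "chart_inv (prod_chart c d) (map_prod (snd c) (snd d) (chart_inv c x, chart_inv d y)) = (chart_inv c x, chart_inv d y)"
    unfolding fst_conv snd_conv
    by (rule inv_into_f_f[OF prod_chart_inj[OF assms(1-4)]]) (use assms(5,6) in \<open>auto intro: inv_into_into\<close>)
  then show ?thesis using assms(5,6) by (simp add: f_inv_into_f)
qed

lemma map_prod_image_Int:
  "map_prod f g ` ((A \<times> B) \<inter> (C \<times> D)) = f ` (A \<inter> C) \<times> g ` (B \<inter> D)"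
  by auto

lemma premanifold_prod:
  assumes A: "premanifold A" and B: "premanifold B" shows "premanifold (prod_manifold A B)"
  unfolding premanifold_def
proof (intro conjI ballI allI)
  show "finite_dim TYPE('b \<times> 'd)" by (intro finite_dim_prod premanifold_finite_dim[OF A] premanifold_finite_dim[OF B])
  fix k assume k: "k \<in> atlas (prod_manifold A B)"
  then obtain c d where cd: "c \<in> atlas A" "d \<in> atlas B" "k = prod_chart c d" by (auto simp: prod_manifold_simps)
  show "inj_on (snd k) (fst k)" using prod_chart_inj[OF A B cd(1,2)] cd(3) by simp
  fix l assume l: "l \<in> atlas (prod_manifold A B)"
  then obtain c' d' where cd': "c' \<in> atlas A" "d' \<in> atlas B" "l = prod_chart c' d'" by (auto simp: prod_manifold_simps)
  have img: "snd k ` (fst k \<inter> fst l) = snd c ` (fst c \<inter> fst c') \<times> snd d ` (fst d \<inter> fst d')"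
    by (simp add: cd cd' map_prod_image_Int)
  show op: "open (snd k ` (fst k \<inter> fst l))"
    unfolding img by (intro open_Times transition_open[OF A cd(1) cd'(1)] transition_open[OF B cd(2) cd'(2)])
  let ?N = "snd k ` (fst k \<inter> fst l)"
  have th: "thick ?N" using op thick_open by blast
  have "smooth_on ?N (\<lambda>z. (snd c' \<circ> chart_inv c) (fst z))"
    by (rule smooth_on_compose[OF th premanifold_finite_dim[OF A] smooth_on_bounded_linear[OF th bounded_linear_fst smooth_on_id[OF th]]
         transition_smooth[OF A cd(1) cd'(1)]]) (use img in auto)
  moreover have "smooth_on ?N (\<lambda>z. (snd d' \<circ> chart_inv d) (snd z))"
    by (rule smooth_on_compose[OF th premanifold_finite_dim[OF B] smooth_on_bounded_linear[OF th bounded_linear_snd smooth_on_id[OF th]]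
         transition_smooth[OF B cd(2) cd'(2)]]) (use img in auto)
  ultimately have "smooth_on ?N (\<lambda>z. ((snd c' \<circ> chart_inv c) (fst z), (snd d' \<circ> chart_inv d) (snd z)))"
    by (rule smooth_on_Pair[OF th])
  then show "smooth_on ?N (snd l \<circ> chart_inv k)"
  proof (rule smooth_on_transform)
    fix z assume "z \<in> ?N"
    then obtain x y where "z = (x, y)" "x \<in> snd c ` fst c" "y \<in> snd d ` fst d" unfolding img by auto
    then show "((snd c' \<circ> chart_inv c) (fst z), (snd d' \<circ> chart_inv d) (snd z)) = (snd l \<circ> chart_inv k) z"
      using prod_chart_inv[OF A B cd(1,2)] cd cd' by simp
  qed
next
  fix z :: "'a \<times> 'c"
  obtain x y where z: "z = (x, y)" by (cases z)
  show "chart_at (prod_manifold A B) z \<in> atlas (prod_manifold A B)"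
    unfolding z prod_manifold_simps using chart_at_atlas[OF A, of x] chart_at_atlas[OF B, of y] by blast
  show "z \<in> fst (chart_at (prod_manifold A B) z)"
    unfolding z prod_manifold_simps using chart_at_mem[OF A, of x] chart_at_mem[OF B, of y] by simp
qed

lemma smooth_map_Pair:
  assumes A: "premanifold A" and B: "premanifold B" and C: "premanifold C" and S: "mthick A S"
    and f: "smooth_map A S B f" and g: "smooth_map A S C g"
  shows "smooth_map A S (prod_manifold B C) (\<lambda>x. (f x, g x))"
proof (rule smooth_mapI[OF A])
  fix x assume x: "x \<in> S"
  define c d e where "c = chart_at A x" and "d = chart_at B (f x)" and "e = chart_at C (g x)"
  have c: "c \<in> atlas A" "x \<in> fst c" and d: "d \<in> atlas B" "f x \<in> fst d" and e: "e \<in> atlas C" "g x \<in> fst e"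
    unfolding c_def d_def e_def using A B C by (auto simp: chart_at_atlas chart_at_mem)
  obtain W1 where W1: "open W1" "snd c x \<in> W1" "\<And>y. y \<in> S \<Longrightarrow> y \<in> fst c \<Longrightarrow> snd c y \<in> W1 \<Longrightarrow> f y \<in> fst d"
    "smooth_on (snd c ` (S \<inter> fst c) \<inter> W1) (snd d \<circ> f \<circ> chart_inv c)"
    using smooth_map_chart[OF A B S f x c d] by blast
  obtain W2 where W2: "open W2" "snd c x \<in> W2" "\<And>y. y \<in> S \<Longrightarrow> y \<in> fst c \<Longrightarrow> snd c y \<in> W2 \<Longrightarrow> g y \<in> fst e"
    "smooth_on (snd c ` (S \<inter> fst c) \<inter> W2) (snd e \<circ> g \<circ> chart_inv c)"
    using smooth_map_chart[OF A C S g x c e] by blast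
  let ?T = "snd c ` (S \<inter> fst c) \<inter> (W1 \<inter> W2)"
  have th: "thick ?T" using S c(1) W1(1) W2(1) thick_Int_open open_Int unfolding mthick_def by blast
  have 1: "smooth_on ?T (snd d \<circ> f \<circ> chart_inv c)" "smooth_on ?T (snd e \<circ> g \<circ> chart_inv c)"
    by (rule smooth_on_subset[OF premanifold_finite_dim[OF A] th W1(4)], blast)
      (rule smooth_on_subset[OF premanifold_finite_dim[OF A] th W2(4)], blast)
  have "smooth_on ?T (snd (prod_chart d e) \<circ> (\<lambda>x. (f x, g x)) \<circ> chart_inv c)"
    using smooth_on_Pair[OF th 1] by (simp add: comp_def)
  moreover have "prod_chart d e \<in> atlas (prod_manifold B C)" unfolding prod_manifold_simps using d(1) e(1) by blast
  ultimately show "\<exists>c\<in>atlas A. \<exists>d\<in>atlas (prod_manifold B C). \<exists>W. x \<in> fst c \<and> open W \<and> snd c x \<in> W \<and>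
      (\<forall>y\<in>S \<inter> fst c. snd c y \<in> W \<longrightarrow> (f y, g y) \<in> fst d) \<and>
      smooth_on (snd c ` (S \<inter> fst c) \<inter> W) (snd d \<circ> (\<lambda>x. (f x, g x)) \<circ> chart_inv c)"
    using c W1 W2 by (intro bexI[OF _ c(1)] bexI[of _ "prod_chart d e"] exI[of _ "W1 \<inter> W2"] conjI) auto
qed

lemma smooth_map_snd:
  assumes A: "premanifold A" and B: "premanifold B"
  shows "smooth_map (prod_manifold A B) UNIV B snd"
proof (rule smooth_mapI[OF premanifold_prod[OF A B]])
  fix z :: "'a \<times> 'c"
  obtain x y where z: "z = (x, y)" by (cases z)
  define c d where "c = chart_at A x" and "d = chart_at B y"
  have c: "c \<in> atlas A" "x \<in> fst c" and d: "d \<in> atlas B" "y \<in> fst d"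
    unfolding c_def d_def using A B by (auto simp: chart_at_atlas chart_at_mem)
  let ?T = "snd (prod_chart c d) ` (UNIV \<inter> fst (prod_chart c d)) \<inter> UNIV"
  have img: "?T = snd c ` fst c \<times> snd d ` fst d"
    using map_prod_image_Int[of "snd c" "snd d" UNIV UNIV "fst c" "fst d"] by simp
  have op: "open ?T" unfolding img by (intro open_Times chart_open[OF A c(1)] chart_open[OF B d(1)])
  have "smooth_on ?T (snd d \<circ> snd \<circ> chart_inv (prod_chart c d))"
  proof (rule smooth_on_transform[OF smooth_on_bounded_linear[OF thick_open[OF op] bounded_linear_snd smooth_on_id[OF thick_open[OF op]]]])
    fix w assume "w \<in> ?T"
    then obtain u v where "w = (u, v)" "u \<in> snd c ` fst c" "v \<in> snd d ` fst d" unfolding img by auto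
    then show "snd w = (snd d \<circ> snd \<circ> chart_inv (prod_chart c d)) w"
      using prod_chart_inv[OF A B c(1) d(1)] by (simp add: f_inv_into_f)
  qed
  moreover have "prod_chart c d \<in> atlas (prod_manifold A B)" unfolding prod_manifold_simps using c(1) d(1) by blast
  ultimately show "\<exists>c\<in>atlas (prod_manifold A B). \<exists>d\<in>atlas B. \<exists>W. z \<in> fst c \<and> open W \<and> snd c z \<in> W \<and>
      (\<forall>y\<in>UNIV \<inter> fst c. snd c y \<in> W \<longrightarrow> snd y \<in> fst d) \<and>
      smooth_on (snd c ` (UNIV \<inter> fst c) \<inter> W) (snd d \<circ> snd \<circ> chart_inv c)"
    using c d z by (intro bexI[of _ "prod_chart c d"] bexI[OF _ d(1)] exI[of _ UNIV] conjI) auto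
qed

lemma differential_Pair:
  assumes A: "premanifold A" and B: "premanifold B" and C: "premanifold C" and S: "openin (mtop A) S"
    and f: "smooth_map A S B f" and g: "smooth_map A S C g" and x: "x \<in> S"
  shows "differential A (prod_manifold B C) (\<lambda>x. (f x, g x)) x v = (differential A B f x v, differential A C g x v)"
proof -
  let ?c = "chart_at A x" and ?d = "chart_at B (f x)" and ?e = "chart_at C (g x)"
  have c: "?c \<in> atlas A" "x \<in> fst ?c" and d: "?d \<in> atlas B" "f x \<in> fst ?d" and e: "?e \<in> atlas C" "g x \<in> fst ?e"
    using A B C by (auto simp: chart_at_atlas chart_at_mem)
  have "((\<lambda>z. ((snd ?d \<circ> f \<circ> chart_inv ?c) z, (snd ?e \<circ> g \<circ> chart_inv ?c) z)) has_derivative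
      (\<lambda>v. (differential A B f x v, differential A C g x v))) (at (snd ?c x))"
    using smooth_map_rep_has_derivative[OF A B S f x c d] smooth_map_rep_has_derivative[OF A C S g x c e]
    unfolding differential_def by (rule has_derivative_Pair)
  moreover have "(\<lambda>z. ((snd ?d \<circ> f \<circ> chart_inv ?c) z, (snd ?e \<circ> g \<circ> chart_inv ?c) z)) =
      snd (chart_at (prod_manifold B C) (f x, g x)) \<circ> (\<lambda>x. (f x, g x)) \<circ> chart_inv ?c"
    by (auto simp: prod_manifold_simps)
  ultimately have "((snd (chart_at (prod_manifold B C) (f x, g x)) \<circ> (\<lambda>x. (f x, g x)) \<circ> chart_inv ?c) has_derivative
      (\<lambda>v. (differential A B f x v, differential A C g x v))) (at (snd ?c x))" by (simp only:)
  from frechet_derivative_at[OF this]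
  have "frechet_derivative (snd (chart_at (prod_manifold B C) (f x, g x)) \<circ> (\<lambda>x. (f x, g x)) \<circ> chart_inv ?c) (at (snd ?c x)) v
      = (differential A B f x v, differential A C g x v)" by (rule fun_cong[OF sym])
  then show ?thesis unfolding differential_def[of A "prod_manifold B C"] .
qed

section \<open>Charts of the tangent bundle\<close>

lemma tangent_chart_simps:
  "fst (tangent_chart A c) = fst c \<times> UNIV"
  "snd (tangent_chart A c) (q, v) = (snd c q, components A c q v)"
  by (simp_all add: tangent_chart_def)

lemma tangent_bundle_simps:
  "atlas (tangent_bundle A) = tangent_chart A ` atlas A"
  "chart_at (tangent_bundle A) (q, v) = tangent_chart A (chart_at A q)"
  by (simp_all add: tangent_bundle_def)

text \<open>\<open>from_components A c x\<close> sends components in \<open>c\<close> to the vector at the point with coordinates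
  \<open>x\<close>.\<close>

definition from_components :: "('q, 'e::real_normed_vector) manifold \<Rightarrow> ('q, 'e) chart \<Rightarrow> 'e \<Rightarrow> 'e \<Rightarrow> 'e" where
  "from_components A c x = frechet_derivative (snd (chart_at A (chart_inv c x)) \<circ> chart_inv c) (at x)"

lemma from_components:
  assumes A: "premanifold A" and c: "c \<in> atlas A" "x \<in> snd c ` fst c"
  shows "from_components A c x (components A c (chart_inv c x) v) = v"
    "components A c (chart_inv c x) (from_components A c x v) = v" "linear (from_components A c x)"
  using components_inverse[OF A c(1), of "chart_inv c x"] c(2)
  by (auto simp: from_components_def inv_into_into f_inv_into_f)

lemma tangent_chart_inj:
  assumes A: "premanifold A" and c: "c \<in> atlas A"
  shows "inj_on (snd (tangent_chart A c)) (fst (tangent_chart A c))"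
proof (rule inj_onI)
  fix z w assume z: "z \<in> fst (tangent_chart A c)" and w: "w \<in> fst (tangent_chart A c)"
    and eq: "snd (tangent_chart A c) z = snd (tangent_chart A c) w"
  obtain q v p u where zw: "z = (q, v)" "w = (p, u)" by (cases z; cases w)
  then have qp: "q \<in> fst c" "p \<in> fst c" and "snd c q = snd c p" and e: "components A c q v = components A c p u"
    using z w eq by (auto simp: tangent_chart_simps)
  then have "q = p" using chart_inj[OF A c] inj_onD by metis
  then show "z = w" using e components_eq_iff[OF A c qp(1)] zw by simp
qed

lemma tangent_chart_inv:
  assumes A: "premanifold A" and c: "c \<in> atlas A" "x \<in> snd c ` fst c"
  shows "chart_inv (tangent_chart A c) (x, w) = (chart_inv c x, from_components A c x w)"
proof -
  have "chart_inv (tangent_chart A c) (snd (tangent_chart A c) (chart_inv c x, from_components A c x w))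
      = (chart_inv c x, from_components A c x w)"
    by (rule inv_into_f_f[OF tangent_chart_inj[OF A c(1)]]) (use c in \<open>auto simp: tangent_chart_simps inv_into_into\<close>)
  then show ?thesis using from_components(2)[OF A c] c by (simp add: tangent_chart_simps f_inv_into_f)
qed

lemma tangent_chart_image:
  assumes A: "premanifold A" and c: "c \<in> atlas A" and S: "S \<subseteq> fst c"
  shows "snd (tangent_chart A c) ` (S \<times> UNIV) = snd c ` S \<times> UNIV"
proof -
  have "(snd c q, w) \<in> snd (tangent_chart A c) ` (S \<times> UNIV)" if "q \<in> S" for q w
  proof -
    have "(snd c q, w) = snd (tangent_chart A c) (q, from_components A c (snd c q) w)"
      using from_components(2)[OF A c, of "snd c q" w] that S chart_inv_chart[OF A c, of q]
      by (auto simp: tangent_chart_simps)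
    then show ?thesis using that by blast
  qed
  then show ?thesis by (auto simp: tangent_chart_simps)
qed

text \<open>A transition map of the tangent bundle is a transition map of the base together with its
  derivative applied to the fibre coordinate. The cocycle rule \<open>components_transition\<close>
  is what removes the preferred charts from this expression.\<close>

lemma premanifold_tangent_bundle:
  assumes A: "premanifold A" shows "premanifold (tangent_bundle A)"
  unfolding premanifold_def
proof (intro conjI ballI allI)
  show "finite_dim TYPE('b \<times> 'b)" by (intro finite_dim_prod premanifold_finite_dim[OF A])
  fix k assume "k \<in> atlas (tangent_bundle A)"
  then obtain c where c: "c \<in> atlas A" "k = tangent_chart A c" by (auto simp: tangent_bundle_simps)
  show "inj_on (snd k) (fst k)" using tangent_chart_inj[OF A c(1)] c(2) by simp
  fix l assume "l \<in> atlas (tangent_bundle A)"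
  then obtain d where d: "d \<in> atlas A" "l = tangent_chart A d" by (auto simp: tangent_bundle_simps)
  have "fst k \<inter> fst l = (fst c \<inter> fst d) \<times> UNIV" using c d by (auto simp: tangent_chart_simps)
  then have img: "snd k ` (fst k \<inter> fst l) = snd c ` (fst c \<inter> fst d) \<times> UNIV"
    using tangent_chart_image[OF A c(1), of "fst c \<inter> fst d"] c by simp
  show op: "open (snd k ` (fst k \<inter> fst l))"
    unfolding img by (intro open_Times transition_open[OF A c(1) d(1)] open_UNIV)
  let ?N = "snd k ` (fst k \<inter> fst l)"
  have th: "thick ?N" using op thick_open by blast
  have fst: "smooth_on ?N fst" and snd: "smooth_on ?N snd"
    using smooth_on_bounded_linear[OF th bounded_linear_fst smooth_on_id[OF th]]
      smooth_on_bounded_linear[OF th bounded_linear_snd smooth_on_id[OF th]] by simp_all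
  have sub: "fst ` ?N \<subseteq> snd c ` (fst c \<inter> fst d)" unfolding img by auto
  have "smooth_on ?N (\<lambda>z. ((snd d \<circ> chart_inv c) (fst z), frechet_derivative (snd d \<circ> chart_inv c) (at (fst z)) (snd z)))"
    by (intro smooth_on_Pair[OF th] smooth_on_compose[OF th premanifold_finite_dim[OF A] fst transition_smooth[OF A c(1) d(1)] sub]
       smooth_on_frechet_apply[OF premanifold_finite_dim[OF A] transition_open[OF A c(1) d(1)] transition_smooth[OF A c(1) d(1)] th fst sub snd])
  then show "smooth_on ?N (snd l \<circ> chart_inv k)"
  proof (rule smooth_on_transform)
    fix z assume "z \<in> ?N"
    then obtain q w where z: "z = (snd c q, w)" "q \<in> fst c" "q \<in> fst d" unfolding img by auto
    have i: "chart_inv k z = (q, from_components A c (snd c q) w)"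
      using tangent_chart_inv[OF A c(1), of "snd c q" w] z chart_inv_chart[OF A c(1) z(2)] c(2) by simp
    have "components A c q (from_components A c (snd c q) w) = w"
      using from_components(2)[OF A c(1), of "snd c q" w] z(2) chart_inv_chart[OF A c(1) z(2)] by simp
    then show "((snd d \<circ> chart_inv c) (fst z), frechet_derivative (snd d \<circ> chart_inv c) (at (fst z)) (snd z)) = (snd l \<circ> chart_inv k) z"
      using i d(2) z chart_inv_chart[OF A c(1) z(2)]
        components_transition[OF A c(1) z(2) d(1) z(3), of "from_components A c (snd c q) w"]
      by (simp add: tangent_chart_simps)
  qed
next
  fix z :: "'a \<times> 'b"
  obtain q v where z: "z = (q, v)" by (cases z)
  show "chart_at (tangent_bundle A) z \<in> atlas (tangent_bundle A)"
    unfolding z tangent_bundle_simps using chart_at_atlas[OF A, of q] by blast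
  show "z \<in> fst (chart_at (tangent_bundle A) z)"
    unfolding z tangent_bundle_simps tangent_chart_simps using chart_at_mem[OF A, of q] by simp
qed

lemma tangent_chart_atlas: "c \<in> atlas A \<Longrightarrow> tangent_chart A c \<in> atlas (tangent_bundle A)"
  by (simp add: tangent_bundle_simps)

lemma smooth_map_tangent_proj:
  assumes A: "premanifold A" shows "smooth_map (tangent_bundle A) UNIV A fst"
proof (rule smooth_mapI[OF premanifold_tangent_bundle[OF A]])
  fix z :: "'a \<times> 'b"
  obtain q v where z: "z = (q, v)" by (cases z)
  define c where "c = chart_at A q"
  have c: "c \<in> atlas A" "q \<in> fst c" unfolding c_def using A by (auto simp: chart_at_atlas chart_at_mem)
  let ?T = "snd (tangent_chart A c) ` (UNIV \<inter> fst (tangent_chart A c)) \<inter> UNIV"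
  have img: "?T = snd c ` fst c \<times> UNIV" using tangent_chart_image[OF A c(1) order_refl] by (simp add: tangent_chart_simps)
  have op: "open ?T" unfolding img by (intro open_Times chart_open[OF A c(1)] open_UNIV)
  have "smooth_on ?T (snd c \<circ> fst \<circ> chart_inv (tangent_chart A c))"
  proof (rule smooth_on_transform[OF smooth_on_bounded_linear[OF thick_open[OF op] bounded_linear_fst smooth_on_id[OF thick_open[OF op]]]])
    fix w assume "w \<in> ?T"
    then obtain u v where "w = (u, v)" "u \<in> snd c ` fst c" unfolding img by auto
    then show "fst w = (snd c \<circ> fst \<circ> chart_inv (tangent_chart A c)) w"
      using tangent_chart_inv[OF A c(1)] by (simp add: f_inv_into_f)
  qed
  then show "\<exists>c\<in>atlas (tangent_bundle A). \<exists>d\<in>atlas A. \<exists>W. z \<in> fst c \<and> open W \<and> snd c z \<in> W \<and>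
      (\<forall>y\<in>UNIV \<inter> fst c. snd c y \<in> W \<longrightarrow> fst y \<in> fst d) \<and>
      smooth_on (snd c ` (UNIV \<inter> fst c) \<inter> W) (snd d \<circ> fst \<circ> chart_inv c)"
    using c z by (intro bexI[OF _ tangent_chart_atlas[OF c(1)]] bexI[OF _ c(1)] exI[of _ UNIV] conjI)
      (auto simp: tangent_chart_simps)
qed

section \<open>Smooth curves in the tangent bundle\<close>

lemma smooth_curve_proj:
  fixes I :: "real set"
  assumes "premanifold A" "thick I" "smooth_map flat I (tangent_bundle A) \<xi>"
  shows "smooth_map flat I A (\<lambda>t. fst (\<xi> t))"
  using smooth_map_compose[OF premanifold_flat[OF finite_dim_real] premanifold_tangent_bundle[OF assms(1)] assms(1) _
      mthick_UNIV[OF premanifold_tangent_bundle[OF assms(1)]] assms(3) smooth_map_tangent_proj[OF assms(1)]] assms(2)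
  by (simp add: mthick_flat)

lemma smooth_tangent_curve_chart:
  fixes I :: "real set"
  assumes A: "premanifold A" and I: "thick I" and \<xi>: "smooth_map flat I (tangent_bundle A) \<xi>" and t: "t \<in> I"
    and c: "c \<in> atlas A" "fst (\<xi> t) \<in> fst c"
  obtains W where "open W" "t \<in> W" "\<And>s. s \<in> I \<Longrightarrow> s \<in> W \<Longrightarrow> fst (\<xi> s) \<in> fst c"
    "smooth_on (I \<inter> W) (\<lambda>s. snd c (fst (\<xi> s)))" "smooth_on (I \<inter> W) (\<lambda>s. components A c (fst (\<xi> s)) (snd (\<xi> s)))"
proof -
  have m: "\<xi> t \<in> fst (tangent_chart A c)" using c by (cases "\<xi> t") (auto simp: tangent_chart_simps)
  obtain W where W: "open W" "t \<in> W" "\<And>s. s \<in> I \<Longrightarrow> s \<in> W \<Longrightarrow> \<xi> s \<in> fst (tangent_chart A c)"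
      "smooth_on (I \<inter> W) (\<lambda>s. snd (tangent_chart A c) (\<xi> s))"
    using smooth_map_flat_chart[OF finite_dim_real premanifold_tangent_bundle[OF A] I \<xi> t tangent_chart_atlas[OF c(1)] m] by blast
  have th: "thick (I \<inter> W)" using I W(1) thick_Int_open by blast
  have e: "snd (tangent_chart A c) (\<xi> s) = (snd c (fst (\<xi> s)), components A c (fst (\<xi> s)) (snd (\<xi> s)))" for s
    by (cases "\<xi> s") (simp add: tangent_chart_simps)
  have "smooth_on (I \<inter> W) (\<lambda>s. fst (snd (tangent_chart A c) (\<xi> s)))"
    "smooth_on (I \<inter> W) (\<lambda>s. snd (snd (tangent_chart A c) (\<xi> s)))"
    using smooth_on_bounded_linear[OF th _ W(4)] bounded_linear_fst bounded_linear_snd by blast+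
  then show ?thesis using that[of W] W(1-3) by (simp add: e mem_Times_iff tangent_chart_simps)
qed

lemma smooth_tangent_curveI:
  fixes A :: "('q, 'e::real_normed_vector) manifold" and \<xi> :: "real \<Rightarrow> 'q \<times> 'e"
  assumes A: "premanifold A" and I: "thick I"
    and "\<And>t. t \<in> I \<Longrightarrow> \<exists>c\<in>atlas A. \<exists>W. open W \<and> t \<in> W \<and> (\<forall>s\<in>I \<inter> W. fst (\<xi> s) \<in> fst c) \<and>
      smooth_on (I \<inter> W) (\<lambda>s. snd c (fst (\<xi> s))) \<and> smooth_on (I \<inter> W) (\<lambda>s. components A c (fst (\<xi> s)) (snd (\<xi> s)))"
  shows "smooth_map flat I (tangent_bundle A) \<xi>"
proof (rule smooth_map_flatI[OF finite_dim_real])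
  fix t assume "t \<in> I"
  then obtain c W where c: "c \<in> atlas A" and W: "open W" "t \<in> W" "\<forall>s\<in>I \<inter> W. fst (\<xi> s) \<in> fst c"
      "smooth_on (I \<inter> W) (\<lambda>s. snd c (fst (\<xi> s)))" "smooth_on (I \<inter> W) (\<lambda>s. components A c (fst (\<xi> s)) (snd (\<xi> s)))"
    using assms(3) by blast
  have e: "snd (tangent_chart A c) (\<xi> s) = (snd c (fst (\<xi> s)), components A c (fst (\<xi> s)) (snd (\<xi> s)))" for s
    by (cases "\<xi> s") (simp add: tangent_chart_simps)
  have "smooth_on (I \<inter> W) (\<lambda>s. snd (tangent_chart A c) (\<xi> s))"
    unfolding e using I W(1) thick_Int_open W(4,5) by (intro smooth_on_Pair) auto
  then show "\<exists>d\<in>atlas (tangent_bundle A). \<exists>W. open W \<and> t \<in> W \<and> (\<forall>y\<in>I \<inter> W. \<xi> y \<in> fst d) \<and> smooth_on (I \<inter> W) (\<lambda>y. snd d (\<xi> y))"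
    using W by (intro bexI[OF _ tangent_chart_atlas[OF c]] exI[of _ W]) (auto simp: tangent_chart_simps mem_Times_iff)
qed

lemma smooth_map_tangent_lift:
  assumes A: "premanifold A" and I: "thick I" and q: "smooth_map flat I A q"
  shows "smooth_map flat I (tangent_bundle A) (tangent_lift A I q)"
proof (rule smooth_tangent_curveI[OF A I])
  fix t assume t: "t \<in> I"
  define c where "c = chart_at A (q t)"
  have c: "c \<in> atlas A" "q t \<in> fst c" unfolding c_def using A by (auto simp: chart_at_atlas chart_at_mem)
  obtain W where W: "open W" "t \<in> W" "\<And>s. s \<in> I \<Longrightarrow> s \<in> W \<Longrightarrow> q s \<in> fst c" "smooth_on (I \<inter> W) (\<lambda>s. snd c (q s))"
    using smooth_map_flat_chart[OF finite_dim_real A I q t c] by blast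
  have th: "thick (I \<inter> W)" using I W(1) thick_Int_open by blast
  have "components A c (q s) (snd (tangent_lift A I q s)) = vector_derivative (\<lambda>s. snd c (q s)) (at s within (I \<inter> W))"
    if s: "s \<in> I \<inter> W" for s
  proof -
    have "((\<lambda>s. snd c (q s)) has_vector_derivative components A c (q s) (snd (tangent_lift A I q s))) (at s within (I \<inter> W))"
      using tangent_lift_chart[OF A I q _ c(1) W(3)] s at_within_Int_open[of s W I] W(1) by simp
    from thick_vector_derivative[OF th s this] show ?thesis by simp
  qed
  then have "smooth_on (I \<inter> W) (\<lambda>s. components A c (q s) (snd (tangent_lift A I q s)))"
    by (intro smooth_on_transform[OF smooth_on_vector_derivative[OF th W(4)]]) simp
  then show "\<exists>c\<in>atlas A. \<exists>W. open W \<and> t \<in> W \<and> (\<forall>s\<in>I \<inter> W. fst (tangent_lift A I q s) \<in> fst c) \<and>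
      smooth_on (I \<inter> W) (\<lambda>s. snd c (fst (tangent_lift A I q s))) \<and>
      smooth_on (I \<inter> W) (\<lambda>s. components A c (fst (tangent_lift A I q s)) (snd (tangent_lift A I q s)))"
    using W by (intro bexI[OF _ c(1)] exI[of _ W]) (auto simp: tangent_lift_def)
qed

text \<open>The second half \<open>y'\<close> of the velocity differentiates the components in the
  chart fixed at time \<open>t\<close>. Differentiating \<open>snd (\<xi> s)\<close> itself would be
  meaningless, since its reference chart depends on \<open>s\<close>.\<close>

lemma tangent_lift_tangent_bundle:
  assumes A: "premanifold A" and I: "thick I" and \<xi>: "smooth_map flat I (tangent_bundle A) \<xi>" and t: "t \<in> I"
  obtains y' where
    "tangent_lift (tangent_bundle A) I \<xi> t = (\<xi> t, (snd (tangent_lift A I (\<lambda>t. fst (\<xi> t)) t), y'))"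
    "((\<lambda>s. components A (chart_at A (fst (\<xi> t))) (fst (\<xi> s)) (snd (\<xi> s))) has_vector_derivative y') (at t within I)"
proof -
  define c where "c = chart_at A (fst (\<xi> t))"
  have c: "c \<in> atlas A" "fst (\<xi> t) \<in> fst c" unfolding c_def using A by (auto simp: chart_at_atlas chart_at_mem)
  obtain W where W: "open W" "t \<in> W" "\<And>s. s \<in> I \<Longrightarrow> s \<in> W \<Longrightarrow> fst (\<xi> s) \<in> fst c"
    "smooth_on (I \<inter> W) (\<lambda>s. snd c (fst (\<xi> s)))" "smooth_on (I \<inter> W) (\<lambda>s. components A c (fst (\<xi> s)) (snd (\<xi> s)))"
    using smooth_tangent_curve_chart[OF A I \<xi> t c] by blast
  have 1: "((\<lambda>s. snd c (fst (\<xi> s))) has_vector_derivative snd (tangent_lift A I (\<lambda>t. fst (\<xi> t)) t)) (at t within I)"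
    using tangent_lift_chart[OF A I smooth_curve_proj[OF A I \<xi>] t c] components_chart_at[OF A] by (simp add: c_def)
  obtain y' where 2: "((\<lambda>s. components A c (fst (\<xi> s)) (snd (\<xi> s))) has_vector_derivative y') (at t within I)"
    using smooth_on_has_vector_derivative[OF W(5), of t] t W(2) at_within_Int_open[OF W(2,1), of I] by auto
  have e: "snd (tangent_chart A c) \<circ> \<xi> = (\<lambda>s. (snd c (fst (\<xi> s)), components A c (fst (\<xi> s)) (snd (\<xi> s))))"
  proof
    fix s show "(snd (tangent_chart A c) \<circ> \<xi>) s = (snd c (fst (\<xi> s)), components A c (fst (\<xi> s)) (snd (\<xi> s)))"
      by (cases "\<xi> s") (simp add: tangent_chart_simps)
  qed
  have ca: "chart_at (tangent_bundle A) (\<xi> t) = tangent_chart A c"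
    by (cases "\<xi> t") (simp add: tangent_bundle_simps c_def)
  have "tangent_lift (tangent_bundle A) I \<xi> t = (\<xi> t, (snd (tangent_lift A I (\<lambda>t. fst (\<xi> t)) t), y'))"
    unfolding tangent_lift_def[of "tangent_bundle A"] ca e
    using thick_vector_derivative[OF I t has_vector_derivative_Pair[OF 1 2]] by simp
  then show ?thesis using that 2 unfolding c_def by blast
qed

section \<open>Ordinary differential equations\<close>

text \<open>The finite sum \<open>s\<close> dominates the operator norm of the derivative and is
  continuous, hence at most \<open>s x0 + 1\<close> on a small ball; the mean value inequality on
  this convex set gives the Lipschitz estimate.\<close>

lemma smooth_on_locally_Lipschitz:
  fixes F :: "'a::real_normed_vector \<Rightarrow> 'b::real_normed_vector"
  assumes fd: "finite_dim TYPE('a)" and S: "open S" "x0 \<in> S" and F: "smooth_on S F"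
  obtains r K M where "r > 0" "K \<ge> 0" "M \<ge> 0" "cball x0 r \<subseteq> S"
    "\<And>x y. x \<in> cball x0 r \<Longrightarrow> y \<in> cball x0 r \<Longrightarrow> norm (F x - F y) \<le> K * norm (x - y)"
    "\<And>x. x \<in> cball x0 r \<Longrightarrow> norm (F x) \<le> M"
proof -
  define D where "D = (\<lambda>x. frechet_derivative F (at x))"
  have D: "(F has_derivative D x) (at x)" if "x \<in> S" for x
    using smooth_on_has_derivative[OF S(1) F that] by (simp add: D_def)
  obtain B :: "'a set" and \<beta> where B: "finite B" "\<And>b. b \<in> B \<Longrightarrow> bounded_linear (\<beta> b)"
    "\<And>v. v = (\<Sum>b\<in>B. \<beta> b v *\<^sub>R b)" using finite_dim_coordinates[OF fd] by blast
  have "\<forall>b\<in>B. \<exists>m>0. \<forall>v. norm (\<beta> b v) \<le> norm v * m"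
    using bounded_linear.pos_bounded[OF B(2)] by blast
  then obtain m where m: "\<And>b. b \<in> B \<Longrightarrow> m b > 0" "\<And>b v. b \<in> B \<Longrightarrow> norm (\<beta> b v) \<le> norm v * m b" by metis
  define s where "s = (\<lambda>x. \<Sum>b\<in>B. m b * norm (D x b))"
  have "continuous_on S s"
    unfolding s_def D_def
    by (intro continuous_intros smooth_on_imp_continuous[OF smooth_on_frechet_derivative[OF S(1) F]])
  then have cont: "\<exists>d>0. \<forall>x\<in>S. dist x x0 < d \<longrightarrow> dist (s x) (s x0) < 1"
    using S(2) unfolding continuous_on_iff by (meson zero_less_one)
  then obtain d where d: "d > 0" "\<And>x. x \<in> S \<Longrightarrow> dist x x0 < d \<Longrightarrow> dist (s x) (s x0) < 1" by blast
  obtain r0 where r0: "r0 > 0" "cball x0 r0 \<subseteq> S" using S open_contains_cball by blast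
  define r where "r = min r0 (d / 2)"
  have r: "r > 0" "r < d" "r \<le> r0" using r0 d(1) by (auto simp: r_def)
  have rS: "cball x0 r \<subseteq> S" using r0(2) r(3) by auto
  define K where "K = s x0 + 1"
  have s0: "s x0 \<ge> 0" unfolding s_def using m(1) by (intro sum_nonneg mult_nonneg_nonneg) (auto intro: less_imp_le)
  have sK: "s x \<le> K" if "x \<in> cball x0 r" for x
    using d(2)[of x] that rS r by (force simp: K_def dist_real_def dist_commute)
  have on: "onorm (D x) \<le> K" if x: "x \<in> cball x0 r" for x
  proof (rule onorm_bound)
    show "0 \<le> K" using s0 by (simp add: K_def)
    fix v
    have lin: "linear (D x)" using D has_derivative_linear rS x by blast
    have "D x v = D x (\<Sum>b\<in>B. \<beta> b v *\<^sub>R b)" using B(3)[of v] by simp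
    also have "\<dots> = (\<Sum>b\<in>B. \<beta> b v *\<^sub>R D x b)" by (simp add: linear_sum[OF lin] linear_scale[OF lin])
    also have "norm \<dots> \<le> (\<Sum>b\<in>B. (norm v * m b) * norm (D x b))"
      using m(2) by (intro sum_norm_le) (auto intro: mult_right_mono)
    also have "\<dots> = s x * norm v" by (simp add: s_def sum_distrib_left sum_distrib_right mult_ac)
    also have "\<dots> \<le> K * norm v" using sK[OF x] by (intro mult_right_mono) auto
    finally show "norm (D x v) \<le> K * norm v" .
  qed
  have lip: "norm (F x - F y) \<le> K * norm (x - y)" if xy: "x \<in> cball x0 r" "y \<in> cball x0 r" for x y
    by (rule differentiable_bound[of "cball x0 r" F D]) (use on xy rS in \<open>auto intro: has_derivative_at_withinI[OF D]\<close>)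
  have K0: "K \<ge> 0" using s0 by (simp add: K_def)
  have "norm (F x) \<le> norm (F x0) + K * r" if x: "x \<in> cball x0 r" for x
  proof -
    have "norm (F x) \<le> norm (F x0) + norm (F x - F x0)" using norm_triangle_sub by blast
    also have "norm (F x - F x0) \<le> K * norm (x - x0)" using lip x r(1) by simp
    also have "\<dots> \<le> K * r" using x K0 by (intro mult_left_mono) (auto simp: dist_norm norm_minus_commute)
    finally show ?thesis by simp
  qed
  moreover have "norm (F x0) + K * r \<ge> 0" using K0 r(1) by simp
  ultimately show ?thesis using that[OF r(1) K0 _ rS lip] by blast
qed

text \<open>Picard iteration: \<open>M * \<epsilon> \<le> r\<close> makes the integral operator a
  self-map of a closed ball of continuous curves, and \<open>K * \<epsilon> \<le> 1/2\<close> makes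
  it a contraction with factor \<open>1/2\<close>.\<close>

lemma ode_solution_exists:
  fixes F :: "'a::banach \<Rightarrow> 'a"
  assumes r: "r \<ge> 0" and \<epsilon>: "\<epsilon> > 0" and K: "K \<ge> 0" "K * \<epsilon> \<le> 1/2" and M: "M \<ge> 0" "M * \<epsilon> \<le> r"
    and cont: "continuous_on (cball x0 r) F"
    and lip: "\<And>x y. x \<in> cball x0 r \<Longrightarrow> y \<in> cball x0 r \<Longrightarrow> norm (F x - F y) \<le> K * norm (x - y)"
    and bnd: "\<And>x. x \<in> cball x0 r \<Longrightarrow> norm (F x) \<le> M"
  obtains x where "x 0 = x0" "\<And>t. t \<in> {0..\<epsilon>} \<Longrightarrow> x t \<in> cball x0 r"
    "\<And>t. t \<in> {0..\<epsilon>} \<Longrightarrow> (x has_vector_derivative F (x t)) (at t within {0..\<epsilon>})"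
proof -
  \<comment> \<open>Clamps time to the interval from \<open>0\<close> to \<open>\<epsilon>\<close>,
    because the elements of \<open>bcontfun\<close> are functions on the whole line.\<close>
  define cl where "cl = (\<lambda>t::real. max 0 (min \<epsilon> t))"
  have cl: "cl t \<in> {0..\<epsilon>}" for t using \<epsilon> by (auto simp: cl_def)
  have clid: "cl t = t" if "t \<in> {0..\<epsilon>}" for t using that by (auto simp: cl_def)
  have contcl: "continuous_on UNIV cl" unfolding cl_def by (intro continuous_intros)
  define S where "S = cball (const_bcontfun x0 :: real \<Rightarrow>\<^sub>C 'a) r"
  have SI: "f \<in> S \<longleftrightarrow> (\<forall>t. apply_bcontfun f t \<in> cball x0 r)" for f
  proof
    assume "f \<in> S"
    then have "dist (const_bcontfun x0) f \<le> r" by (simp add: S_def)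
    then show "\<forall>t. apply_bcontfun f t \<in> cball x0 r"
      using dist_bounded[of "const_bcontfun x0" _ f] order_trans by (fastforce simp: const_bcontfun.rep_eq)
  next
    assume "\<forall>t. apply_bcontfun f t \<in> cball x0 r"
    then show "f \<in> S" unfolding S_def by (auto intro!: dist_bound simp: const_bcontfun.rep_eq)
  qed
  have contF: "continuous_on T (\<lambda>s. F (apply_bcontfun f s))" if "f \<in> S" for f T
    using that SI by (intro continuous_on_compose2[OF cont]) auto
  define I where "I = (\<lambda>f t. x0 + integral {0..cl t} (\<lambda>s. F (apply_bcontfun f s)))"
  have Iball: "I f t \<in> cball x0 r" if "f \<in> S" for f t
  proof -
    have "norm (integral {0..cl t} (\<lambda>s. F (apply_bcontfun f s))) \<le> M * (cl t - 0)"
      using cl[of t] contF[OF that] bnd SI[of f] that by (intro integral_bound) auto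
    also have "\<dots> \<le> M * \<epsilon>" using cl[of t] M by (intro mult_left_mono) auto
    finally show ?thesis using M(2) by (simp add: I_def dist_norm)
  qed
  have Icont: "continuous_on UNIV (I f)" if "f \<in> S" for f
  proof -
    have "continuous_on {0..\<epsilon>} (\<lambda>u. integral {0..u} (\<lambda>s. F (apply_bcontfun f s)))"
      by (intro indefinite_integral_continuous_1 integrable_continuous_interval contF that)
    then have "continuous_on UNIV (\<lambda>t. integral {0..cl t} (\<lambda>s. F (apply_bcontfun f s)))"
      by (rule continuous_on_compose2[OF _ contcl]) (use cl in auto)
    then show ?thesis unfolding I_def by (intro continuous_intros)
  qed
  have Ib: "I f \<in> bcontfun" if "f \<in> S" for f
  proof -
    have "range (I f) \<subseteq> cball x0 r" using Iball[OF that] by blast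
    then show ?thesis using Icont[OF that] bounded_subset[OF bounded_cball] by (auto simp: bcontfun_def)
  qed
  define T where "T = (\<lambda>f. Bcontfun (I f))"
  have T: "apply_bcontfun (T f) = I f" if "f \<in> S" for f
    unfolding T_def using Bcontfun_inverse[OF Ib[OF that]] .
  have "\<exists>!f\<in>S. T f = f"
  proof (rule Banach_fix[where c = "1/2"])
    show "complete S" unfolding S_def complete_eq_closed by simp
    show "S \<noteq> {}" unfolding S_def using r by auto
    show "T ` S \<subseteq> S" using SI T Iball by auto
    fix f g assume f: "f \<in> S" and g: "g \<in> S"
    show "dist (T f) (T g) \<le> 1/2 * dist f g"
    proof (rule dist_bound)
      fix t
      have "norm (F (apply_bcontfun f s) - F (apply_bcontfun g s)) \<le> K * dist f g" for s
      proof -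
        have "norm (F (apply_bcontfun f s) - F (apply_bcontfun g s)) \<le> K * dist (apply_bcontfun f s) (apply_bcontfun g s)"
          using lip[of "apply_bcontfun f s" "apply_bcontfun g s"] SI f g by (simp add: dist_norm)
        also have "\<dots> \<le> K * dist f g" using K(1) dist_bounded by (intro mult_left_mono) auto
        finally show ?thesis .
      qed
      then have "norm (integral {0..cl t} (\<lambda>s. F (apply_bcontfun f s) - F (apply_bcontfun g s))) \<le> K * dist f g * (cl t - 0)"
        using cl[of t] contF[OF f] contF[OF g] by (intro integral_bound continuous_intros) auto
      also have "\<dots> \<le> K * dist f g * \<epsilon>" using cl[of t] K(1) by (intro mult_left_mono) auto
      also have "\<dots> \<le> 1/2 * dist f g" using mult_right_mono[OF K(2), of "dist f g"] by (simp add: mult_ac)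
      finally show "dist (apply_bcontfun (T f) t) (apply_bcontfun (T g) t) \<le> 1/2 * dist f g"
        unfolding T[OF f] T[OF g] I_def dist_norm
        using contF[OF f, of "{0..cl t}"] contF[OF g, of "{0..cl t}"]
        by (simp add: integral_diff integrable_continuous_interval)
    qed
  qed auto
  then obtain f where f: "f \<in> S" "T f = f" by blast
  define x where "x = apply_bcontfun f"
  have x: "x t = x0 + integral {0..cl t} (\<lambda>s. F (x s))" for t
    using T[OF f(1)] f(2) unfolding x_def I_def by (metis (no_types))
  show ?thesis
  proof (rule that[of x])
    have "cl 0 = 0" using clid[of 0] \<epsilon> by simp
    then show "x 0 = x0" using x[of 0] by (simp only: integral_singleton atLeastAtMost_singleton add_0_right)
    show "x t \<in> cball x0 r" for t using f(1) SI by (simp add: x_def)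
    fix t assume t: "t \<in> {0..\<epsilon>}"
    have "((\<lambda>u. integral {0..u} (\<lambda>s. F (x s))) has_vector_derivative F (x t)) (at t within {0..\<epsilon>})"
      using integral_has_vector_derivative[OF _ t, of "\<lambda>s. F (x s)"] contF[OF f(1)] by (simp add: x_def)
    then have "((\<lambda>u. x0 + integral {0..u} (\<lambda>s. F (x s))) has_vector_derivative F (x t)) (at t within {0..\<epsilon>})"
      using has_vector_derivative_add[OF has_vector_derivative_const] by fastforce
    moreover have "x u = x0 + integral {0..u} (\<lambda>s. F (x s))" if "u \<in> {0..\<epsilon>}" for u
      using x[of u] unfolding clid[OF that] .
    ultimately show "(x has_vector_derivative F (x t)) (at t within {0..\<epsilon>})"
      by (rule has_vector_derivative_transform[OF t, rotated])
  qed
qed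

text \<open>Where the distance of the two solutions attains its maximum \<open>m\<close>, the mean
  value inequality gives \<open>m \<le> K * m * \<epsilon> \<le> m / 2\<close>, so \<open>m\<close>
  vanishes.\<close>

lemma ode_solution_unique:
  fixes F :: "'a::real_normed_vector \<Rightarrow> 'a"
  assumes \<epsilon>: "\<epsilon> \<ge> 0" and K: "K \<ge> 0" "K * \<epsilon> \<le> 1/2"
    and lip: "\<And>x y. x \<in> C \<Longrightarrow> y \<in> C \<Longrightarrow> norm (F x - F y) \<le> K * norm (x - y)"
    and x: "\<And>t. t \<in> {0..\<epsilon>} \<Longrightarrow> x t \<in> C" "\<And>t. t \<in> {0..\<epsilon>} \<Longrightarrow> (x has_vector_derivative F (x t)) (at t within {0..\<epsilon>})"
    and y: "\<And>t. t \<in> {0..\<epsilon>} \<Longrightarrow> y t \<in> C" "\<And>t. t \<in> {0..\<epsilon>} \<Longrightarrow> (y has_vector_derivative F (y t)) (at t within {0..\<epsilon>})"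
    and eq: "x 0 = y 0" and t: "t \<in> {0..\<epsilon>}"
  shows "x t = y t"
proof -
  have der: "((\<lambda>t. x t - y t) has_vector_derivative F (x t) - F (y t)) (at t within {0..\<epsilon>})" if "t \<in> {0..\<epsilon>}" for t
    by (intro has_vector_derivative_diff x y that)
  then have "continuous_on {0..\<epsilon>} (\<lambda>t. x t - y t)"
    unfolding continuous_on_eq_continuous_within using has_vector_derivative_continuous by blast
  then have "continuous_on {0..\<epsilon>} (\<lambda>t. norm (x t - y t))" by (rule continuous_on_norm)
  then obtain s where s: "s \<in> {0..\<epsilon>}" "\<And>t. t \<in> {0..\<epsilon>} \<Longrightarrow> norm (x t - y t) \<le> norm (x s - y s)"
    using continuous_attains_sup[of "{0..\<epsilon>}" "\<lambda>t. norm (x t - y t)"] \<epsilon> by auto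
  define m where "m = norm (x s - y s)"
  have "norm ((x s - y s) - (x 0 - y 0)) \<le> (K * m) * norm (s - 0)"
  proof (rule differentiable_bound[where f' = "\<lambda>t u. u *\<^sub>R (F (x t) - F (y t))" and S = "{0..\<epsilon>}"])
    fix t assume t: "t \<in> {0..\<epsilon>}"
    show "((\<lambda>t. x t - y t) has_derivative (\<lambda>u. u *\<^sub>R (F (x t) - F (y t)))) (at t within {0..\<epsilon>})"
      using der[OF t] by (simp add: has_vector_derivative_def)
    have "norm (F (x t) - F (y t)) \<le> K * norm (x t - y t)" using lip x(1) y(1) t by blast
    also have "\<dots> \<le> K * m" using s(2)[OF t] K(1) by (auto simp: m_def intro: mult_left_mono)
    finally show "onorm (\<lambda>u. u *\<^sub>R (F (x t) - F (y t))) \<le> K * m"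
      using onorm_scaleR_left[OF bounded_linear_ident, of "F (x t) - F (y t)"] by (simp add: onorm_id)
  qed (use s \<epsilon> in auto)
  also have "(K * m) * norm (s - 0) \<le> (K * m) * \<epsilon>" using s(1) K(1) by (intro mult_left_mono) (auto simp: m_def)
  also have "\<dots> \<le> 1/2 * m" using mult_right_mono[OF K(2), of m] by (simp add: m_def mult_ac)
  finally have "m \<le> 1/2 * m" using eq by (simp add: m_def)
  then have "m = 0" unfolding m_def using norm_ge_zero[of "x s - y s"] by linarith
  then show ?thesis using s(2)[OF t] by (simp add: m_def)
qed

text \<open>Bootstrapping: the derivative of \<open>x\<close> is \<open>F (x t)\<close>, which is as
  regular as \<open>x\<close>, so each order of differentiability yields the next.\<close>

lemma ode_solution_smooth:
  fixes F :: "'a::real_normed_vector \<Rightarrow> 'a" and I :: "real set"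
  assumes fd: "finite_dim TYPE('a)" and I: "thick I" and F: "smooth_on S F" and xS: "x ` I \<subseteq> S"
    and x: "\<And>t. t \<in> I \<Longrightarrow> (x has_vector_derivative F (x t)) (at t within I)"
  shows "smooth_on I x"
  unfolding smooth_on_def
proof
  fix k show "Ck_on k I x"
  proof (induction k)
    case 0
    show ?case unfolding Ck_on.simps(1) continuous_on_eq_continuous_within
      using has_vector_derivative_continuous[OF x] by blast
  next
    case (Suc k)
    have "Ck_on k S F" using F unfolding smooth_on_def by blast
    then have "Ck_on k I (\<lambda>t. F (x t))" by (rule Ck_on_compose[OF I fd Suc _ xS])
    then have "Ck_on k I (\<lambda>t. v *\<^sub>R F (x t))" for v
      by (rule Ck_on_bounded_linear[OF I bounded_linear_scaleR_right])
    then show ?case using x by (intro Ck_onI[OF I, where f' = "\<lambda>t u. u *\<^sub>R F (x t)"]) (auto simp: has_vector_derivative_def)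
  qed
qed

section \<open>One-parameter subgroups\<close>

text \<open>Divide \<open>t\<close> by \<open>\<delta>\<close> with remainder \<open>p t\<close> and
  put \<open>h t = g \<delta> [^] k t \<otimes> g (p t)\<close>. Two remainders add up to less than
  \<open>2 * \<delta>\<close>, within reach of the local law, and \<open>g \<delta>\<close> commutes
  with the values at remainders because addition of times is commutative.\<close>

lemma local_hom_extends:
  fixes G (structure) and g :: "real \<Rightarrow> 'g"
  assumes "group G" and carrier: "carrier G = UNIV" and \<delta>: "\<delta> > 0"
    and g: "\<And>s t. 0 \<le> s \<Longrightarrow> 0 \<le> t \<Longrightarrow> s + t \<le> 2 * \<delta> \<Longrightarrow> g (s + t) = g s \<otimes> g t"
  obtains h where "\<And>s t. h (s + t) = h s \<otimes> h t" "\<And>t. 0 \<le> t \<Longrightarrow> t < \<delta> \<Longrightarrow> h t = g t"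
proof -
  interpret group G by fact
  have [simp]: "x \<in> carrier G" for x using carrier by simp
  define k where "k = (\<lambda>t. \<lfloor>t / \<delta>\<rfloor>)"
  define p where "p = (\<lambda>t. t - \<delta> * of_int (k t))"
  have p: "0 \<le> p t" "p t < \<delta>" for t
  proof -
    have "of_int (k t) \<le> t / \<delta>" "t / \<delta> < of_int (k t) + 1" unfolding k_def by linarith+
    then show "0 \<le> p t" "p t < \<delta>" using \<delta> by (auto simp: p_def field_simps)
  qed
  have kI: "k t = n \<and> p t = u" if "t = \<delta> * of_int n + u" "0 \<le> u" "u < \<delta>" for t u n
  proof -
    have "of_int n \<le> t / \<delta>" "t / \<delta> < of_int n + 1" using that \<delta> by (auto simp: field_simps)
    then have "k t = n" unfolding k_def by linarith
    then show ?thesis using that by (simp add: p_def)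
  qed
  define h where "h = (\<lambda>t. g \<delta> [^] k t \<otimes> g (p t))"
  have comm: "g \<delta> \<otimes> g t = g t \<otimes> g \<delta>" if "0 \<le> t" "t < \<delta>" for t
    using g[of \<delta> t] g[of t \<delta>] that \<delta> by (simp add: add.commute)
  have commn: "g \<delta> [^] (n::int) \<otimes> g t = g t \<otimes> g \<delta> [^] n" if t: "0 \<le> t" "t < \<delta>" for n t
  proof (cases n)
    case (nonneg m)
    then show ?thesis using group_commutes_pow[OF comm[OF t]] by (simp add: int_pow_int)
  next
    case (neg m)
    define y where "y = g \<delta> [^] Suc m"
    have y: "y \<otimes> g t = g t \<otimes> y" unfolding y_def by (rule group_commutes_pow[OF comm[OF t]]) simp_all
    have "inv y \<otimes> g t = inv y \<otimes> g t \<otimes> (y \<otimes> inv y)" by simp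
    also have "\<dots> = inv y \<otimes> (g t \<otimes> y) \<otimes> inv y" by (simp add: m_assoc)
    also have "inv y \<otimes> (g t \<otimes> y) = g t" unfolding y[symmetric] by (simp add: m_assoc[symmetric])
    finally show ?thesis using neg int_pow_neg_int[of "g \<delta>" "Suc m"] by (simp add: y_def)
  qed
  have g0: "g 0 = \<one>" using g[of 0 0] \<delta> by (simp add: l_cancel_one')
  show ?thesis
  proof (rule that[of h])
    fix s t
    have st: "s + t = \<delta> * of_int (k s + k t) + (p s + p t)" by (simp add: p_def algebra_simps)
    have hh: "h s \<otimes> h t = g \<delta> [^] (k s + k t) \<otimes> g (p s + p t)"
    proof -
      have "h s \<otimes> h t = g \<delta> [^] k s \<otimes> (g (p s) \<otimes> g \<delta> [^] k t) \<otimes> g (p t)" by (simp add: h_def m_assoc)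
      also have "\<dots> = (g \<delta> [^] k s \<otimes> g \<delta> [^] k t) \<otimes> (g (p s) \<otimes> g (p t))"
        unfolding commn[OF p, symmetric] by (simp add: m_assoc)
      also have "g (p s) \<otimes> g (p t) = g (p s + p t)" using g[of "p s" "p t"] p[of s] p[of t] by simp
      finally show ?thesis by (simp add: int_pow_mult)
    qed
    show "h (s + t) = h s \<otimes> h t"
    proof (cases "p s + p t < \<delta>")
      case True
      then show ?thesis using kI[OF st] p[of s] p[of t] hh by (simp add: h_def)
    next
      case False
      \<comment> \<open>The remainders reach \<open>\<delta>\<close> together, so one factor
        \<open>g \<delta>\<close> is carried over to the power.\<close>
      define u where "u = p s + p t - \<delta>"
      have u: "0 \<le> u" "u < \<delta>" using False p[of s] p[of t] by (auto simp: u_def)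
      have "s + t = \<delta> * of_int (k s + k t + 1) + u" using st by (simp add: u_def algebra_simps)
      from kI[OF this u] have "h (s + t) = g \<delta> [^] (k s + k t + 1) \<otimes> g u" unfolding h_def by metis
      also have "\<dots> = g \<delta> [^] (k s + k t) \<otimes> (g \<delta> \<otimes> g u)" using int_pow_mult[of "g \<delta>" "k s + k t" 1] by (simp add: m_assoc)
      also have "g \<delta> \<otimes> g u = g (p s + p t)" using g[of \<delta> u] u by (simp add: u_def)
      finally show ?thesis using hh by simp
    qed
  next
    fix t assume t: "0 \<le> t" "t < \<delta>"
    then show "h t = g t" using kI[of t 0 t] by (simp add: h_def)
  qed
qed

text \<open>Every nonnegative time is a multiple of a time at most \<open>\<delta>\<close>, and
  cancellation in the group handles negative times. Agreement to the right of \<open>0\<close> is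
  therefore enough.\<close>

lemma homs_eq_if_eq_near_0:
  fixes G (structure) and g h :: "real \<Rightarrow> 'g"
  assumes "group G" and carrier: "carrier G = UNIV" and \<delta>: "\<delta> > 0"
    and g: "\<And>s t. g (s + t) = g s \<otimes> g t" and h: "\<And>s t. h (s + t) = h s \<otimes> h t"
    and eq: "\<And>t. 0 \<le> t \<Longrightarrow> t \<le> \<delta> \<Longrightarrow> g t = h t"
  shows "g = h"
proof -
  interpret group G by fact
  have [simp]: "x \<in> carrier G" for x using carrier by simp
  have pos: "g t = h t" if t: "t \<ge> 0" for t
  proof -
    obtain n where n: "t / \<delta> \<le> real n" using real_arch_simple by blast
    define s where "s = t / real (Suc n)"
    have "t \<le> \<delta> * real n" using n \<delta> by (simp add: field_simps)
    also have "\<dots> \<le> \<delta> * real (Suc n)" using \<delta> by simp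
    finally have s: "0 \<le> s" "s \<le> \<delta>" using t by (auto simp: s_def divide_le_eq)
    have "g (real m * s) = h (real m * s)" for m
    proof (induction m)
      case 0
      then show ?case using eq[of 0] \<delta> by simp
    next
      case (Suc m)
      then show ?case using g[of "real m * s" s] h[of "real m * s" s] eq[OF s] by (simp add: algebra_simps)
    qed
    from this[of "Suc n"] show ?thesis by (simp add: s_def)
  qed
  have zero: "g 0 = \<one>" "h 0 = \<one>" using g[of 0 0] h[of 0 0] by (simp_all add: l_cancel_one')
  have neg: "g (- t) = h (- t)" if "t \<ge> 0" for t
  proof -
    have "g (- t) \<otimes> g t = \<one>" "h (- t) \<otimes> g t = \<one>"
      using g[of "- t" t] h[of "- t" t] zero pos[OF that] by simp_all
    then have "g (- t) \<otimes> g t = h (- t) \<otimes> g t" by simp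
    then show ?thesis by simp
  qed
  show ?thesis
  proof
    fix t show "g t = h t" using pos[of t] neg[of "- t"] by (cases "t \<ge> 0") auto
  qed
qed

lemma has_vector_derivative_compose_has_derivative:
  assumes "(f has_vector_derivative f') (at t within S)" "(g has_derivative g') (at (f t))"
  shows "((\<lambda>s. g (f s)) has_vector_derivative g' f') (at t within S)"
proof -
  have "((\<lambda>s. g (f s)) has_derivative (\<lambda>u. g' (u *\<^sub>R f'))) (at t within S)"
    by (rule has_derivative_compose[OF assms(1)[unfolded has_vector_derivative_def] assms(2)])
  then show ?thesis
    by (simp add: has_vector_derivative_def linear_scale[OF has_derivative_linear[OF assms(2)]])
qed

lemma lie_groupD:
  assumes "lie_group M G"
  shows "premanifold M" "group G" "carrier G = UNIV"
    "smooth_map (prod_manifold M M) UNIV M (\<lambda>z. fst z \<otimes>\<^bsub>G\<^esub> snd z)"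
  using assms smooth_manifold_premanifold unfolding lie_group_def by (auto simp: case_prod_beta')

text \<open>\<open>F\<close> is the coordinate expression of the left-invariant field with value
  \<open>a\<close> at the unit, obtained by differentiating the right factor of the product there.
  Of the two derivative rules for curves, the one through the unit serves a given one-parameter
  subgroup, the other the solutions of the differential equation of \<open>F\<close>.\<close>

lemma group_chart_field:
  fixes M :: "('g, 'h::banach) manifold" and G (structure) and a :: 'h
  assumes lg: "lie_group M G" and c_def: "c = chart_at M \<one>" and z0_def: "z0 = snd c \<one>"
    and \<mu>_def: "\<mu> = (\<lambda>x y. snd c (chart_inv c x \<otimes> chart_inv c y))"
  obtains r F where "r > 0" "ball z0 r \<subseteq> snd c ` fst c" "smooth_on (ball z0 r) F" "F z0 = a"
    "\<And>x y. x \<in> ball z0 r \<Longrightarrow> y \<in> ball z0 r \<Longrightarrow> chart_inv c x \<otimes> chart_inv c y \<in> fst c"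
    "\<And>\<rho>. \<rho> > 0 \<Longrightarrow> \<exists>r'>0. r' \<le> r \<and> (\<forall>x\<in>ball z0 r'. \<forall>y\<in>ball z0 r'. \<mu> x y \<in> ball z0 \<rho>)"
    "\<And>X x T t. X \<in> ball z0 r \<Longrightarrow> x t = z0 \<Longrightarrow> (x has_vector_derivative a) (at t within T) \<Longrightarrow>
       ((\<lambda>s. \<mu> X (x s)) has_vector_derivative F X) (at t within T)"
    "\<And>X y T t. X \<in> ball z0 r \<Longrightarrow> y t \<in> ball z0 r \<Longrightarrow> \<mu> X (y t) \<in> ball z0 r \<Longrightarrow>
       (y has_vector_derivative F (y t)) (at t within T) \<Longrightarrow>
       ((\<lambda>s. \<mu> X (y s)) has_vector_derivative F (\<mu> X (y t))) (at t within T)"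
proof -
  have M: "premanifold M" and "group G" and carrier: "carrier G = UNIV"
    and mult: "smooth_map (prod_manifold M M) UNIV M (\<lambda>z. fst z \<otimes> snd z)" using lie_groupD[OF lg] by blast+
  interpret group G by fact
  have [simp]: "x \<in> carrier G" for x using carrier by simp
  have c: "c \<in> atlas M" "\<one> \<in> fst c" using M by (auto simp: c_def chart_at_atlas chart_at_mem)
  note MM = premanifold_prod[OF M M] and ci = chart_inv_chart[OF M c(1)]
  have fd: "finite_dim TYPE('h)" using premanifold_finite_dim[OF M] .
  let ?k = "prod_chart c c"
  have k: "?k \<in> atlas (prod_manifold M M)" unfolding prod_manifold_simps using c(1) by blast
  obtain W where W: "open W" "snd ?k (\<one>, \<one>) \<in> W"
    "\<And>y. y \<in> UNIV \<Longrightarrow> y \<in> fst ?k \<Longrightarrow> snd ?k y \<in> W \<Longrightarrow> fst y \<otimes> snd y \<in> fst c"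
    "smooth_on (snd ?k ` (UNIV \<inter> fst ?k) \<inter> W) (snd c \<circ> (\<lambda>z. fst z \<otimes> snd z) \<circ> chart_inv ?k)"
    using smooth_map_chart[OF MM M mthick_UNIV[OF MM] mult, of "(\<one>, \<one>)" ?k c] k c by auto
  have img: "snd ?k ` (UNIV \<inter> fst ?k) = snd c ` fst c \<times> snd c ` fst c"
    using map_prod_image_Int[of "snd c" "snd c" UNIV UNIV "fst c" "fst c"] by simp
  define W' where "W' = (snd c ` fst c \<times> snd c ` fst c) \<inter> W"
  have "open W'" unfolding W'_def by (intro open_Int open_Times chart_open[OF M c(1)] W(1))
  moreover have "(z0, z0) \<in> W'" using W(2) c by (auto simp: W'_def z0_def)
  ultimately obtain A B where AB0: "open A" "open B" "(z0, z0) \<in> A \<times> B" and AB: "A \<times> B \<subseteq> W'"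
    by (rule open_prod_elim)
  then have "open (A \<inter> B)" "z0 \<in> A \<inter> B" by auto
  then obtain r where r: "r > 0" "ball z0 r \<subseteq> A \<inter> B" using open_contains_ball by blast
  let ?B = "ball z0 r"
  have BW: "?B \<times> ?B \<subseteq> W'" using AB r(2) by blast
  have Bc: "?B \<subseteq> snd c ` fst c" using BW r(1) centre_in_ball unfolding W'_def by blast
  have mem: "chart_inv c x \<otimes> chart_inv c y \<in> fst c" if "x \<in> ?B" "y \<in> ?B" for x y
  proof -
    have "(x, y) \<in> W'" using BW that by blast
    then obtain p q where "p \<in> fst c" "q \<in> fst c" "x = snd c p" "y = snd c q" "(x, y) \<in> W" by (auto simp: W'_def)
    then show ?thesis using W(3)[of "(p, q)"] ci by simp
  qed
  define m where "m = (\<lambda>z. \<mu> (fst z) (snd z))"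
  have thB: "open (?B \<times> ?B)" by (intro open_Times open_ball)
  have "smooth_on (?B \<times> ?B) (snd c \<circ> (\<lambda>z. fst z \<otimes> snd z) \<circ> chart_inv ?k)"
    by (rule smooth_on_subset[OF finite_dim_prod[OF fd fd] thick_open[OF thB] W(4)])
      (use BW in \<open>simp only: img W'_def\<close>)
  then have msm: "smooth_on (?B \<times> ?B) m"
  proof (rule smooth_on_transform)
    fix z assume "z \<in> ?B \<times> ?B"
    then obtain x y where "z = (x, y)" "x \<in> ?B" "y \<in> ?B" by blast
    then have "z = (x, y)" "x \<in> snd c ` fst c" "y \<in> snd c ` fst c" using Bc by blast+
    then show "(snd c \<circ> (\<lambda>z. fst z \<otimes> snd z) \<circ> chart_inv ?k) z = m z"
      using prod_chart_inv[OF M M c(1) c(1)] by (simp add: m_def \<mu>_def)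
  qed
  have z0B: "z0 \<in> ?B" using r(1) by simp
  have cz0: "chart_inv c z0 = \<one>" using ci[OF c(2)] by (simp add: z0_def)
  have right_unit: "\<mu> x z0 = x" if "x \<in> ?B" for x
    using that Bc cz0 by (auto simp: \<mu>_def f_inv_into_f subset_iff)
  define D where "D = (\<lambda>X Y w. frechet_derivative m (at (X, Y)) (0, w))"
  have D: "((\<lambda>y. \<mu> X y) has_derivative D X Y) (at Y)" if "X \<in> ?B" "Y \<in> ?B" for X Y
  proof -
    have 1: "(m has_derivative frechet_derivative m (at (X, Y))) (at (X, Y))"
      using smooth_on_has_derivative[OF thB msm] that by blast
    have "((\<lambda>y. (X, y)) has_derivative (\<lambda>w. (0, w))) (at Y)"
      by (auto intro!: derivative_eq_intros)
    from has_derivative_compose[OF this 1] show ?thesis unfolding D_def m_def by simp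
  qed
  define F where "F = (\<lambda>X. D X z0 a)"
  have Fsm: "smooth_on ?B F"
    unfolding F_def D_def
    by (rule smooth_on_frechet_apply[OF finite_dim_prod[OF fd fd] thB msm thick_open[OF open_ball]])
      (use z0B in \<open>auto intro!: smooth_on_Pair smooth_on_id smooth_on_const thick_open\<close>)
  have Fz0: "F z0 = a"
  proof -
    have "((\<lambda>y. \<mu> z0 y) has_derivative (\<lambda>w. w)) (at z0)"
    proof (rule has_derivative_transform_within_open[OF has_derivative_ident open_ball z0B])
      fix x assume "x \<in> ?B"
      then show "x = \<mu> z0 x" using Bc cz0 by (auto simp: \<mu>_def f_inv_into_f subset_iff)
    qed
    from has_derivative_unique[OF this D[OF z0B z0B]] show ?thesis unfolding F_def by metis
  qed
  \<comment> \<open>Left invariance of \<open>F\<close>: differentiate the associative law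
    \<open>(X Y) z = X (Y z)\<close> in \<open>z\<close> at the unit. The neighbourhood
    \<open>N\<close> keeps \<open>Y z\<close> inside the ball.\<close>
  have key: "D X Y (F Y) = F (\<mu> X Y)" if X: "X \<in> ?B" and Y: "Y \<in> ?B" and XY: "\<mu> X Y \<in> ?B" for X Y
  proof -
    have contY: "continuous_on ?B (\<lambda>z. \<mu> Y z)"
      unfolding continuous_on_eq_continuous_within
      using D[OF Y] has_derivative_continuous continuous_at_imp_continuous_at_within by blast
    define N where "N = ?B \<inter> (\<lambda>z. \<mu> Y z) -` ?B"
    have N: "open N" "z0 \<in> N" using continuous_open_preimage[OF contY open_ball open_ball] right_unit[OF Y] Y z0B
      by (auto simp: N_def)
    have "((\<lambda>z. \<mu> X (\<mu> Y z)) has_derivative (\<lambda>w. D X Y (D Y z0 w))) (at z0)"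
      by (rule has_derivative_compose[OF D[OF Y z0B]]) (use D[OF X Y] right_unit[OF Y] in simp)
    moreover have "((\<lambda>z. \<mu> X (\<mu> Y z)) has_derivative D (\<mu> X Y) z0) (at z0)"
    proof (rule has_derivative_transform_within_open[OF D[OF XY z0B] N])
      fix z assume "z \<in> N"
      then have z: "z \<in> ?B" "\<mu> Y z \<in> ?B" by (auto simp: N_def)
      show "\<mu> (\<mu> X Y) z = \<mu> X (\<mu> Y z)"
        unfolding \<mu>_def by (simp add: ci[OF mem[OF X Y]] ci[OF mem[OF Y z(1)]] m_assoc)
    qed
    ultimately have "(\<lambda>w. D X Y (D Y z0 w)) = D (\<mu> X Y) z0" by (rule has_derivative_unique)
    then show ?thesis unfolding F_def by metis
  qed
  show ?thesis
  proof (rule that[OF r(1) Bc Fsm Fz0 mem])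
    fix \<rho> :: real assume \<rho>: "\<rho> > 0"
    have "continuous_on (?B \<times> ?B) m" using msm smooth_on_imp_continuous by blast
    then have "open ((?B \<times> ?B) \<inter> m -` ball z0 \<rho>)" using continuous_open_preimage thB open_ball by blast
    moreover have "(z0, z0) \<in> (?B \<times> ?B) \<inter> m -` ball z0 \<rho>" using z0B \<rho> right_unit[OF z0B] by (simp add: m_def)
    ultimately obtain A' B' where "open A'" "open B'" "(z0, z0) \<in> A' \<times> B'"
      and AB': "A' \<times> B' \<subseteq> (?B \<times> ?B) \<inter> m -` ball z0 \<rho>" by (rule open_prod_elim)
    then have "open (A' \<inter> B')" "z0 \<in> A' \<inter> B'" by auto
    then obtain r' where r': "r' > 0" "ball z0 r' \<subseteq> A' \<inter> B'" using open_contains_ball by blast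
    have "\<mu> x y \<in> ball z0 \<rho>" if "x \<in> ball z0 (min r r')" "y \<in> ball z0 (min r r')" for x y
    proof -
      have "x \<in> A'" "y \<in> B'" using that r'(2) by auto
      then have "(x, y) \<in> m -` ball z0 \<rho>" using AB' by blast
      then show ?thesis by (simp add: m_def)
    qed
    then show "\<exists>r'>0. r' \<le> r \<and> (\<forall>x\<in>ball z0 r'. \<forall>y\<in>ball z0 r'. \<mu> x y \<in> ball z0 \<rho>)"
      using r(1) r'(1) by (intro exI[of _ "min r r'"]) auto
  next
    fix X x T t assume X: "X \<in> ?B" and x: "x t = z0" "(x has_vector_derivative a) (at t within T)"
    show "((\<lambda>s. \<mu> X (x s)) has_vector_derivative F X) (at t within T)"
      unfolding F_def by (rule has_vector_derivative_compose_has_derivative[OF x(2)]) (use D[OF X z0B] x in simp)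
  next
    fix X y T t assume *: "X \<in> ?B" "y t \<in> ?B" "\<mu> X (y t) \<in> ?B" "(y has_vector_derivative F (y t)) (at t within T)"
    show "((\<lambda>s. \<mu> X (y s)) has_vector_derivative F (\<mu> X (y t))) (at t within T)"
      using has_vector_derivative_compose_has_derivative[OF *(4) D[OF *(1,2)]] unfolding key[OF *(1-3)] .
  qed
qed

text \<open>\<open>g\<close> is the integral curve of the left-invariant field through the unit. It
  is multiplicative by uniqueness of solutions, and every one-parameter subgroup with velocity
  \<open>a\<close> solves the same equation for small times, whence the last conclusion.\<close>

lemma one_param_local_ode:
  fixes M :: "('g, 'h::banach) manifold" and G (structure)
  assumes lg: "lie_group M G"
  defines "c \<equiv> chart_at M \<one>"
  defines "z0 \<equiv> snd c \<one>"
  obtains \<delta> g where "\<delta> > 0" "\<And>s t. 0 \<le> s \<Longrightarrow> 0 \<le> t \<Longrightarrow> s + t \<le> 2 * \<delta> \<Longrightarrow> g (s + t) = g s \<otimes> g t"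
    "\<And>t. 0 \<le> t \<Longrightarrow> t \<le> 2 * \<delta> \<Longrightarrow> g t \<in> fst c" "smooth_on {0<..<\<delta>} (\<lambda>t. snd c (g t))"
    "((\<lambda>t. snd c (g t)) has_vector_derivative a) (at 0 within {0..\<delta>})" "g 0 = \<one>"
    "\<And>\<gamma>. one_param_subgroup M G a \<gamma> \<Longrightarrow> \<exists>\<epsilon>>0. \<forall>t. 0 \<le> t \<and> t \<le> \<epsilon> \<longrightarrow> \<gamma> t = g t"
proof -
  have M: "premanifold M" and "group G" and carrier: "carrier G = UNIV" using lie_groupD[OF lg] by blast+
  interpret group G by fact
  have [simp]: "x \<in> carrier G" for x using carrier by simp
  have c: "c \<in> atlas M" "\<one> \<in> fst c" using M by (auto simp: c_def chart_at_atlas chart_at_mem)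
  note ci = chart_inv_chart[OF M c(1)]
  have fd: "finite_dim TYPE('h)" using premanifold_finite_dim[OF M] .
  define \<mu> where "\<mu> = (\<lambda>x y. snd c (chart_inv c x \<otimes> chart_inv c y))"
  obtain r F where r: "r > 0" "ball z0 r \<subseteq> snd c ` fst c" and Fsm: "smooth_on (ball z0 r) F" and Fz0: "F z0 = a"
    and mem: "\<And>x y. x \<in> ball z0 r \<Longrightarrow> y \<in> ball z0 r \<Longrightarrow> chart_inv c x \<otimes> chart_inv c y \<in> fst c"
    and shrink: "\<And>\<rho>. \<rho> > 0 \<Longrightarrow> \<exists>r'>0. r' \<le> r \<and> (\<forall>x\<in>ball z0 r'. \<forall>y\<in>ball z0 r'. \<mu> x y \<in> ball z0 \<rho>)"
    and d1: "\<And>X x T t. X \<in> ball z0 r \<Longrightarrow> x t = z0 \<Longrightarrow> (x has_vector_derivative a) (at t within T) \<Longrightarrow>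
       ((\<lambda>s. \<mu> X (x s)) has_vector_derivative F X) (at t within T)"
    and d2: "\<And>X y T t. X \<in> ball z0 r \<Longrightarrow> y t \<in> ball z0 r \<Longrightarrow> \<mu> X (y t) \<in> ball z0 r \<Longrightarrow>
       (y has_vector_derivative F (y t)) (at t within T) \<Longrightarrow>
       ((\<lambda>s. \<mu> X (y s)) has_vector_derivative F (\<mu> X (y t))) (at t within T)"
    by (rule group_chart_field[OF lg c_def[THEN meta_eq_to_obj_eq] z0_def[THEN meta_eq_to_obj_eq] \<mu>_def, of a])
      (rule that, assumption+)
  have z0B: "z0 \<in> ball z0 r" using r(1) by simp
  obtain r1 K B where r1: "r1 > 0" "cball z0 r1 \<subseteq> ball z0 r" and K: "K \<ge> 0" and B: "B \<ge> 0"
    and lip: "\<And>x y. x \<in> cball z0 r1 \<Longrightarrow> y \<in> cball z0 r1 \<Longrightarrow> norm (F x - F y) \<le> K * norm (x - y)"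
    and bnd: "\<And>x. x \<in> cball z0 r1 \<Longrightarrow> norm (F x) \<le> B"
    using smooth_on_locally_Lipschitz[OF fd open_ball z0B Fsm] by metis
  obtain r2 where r2: "r2 > 0" "r2 \<le> r" "\<And>x y. x \<in> ball z0 r2 \<Longrightarrow> y \<in> ball z0 r2 \<Longrightarrow> \<mu> x y \<in> ball z0 r1"
    using shrink[OF r1(1)] by blast
  \<comment> \<open>Nested radii: the solution is confined to the closed ball of radius
    \<open>r3\<close>, products of two of its values then stay in the ball of radius
    \<open>r1\<close>, and there \<open>F\<close> is Lipschitz.\<close>
  define r3 where "r3 = min (r2 / 2) r1"
  have r3: "r3 > 0" "cball z0 r3 \<subseteq> ball z0 r2" "cball z0 r3 \<subseteq> cball z0 r1" using r1 r2 by (auto simp: r3_def)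
  have r2B: "ball z0 r2 \<subseteq> ball z0 r" using r2(2) by auto
  \<comment> \<open>Chosen to give \<open>K * \<epsilon> \<le> 1/2\<close> and
    \<open>B * \<epsilon> \<le> r3\<close>, as the Picard iteration requires; each
    \<open>+ 1\<close> keeps a denominator positive.\<close>
  define \<epsilon> where "\<epsilon> = min (1 / (2 * (K + 1))) (r3 / (B + 1))"
  have \<epsilon>: "\<epsilon> > 0" using K B r3 by (auto simp: \<epsilon>_def)
  have "\<epsilon> \<le> 1 / (2 * (K + 1))" "2 * (K + 1) > 0" using K by (auto simp: \<epsilon>_def)
  then have "\<epsilon> * (2 * (K + 1)) \<le> 1" by (simp only: pos_le_divide_eq)
  then have K\<epsilon>: "K * \<epsilon> \<le> 1/2" using \<epsilon> by (simp add: algebra_simps)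
  have "(B + 1) * \<epsilon> \<le> (B + 1) * (r3 / (B + 1))" using B by (intro mult_left_mono) (auto simp: \<epsilon>_def)
  then have "(B + 1) * \<epsilon> \<le> r3" using B by simp
  then have B\<epsilon>: "B * \<epsilon> \<le> r3" using \<epsilon> by (simp add: algebra_simps)
  have contF: "continuous_on (cball z0 r3) F"
    using smooth_on_imp_continuous[OF Fsm] r1(2) r3(3) continuous_on_subset by blast
  obtain x where x: "x 0 = z0" "\<And>t. t \<in> {0..\<epsilon>} \<Longrightarrow> x t \<in> cball z0 r3"
    "\<And>t. t \<in> {0..\<epsilon>} \<Longrightarrow> (x has_vector_derivative F (x t)) (at t within {0..\<epsilon>})"
    by (rule ode_solution_exists[OF less_imp_le[OF r3(1)] \<epsilon> K K\<epsilon> B B\<epsilon> contF])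
      (use lip bnd r3(3) in blast)+
  have x2: "x t \<in> ball z0 r2" if "t \<in> {0..\<epsilon>}" for t using x(2)[OF that] r3(2) by blast
  have x1: "x t \<in> cball z0 r1" if "t \<in> {0..\<epsilon>}" for t using x(2)[OF that] r3(3) by blast
  have xc: "chart_inv c (x t) \<in> fst c" "snd c (chart_inv c (x t)) = x t" if "t \<in> {0..\<epsilon>}" for t
  proof -
    have "x t \<in> snd c ` fst c" using x2[OF that] r2B r(2) by blast
    then show "chart_inv c (x t) \<in> fst c" "snd c (chart_inv c (x t)) = x t"
      by (auto intro: inv_into_into f_inv_into_f)
  qed
  define g where "g = (\<lambda>t. chart_inv c (x t))"
  have hom: "g (s + t) = g s \<otimes> g t" if st: "0 \<le> s" "0 \<le> t" "s + t \<le> \<epsilon>" for s t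
  proof -
    define e where "e = \<epsilon> - s"
    have e: "0 \<le> e" "e \<le> \<epsilon>" "t \<in> {0..e}" "s \<in> {0..\<epsilon>}" using st by (auto simp: e_def)
    have "K * e \<le> K * \<epsilon>" using e K by (intro mult_left_mono) auto
    then have Ke: "K * e \<le> 1/2" using K\<epsilon> by simp
    \<comment> \<open>As functions of \<open>t\<close> both sides start at \<open>x s\<close> and
      solve the same equation, the left one because the equation is autonomous, the right one
      because \<open>F\<close> is left-invariant.\<close>
    have "x (s + t) = \<mu> (x s) (x t)"
    proof (rule ode_solution_unique[where x = "\<lambda>t. x (s + t)" and y = "\<lambda>t. \<mu> (x s) (x t)", OF e(1) K Ke lip _ _ _ _ _ e(3)])
      fix u assume u: "u \<in> {0..e}"
      then have su: "s + u \<in> {0..\<epsilon>}" and u': "u \<in> {0..\<epsilon>}" using e st by (auto simp: e_def)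
      show "x (s + u) \<in> cball z0 r1" by (rule x1[OF su])
      have img: "(\<lambda>v. s + v) ` {0..e} \<subseteq> {0..\<epsilon>}" using e st by (auto simp: e_def)
      have "((\<lambda>v. x (s + v)) has_derivative (\<lambda>h. h *\<^sub>R F (x (s + u)))) (at u within {0..e})"
        by (rule has_derivative_in_compose2[where f = "\<lambda>v. s + v" and g = x and g' = "\<lambda>t h. h *\<^sub>R F (x t)", OF _ img u])
          (use x(3) in \<open>auto simp: has_vector_derivative_def intro!: derivative_eq_intros\<close>)
      then show "((\<lambda>v. x (s + v)) has_vector_derivative F (x (s + u))) (at u within {0..e})"
        by (simp add: has_vector_derivative_def)
      have m1: "\<mu> (x s) (x u) \<in> ball z0 r1" by (rule r2(3)[OF x2[OF e(4)] x2[OF u']])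
      then show "\<mu> (x s) (x u) \<in> cball z0 r1" by simp
      have mB: "\<mu> (x s) (x u) \<in> ball z0 r" using m1 r1(2) ball_subset_cball by blast
      have sub: "{0..e} \<subseteq> {0..\<epsilon>}" using e by auto
      show "((\<lambda>v. \<mu> (x s) (x v)) has_vector_derivative F (\<mu> (x s) (x u))) (at u within {0..e})"
        by (rule d2[OF _ _ mB has_vector_derivative_within_subset[OF x(3)[OF u'] sub]]) (use x2 e(4) u' r2B in blast)+
    next
      have "\<mu> (x s) z0 = x s" using xc[OF e(4)] ci[OF c(2)] by (simp add: \<mu>_def z0_def)
      then show "x (s + 0) = \<mu> (x s) (x 0)" using x(1) by simp
    qed
    moreover have "x s \<in> ball z0 r" "x t \<in> ball z0 r" using x2[of s] x2[of t] r2B st by fastforce+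
    ultimately have "chart_inv c (x (s + t)) = chart_inv c (x s) \<otimes> chart_inv c (x t)"
      using ci[OF mem[of "x s" "x t"]] by (simp add: \<mu>_def del: mem_ball)
    then show ?thesis by (simp add: g_def)
  qed
  have gx: "snd c (g t) = x t" if "t \<in> {0..\<epsilon>}" for t using xc[OF that] by (simp add: g_def)
  \<comment> \<open>Half of \<open>\<epsilon>\<close>, since the extension to all times needs the
    addition law up to twice \<open>\<delta>\<close>.\<close>
  show ?thesis
  proof (rule that[of "\<epsilon> / 2" g])
    show "\<epsilon> / 2 > 0" using \<epsilon> by simp
    show "g (s + t) = g s \<otimes> g t" if "0 \<le> s" "0 \<le> t" "s + t \<le> 2 * (\<epsilon> / 2)" for s t using hom that by simp
    show "g t \<in> fst c" if "0 \<le> t" "t \<le> 2 * (\<epsilon> / 2)" for t using xc[of t] that by (simp add: g_def)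
    show "g 0 = \<one>" using x(1) ci[OF c(2)] by (simp add: g_def z0_def)
    have op: "open {0<..<\<epsilon> / 2}" by simp
    have "smooth_on {0<..<\<epsilon> / 2} x"
    proof (rule ode_solution_smooth[OF fd thick_open[OF op] Fsm])
      show "x ` {0<..<\<epsilon> / 2} \<subseteq> ball z0 r" using x2 r2B by fastforce
      fix t assume "t \<in> {0<..<\<epsilon> / 2}"
      then show "(x has_vector_derivative F (x t)) (at t within {0<..<\<epsilon> / 2})"
        using \<epsilon> by (intro has_vector_derivative_within_subset[OF x(3)]) auto
    qed
    then show "smooth_on {0<..<\<epsilon> / 2} (\<lambda>t. snd c (g t))"
    proof (rule smooth_on_transform)
      show "x t = snd c (g t)" if "t \<in> {0<..<\<epsilon> / 2}" for t using gx[of t] that by simp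
    qed
    have "0 \<in> {0..\<epsilon>}" "{0..\<epsilon> / 2} \<subseteq> {0..\<epsilon>}" "0 \<in> {0..\<epsilon> / 2}" using \<epsilon> by auto
    from has_vector_derivative_within_subset[OF x(3)[OF this(1)] this(2)]
    have "(x has_vector_derivative a) (at 0 within {0..\<epsilon> / 2})" unfolding x(1) Fz0 .
    moreover have "snd c (g t) = x t" if "t \<in> {0..\<epsilon> / 2}" for t using gx[of t] that \<epsilon> by simp
    ultimately show "((\<lambda>t. snd c (g t)) has_vector_derivative a) (at 0 within {0..\<epsilon> / 2})"
      using has_vector_derivative_transform[OF \<open>0 \<in> {0..\<epsilon> / 2}\<close>, of "\<lambda>t. snd c (g t)" x] by blast
  next
    fix \<gamma> assume \<gamma>: "one_param_subgroup M G a \<gamma>"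
    have \<gamma>sm: "smooth_map flat UNIV M \<gamma>" and \<gamma>hom: "\<And>s t. \<gamma> (s + t) = \<gamma> s \<otimes> \<gamma> t"
      and \<gamma>0: "tangent_lift M UNIV \<gamma> 0 = (\<one>, a)" using \<gamma> unfolding one_param_subgroup_def by blast+
    have \<gamma>1: "\<gamma> 0 = \<one>" using \<gamma>0 by (simp add: tangent_lift_def)
    have thU: "thick (UNIV :: real set)" using thick_open open_UNIV by blast
    have \<gamma>c: "\<gamma> 0 \<in> fst c" using \<gamma>1 c by simp
    have der0: "((\<lambda>s. snd c (\<gamma> s)) has_vector_derivative a) (at 0)"
      using tangent_lift_chart[OF M thU \<gamma>sm UNIV_I c(1) \<gamma>c] components_chart_at[OF M] \<gamma>0 \<gamma>1 by (simp add: c_def)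
    obtain W where W: "open W" "0 \<in> W" "\<And>y. y \<in> UNIV \<Longrightarrow> y \<in> W \<Longrightarrow> \<gamma> y \<in> fst c" "smooth_on (UNIV \<inter> W) (\<lambda>y. snd c (\<gamma> y))"
      using smooth_map_flat_chart[OF finite_dim_real M thU \<gamma>sm UNIV_I c(1) \<gamma>c] by blast
    have "continuous_on W (\<lambda>y. snd c (\<gamma> y))" using smooth_on_imp_continuous[OF W(4)] by simp
    then have "open (W \<inter> (\<lambda>y. snd c (\<gamma> y)) -` ball z0 r3)" using continuous_open_preimage W(1) open_ball by blast
    moreover have "0 \<in> W \<inter> (\<lambda>y. snd c (\<gamma> y)) -` ball z0 r3" using W(2) \<gamma>1 r3(1) by (simp add: z0_def)
    ultimately obtain \<eta> where \<eta>: "\<eta> > 0" "ball 0 \<eta> \<subseteq> W \<inter> (\<lambda>y. snd c (\<gamma> y)) -` ball z0 r3" using open_contains_ball by blast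
    have inW: "\<gamma> t \<in> fst c" "snd c (\<gamma> t) \<in> ball z0 r3" if "\<bar>t\<bar> < \<eta>" for t
      using \<eta>(2) W(3) that by (auto simp: dist_real_def subset_iff)
    define e where "e = min \<epsilon> (\<eta> / 2)"
    have e: "e > 0" "e \<le> \<epsilon>" "e < \<eta>" using \<epsilon> \<eta>(1) by (auto simp: e_def)
    have "K * e \<le> K * \<epsilon>" using e K by (intro mult_left_mono) auto
    then have Ke: "K * e \<le> 1/2" using K\<epsilon> by simp
    have "\<gamma> t = g t" if t: "0 \<le> t" "t \<le> e" for t
    proof -
      have "snd c (\<gamma> t) = x t"
      proof (rule ode_solution_unique[where x = "\<lambda>t. snd c (\<gamma> t)" and y = x and t = t, OF less_imp_le[OF e(1)] K Ke lip])
        fix u assume u: "u \<in> {0..e}"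
        then have u': "\<bar>u\<bar> < \<eta>" "u \<in> {0..\<epsilon>}" using e by auto
        show "snd c (\<gamma> u) \<in> cball z0 r1" using inW(2)[OF u'(1)] r3(3) ball_subset_cball by blast
        show "x u \<in> cball z0 r1" by (rule x1[OF u'(2)])
        show "(x has_vector_derivative F (x u)) (at u within {0..e})"
          by (rule has_vector_derivative_within_subset[OF x(3)[OF u'(2)]]) (use e in auto)
        have uB: "snd c (\<gamma> u) \<in> ball z0 r" using inW(2)[OF u'(1)] r3(2) r2B ball_subset_cball by blast
        \<comment> \<open>Writing \<open>\<gamma> s = \<gamma> u \<otimes> \<gamma> (s - u)\<close>
          reduces the velocity at \<open>u\<close> to the velocity \<open>a\<close> at the unit,
          translated from the left.\<close>
        have "((\<lambda>s. snd c (\<gamma> (s - u))) has_vector_derivative a) (at u)"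
          using vector_diff_chain_at[of "\<lambda>s. s - u" 1 u "\<lambda>s. snd c (\<gamma> s)" a] der0
          by (simp add: comp_def has_vector_derivative_diff_const has_vector_derivative_id)
        from d1[OF uB _ this] have "((\<lambda>s. \<mu> (snd c (\<gamma> u)) (snd c (\<gamma> (s - u)))) has_vector_derivative F (snd c (\<gamma> u))) (at u)"
          using \<gamma>1 by (simp add: z0_def)
        then have "((\<lambda>s. snd c (\<gamma> s)) has_vector_derivative F (snd c (\<gamma> u))) (at u)"
        proof (rule has_vector_derivative_transform_within_open[where S = "ball u \<eta>"])
          fix s assume "s \<in> ball u \<eta>"
          then have "\<bar>s - u\<bar> < \<eta>" by (simp add: dist_real_def)
          from ci[OF inW(1)[OF this]] ci[OF inW(1)[OF u'(1)]]
          show "\<mu> (snd c (\<gamma> u)) (snd c (\<gamma> (s - u))) = snd c (\<gamma> s)"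
            using \<gamma>hom[of u "s - u"] by (simp add: \<mu>_def)
        qed (use \<eta>(1) in auto)
        then show "((\<lambda>s. snd c (\<gamma> s)) has_vector_derivative F (snd c (\<gamma> u))) (at u within {0..e})"
          by (rule has_vector_derivative_at_within)
      qed (use t x(1) \<gamma>1 in \<open>auto simp: z0_def\<close>)
      then show ?thesis using ci[OF inW(1)[of t]] t e by (simp add: g_def)
    qed
    then show "\<exists>\<epsilon>>0. \<forall>t. 0 \<le> t \<and> t \<le> \<epsilon> \<longrightarrow> \<gamma> t = g t" using e(1) by blast
  qed
qed

lemma smooth_map_flat_locally:
  fixes h :: "real \<Rightarrow> 'q"
  assumes M: "premanifold M" and "\<And>t. \<exists>S. open S \<and> t \<in> S \<and> smooth_map flat S M h"
  shows "smooth_map flat UNIV M h"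
proof (rule smooth_map_flatI[OF finite_dim_real])
  fix t :: real
  obtain S where S: "open S" "t \<in> S" "smooth_map flat S M h" using assms(2) by blast
  have d: "chart_at M (h t) \<in> atlas M" "h t \<in> fst (chart_at M (h t))" using M by (auto simp: chart_at_atlas chart_at_mem)
  obtain W where "open W" "t \<in> W" "\<And>y. y \<in> S \<Longrightarrow> y \<in> W \<Longrightarrow> h y \<in> fst (chart_at M (h t))"
      "smooth_on (S \<inter> W) (\<lambda>y. snd (chart_at M (h t)) (h y))"
    using smooth_map_flat_chart[OF finite_dim_real M thick_open[OF S(1)] S(3,2) d] by blast
  then show "\<exists>d\<in>atlas M. \<exists>W. open W \<and> t \<in> W \<and> (\<forall>y\<in>UNIV \<inter> W. h y \<in> fst d) \<and> smooth_on (UNIV \<inter> W) (\<lambda>y. snd d (h y))"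
    using S d by (intro bexI[OF _ d(1)] exI[of _ "S \<inter> W"]) auto
qed

lemma smooth_map_left_mult:
  assumes lg: "lie_group M G"
  shows "smooth_map M UNIV M (\<lambda>x. p \<otimes>\<^bsub>G\<^esub> x)"
proof -
  note M = lie_groupD(1)[OF lg]
  have "smooth_map M UNIV (prod_manifold M M) (\<lambda>x. (p, x))"
    by (intro smooth_map_Pair[OF M M M] smooth_map_const[OF M M] smooth_map_id[OF M] mthick_UNIV[OF M])
  from smooth_map_compose[OF M premanifold_prod[OF M M] M mthick_UNIV[OF M] mthick_UNIV[OF premanifold_prod[OF M M]] this lie_groupD(4)[OF lg]]
  show ?thesis by simp
qed

lemma one_param_subgroup_ex1:
  fixes M :: "('g, 'h::banach) manifold" and G (structure)
  assumes lg: "lie_group M G"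
  shows "\<exists>!\<gamma>. one_param_subgroup M G a \<gamma>"
proof -
  have M: "premanifold M" and "group G" and carrier: "carrier G = UNIV" using lie_groupD[OF lg] by blast+
  define c where "c = chart_at M \<one>"
  have c: "c \<in> atlas M" "\<one> \<in> fst c" using M by (auto simp: c_def chart_at_atlas chart_at_mem)
  have fd: "finite_dim TYPE('h)" using premanifold_finite_dim[OF M] .
  obtain \<delta> g where \<delta>: "\<delta> > 0" and hom: "\<And>s t. 0 \<le> s \<Longrightarrow> 0 \<le> t \<Longrightarrow> s + t \<le> 2 * \<delta> \<Longrightarrow> g (s + t) = g s \<otimes> g t"
    and gc: "\<And>t. 0 \<le> t \<Longrightarrow> t \<le> 2 * \<delta> \<Longrightarrow> g t \<in> fst c" and gsm: "smooth_on {0<..<\<delta>} (\<lambda>t. snd c (g t))"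
    and gder: "((\<lambda>t. snd c (g t)) has_vector_derivative a) (at 0 within {0..\<delta>})" and g0: "g 0 = \<one>"
    and uniq: "\<And>\<gamma>. one_param_subgroup M G a \<gamma> \<Longrightarrow> \<exists>\<epsilon>>0. \<forall>t. 0 \<le> t \<and> t \<le> \<epsilon> \<longrightarrow> \<gamma> t = g t"
    unfolding c_def by (rule one_param_local_ode[OF lg, of a]) blast
  obtain h where h: "\<And>s t. h (s + t) = h s \<otimes> h t" "\<And>t. 0 \<le> t \<Longrightarrow> t < \<delta> \<Longrightarrow> h t = g t"
    using local_hom_extends[OF \<open>group G\<close> carrier \<delta> hom] by blast
  have thU: "thick (UNIV :: real set)" using thick_open open_UNIV by blast
  have hsm: "smooth_map flat UNIV M h"
  proof (rule smooth_map_flat_locally[OF M])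
    fix t
    \<comment> \<open>Left translation moves a neighbourhood of \<open>t\<close> to one of
      \<open>\<delta>/2\<close>, the middle of the interval on which \<open>g\<close> is known to be
      smooth.\<close>
    define S where "S = {t - \<delta>/2 <..< t + \<delta>/2}"
    have S: "open S" "t \<in> S" using \<delta> by (auto simp: S_def)
    have thS: "thick S" using thick_open[OF S(1)] .
    have "smooth_on S (\<lambda>s. s + (\<delta>/2 - t))" by (intro smooth_on_add smooth_on_id smooth_on_const thS)
    moreover have "(\<lambda>s. s + (\<delta>/2 - t)) ` S \<subseteq> {0<..<\<delta>}" by (auto simp: S_def)
    ultimately have "smooth_on S (\<lambda>s. snd c (g (s + (\<delta>/2 - t))))"
      using smooth_on_compose[OF thS finite_dim_real _ gsm] by blast
    then have "smooth_map flat S M (\<lambda>s. g (s + (\<delta>/2 - t)))"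
      by (intro smooth_map_flatI[OF finite_dim_real] bexI[OF _ c(1)] exI[of _ S])
        (use S(1) gc \<delta> in \<open>auto simp: S_def\<close>)
    then have sm: "smooth_map flat S M (\<lambda>s. h (t - \<delta>/2) \<otimes> g (s + (\<delta>/2 - t)))"
      using smooth_map_compose[OF premanifold_flat[OF finite_dim_real] M M _ mthick_UNIV[OF M] _ smooth_map_left_mult[OF lg], of S]
        thS by (simp add: mthick_flat)
    have "smooth_map flat S M h"
    proof (rule smooth_map_cong[OF premanifold_flat[OF finite_dim_real] _ sm])
      fix s assume "s \<in> S"
      then have "h (s + (\<delta>/2 - t)) = g (s + (\<delta>/2 - t))" by (intro h(2)) (auto simp: S_def)
      then show "h (t - \<delta>/2) \<otimes> g (s + (\<delta>/2 - t)) = h s" using h(1)[of "t - \<delta>/2" "s + (\<delta>/2 - t)"] by simp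
    qed
    then show "\<exists>S. open S \<and> t \<in> S \<and> smooth_map flat S M h" using S by blast
  qed
  have h0: "h 0 = \<one>" using h(2)[of 0] g0 \<delta> by simp
  have "tangent_lift M UNIV h 0 = (\<one>, a)"
  proof -
    have h0c: "h 0 \<in> fst c" using h0 c by simp
    \<comment> \<open>\<open>h\<close> is already known to be smooth at \<open>0\<close>, so its
      velocity there can be read off from the right, where it coincides with
      \<open>g\<close>.\<close>
    let ?v = "snd (tangent_lift M UNIV h 0)" and ?J = "{0..\<delta>/2}"
    have "((\<lambda>s. snd c (h s)) has_vector_derivative ?v) (at 0)"
      using tangent_lift_chart[OF M thU hsm UNIV_I c(1) h0c] components_chart_at[OF M] h0 by (simp add: c_def)
    then have 1: "((\<lambda>s. snd c (h s)) has_vector_derivative ?v) (at 0 within ?J)" by (rule has_vector_derivative_at_within)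
    have "((\<lambda>s. snd c (g s)) has_vector_derivative a) (at 0 within ?J)"
      by (rule has_vector_derivative_within_subset[OF gder]) (use \<delta> in auto)
    then have 2: "((\<lambda>s. snd c (h s)) has_vector_derivative a) (at 0 within ?J)"
      by (rule has_vector_derivative_transform[rotated 2]) (use h(2) \<delta> in auto)
    have "thick ?J" "0 \<in> ?J" using \<delta> by (auto intro: thick_interval)
    then have "?v = a" using thick_vector_derivative 1 2 by metis
    then show ?thesis using h0 by (simp add: tangent_lift_def)
  qed
  then have "one_param_subgroup M G a h" unfolding one_param_subgroup_def using hsm h(1) by blast
  moreover have "\<gamma> = \<gamma>'" if g1: "one_param_subgroup M G a \<gamma>" and g2: "one_param_subgroup M G a \<gamma>'" for \<gamma> \<gamma>'
  proof -
    obtain e1 e2 where e: "e1 > 0" "\<And>t. 0 \<le> t \<Longrightarrow> t \<le> e1 \<Longrightarrow> \<gamma> t = g t" "e2 > 0" "\<And>t. 0 \<le> t \<Longrightarrow> t \<le> e2 \<Longrightarrow> \<gamma>' t = g t"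
      using uniq[OF g1] uniq[OF g2] by blast
    have "\<And>s t. \<gamma> (s + t) = \<gamma> s \<otimes> \<gamma> t" "\<And>s t. \<gamma>' (s + t) = \<gamma>' s \<otimes> \<gamma>' t"
      using g1 g2 unfolding one_param_subgroup_def by blast+
    then show ?thesis using homs_eq_if_eq_near_0[OF \<open>group G\<close> carrier, of "min e1 e2" \<gamma> \<gamma>'] e by simp
  qed
  ultimately show ?thesis by blast
qed

text \<open>The curve \<open>s \<mapsto> \<gamma> (t * s)\<close> is the subgroup with velocity
  \<open>t *\<^sub>R a\<close>. This replaces the exponentials in the definitions of
  \<open>fundamental\<close> and \<open>HL\<close>, a different subgroup for every \<open>t\<close>,
  by the single curve \<open>\<gamma>\<close>.\<close>

lemma lie_exp_scaleR:
  fixes M :: "('g, 'h::banach) manifold" and G (structure)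
  assumes lg: "lie_group M G" and \<gamma>: "one_param_subgroup M G a \<gamma>"
  shows "lie_exp M G (t *\<^sub>R a) = \<gamma> t"
proof -
  note M = lie_groupD(1)[OF lg]
  define c where "c = chart_at M \<one>"
  have thU: "thick (UNIV :: real set)" using thick_open open_UNIV by blast
  have \<gamma>sm: "smooth_map flat UNIV M \<gamma>" and hom: "\<And>s t. \<gamma> (s + t) = \<gamma> s \<otimes> \<gamma> t"
    and \<gamma>0: "tangent_lift M UNIV \<gamma> 0 = (\<one>, a)" using \<gamma> unfolding one_param_subgroup_def by blast+
  have \<gamma>1: "\<gamma> 0 = \<one>" using \<gamma>0 by (simp add: tangent_lift_def)
  have c: "c \<in> atlas M" "\<one> \<in> fst c" using M by (auto simp: c_def chart_at_atlas chart_at_mem)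
  have lin: "smooth_map flat UNIV flat (\<lambda>s. t * s)"
    unfolding smooth_map_flat_flat[OF finite_dim_real finite_dim_real thU]
    by (rule smooth_on_bounded_linear[OF thU bounded_linear_mult_right smooth_on_id[OF thU]])
  have sm: "smooth_map flat UNIV M (\<lambda>s. \<gamma> (t * s))"
    using smooth_map_compose[OF premanifold_flat[OF finite_dim_real] premanifold_flat[OF finite_dim_real] M _ _ lin \<gamma>sm]
    by (simp add: mthick_flat thU)
  have \<gamma>c: "\<gamma> 0 \<in> fst c" "\<gamma> (t * 0) \<in> fst c" using \<gamma>1 c by auto
  have "((\<lambda>s. snd c (\<gamma> s)) has_vector_derivative a) (at 0)"
    using tangent_lift_chart[OF M thU \<gamma>sm UNIV_I c(1) \<gamma>c(1)] components_chart_at[OF M] \<gamma>0 \<gamma>1 by (simp add: c_def)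
  moreover have "((\<lambda>s. t * s) has_vector_derivative t) (at 0)"
    by (auto intro!: derivative_eq_intros simp: has_real_derivative_iff_has_vector_derivative[symmetric])
  ultimately have "((\<lambda>s. snd c (\<gamma> (t * s))) has_vector_derivative t *\<^sub>R a) (at 0)"
    using vector_diff_chain_at[of "\<lambda>s. t * s" t 0 "\<lambda>s. snd c (\<gamma> s)" a] by (simp add: comp_def)
  then have "tangent_lift M UNIV (\<lambda>s. \<gamma> (t * s)) 0 = (\<one>, t *\<^sub>R a)"
    using tangent_lift_eqI[OF M thU sm UNIV_I c(1) \<gamma>c(2), of "t *\<^sub>R a"] components_chart_at[OF M] \<gamma>1 by (simp add: c_def)
  then have "one_param_subgroup M G (t *\<^sub>R a) (\<lambda>s. \<gamma> (t * s))"
    unfolding one_param_subgroup_def using sm hom by (simp add: distrib_left)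
  then have "(THE \<gamma>. one_param_subgroup M G (t *\<^sub>R a) \<gamma>) = (\<lambda>s. \<gamma> (t * s))"
    using one_param_subgroup_ex1[OF lg] by (metis the1_equality)
  then show ?thesis by (simp add: lie_exp_def)
qed

section \<open>Geometry of the principal bundle\<close>

lemma openin_smooth_vimage:
  assumes A: "premanifold A" and B: "premanifold B" and f: "smooth_map A UNIV B f" and U: "openin (mtop B) U"
  shows "openin (mtop A) (f -` U)"
proof (subst openin_subopen, intro ballI)
  fix x assume x: "x \<in> f -` U"
  define c d where "c = chart_at A x" and "d = chart_at B (f x)"
  have c: "c \<in> atlas A" "x \<in> fst c" and d: "d \<in> atlas B" "f x \<in> fst d"
    unfolding c_def d_def using A B by (auto simp: chart_at_atlas chart_at_mem)
  obtain W where W: "open W" "snd c x \<in> W" "\<And>y. y \<in> UNIV \<Longrightarrow> y \<in> fst c \<Longrightarrow> snd c y \<in> W \<Longrightarrow> f y \<in> fst d"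
    "smooth_on (snd c ` (UNIV \<inter> fst c) \<inter> W) (snd d \<circ> f \<circ> chart_inv c)"
    using smooth_map_chart[OF A B mthick_UNIV[OF A] f UNIV_I c d] by blast
  define N where "N = (snd c ` (UNIV \<inter> fst c) \<inter> W) \<inter> (snd d \<circ> f \<circ> chart_inv c) -` (snd d ` (U \<inter> fst d))"
  have "open (snd d ` (U \<inter> fst d))" using U d(1) unfolding openin_mtop[OF B] by blast
  moreover have "open (snd c ` (UNIV \<inter> fst c) \<inter> W)" using chart_open[OF A c(1)] W(1) by auto
  ultimately have "open N"
    unfolding N_def using continuous_open_preimage[OF smooth_on_imp_continuous[OF W(4)]] by blast
  then have "openin (mtop A) {y \<in> fst c. snd c y \<in> N}" by (rule openin_chart_preimage[OF A c(1)])
  moreover have "x \<in> {y \<in> fst c. snd c y \<in> N}"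
    using c d x W(2) chart_inv_chart[OF A c] by (auto simp: N_def)
  moreover have "{y \<in> fst c. snd c y \<in> N} \<subseteq> f -` U"
  proof
    fix y assume y: "y \<in> {y \<in> fst c. snd c y \<in> N}"
    then have fd: "f y \<in> fst d" using W(3)[of y] by (auto simp: N_def)
    have "snd d (f y) \<in> snd d ` (U \<inter> fst d)" using y chart_inv_chart[OF A c(1), of y] by (auto simp: N_def)
    then obtain u where "u \<in> U" "u \<in> fst d" "snd d (f y) = snd d u" by blast
    then show "y \<in> f -` U" using inj_onD[OF chart_inj[OF B d(1)] _ fd, of u] by auto
  qed
  ultimately show "\<exists>T. openin (mtop A) T \<and> x \<in> T \<and> T \<subseteq> f -` U" by blast
qed

lemma openin_prod_UNIV:
  assumes A: "premanifold A" and B: "premanifold B" and U: "openin (mtop A) U"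
  shows "openin (mtop (prod_manifold A B)) (U \<times> UNIV)"
  unfolding openin_mtop[OF premanifold_prod[OF A B]]
proof
  fix k assume "k \<in> atlas (prod_manifold A B)"
  then obtain c d where cd: "c \<in> atlas A" "d \<in> atlas B" "k = prod_chart c d" unfolding prod_manifold_simps by blast
  have "snd k ` ((U \<times> UNIV) \<inter> fst k) = snd c ` (U \<inter> fst c) \<times> snd d ` fst d"
    using map_prod_image_Int[of "snd c" "snd d" U UNIV "fst c" "fst d"] cd(3) by simp
  moreover have "open (snd c ` (U \<inter> fst c))" using U cd(1) unfolding openin_mtop[OF A] by blast
  ultimately show "open (snd k ` ((U \<times> UNIV) \<inter> fst k))" using open_Times chart_open[OF B cd(2)] by metis
qed

lemma differential_const: "differential A B (\<lambda>x. b) x v = 0"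
  by (simp add: differential_def comp_def)

section \<open>Vector fields in charts\<close>

lemma local_rep_eq: "local_rep A c X x = components A c (chart_inv c x) (X (chart_inv c x))"
  by (simp add: local_rep_def Let_def tangent_chart_simps)

lemma smooth_vector_field_local_rep:
  assumes A: "premanifold A" and U: "openin (mtop A) U" and X: "smooth_vector_field A U X" and c: "c \<in> atlas A"
  shows "smooth_on (snd c ` (U \<inter> fst c)) (local_rep A c X)"
proof (rule smooth_on_locally)
  fix x assume "x \<in> snd c ` (U \<inter> fst c)"
  then obtain q where q: "x = snd c q" "q \<in> U" "q \<in> fst c" by blast
  have m: "(q, X q) \<in> fst (tangent_chart A c)" using q by (simp add: tangent_chart_simps)
  obtain W where W: "open W" "snd c q \<in> W"
    "smooth_on (snd c ` (U \<inter> fst c) \<inter> W) (snd (tangent_chart A c) \<circ> (\<lambda>q. (q, X q)) \<circ> chart_inv c)"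
    using smooth_map_chart[OF A premanifold_tangent_bundle[OF A] openin_mthick[OF A U]
        X[unfolded smooth_vector_field_def] q(2) c q(3) tangent_chart_atlas[OF c] m] by blast
  have op: "open (snd c ` (U \<inter> fst c) \<inter> W)" using U c W(1) unfolding openin_mtop[OF A] by blast
  from smooth_on_bounded_linear[OF thick_open[OF op] bounded_linear_snd W(3)]
  have "smooth_on (snd c ` (U \<inter> fst c) \<inter> W) (local_rep A c X)"
    by (simp add: tangent_chart_simps local_rep_eq[abs_def] comp_def)
  then show "\<exists>W. open W \<and> x \<in> W \<and> smooth_on (snd c ` (U \<inter> fst c) \<inter> W) (local_rep A c X)"
    using W(1,2) q(1) by blast
qed

lemma smooth_vector_field_in_chart:
  assumes A: "premanifold A" and c: "c \<in> atlas A" and X: "smooth_on (snd c ` fst c) (local_rep A c X)"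
  shows "smooth_vector_field A (fst c) X"
  unfolding smooth_vector_field_def
proof (rule smooth_mapI[OF A])
  fix q assume q: "q \<in> fst c"
  have th: "thick (snd c ` fst c)" using thick_open[OF chart_open[OF A c]] .
  have "smooth_on (snd c ` fst c) (\<lambda>x. (x, local_rep A c X x))"
    by (intro smooth_on_Pair th smooth_on_id X)
  then have "smooth_on (snd c ` fst c) (snd (tangent_chart A c) \<circ> (\<lambda>q. (q, X q)) \<circ> chart_inv c)"
    by (rule smooth_on_transform) (auto simp: tangent_chart_simps local_rep_eq f_inv_into_f)
  then show "\<exists>ca\<in>atlas A. \<exists>d\<in>atlas (tangent_bundle A). \<exists>W. q \<in> fst ca \<and> open W \<and> snd ca q \<in> W \<and>
      (\<forall>y\<in>fst c \<inter> fst ca. snd ca y \<in> W \<longrightarrow> (y, X y) \<in> fst d) \<and>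
      smooth_on (snd ca ` (fst c \<inter> fst ca) \<inter> W) (snd d \<circ> (\<lambda>q. (q, X q)) \<circ> chart_inv ca)"
    using q by (intro bexI[OF _ c] bexI[OF _ tangent_chart_atlas[OF c]] exI[of _ UNIV]) (auto simp: tangent_chart_simps)
qed

text \<open>The extension has constant components in one chart. It ensures that the conditions under
  \<open>THE\<close> in \<open>curvature\<close> and \<open>tensor_B\<close> are not
  vacuous.\<close>

lemma vector_field_extension:
  assumes A: "premanifold A"
  obtains U X where "openin (mtop A) U" "x \<in> U" "smooth_vector_field A U X" "X x = v"
proof -
  define c where "c = chart_at A x"
  have c: "c \<in> atlas A" "x \<in> fst c" unfolding c_def using A by (auto simp: chart_at_atlas chart_at_mem)
  define X where "X = (\<lambda>q. from_components A c (snd c q) v)"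
  have "local_rep A c X y = v" if "y \<in> snd c ` fst c" for y
    using from_components(2)[OF A c(1) that] that by (simp add: local_rep_eq X_def f_inv_into_f)
  then have "smooth_on (snd c ` fst c) (local_rep A c X)"
    using smooth_on_transform[OF smooth_on_const[OF thick_open[OF chart_open[OF A c(1)]], of v]] by metis
  then have "smooth_vector_field A (fst c) X" by (rule smooth_vector_field_in_chart[OF A c(1)])
  moreover have "X x = v"
    using from_components(1)[OF A c(1), of "snd c x" v] c chart_inv_chart[OF A c] components_chart_at[OF A, of x v]
    by (simp add: X_def c_def)
  ultimately show ?thesis using that openin_chart[OF A c(1)] c(2) by blast
qed

locale principal =
  fixes P :: "('q, 'e::banach, 'm, 'f::banach, 'g, 'h::banach) bundle_data"
  assumes principal: "principal_bundle P"
begin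

abbreviation "Q \<equiv> total P"
abbreviation "M \<equiv> base P"
abbreviation "S \<equiv> struct_mfd P"
abbreviation "G \<equiv> struct_grp P"

lemma Q: "premanifold Q" and M: "premanifold M" and lg: "lie_group S G" and S: "premanifold S"
  using principal smooth_manifold_premanifold lie_groupD(1) unfolding principal_bundle_def by blast+

lemma fdQ: "finite_dim TYPE('e)" and fdM: "finite_dim TYPE('f)" and fdS: "finite_dim TYPE('h)"
  using premanifold_finite_dim Q M S by blast+

lemma G: "group G" "carrier G = UNIV"
  using lie_groupD[OF lg] by blast+

lemma proj_smooth: "smooth_map Q UNIV M (proj P)"
  using principal unfolding principal_bundle_def by blast

lemma act_smooth: "smooth_map (prod_manifold Q S) UNIV Q (\<lambda>z. act P (fst z) (snd z))"
  using principal unfolding principal_bundle_def by (simp add: case_prod_beta')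

lemma act_one [simp]: "act P q \<one>\<^bsub>G\<^esub> = q"
  and proj_act [simp]: "proj P (act P q g) = proj P q"
  using principal unfolding principal_bundle_def by metis+

lemma right_act_smooth: "smooth_map Q UNIV Q (\<lambda>q. act P q g)"
proof -
  have "smooth_map Q UNIV (prod_manifold Q S) (\<lambda>q. (q, g))"
    by (intro smooth_map_Pair[OF Q Q S] smooth_map_const[OF Q S] smooth_map_id[OF Q] mthick_UNIV[OF Q])
  from smooth_map_compose[OF Q premanifold_prod[OF Q S] Q mthick_UNIV[OF Q] mthick_UNIV[OF premanifold_prod[OF Q S]] this act_smooth]
  show ?thesis by simp
qed

lemma orbit_smooth: "smooth_map S UNIV Q (act P q)"
proof -
  have "smooth_map S UNIV (prod_manifold Q S) (\<lambda>g. (q, g))"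
    by (intro smooth_map_Pair[OF S Q S] smooth_map_const[OF S Q] smooth_map_id[OF S] mthick_UNIV[OF S])
  from smooth_map_compose[OF S premanifold_prod[OF Q S] Q mthick_UNIV[OF S] mthick_UNIV[OF premanifold_prod[OF Q S]] this act_smooth]
  show ?thesis by simp
qed

lemma exponential_scaleR: "one_param_subgroup S G a \<gamma> \<Longrightarrow> exponential P (t *\<^sub>R a) = \<gamma> t"
  unfolding exponential_def using lie_exp_scaleR[OF lg] .

lemma one_param_obtain:
  obtains \<gamma> where "one_param_subgroup S G a \<gamma>"
  using one_param_subgroup_ex1[OF lg] by blast

lemma one_param_smooth: "one_param_subgroup S G a \<gamma> \<Longrightarrow> smooth_map flat UNIV S \<gamma>"
  and one_param_velocity: "one_param_subgroup S G a \<gamma> \<Longrightarrow> tangent_lift S UNIV \<gamma> 0 = (\<one>\<^bsub>G\<^esub>, a)"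
  and one_param_0: "one_param_subgroup S G a \<gamma> \<Longrightarrow> \<gamma> 0 = \<one>\<^bsub>G\<^esub>"
  unfolding one_param_subgroup_def by (auto simp: tangent_lift_def)

text \<open>The chain rule along the subgroup. As the value of a differential at \<open>a\<close>,
  the fundamental vector is linear in \<open>a\<close>, which its definition by exponentials does
  not show.\<close>

lemma fundamental_eq_differential: "fundamental P a q = differential S Q (act P q) \<one>\<^bsub>G\<^esub> a"
proof -
  obtain \<gamma> where \<gamma>: "one_param_subgroup S G a \<gamma>" by (rule one_param_obtain)
  have "tangent_lift Q UNIV (\<lambda>s. act P q (\<gamma> s)) 0 =
      (act P q (\<gamma> 0), differential S Q (act P q) (\<gamma> 0) (snd (tangent_lift S UNIV \<gamma> 0)))"
    by (rule tangent_lift_compose[OF S Q thick_open[OF open_UNIV] one_param_smooth[OF \<gamma>] UNIV_I openin_UNIV_mtop[OF S] orbit_smooth]) simp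
  then show ?thesis
    unfolding fundamental_def exponential_scaleR[OF \<gamma>] using one_param_velocity[OF \<gamma>] one_param_0[OF \<gamma>] by simp
qed

lemma fundamental_linear: "linear (\<lambda>a. fundamental P a q)"
  unfolding fundamental_eq_differential
  by (rule differential_linear[OF S Q openin_UNIV_mtop[OF S] orbit_smooth UNIV_I])

lemma pi_star_linear: "linear (pi_star P q)"
  unfolding pi_star_def by (rule differential_linear[OF Q M openin_UNIV_mtop[OF Q] proj_smooth UNIV_I])

text \<open>\<open>D\<close> is the differential of the group part \<open>\<tau>\<close> of a local
  trivialization. Equivariance turns \<open>\<tau>\<close> along the orbit of \<open>q\<close> into
  left translation by \<open>\<tau> q\<close>, whose differential \<open>L\<close> at the unit is
  invertible. Surjectivity of \<open>pi_star\<close>, the equality of vertical and fundamental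
  vectors, and the injectivity of \<open>a \<mapsto> fundamental P a q\<close> all follow from
  this.\<close>

lemma trivialization_differential:
  obtains D :: "'e \<Rightarrow> 'h" and L where "bij (\<lambda>v. (pi_star P q v, D v))" "linear D" "bij L" "\<And>a. D (fundamental P a q) = L a"
proof -
  obtain U \<tau> where U: "openin (mtop M) U" "proj P q \<in> U"
    and dif: "diffeo Q (proj P -` U) (prod_manifold M S) (U \<times> UNIV) (\<lambda>q. (proj P q, \<tau> q))"
    and \<tau>: "\<And>p g. p \<in> proj P -` U \<Longrightarrow> \<tau> (act P p g) = \<tau> p \<otimes>\<^bsub>G\<^esub> g"
  proof -
    have "\<forall>x. \<exists>U \<tau>. openin (mtop M) U \<and> x \<in> U \<and>
        diffeo Q (proj P -` U) (prod_manifold M S) (U \<times> UNIV) (\<lambda>q. (proj P q, \<tau> q)) \<and>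
        (\<forall>q \<in> proj P -` U. \<forall>g. \<tau> (act P q g) = \<tau> q \<otimes>\<^bsub>G\<^esub> g)"
      using principal unfolding principal_bundle_def by (elim conjE)
    from this[rule_format, of "proj P q"] show ?thesis using that by blast
  qed
  let ?V = "proj P -` U" and ?\<Psi> = "\<lambda>q. (proj P q, \<tau> q)"
  note MS = premanifold_prod[OF M S]
  have V: "openin (mtop Q) ?V" by (rule openin_smooth_vimage[OF Q M proj_smooth U(1)])
  have qV: "q \<in> ?V" using U(2) by simp
  have bijV: "bij_betw ?\<Psi> ?V (U \<times> UNIV)" and sm: "smooth_map Q ?V (prod_manifold M S) ?\<Psi>"
    and smi: "smooth_map (prod_manifold M S) (U \<times> UNIV) Q (inv_into ?V ?\<Psi>)"
    using dif unfolding diffeo_def by blast+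
  have T: "openin (mtop (prod_manifold M S)) (U \<times> UNIV)" by (rule openin_prod_UNIV[OF M S U(1)])
  have bij: "bij (differential Q (prod_manifold M S) ?\<Psi> q)"
  proof (rule differential_bij[OF Q MS V T sm smi _ _ qV])
    show "?\<Psi> x \<in> U \<times> UNIV \<and> inv_into ?V ?\<Psi> (?\<Psi> x) = x" if "x \<in> ?V" for x
      using bij_betw_apply[OF bijV that] bij_betw_inv_into_left[OF bijV that] by blast
    show "inv_into ?V ?\<Psi> y \<in> ?V \<and> ?\<Psi> (inv_into ?V ?\<Psi> y) = y" if "y \<in> U \<times> UNIV" for y
      using bij_betw_apply[OF bij_betw_inv_into[OF bijV] that] bij_betw_inv_into_right[OF bijV that] by blast
  qed
  have \<tau>sm: "smooth_map Q ?V S \<tau>"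
    using smooth_map_compose[OF Q MS S openin_mthick[OF Q V] mthick_UNIV[OF MS] sm smooth_map_snd[OF M S]] by simp
  have \<pi>sm: "smooth_map Q ?V M (proj P)"
    by (rule smooth_map_subset[OF Q M openin_mthick[OF Q V] mthick_UNIV[OF Q] proj_smooth]) simp
  define D where "D = differential Q S \<tau> q"
  have eq: "differential Q (prod_manifold M S) ?\<Psi> q = (\<lambda>v. (pi_star P q v, D v))"
    unfolding D_def pi_star_def using differential_Pair[OF Q M S V \<pi>sm \<tau>sm qV] by blast
  define L where "L = differential S S (\<lambda>g. \<tau> q \<otimes>\<^bsub>G\<^esub> g) \<one>\<^bsub>G\<^esub>"
  interpret group G by (rule G)
  have [simp]: "x \<in> carrier G" for x using G(2) by simp
  have "bij L"
    unfolding L_def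
    by (rule differential_bij[OF S S openin_UNIV_mtop[OF S] openin_UNIV_mtop[OF S]
        smooth_map_left_mult[OF lg] smooth_map_left_mult[OF lg, of "inv\<^bsub>G\<^esub> \<tau> q"]])
      (auto simp: m_assoc[symmetric])
  moreover have "D (fundamental P a q) = L a" for a
  proof -
    have "D (fundamental P a q) = differential S S (\<lambda>g. \<tau> (act P q g)) \<one>\<^bsub>G\<^esub> a"
      unfolding D_def fundamental_eq_differential
      using differential_compose[OF S Q S openin_UNIV_mtop[OF S] orbit_smooth UNIV_I V \<tau>sm] qV by simp
    also have "(\<lambda>g. \<tau> (act P q g)) = (\<lambda>g. \<tau> q \<otimes>\<^bsub>G\<^esub> g)" using \<tau>[OF qV] by blast
    finally show ?thesis by (simp add: L_def)
  qed
  moreover have "linear D" unfolding D_def by (rule differential_linear[OF Q S V \<tau>sm qV])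
  ultimately show ?thesis using that bij unfolding eq by blast
qed

lemma pi_star_fundamental: "pi_star P q (fundamental P a q) = 0"
proof -
  have "pi_star P q (fundamental P a q) = differential S M (\<lambda>g. proj P (act P q g)) \<one>\<^bsub>G\<^esub> a"
    unfolding pi_star_def fundamental_eq_differential
    using differential_compose[OF S Q M openin_UNIV_mtop[OF S] orbit_smooth UNIV_I openin_UNIV_mtop[OF Q] proj_smooth UNIV_I, of q "\<one>\<^bsub>G\<^esub>" a]
    by simp
  then show ?thesis by (simp add: differential_const)
qed

lemma pi_star_surj: "\<exists>v. pi_star P q v = X"
proof -
  obtain D :: "'e \<Rightarrow> 'h" where "bij (\<lambda>v. (pi_star P q v, D v))" by (rule trivialization_differential[of q]) blast
  then have "surj (\<lambda>v. (pi_star P q v, D v))" by (rule bij_is_surj)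
  from surjD[OF this, of "(X, 0)"] obtain v where "(X, 0) = (pi_star P q v, D v)" ..
  then have "pi_star P q v = X" by simp
  then show ?thesis ..
qed

lemma vertical_iff: "pi_star P q v = 0 \<longleftrightarrow> (\<exists>a. v = fundamental P a q)"
proof
  assume v: "pi_star P q v = 0"
  obtain D :: "'e \<Rightarrow> 'h" and L where DL: "bij (\<lambda>v. (pi_star P q v, D v))" "linear D" "bij L" "\<And>a. D (fundamental P a q) = L a"
    by (rule trivialization_differential[of q]) blast
  obtain a where "D v = L a" using surjD[OF bij_is_surj[OF DL(3)]] by blast
  then have "(pi_star P q v, D v) = (pi_star P q (fundamental P a q), D (fundamental P a q))"
    using v pi_star_fundamental DL(4) by simp
  then have "v = fundamental P a q" using injD[OF bij_is_inj[OF DL(1)]] by blast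
  then show "\<exists>a. v = fundamental P a q" by blast
qed (auto simp: pi_star_fundamental)

lemma fundamental_inj: "fundamental P a q = fundamental P b q \<Longrightarrow> a = b"
proof -
  assume eq: "fundamental P a q = fundamental P b q"
  obtain D :: "'e \<Rightarrow> 'h" and L where "bij L" "\<And>a. D (fundamental P a q) = L a"
    by (rule trivialization_differential[of q]) blast
  then show "a = b" using eq by (metis bij_is_inj injD)
qed

lemma fundamental_zero_iff: "fundamental P a q = 0 \<longleftrightarrow> a = 0"
  using fundamental_inj[of a q 0] linear_0[OF fundamental_linear] by auto

lemma act_chart:
  assumes c: "c \<in> atlas Q" "q \<in> fst c"
  defines "e \<equiv> chart_at S \<one>\<^bsub>G\<^esub>"
  obtains N F where "open N" "(snd c q, snd e \<one>\<^bsub>G\<^esub>) \<in> N" "N \<subseteq> snd c ` fst c \<times> snd e ` fst e" "smooth_on N F"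
    "\<And>p g. p \<in> fst c \<Longrightarrow> g \<in> fst e \<Longrightarrow> (snd c p, snd e g) \<in> N \<Longrightarrow> act P p g \<in> fst c \<and> F (snd c p, snd e g) = snd c (act P p g)"
proof -
  have e: "e \<in> atlas S" "\<one>\<^bsub>G\<^esub> \<in> fst e" unfolding e_def using S by (auto simp: chart_at_atlas chart_at_mem)
  note QS = premanifold_prod[OF Q S]
  let ?k = "prod_chart c e"
  have k: "?k \<in> atlas (prod_manifold Q S)" unfolding prod_manifold_simps using c(1) e(1) by blast
  obtain W where W: "open W" "snd ?k (q, \<one>\<^bsub>G\<^esub>) \<in> W"
    "\<And>y. y \<in> UNIV \<Longrightarrow> y \<in> fst ?k \<Longrightarrow> snd ?k y \<in> W \<Longrightarrow> act P (fst y) (snd y) \<in> fst c"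
    "smooth_on (snd ?k ` (UNIV \<inter> fst ?k) \<inter> W) (snd c \<circ> (\<lambda>z. act P (fst z) (snd z)) \<circ> chart_inv ?k)"
    using smooth_map_chart[OF QS Q mthick_UNIV[OF QS] act_smooth, of "(q, \<one>\<^bsub>G\<^esub>)" ?k c] k c e by auto
  have img: "snd ?k ` (UNIV \<inter> fst ?k) = snd c ` fst c \<times> snd e ` fst e"
    using map_prod_image_Int[of "snd c" "snd e" UNIV UNIV "fst c" "fst e"] by simp
  let ?N = "(snd c ` fst c \<times> snd e ` fst e) \<inter> W"
  show ?thesis
  proof (rule that[of ?N "snd c \<circ> (\<lambda>z. act P (fst z) (snd z)) \<circ> chart_inv ?k"])
    show "open ?N" by (intro open_Int open_Times chart_open[OF Q c(1)] chart_open[OF S e(1)] W(1))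
    show "(snd c q, snd e \<one>\<^bsub>G\<^esub>) \<in> ?N" using W(2) c e by auto
    show "smooth_on ?N (snd c \<circ> (\<lambda>z. act P (fst z) (snd z)) \<circ> chart_inv ?k)" using W(4) unfolding img .
    fix p g assume pg: "p \<in> fst c" "g \<in> fst e" "(snd c p, snd e g) \<in> ?N"
    have "chart_inv ?k (snd c p, snd e g) = (p, g)"
      using prod_chart_inv[OF Q S c(1) e(1), of "snd c p" "snd e g"] pg chart_inv_chart[OF Q c(1)] chart_inv_chart[OF S e(1)] by auto
    then show "act P p g \<in> fst c \<and> (snd c \<circ> (\<lambda>z. act P (fst z) (snd z)) \<circ> chart_inv ?k) (snd c p, snd e g) = snd c (act P p g)"
      using W(3)[of "(p, g)"] pg by simp
  qed auto
qed

section \<open>Fundamental fields in coordinates\<close>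

abbreviation "fund_rep c a \<equiv> local_rep Q c (fundamental P a)"

lemma fund_rep_linear:
  assumes "c \<in> atlas Q" "x \<in> snd c ` fst c" shows "linear (\<lambda>a. fund_rep c a x)"
  unfolding local_rep_eq
  using linear_compose[OF fundamental_linear components_linear[OF Q assms(1) inv_into_into[OF assms(2)]]]
  by (simp add: comp_def)

text \<open>In coordinates the fundamental field is the derivative of the action in the group
  variable at the unit, hence smooth. The last derivative compares mixed second derivatives of the
  flow: moving a vector \<open>v\<close> by the flow and differentiating in time is the same as
  differentiating the velocity field in the direction \<open>v\<close>.\<close>

lemma fund_rep_smooth_and_flow:
  assumes c: "c \<in> atlas Q" "q \<in> fst c"
  shows "\<exists>W. open W \<and> snd c q \<in> W \<and> smooth_on (snd c ` fst c \<inter> W) (fund_rep c a)" (is ?smooth)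
    and "one_param_subgroup S G a \<gamma> \<Longrightarrow>
      (\<exists>d>0. \<forall>t. \<bar>t\<bar> < d \<longrightarrow> act P q (\<gamma> t) \<in> fst c) \<and>
      ((\<lambda>t. snd c (act P q (\<gamma> t))) has_vector_derivative fund_rep c a (snd c q)) (at 0) \<and>
      ((\<lambda>t. components Q c (act P q (\<gamma> t)) (differential Q Q (\<lambda>p. act P p (\<gamma> t)) q v)) has_vector_derivative
        frechet_derivative (fund_rep c a) (at (snd c q)) (components Q c q v)) (at 0)"
proof -
  define e where "e = chart_at S \<one>\<^bsub>G\<^esub>"
  define e0 where "e0 = snd e \<one>\<^bsub>G\<^esub>"
  have e: "e \<in> atlas S" "\<one>\<^bsub>G\<^esub> \<in> fst e" unfolding e_def using S by (auto simp: chart_at_atlas chart_at_mem)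
  note ciQ = chart_inv_chart[OF Q c(1)] and ciS = chart_inv_chart[OF S e(1)]
  obtain N F where N: "open N" "(snd c q, e0) \<in> N" "N \<subseteq> snd c ` fst c \<times> snd e ` fst e" and F: "smooth_on N F"
    and FN: "\<And>p g. p \<in> fst c \<Longrightarrow> g \<in> fst e \<Longrightarrow> (snd c p, snd e g) \<in> N \<Longrightarrow> act P p g \<in> fst c \<and> F (snd c p, snd e g) = snd c (act P p g)"
    unfolding e_def e0_def by (rule act_chart[OF c]) blast
  define DF where "DF = (\<lambda>z. frechet_derivative F (at z))"
  have DF: "(F has_derivative DF z) (at z)" if "z \<in> N" for z
    unfolding DF_def using smooth_on_has_derivative[OF N(1) F that] .
  define N1 where "N1 = (\<lambda>x. (x, e0)) -` N"
  have N1: "open N1" "snd c q \<in> N1" using N(1,2) by (auto simp: N1_def intro!: open_vimage continuous_intros)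
  have N1c: "N1 \<subseteq> snd c ` fst c" using N(3) by (auto simp: N1_def)
  have sig: "fund_rep c a x = DF (x, e0) (0, a)" if x: "x \<in> N1" for x a
  proof -
    define p where "p = chart_inv c x"
    have p: "p \<in> fst c" "x = snd c p" using x N1c by (auto simp: p_def f_inv_into_f inv_into_into)
    have xe: "(x, e0) \<in> N" using x by (simp add: N1_def)
    have "fund_rep c a x = components Q c (act P p \<one>\<^bsub>G\<^esub>) (differential S Q (act P p) \<one>\<^bsub>G\<^esub> a)"
      by (simp add: local_rep_eq p_def[symmetric] fundamental_eq_differential)
    also have "\<dots> = frechet_derivative (snd c \<circ> act P p \<circ> chart_inv e) (at (snd e \<one>\<^bsub>G\<^esub>)) (components S e \<one>\<^bsub>G\<^esub> a)"
      by (rule differential_chart(2)[OF S Q openin_UNIV_mtop[OF S] orbit_smooth UNIV_I e c(1), symmetric]) (use p in simp)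
    also have "components S e \<one>\<^bsub>G\<^esub> a = a" unfolding e_def by (rule components_chart_at[OF S])
    also have "frechet_derivative (snd c \<circ> act P p \<circ> chart_inv e) (at (snd e \<one>\<^bsub>G\<^esub>)) = (\<lambda>w. DF (x, e0) (0, w))"
    proof (rule frechet_derivative_at[symmetric])
      have "((\<lambda>y. (x, y)) has_derivative (\<lambda>w. (0, w))) (at e0)" by (auto intro!: derivative_eq_intros)
      from has_derivative_compose[OF this DF[OF xe]]
      have D: "((\<lambda>y. F (x, y)) has_derivative (\<lambda>w. DF (x, e0) (0, w))) (at (snd e \<one>\<^bsub>G\<^esub>))" by (simp add: e0_def)
      have op: "open ((\<lambda>y. (x, y)) -` N)" using N(1) by (auto intro!: open_vimage continuous_intros)
      show "(snd c \<circ> act P p \<circ> chart_inv e has_derivative (\<lambda>w. DF (x, e0) (0, w))) (at (snd e \<one>\<^bsub>G\<^esub>))"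
      proof (rule has_derivative_transform_within_open[OF D op])
        show "snd e \<one>\<^bsub>G\<^esub> \<in> (\<lambda>y. (x, y)) -` N" using xe by (simp add: e0_def)
        fix y assume y: "y \<in> (\<lambda>y. (x, y)) -` N"
        then obtain g where g: "g \<in> fst e" "y = snd e g" using N(3) by blast
        then show "F (x, y) = (snd c \<circ> act P p \<circ> chart_inv e) y" using FN[OF p(1) g(1)] y p(2) ciS by simp
      qed
    qed
    finally show ?thesis .
  qed
  have thN1: "thick N1" using thick_open[OF N1(1)] .
  have "smooth_on N1 (\<lambda>x. DF (x, e0) (0, a))"
    unfolding DF_def
    by (rule smooth_on_frechet_apply[OF finite_dim_prod[OF fdQ fdS] N(1) F thN1])
      (auto simp: N1_def intro!: smooth_on_Pair smooth_on_id smooth_on_const thN1[unfolded N1_def])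
  then have smN1: "smooth_on N1 (fund_rep c a)" by (rule smooth_on_transform) (use sig in simp)
  then show ?smooth using N1 N1c by (intro exI[of _ N1]) (auto simp: Int_absorb1)
  assume \<gamma>: "one_param_subgroup S G a \<gamma>"
  have thU: "thick (UNIV :: real set)" using thick_open open_UNIV by blast
  note \<gamma>sm = one_param_smooth[OF \<gamma>] and \<gamma>0 = one_param_0[OF \<gamma>]
  have \<gamma>e: "\<gamma> 0 \<in> fst e" using e \<gamma>0 by simp
  obtain W where W: "open W" "0 \<in> W" "\<And>y. y \<in> UNIV \<Longrightarrow> y \<in> W \<Longrightarrow> \<gamma> y \<in> fst e" "smooth_on (UNIV \<inter> W) (\<lambda>y. snd e (\<gamma> y))"
    using smooth_map_flat_chart[OF finite_dim_real S thU \<gamma>sm UNIV_I e(1) \<gamma>e] by blast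
  have smW: "smooth_on W (\<lambda>y. snd e (\<gamma> y))" using W(4) by simp
  define K where "K = (UNIV \<times> W) \<inter> (\<lambda>z. (fst z, snd e (\<gamma> (snd z)))) -` N"
  have opUW: "open (UNIV \<times> W :: ('e \<times> real) set)" by (intro open_Times open_UNIV W(1))
  have thUW: "thick (UNIV \<times> W :: ('e \<times> real) set)" using thick_open[OF opUW] .
  have jsm: "smooth_on (UNIV \<times> W) (\<lambda>z::'e \<times> real. (fst z, snd e (\<gamma> (snd z))))"
  proof (rule smooth_on_Pair[OF thUW])
    show "smooth_on (UNIV \<times> W) (fst :: 'e \<times> real \<Rightarrow> 'e)"
      using smooth_on_bounded_linear[OF thUW bounded_linear_fst smooth_on_id[OF thUW]] .
    show "smooth_on (UNIV \<times> W) (\<lambda>z::'e \<times> real. snd e (\<gamma> (snd z)))"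
      by (rule smooth_on_compose[OF thUW finite_dim_real smooth_on_bounded_linear[OF thUW bounded_linear_snd smooth_on_id[OF thUW]] smW]) auto
  qed
  have K: "open K" unfolding K_def using continuous_open_preimage[OF smooth_on_imp_continuous[OF jsm] opUW N(1)] .
  have K0: "(snd c q, 0) \<in> K" using W(2) N(2) \<gamma>0 by (simp add: K_def e0_def)
  \<comment> \<open>The flow of the fundamental field in coordinates, as one function of point and
    time, so that its mixed second derivatives can be compared.\<close>
  define \<rho> where "\<rho> = (\<lambda>z. F (fst z, snd e (\<gamma> (snd z))))"
  have \<rho>sm: "smooth_on K \<rho>"
    unfolding \<rho>_def
    by (rule smooth_on_compose[OF thick_open[OF K] finite_dim_prod[OF fdQ fdS] smooth_on_subset[OF finite_dim_prod[OF fdQ finite_dim_real] thick_open[OF K] jsm] F])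
      (auto simp: K_def)
  define D\<rho> where "D\<rho> = (\<lambda>z. frechet_derivative \<rho> (at z))"
  have D\<rho>: "(\<rho> has_derivative D\<rho> z) (at z)" if "z \<in> K" for z
    unfolding D\<rho>_def using smooth_on_has_derivative[OF K \<rho>sm that] .
  have \<rho>act: "act P p (\<gamma> t) \<in> fst c" "\<rho> (snd c p, t) = snd c (act P p (\<gamma> t))" if "p \<in> fst c" "(snd c p, t) \<in> K" for p t
  proof -
    have "\<gamma> t \<in> fst e" "(snd c p, snd e (\<gamma> t)) \<in> N" using that(2) W(3) by (auto simp: K_def)
    from FN[OF that(1) this] show "act P p (\<gamma> t) \<in> fst c" "\<rho> (snd c p, t) = snd c (act P p (\<gamma> t))"
      by (auto simp: \<rho>_def)
  qed
  have "((\<lambda>y. snd e (\<gamma> y)) has_vector_derivative components S e (\<gamma> 0) (snd (tangent_lift S UNIV \<gamma> 0))) (at 0 within UNIV)"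
    by (rule tangent_lift_chart[OF S thU \<gamma>sm UNIV_I e(1) \<gamma>e])
  then have \<gamma>d: "((\<lambda>y. snd e (\<gamma> y)) has_vector_derivative a) (at 0)"
    using one_param_velocity[OF \<gamma>] \<gamma>0 components_chart_at[OF S] by (simp add: e_def)
  have \<rho>t: "D\<rho> (x, 0) (0, 1) = fund_rep c a x" if x: "(x, 0) \<in> K" for x
  proof -
    have "(x, e0) \<in> N" using x \<gamma>0 by (simp add: K_def e0_def)
    then have xN: "x \<in> N1" "(x, snd e (\<gamma> 0)) \<in> N" using \<gamma>0 by (auto simp: N1_def e0_def)
    have "((\<lambda>t. (x, snd e (\<gamma> t))) has_derivative (\<lambda>u. (0, u *\<^sub>R a))) (at 0)"
      using \<gamma>d unfolding has_vector_derivative_def by (auto intro!: derivative_eq_intros)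
    from has_derivative_compose[OF this DF[OF xN(2)]]
    have "((\<lambda>t. \<rho> (x, t)) has_derivative (\<lambda>u. DF (x, e0) (0, u *\<^sub>R a))) (at 0)" using \<gamma>0 by (simp add: \<rho>_def e0_def)
    moreover have "((\<lambda>t. \<rho> (x, t)) has_derivative (\<lambda>u. D\<rho> (x, 0) (0, u))) (at 0)"
      by (rule has_derivative_compose[where f="\<lambda>t. (x, t)" and g="\<rho>", OF _ D\<rho>[OF x]]) (auto intro!: derivative_eq_intros)
    ultimately have "(\<lambda>u. DF (x, e0) (0, u *\<^sub>R a)) = (\<lambda>u. D\<rho> (x, 0) (0, u))" by (rule has_derivative_unique)
    then have "DF (x, e0) (0, 1 *\<^sub>R a) = D\<rho> (x, 0) (0, 1)" by (rule fun_cong)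
    then show ?thesis using sig[OF xN(1), of a] by simp
  qed
  have \<rho>x: "components Q c (act P q (\<gamma> t)) (differential Q Q (\<lambda>p. act P p (\<gamma> t)) q v) = D\<rho> (snd c q, t) (components Q c q v, 0)"
    if t: "(snd c q, t) \<in> K" for t
  proof -
    have "components Q c (act P q (\<gamma> t)) (differential Q Q (\<lambda>p. act P p (\<gamma> t)) q v) =
       frechet_derivative (snd c \<circ> (\<lambda>p. act P p (\<gamma> t)) \<circ> chart_inv c) (at (snd c q)) (components Q c q v)"
      by (rule differential_chart(2)[OF Q Q openin_UNIV_mtop[OF Q] right_act_smooth UNIV_I c c(1), symmetric])
        (rule \<rho>act(1)[OF c(2) t])
    also have "frechet_derivative (snd c \<circ> (\<lambda>p. act P p (\<gamma> t)) \<circ> chart_inv c) (at (snd c q)) = (\<lambda>w. D\<rho> (snd c q, t) (w, 0))"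
    proof (rule frechet_derivative_at[symmetric])
      have D: "((\<lambda>x. \<rho> (x, t)) has_derivative (\<lambda>w. D\<rho> (snd c q, t) (w, 0))) (at (snd c q))"
        by (rule has_derivative_compose[where f="\<lambda>x. (x, t)" and g="\<rho>", OF _ D\<rho>[OF t]]) (auto intro!: derivative_eq_intros)
      have op: "open (snd c ` fst c \<inter> (\<lambda>x. (x, t)) -` K)"
        using K chart_open[OF Q c(1)] by (auto intro!: open_Int open_vimage continuous_intros)
      show "(snd c \<circ> (\<lambda>p. act P p (\<gamma> t)) \<circ> chart_inv c has_derivative (\<lambda>w. D\<rho> (snd c q, t) (w, 0))) (at (snd c q))"
        by (rule has_derivative_transform_within_open[OF D op]) (use t c \<rho>act(2) ciQ in auto)
    qed
    finally show ?thesis .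
  qed
  have opt: "open ((\<lambda>t. (snd c q, t)) -` K)" "0 \<in> (\<lambda>t. (snd c q, t)) -` K"
    using K K0 by (auto intro!: open_vimage continuous_intros)
  obtain d where d: "d > 0" "ball 0 d \<subseteq> (\<lambda>t. (snd c q, t)) -` K" using opt open_contains_ball by blast
  have 1: "\<exists>d>0. \<forall>t. \<bar>t\<bar> < d \<longrightarrow> act P q (\<gamma> t) \<in> fst c"
  proof (intro exI[of _ d] conjI allI impI)
    fix t :: real assume "\<bar>t\<bar> < d"
    then have "t \<in> ball 0 d" by simp
    then have "(snd c q, t) \<in> K" using d(2) by blast
    then show "act P q (\<gamma> t) \<in> fst c" using \<rho>act(1) c(2) by blast
  qed (rule d(1))
  have \<rho>d: "((\<lambda>t. \<rho> (snd c q, t)) has_derivative (\<lambda>u. D\<rho> (snd c q, 0) (0, u))) (at 0)"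
    by (rule has_derivative_compose[where f="\<lambda>t. (snd c q, t)" and g="\<rho>", OF _ D\<rho>[OF K0]]) (auto intro!: derivative_eq_intros)
  have "((\<lambda>t. \<rho> (snd c q, t)) has_vector_derivative fund_rep c a (snd c q)) (at 0)"
  proof -
    have "D\<rho> (snd c q, 0) (0, u) = u *\<^sub>R fund_rep c a (snd c q)" for u
      using linear_scale[OF has_derivative_linear[OF D\<rho>[OF K0]], of u "(0, 1)"] \<rho>t[OF K0] by simp
    then show ?thesis using \<rho>d by (simp add: has_vector_derivative_def)
  qed
  then have 2: "((\<lambda>t. snd c (act P q (\<gamma> t))) has_vector_derivative fund_rep c a (snd c q)) (at 0)"
    by (rule has_vector_derivative_transform_within_open[OF _ opt]) (use \<rho>act(2)[OF c(2)] in auto)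
  let ?w = "components Q c q v"
  define V where "V = frechet_derivative (\<lambda>z. D\<rho> z (?w, 0)) (at (snd c q, 0))"
  define U where "U = frechet_derivative (\<lambda>z. D\<rho> z (0, 1)) (at (snd c q, 0))"
  have V: "((\<lambda>z. D\<rho> z (?w, 0)) has_derivative V) (at (snd c q, 0))"
    and U: "((\<lambda>z. D\<rho> z (0, 1)) has_derivative U) (at (snd c q, 0))"
    unfolding V_def U_def D\<rho>_def
    using smooth_on_has_derivative[OF K smooth_on_frechet_derivative[OF K \<rho>sm] K0] by blast+
  \<comment> \<open>\<open>V\<close> differentiates the spatial derivative in time, \<open>U\<close>
    the time derivative in space; the latter is the derivative of \<open>fund_rep c a\<close>, since
    \<open>D\<rho> (x, 0) (0, 1)\<close> is that field.\<close>
  have sym: "V (0, 1) = U (?w, 0)"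
    by (rule symmetric_second_derivative[OF K K0 D\<rho> V U])
  have "((\<lambda>t. D\<rho> (snd c q, t) (?w, 0)) has_derivative (\<lambda>u. V (0, u))) (at 0)"
    by (rule has_derivative_compose[where f="\<lambda>t. (snd c q, t)" and g="\<lambda>z. D\<rho> z (?w, 0)", OF _ V]) (auto intro!: derivative_eq_intros)
  moreover have "(\<lambda>u. V (0, u)) = (\<lambda>u. u *\<^sub>R V (0, 1))"
  proof
    fix u show "V (0, u) = u *\<^sub>R V (0, 1)"
      using linear_scale[OF has_derivative_linear[OF V], of u "(0, 1)"] by simp
  qed
  ultimately have "((\<lambda>t. D\<rho> (snd c q, t) (?w, 0)) has_vector_derivative V (0, 1)) (at 0)"
    unfolding has_vector_derivative_def by (simp only:)
  moreover have "V (0, 1) = frechet_derivative (fund_rep c a) (at (snd c q)) ?w"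
  proof -
    have "((\<lambda>x. D\<rho> (x, 0) (0, 1)) has_derivative (\<lambda>w. U (w, 0))) (at (snd c q))"
      by (rule has_derivative_compose[where f="\<lambda>x. (x, 0)" and g="\<lambda>z. D\<rho> z (0, 1)", OF _ U]) (auto intro!: derivative_eq_intros)
    then have "(fund_rep c a has_derivative (\<lambda>w. U (w, 0))) (at (snd c q))"
    proof (rule has_derivative_transform_within_open)
      show "open ((\<lambda>x. (x, 0)) -` K)" using K by (auto intro!: open_vimage continuous_intros)
    qed (use K0 \<rho>t in auto)
    from frechet_derivative_at[OF this] show ?thesis unfolding sym by metis
  qed
  ultimately have "((\<lambda>t. D\<rho> (snd c q, t) (?w, 0)) has_vector_derivative frechet_derivative (fund_rep c a) (at (snd c q)) ?w) (at 0)"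
    by simp
  then have 3: "((\<lambda>t. components Q c (act P q (\<gamma> t)) (differential Q Q (\<lambda>p. act P p (\<gamma> t)) q v)) has_vector_derivative
        frechet_derivative (fund_rep c a) (at (snd c q)) ?w) (at 0)"
    by (rule has_vector_derivative_transform_within_open[OF _ opt]) (use \<rho>x in auto)
  show "(\<exists>d>0. \<forall>t. \<bar>t\<bar> < d \<longrightarrow> act P q (\<gamma> t) \<in> fst c) \<and>
      ((\<lambda>t. snd c (act P q (\<gamma> t))) has_vector_derivative fund_rep c a (snd c q)) (at 0) \<and>
      ((\<lambda>t. components Q c (act P q (\<gamma> t)) (differential Q Q (\<lambda>p. act P p (\<gamma> t)) q v)) has_vector_derivative
        frechet_derivative (fund_rep c a) (at (snd c q)) (components Q c q v)) (at 0)"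
    using 1 2 3 by blast
qed

lemma fund_rep_smooth:
  assumes c: "c \<in> atlas Q" shows "smooth_on (snd c ` fst c) (fund_rep c a)"
proof (rule smooth_on_locally)
  fix x assume "x \<in> snd c ` fst c"
  then obtain q where "x = snd c q" "q \<in> fst c" by blast
  then show "\<exists>U. open U \<and> x \<in> U \<and> smooth_on (snd c ` fst c \<inter> U) (fund_rep c a)"
    using fund_rep_smooth_and_flow(1)[OF c] by blast
qed

end

section \<open>The connection\<close>

locale horizontal = principal P
  for P :: "('q, 'e::banach, 'm, 'f::banach, 'g, 'h::banach) bundle_data" +
  fixes H :: "('q \<times> 'e) set"
  assumes horizontal: "horizontal_distribution P H"
begin

lemma local_frame:
  obtains W n X where "openin (mtop Q) W" "q \<in> W" "\<And>i. i < n \<Longrightarrow> smooth_vector_field Q W (X i)"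
    "\<And>p. p \<in> W \<Longrightarrow> inj_on (\<lambda>i. X i p) {..<n::nat}" "\<And>p. p \<in> W \<Longrightarrow> independent ((\<lambda>i. X i p) ` {..<n})"
    "\<And>p. p \<in> W \<Longrightarrow> span ((\<lambda>i. X i p) ` {..<n}) = fiber H p"
proof -
  have "smooth_distribution Q H" using horizontal unfolding horizontal_distribution_def by (elim conjE)
  from spec[OF this[unfolded smooth_distribution_def], of q]
  obtain W and n :: nat and X where w: "openin (mtop Q) W" "q \<in> W" "\<forall>i<n. smooth_vector_field Q W (X i)"
    "\<forall>p\<in>W. inj_on (\<lambda>i. X i p) {..<n} \<and> independent ((\<lambda>i. X i p) ` {..<n}) \<and>
      span ((\<lambda>i. X i p) ` {..<n}) = fiber H p" by (elim exE conjE) (rule that)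
  show ?thesis by (rule that[OF w(1,2), of n X]) (simp_all add: w(3) bspec[OF w(4)])
qed

lemma fiber_subspace: "subspace (fiber H q)"
proof -
  obtain W and n :: nat and X where "q \<in> W" and s: "\<And>p. p \<in> W \<Longrightarrow> span ((\<lambda>i. X i p) ` {..<n}) = fiber H p"
    by (rule local_frame[of q]) (rule that)
  from s[OF this(1)] show ?thesis using subspace_span[of "(\<lambda>i. X i q) ` {..<n}"] by simp
qed

lemma fiber_Int_vertical: "v \<in> fiber H q \<Longrightarrow> pi_star P q v = 0 \<Longrightarrow> v = 0"
  using horizontal unfolding horizontal_distribution_def vertical_def by blast

lemma fiber_decomposition: "\<exists>a. v - fundamental P a q \<in> fiber H q"
proof -
  have "v \<in> {h + v |h v. h \<in> fiber H q \<and> v \<in> vertical P q}"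
    using horizontal unfolding horizontal_distribution_def by blast
  then obtain h w where "v = h + w" "h \<in> fiber H q" "pi_star P q w = 0" unfolding vertical_def by blast
  then show ?thesis using vertical_iff by (metis add_diff_cancel_right')
qed

lemma fundamental_in_fiber: "fundamental P a q \<in> fiber H q \<Longrightarrow> a = 0"
  using fiber_Int_vertical pi_star_fundamental fundamental_zero_iff by blast

lemma connection_eqI: "v - fundamental P a q \<in> fiber H q \<Longrightarrow> connection P H (q, v) = a"
  unfolding connection_def prod.case
proof (rule the_equality)
  fix b assume a: "v - fundamental P a q \<in> fiber H q" and b: "v - fundamental P b q \<in> fiber H q"
  have "(v - fundamental P a q) - (v - fundamental P b q) \<in> fiber H q"
    by (rule subspace_diff[OF fiber_subspace a b])
  then have "fundamental P (b - a) q \<in> fiber H q" by (simp add: linear_diff[OF fundamental_linear])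
  then show "b = a" using fundamental_in_fiber by force
qed

lemma connection_horizontal: "v - fundamental P (connection P H (q, v)) q \<in> fiber H q"
  using fiber_decomposition[of v q] connection_eqI by metis

lemma connection_linear: "linear (\<lambda>v. connection P H (q, v))"
proof (rule linearI)
  fix v w r
  have "(v - fundamental P (connection P H (q, v)) q) + (w - fundamental P (connection P H (q, w)) q) \<in> fiber H q"
    by (rule subspace_add[OF fiber_subspace connection_horizontal connection_horizontal])
  then show "connection P H (q, v + w) = connection P H (q, v) + connection P H (q, w)"
    by (intro connection_eqI) (simp add: linear_add[OF fundamental_linear] algebra_simps)
  have "r *\<^sub>R (v - fundamental P (connection P H (q, v)) q) \<in> fiber H q"
    by (rule subspace_scale[OF fiber_subspace connection_horizontal])
  then show "connection P H (q, r *\<^sub>R v) = r *\<^sub>R connection P H (q, v)"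
    by (intro connection_eqI) (simp add: linear_scale[OF fundamental_linear] algebra_simps)
qed

lemma connection_fundamental: "connection P H (q, fundamental P a q) = a"
  by (rule connection_eqI) (simp add: subspace_0[OF fiber_subspace, simplified])

lemma connection_zero_iff: "connection P H (q, v) = 0 \<longleftrightarrow> (q, v) \<in> H"
  using connection_horizontal[of v q] connection_eqI[of v 0 q] linear_0[OF fundamental_linear, of q] by auto

lemma hlift: "(q, hlift P H q X) \<in> H" "pi_star P q (hlift P H q X) = X"
  and hlift_eqI: "(q, v) \<in> H \<Longrightarrow> pi_star P q v = X \<Longrightarrow> hlift P H q X = v"
proof -
  have uniq: "w = v" if "(q, v) \<in> H" "pi_star P q v = X" "(q, w) \<in> H" "pi_star P q w = X" for v w
  proof -
    have "w - v \<in> fiber H q" using subspace_diff[OF fiber_subspace] that by blast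
    then have "w - v = 0" by (rule fiber_Int_vertical) (simp add: that linear_diff[OF pi_star_linear])
    then show ?thesis by simp
  qed
  show eq: "hlift P H q X = v" if "(q, v) \<in> H" "pi_star P q v = X" for v
    unfolding hlift_def by (rule the_equality) (use that uniq in auto)
  obtain u where u: "pi_star P q u = X" using pi_star_surj by blast
  define v where "v = u - fundamental P (connection P H (q, u)) q"
  have "(q, v) \<in> H" using connection_horizontal by (simp add: v_def)
  moreover have "pi_star P q v = X" by (simp add: v_def linear_diff[OF pi_star_linear] pi_star_fundamental u)
  ultimately show "(q, hlift P H q X) \<in> H" "pi_star P q (hlift P H q X) = X" using eq by auto
qed

section \<open>The connection form in coordinates\<close>

abbreviation "con_rep c x w \<equiv> connection P H (chart_inv c x, from_components Q c x w)"

lemma con_rep_linear: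
  assumes "c \<in> atlas Q" "x \<in> snd c ` fst c" shows "linear (con_rep c x)"
  using linear_compose[OF from_components(3)[OF Q assms] connection_linear] by (simp add: comp_def)

lemma con_rep_components:
  assumes "c \<in> atlas Q" "q \<in> fst c"
  shows "con_rep c (snd c q) (components Q c q v) = connection P H (q, v)"
  using from_components(1)[OF Q assms(1), of "snd c q" v] chart_inv_chart[OF Q assms] assms(2) by simp

lemma con_rep_fund_rep:
  assumes "c \<in> atlas Q" "x \<in> snd c ` fst c"
  shows "con_rep c x (fund_rep c a x) = a"
  using from_components(1)[OF Q assms] by (simp add: local_rep_eq connection_fundamental)

text \<open>Near \<open>q\<close> a local frame of the distribution and the fundamental fields
  together describe every vector by unique coefficients, and \<omega> reads off the fundamental one.
  That this coefficient depends smoothly on the point comes from inverting a smooth family of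
  operators.\<close>

lemma con_rep_smooth_locally:
  assumes c: "c \<in> atlas Q" and q: "q \<in> fst c"
  obtains N where "open N" "snd c q \<in> N" "N \<subseteq> snd c ` fst c" "\<And>w. smooth_on N (\<lambda>x. con_rep c x w)"
proof -
  obtain W n X where W: "openin (mtop Q) W" "q \<in> W" and X: "\<And>i. i < n \<Longrightarrow> smooth_vector_field Q W (X i)"
    and fr: "\<And>p. p\<in>W \<Longrightarrow> inj_on (\<lambda>i. X i p) {..<n::nat}" "\<And>p. p\<in>W \<Longrightarrow> independent ((\<lambda>i. X i p) ` {..<n})"
      "\<And>p. p\<in>W \<Longrightarrow> span ((\<lambda>i. X i p) ` {..<n}) = fiber H p"
    by (rule local_frame[of q]) (rule that)
  define N where "N = snd c ` (W \<inter> fst c)"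
  define x0 where "x0 = snd c q"
  have N: "open N" "N \<subseteq> snd c ` fst c" "x0 \<in> N"
    using W q c unfolding N_def x0_def openin_mtop[OF Q] by auto
  have th: "thick N" using thick_open[OF N(1)] .
  define \<xi> where "\<xi> = (\<lambda>i. local_rep Q c (X i))"
  have \<xi>sm: "smooth_on N (\<xi> i)" if "i < n" for i
    unfolding \<xi>_def N_def by (rule smooth_vector_field_local_rep[OF Q W(1) X[OF that] c])
  have fsm: "smooth_on N (fund_rep c b)" for b by (rule smooth_on_subset[OF fdQ th fund_rep_smooth[OF c] N(2)])
  have pt: "chart_inv c x \<in> W" "chart_inv c x \<in> fst c" "x \<in> snd c ` fst c" if "x \<in> N" for x
    using that chart_inv_chart[OF Q c] unfolding N_def by auto
  have comb: "(\<Sum>i<n. k i *\<^sub>R \<xi> i x) + fund_rep c b x =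
      components Q c (chart_inv c x) ((\<Sum>i<n. k i *\<^sub>R X i (chart_inv c x)) + fundamental P b (chart_inv c x))"
    if x: "x \<in> N" for k b x
  proof -
    have lin: "linear (components Q c (chart_inv c x))" by (rule components_linear[OF Q c pt(2)[OF x]])
    show ?thesis by (simp add: \<xi>_def local_rep_eq linear_add[OF lin] linear_sum[OF lin] linear_scale[OF lin])
  qed
  have inF: "(\<Sum>i<n. k i *\<^sub>R X i p) \<in> fiber H p" if "p \<in> W" for k p
    unfolding fr(3)[OF that, symmetric] by (intro span_sum span_scale span_base) auto
  have ex: "\<exists>k b. w = (\<Sum>i<n. k i *\<^sub>R \<xi> i x) + fund_rep c b x" if x: "x \<in> N" for x w
  proof -
    define p where "p = chart_inv c x"
    have p: "p \<in> W" using pt[OF x] by (simp add: p_def)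
    define v where "v = from_components Q c x w"
    obtain b where b: "v - fundamental P b p \<in> fiber H p" using fiber_decomposition by blast
    then have "v - fundamental P b p \<in> range (\<lambda>u. \<Sum>v\<in>(\<lambda>i. X i p) ` {..<n}. u v *\<^sub>R v)"
      unfolding fr(3)[OF p, symmetric] by (subst (asm) span_finite) auto
    then obtain u where u: "v - fundamental P b p = (\<Sum>v\<in>(\<lambda>i. X i p) ` {..<n}. u v *\<^sub>R v)" by blast
    also have "\<dots> = (\<Sum>i<n. u (X i p) *\<^sub>R X i p)" using sum.reindex[OF fr(1)[OF p]] by simp
    finally have "v = (\<Sum>i<n. u (X i p) *\<^sub>R X i p) + fundamental P b p" by (simp add: algebra_simps)
    then have "w = (\<Sum>i<n. u (X i p) *\<^sub>R \<xi> i x) + fund_rep c b x"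
      unfolding comb[OF x] p_def[symmetric] using from_components(2)[OF Q c pt(3)[OF x], of w] by (simp add: v_def p_def)
    then show ?thesis by (intro exI[of _ "\<lambda>i. u (X i p)"] exI[of _ b]) simp
  qed
  have zero: "b = 0 \<and> (\<forall>i<n. k i = 0)" if x: "x \<in> N" and eq: "(\<Sum>i<n. k i *\<^sub>R \<xi> i x) + fund_rep c b x = 0" for x k b
  proof -
    define p where "p = chart_inv c x"
    have p: "p \<in> W" "p \<in> fst c" using pt[OF x] by (auto simp: p_def)
    have "components Q c p ((\<Sum>i<n. k i *\<^sub>R X i p) + fundamental P b p) = components Q c p 0"
      using eq unfolding comb[OF x] by (simp add: p_def[symmetric] linear_0[OF components_linear[OF Q c p(2)]])
    then have s: "(\<Sum>i<n. k i *\<^sub>R X i p) + fundamental P b p = 0" using components_eq_iff[OF Q c p(2)] by blast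
    then have "fundamental P b p = - (\<Sum>i<n. k i *\<^sub>R X i p)" by (simp add: eq_neg_iff_add_eq_0 add.commute)
    then have "fundamental P b p \<in> fiber H p" using subspace_neg[OF fiber_subspace inF[OF p(1)]] by metis
    then have b0: "b = 0" by (rule fundamental_in_fiber)
    then have s0: "(\<Sum>i<n. k i *\<^sub>R X i p) = 0" using s linear_0[OF fundamental_linear] by simp
    define u where "u = (\<lambda>v. k (inv_into {..<n} (\<lambda>i. X i p) v))"
    have "(\<Sum>v\<in>(\<lambda>i. X i p) ` {..<n}. u v *\<^sub>R v) = (\<Sum>i<n. k i *\<^sub>R X i p)"
      unfolding sum.reindex[OF fr(1)[OF p(1)]] comp_def by (intro sum.cong refl) (simp add: u_def inv_into_f_f[OF fr(1)[OF p(1)]])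
    then have "(\<Sum>v\<in>(\<lambda>i. X i p) ` {..<n}. u v *\<^sub>R v) = 0" using s0 by simp
    then have "u (X i p) = 0" if "i < n" for i
      using independentD[OF fr(2)[OF p(1)] _ order_refl, of u "X i p"] that by auto
    then show ?thesis using b0 by (simp add: u_def inv_into_f_f[OF fr(1)[OF p(1)]])
  qed
  have "\<forall>x\<in>N. \<forall>w. \<exists>kb. w = (\<Sum>i<n. fst kb i *\<^sub>R \<xi> i x) + fund_rep c (snd kb) x" using ex by simp
  then obtain kb where kb': "\<And>x w. x \<in> N \<Longrightarrow> w = (\<Sum>i<n. fst (kb x w) i *\<^sub>R \<xi> i x) + fund_rep c (snd (kb x w)) x" by metis
  define k where "k = (\<lambda>x w. fst (kb x w))"
  define b where "b = (\<lambda>x w. snd (kb x w))"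
  have kb: "w = (\<Sum>i<n. k x w i *\<^sub>R \<xi> i x) + fund_rep c (b x w) x" if "x \<in> N" for x w
    unfolding k_def b_def using that by (rule kb')
  have kbI: "b x w = b' \<and> (\<forall>i<n. k x w i = k' i)"
    if x: "x \<in> N" and w: "w = (\<Sum>i<n. k' i *\<^sub>R \<xi> i x) + fund_rep c b' x" for x w k' b'
  proof -
    have lin: "linear (\<lambda>a. fund_rep c a x)" by (rule fund_rep_linear[OF c pt(3)[OF x]])
    have "(\<Sum>i<n. (k x w i - k' i) *\<^sub>R \<xi> i x) + fund_rep c (b x w - b') x =
       ((\<Sum>i<n. k x w i *\<^sub>R \<xi> i x) + fund_rep c (b x w) x) - ((\<Sum>i<n. k' i *\<^sub>R \<xi> i x) + fund_rep c b' x)"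
      by (simp add: scaleR_diff_left sum_subtractf linear_diff[OF lin])
    also have "\<dots> = w - w" using kb[OF x, of w] w by simp
    finally have "(\<Sum>i<n. (k x w i - k' i) *\<^sub>R \<xi> i x) + fund_rep c (b x w - b') x = 0" by simp
    from zero[OF x this] show ?thesis by simp
  qed
  have add: "b x (v + w) = b x v + b x w \<and> (\<forall>i<n. k x (v + w) i = k x v i + k x w i)" if x: "x \<in> N" for x v w
  proof (rule kbI[OF x])
    have lin: "linear (\<lambda>a. fund_rep c a x)" by (rule fund_rep_linear[OF c pt(3)[OF x]])
    have "(\<Sum>i<n. (k x v i + k x w i) *\<^sub>R \<xi> i x) + fund_rep c (b x v + b x w) x =
       ((\<Sum>i<n. k x v i *\<^sub>R \<xi> i x) + fund_rep c (b x v) x) + ((\<Sum>i<n. k x w i *\<^sub>R \<xi> i x) + fund_rep c (b x w) x)"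
      by (simp add: scaleR_add_left sum.distrib linear_add[OF lin])
    then show "v + w = (\<Sum>i<n. (k x v i + k x w i) *\<^sub>R \<xi> i x) + fund_rep c (b x v + b x w) x"
      unfolding kb[OF x, symmetric] by simp
  qed
  have scale: "b x (r *\<^sub>R v) = r *\<^sub>R b x v \<and> (\<forall>i<n. k x (r *\<^sub>R v) i = r * k x v i)" if x: "x \<in> N" for x r v
  proof (rule kbI[OF x])
    have lin: "linear (\<lambda>a. fund_rep c a x)" by (rule fund_rep_linear[OF c pt(3)[OF x]])
    have "(\<Sum>i<n. (r * k x v i) *\<^sub>R \<xi> i x) + fund_rep c (r *\<^sub>R b x v) x =
       r *\<^sub>R ((\<Sum>i<n. k x v i *\<^sub>R \<xi> i x) + fund_rep c (b x v) x)"
      by (simp add: scaleR_add_right scaleR_sum_right linear_scale[OF lin])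
    then show "r *\<^sub>R v = (\<Sum>i<n. (r * k x v i) *\<^sub>R \<xi> i x) + fund_rep c (r *\<^sub>R b x v) x"
      unfolding kb[OF x, symmetric] by simp
  qed
  \<comment> \<open>\<open>A x\<close> carries a vector at \<open>x0\<close> to the vector at
    \<open>x\<close> with the same coefficients, and \<open>B x\<close> carries it back. Such
    endomorphisms of \<open>'e\<close> stand in for the map to the coefficients, whose number
    \<open>n\<close> is not a type, and make \<open>smooth_on_inverse_family\<close> applicable. The
    fundamental coefficient at \<open>x\<close> is then the one of \<open>B x w\<close> at the fixed
    point \<open>x0\<close>.\<close>
  define A where "A = (\<lambda>x v. (\<Sum>i<n. k x0 v i *\<^sub>R \<xi> i x) + fund_rep c (b x0 v) x)"
  define B where "B = (\<lambda>x w. (\<Sum>i<n. k x w i *\<^sub>R \<xi> i x0) + fund_rep c (b x w) x0)"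
  have linA: "linear (A x)" if x: "x \<in> N" for x
  proof (rule linearI)
    have lin: "linear (\<lambda>a. fund_rep c a x)" by (rule fund_rep_linear[OF c pt(3)[OF x]])
    show "A x (v + w) = A x v + A x w" for v w
      using add[OF N(3), of v w] by (simp add: A_def scaleR_add_left sum.distrib linear_add[OF lin])
    show "A x (r *\<^sub>R v) = r *\<^sub>R A x v" for r v
      using scale[OF N(3), of r v] by (simp add: A_def scaleR_add_right scaleR_sum_right linear_scale[OF lin])
  qed
  have BA: "B x (A x v) = v" if x: "x \<in> N" for x v
    using kbI[OF x, of "A x v" "k x0 v" "b x0 v"] kb[OF N(3), of v] by (simp add: A_def B_def)
  have AB: "A x (B x w) = w" if x: "x \<in> N" for x w
    using kbI[OF N(3), of "B x w" "k x w" "b x w"] kb[OF x, of w] by (simp add: A_def B_def)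
  have Asm: "smooth_on N (\<lambda>x. A x v)" for v
    unfolding A_def
    by (intro smooth_on_add[OF th] smooth_on_sum[OF th] smooth_on_bounded_linear[OF th bounded_linear_scaleR_right] fsm)
      (use \<xi>sm in auto)
  have Bsm: "smooth_on N (\<lambda>x. B x w)" for w
    by (rule smooth_on_inverse_family[OF th fdQ fdQ linA Asm BA AB])
  have "linear (b x0)" using add[OF N(3)] scale[OF N(3)] by (intro linearI) auto
  then have bsm: "smooth_on N (\<lambda>x. b x0 (B x w))" for w
    using smooth_on_bounded_linear[OF th finite_dim_linear_bounded[OF fdQ] Bsm] by blast
  have "b x0 (B x w) = con_rep c x w" if x: "x \<in> N" for x w
  proof -
    have 1: "b x0 (B x w) = b x w" using kbI[OF N(3), of "B x w" "k x w" "b x w"] by (simp add: B_def)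
    let ?p = "chart_inv c x"
    have "w = components Q c ?p ((\<Sum>i<n. k x w i *\<^sub>R X i ?p) + fundamental P (b x w) ?p)"
      using kb[OF x, of w] unfolding comb[OF x] .
    from arg_cong[OF this, of "from_components Q c x"]
    have "from_components Q c x w = (\<Sum>i<n. k x w i *\<^sub>R X i ?p) + fundamental P (b x w) ?p"
      unfolding from_components(1)[OF Q c pt(3)[OF x]] .
    then have "connection P H (?p, from_components Q c x w) = b x w"
      using inF[OF pt(1)[OF x], of "k x w"] by (intro connection_eqI) simp
    then show ?thesis using 1 by simp
  qed
  then have "smooth_on N (\<lambda>x. con_rep c x w)" for w by (intro smooth_on_transform[OF bsm])
  then show ?thesis using that[OF N(1)] N(2,3) unfolding x0_def by blast
qed

lemma con_rep_smooth:
  assumes c: "c \<in> atlas Q"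
  shows "smooth_on (snd c ` fst c) (\<lambda>x. con_rep c x w)"
proof (rule smooth_on_locally)
  fix x assume "x \<in> snd c ` fst c"
  then obtain q where q: "x = snd c q" "q \<in> fst c" by blast
  obtain N where "open N" "snd c q \<in> N" "N \<subseteq> snd c ` fst c" "\<And>w. smooth_on N (\<lambda>x. con_rep c x w)"
    by (rule con_rep_smooth_locally[OF c q(2)]) blast
  then show "\<exists>U. open U \<and> x \<in> U \<and> smooth_on (snd c ` fst c \<inter> U) (\<lambda>x. con_rep c x w)"
    using q(1) by (intro exI[of _ N]) (auto simp: Int_absorb1)
qed

lemma con_rep_smooth_apply:
  assumes c: "c \<in> atlas Q" and T: "thick T" and x: "smooth_on T x" "x ` T \<subseteq> snd c ` fst c" and w: "smooth_on T w"
  shows "smooth_on T (\<lambda>t. con_rep c (x t) (w t))"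
proof (rule smooth_on_linear_apply[OF T fdQ _ _ w])
  show "linear (con_rep c (x t))" if "t \<in> T" for t using con_rep_linear[OF c] x(2) that by blast
  show "smooth_on T (\<lambda>t. con_rep c (x t) v)" for v by (rule smooth_on_compose[OF T fdQ x(1) con_rep_smooth[OF c] x(2)])
qed

text \<open>A horizontal lift is the preimage of \<open>(X, 0)\<close> under the map sending a
  vector to its projection and its connection value. In coordinates these maps \<open>A x\<close>
  form a smooth family of invertible operators, so the inverse family is smooth.\<close>

lemma hlift_field_smooth:
  assumes X: "smooth_vector_field M U X" and U: "openin (mtop M) U" and c: "c \<in> atlas Q" and q: "q \<in> fst c" "proj P q \<in> U"
  obtains N where "open N" "snd c q \<in> N" "N \<subseteq> snd c ` (proj P -` U \<inter> fst c)" "smooth_on N (local_rep Q c (hlift_field P H X))"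
proof -
  define m where "m = chart_at M (proj P q)"
  have m: "m \<in> atlas M" "proj P q \<in> fst m" unfolding m_def using M by (auto simp: chart_at_atlas chart_at_mem)
  obtain W where W: "open W" "snd c q \<in> W" "\<And>y. y \<in> UNIV \<Longrightarrow> y \<in> fst c \<Longrightarrow> snd c y \<in> W \<Longrightarrow> proj P y \<in> fst m"
    "smooth_on (snd c ` (UNIV \<inter> fst c) \<inter> W) (snd m \<circ> proj P \<circ> chart_inv c)"
    using smooth_map_chart[OF Q M mthick_UNIV[OF Q] proj_smooth UNIV_I c q(1) m] by blast
  define pr where "pr = snd m \<circ> proj P \<circ> chart_inv c"
  define N where "N = snd c ` (proj P -` U \<inter> fst c) \<inter> W"
  have "open (snd c ` (proj P -` U \<inter> fst c))"
    using openin_smooth_vimage[OF Q M proj_smooth U] c unfolding openin_mtop[OF Q] by blast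
  then have N: "open N" "snd c q \<in> N" "N \<subseteq> snd c ` fst c" using W q by (auto simp: N_def)
  have th: "thick N" using thick_open[OF N(1)] .
  have pt: "chart_inv c x \<in> fst c" "proj P (chart_inv c x) \<in> U" "proj P (chart_inv c x) \<in> fst m" "x = snd c (chart_inv c x)" 
    if "x \<in> N" for x
    using that W(3) chart_inv_chart[OF Q c] unfolding N_def by auto
  have prsm: "smooth_on N pr"
    unfolding pr_def by (rule smooth_on_subset[OF fdQ th W(4)]) (auto simp: N_def)
  have Dpr: "frechet_derivative pr (at x) (components Q c (chart_inv c x) v) =
      components M m (proj P (chart_inv c x)) (pi_star P (chart_inv c x) v)" if x: "x \<in> N" for x v
    unfolding pr_def pi_star_def
    using differential_chart(2)[OF Q M openin_UNIV_mtop[OF Q] proj_smooth UNIV_I c pt(1)[OF x] m(1) pt(3)[OF x]] pt(4)[OF x] by simp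
  define A where "A = (\<lambda>x w. (frechet_derivative pr (at x) w, con_rep c x w))"
  define B where "B = (\<lambda>x z. components Q c (chart_inv c x)
      (hlift P H (chart_inv c x) (from_components M m (pr x) (fst z)) + fundamental P (snd z) (chart_inv c x)))"
  have linA: "linear (A x)" if x: "x \<in> N" for x
  proof -
    have 1: "linear (frechet_derivative pr (at x))" using smooth_on_has_derivative[OF N(1) prsm x] has_derivative_linear by blast
    have 2: "linear (con_rep c x)" using con_rep_linear[OF c] x N(3) by blast
    show ?thesis unfolding A_def
      by (rule linearI) (simp_all add: linear_add[OF 1] linear_scale[OF 1] linear_add[OF 2] linear_scale[OF 2])
  qed
  have Asm: "smooth_on N (\<lambda>x. A x w)" for w
    unfolding A_def
    by (intro smooth_on_Pair[OF th] smooth_on_frechet_derivative[OF N(1) prsm] smooth_on_subset[OF fdQ th con_rep_smooth[OF c] N(3)])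
  have prx: "pr x = snd m (proj P (chart_inv c x))" "pr x \<in> snd m ` fst m" "chart_inv m (pr x) = proj P (chart_inv c x)" if x: "x \<in> N" for x
    using pt(3)[OF x] chart_inv_chart[OF M m(1)] by (auto simp: pr_def)
  have ABcomp: "A x (components Q c (chart_inv c x) v) =
      (components M m (proj P (chart_inv c x)) (pi_star P (chart_inv c x) v), connection P H (chart_inv c x, v))" if x: "x \<in> N" for x v
    unfolding A_def Dpr[OF x] using con_rep_components[OF c pt(1)[OF x], of v] pt(4)[OF x] by simp
  have AB: "A x (B x z) = z" if x: "x \<in> N" for x z
  proof -
    let ?p = "chart_inv c x"
    let ?h = "hlift P H ?p (from_components M m (pr x) (fst z))"
    have h: "(?p, ?h) \<in> H" "pi_star P ?p ?h = from_components M m (pr x) (fst z)" using hlift by blast+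
    have "connection P H (?p, ?h + fundamental P (snd z) ?p) = snd z" by (rule connection_eqI) (use h(1) in simp)
    moreover have "pi_star P ?p (?h + fundamental P (snd z) ?p) = from_components M m (pr x) (fst z)"
      using h(2) by (simp add: linear_add[OF pi_star_linear] pi_star_fundamental)
    moreover have "components M m (proj P ?p) (from_components M m (pr x) (fst z)) = fst z"
      using from_components(2)[OF M m(1) prx(2)[OF x], of "fst z"] prx(3)[OF x] by simp
    ultimately show ?thesis unfolding B_def ABcomp[OF x] by simp
  qed
  have BA: "B x (A x w) = w" if x: "x \<in> N" for x w
  proof -
    let ?p = "chart_inv c x"
    define v where "v = from_components Q c x w"
    have xc: "x \<in> snd c ` fst c" using x N(3) by blast
    have w: "w = components Q c ?p v" using from_components(2)[OF Q c xc] by (simp add: v_def)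
    define a where "a = connection P H (?p, v)"
    have h: "(?p, v - fundamental P a ?p) \<in> H" using connection_horizontal by (simp add: a_def)
    have "from_components M m (pr x) (components M m (proj P ?p) (pi_star P ?p v)) = pi_star P ?p v"
      using from_components(1)[OF M m(1) prx(2)[OF x], of "pi_star P ?p v"] prx(3)[OF x] by simp
    moreover have "hlift P H ?p (pi_star P ?p v) = v - fundamental P a ?p"
      by (rule hlift_eqI[OF h]) (simp add: linear_diff[OF pi_star_linear] pi_star_fundamental)
    ultimately show ?thesis unfolding w ABcomp[OF x] by (simp add: B_def a_def)
  qed
  have Bsm: "smooth_on N (\<lambda>x. B x z)" for z
    by (rule smooth_on_inverse_family[OF th fdQ finite_dim_prod[OF fdM fdS] linA Asm BA AB])
  have linB: "linear (B x)" if x: "x \<in> N" for x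
    by (rule linear_two_sided_inverse[OF linA[OF x]]) (use BA AB x in auto)
  have "smooth_on N (\<lambda>x. local_rep M m X (pr x))"
  proof (rule smooth_on_compose[OF th fdM prsm smooth_vector_field_local_rep[OF M U X m(1)]])
    show "pr ` N \<subseteq> snd m ` (U \<inter> fst m)" using prx(1) pt(2,3) by auto
  qed
  then have "smooth_on N (\<lambda>x. B x (local_rep M m X (pr x), 0))"
    by (intro smooth_on_linear_apply[OF th finite_dim_prod[OF fdM fdS] linB Bsm] smooth_on_Pair[OF th] smooth_on_const[OF th])
  moreover have "B x (local_rep M m X (pr x), 0) = local_rep Q c (hlift_field P H X) x" if x: "x \<in> N" for x
  proof -
    have "from_components M m (pr x) (local_rep M m X (pr x)) = X (proj P (chart_inv c x))"
      using from_components(1)[OF M m(1) prx(2)[OF x], of "X (proj P (chart_inv c x))"] prx(3)[OF x] by (simp add: local_rep_eq)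
    then show ?thesis unfolding B_def local_rep_eq[of Q] hlift_field_def by (simp add: linear_0[OF fundamental_linear])
  qed
  ultimately have "smooth_on N (local_rep Q c (hlift_field P H X))" by (rule smooth_on_transform)
  then show ?thesis using that[OF N(1,2)] by (auto simp: N_def)
qed

text \<open>\<open>w\<close> is the argument of the form and \<open>u\<close> the direction of
  differentiation, so \<open>dcon c x w u - dcon c x u w\<close> is
  \<open>- d\<omega>(w, u)\<close>.\<close>

definition dcon where
  "dcon c x w u = frechet_derivative (\<lambda>x. con_rep c x w) (at x) u"

context
  fixes c assumes c: "c \<in> atlas Q"
begin

lemma dcon_has_derivative:
  "x \<in> snd c ` fst c \<Longrightarrow> ((\<lambda>x. con_rep c x w) has_derivative dcon c x w) (at x)"
  unfolding dcon_def by (rule smooth_on_has_derivative[OF chart_open[OF Q c] con_rep_smooth[OF c]])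

lemma dcon_linear: "x \<in> snd c ` fst c \<Longrightarrow> linear (dcon c x w)"
  using dcon_has_derivative has_derivative_linear by blast

lemma dcon_add:
  assumes x: "x \<in> snd c ` fst c"
  shows "dcon c x (w + w') u = dcon c x w u + dcon c x w' u"
proof -
  have "((\<lambda>x. con_rep c x w + con_rep c x w') has_derivative (\<lambda>u. dcon c x w u + dcon c x w' u)) (at x)"
    by (intro has_derivative_add dcon_has_derivative x)
  then have "((\<lambda>x. con_rep c x (w + w')) has_derivative (\<lambda>u. dcon c x w u + dcon c x w' u)) (at x)"
    by (rule has_derivative_transform_within_open[OF _ chart_open[OF Q c] x]) (simp add: linear_add[OF con_rep_linear[OF c]])
  from has_derivative_unique[OF this dcon_has_derivative[OF x]] show ?thesis by metis
qed

lemma con_rep_product_rule: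
  assumes x: "(x has_derivative x') (at t within I)" and w: "(w has_derivative w') (at t within I)"
    and xt: "x t \<in> snd c ` fst c"
  shows "((\<lambda>s. con_rep c (x s) (w s)) has_derivative (\<lambda>h. dcon c (x t) (w t) (x' h) + con_rep c (x t) (w' h))) (at t within I)"
  unfolding dcon_def
  by (rule linear_family_product_rule[OF fdQ chart_open[OF Q c] con_rep_linear[OF c] con_rep_smooth[OF c] x w xt])

lemma con_rep_field:
  assumes Y: "(Y has_derivative Y') (at x)" and N: "open N" "x \<in> N" "N \<subseteq> snd c ` fst c"
    and k: "\<And>y. y \<in> N \<Longrightarrow> con_rep c y (Y y) = k"
  shows "dcon c x (Y x) u + con_rep c x (Y' u) = 0"
proof -
  have 1: "((\<lambda>y. con_rep c y (Y y)) has_derivative (\<lambda>h. dcon c x (Y x) h + con_rep c x (Y' h))) (at x)"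
    by (rule con_rep_product_rule[OF has_derivative_ident Y]) (use N in auto)
  have 2: "((\<lambda>y. con_rep c y (Y y)) has_derivative (\<lambda>h. 0)) (at x)"
    by (rule has_derivative_transform_within_open[OF has_derivative_const[of k] N(1,2)]) (use k in simp)
  from fun_cong[OF has_derivative_unique[OF 1 2], of u] show ?thesis .
qed

end

text \<open>With \<open>\<omega>(X)\<close> and \<open>\<omega>(Y)\<close> constant near
  \<open>q\<close>, the formula \<open>d\<omega>(X, Y) = X \<omega>(Y) - Y \<omega>(X) -
  \<omega>([X, Y])\<close> loses its first two terms. It is used with horizontal lifts, where the
  constant is \<open>0\<close>, and with fundamental fields, where it is \<open>a\<close>.\<close>

lemma connection_bracket:
  assumes c: "c = chart_at Q q" and N: "open N" "snd c q \<in> N" "N \<subseteq> snd c ` fst c"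
    and X: "smooth_on N (local_rep Q c X)" "\<And>y. y \<in> N \<Longrightarrow> con_rep c y (local_rep Q c X y) = k"
    and Y: "smooth_on N (local_rep Q c Y)" "\<And>y. y \<in> N \<Longrightarrow> con_rep c y (local_rep Q c Y y) = l"
  shows "connection P H (q, lie_bracket Q X Y q) =
    dcon c (snd c q) (X q) (Y q) - dcon c (snd c q) (Y q) (X q)"
proof -
  let ?X = "local_rep Q c X" and ?Y = "local_rep Q c Y" and ?x = "snd c q"
  have ca: "c \<in> atlas Q" "q \<in> fst c" using Q by (auto simp: c chart_at_atlas chart_at_mem)
  have x: "?x \<in> snd c ` fst c" using N by blast
  have val: "?X ?x = X q" "?Y ?x = Y q"
    using chart_inv_chart[OF Q ca] components_chart_at[OF Q] by (simp_all add: local_rep_eq c)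
  have con: "connection P H (q, v) = con_rep c ?x v" for v
    using con_rep_components[OF ca, of v] components_chart_at[OF Q, of q v] by (simp add: c)
  have "dcon c ?x (?X ?x) u + con_rep c ?x (frechet_derivative ?X (at ?x) u) = 0" for u
    by (rule con_rep_field[OF ca(1) smooth_on_has_derivative[OF N(1) X(1) N(2)] N X(2)])
  moreover have "dcon c ?x (?Y ?x) u + con_rep c ?x (frechet_derivative ?Y (at ?x) u) = 0" for u
    by (rule con_rep_field[OF ca(1) smooth_on_has_derivative[OF N(1) Y(1) N(2)] N Y(2)])
  ultimately have e: "con_rep c ?x (frechet_derivative ?X (at ?x) u) = - dcon c ?x (X q) u"
    "con_rep c ?x (frechet_derivative ?Y (at ?x) u) = - dcon c ?x (Y q) u" for u
    by (simp_all add: val eq_neg_iff_add_eq_0 add.commute)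
  have lb: "lie_bracket Q X Y q = frechet_derivative ?Y (at ?x) (X q) - frechet_derivative ?X (at ?x) (Y q)"
    by (simp add: lie_bracket_def Let_def c[symmetric] val)
  show ?thesis unfolding lb con linear_diff[OF con_rep_linear[OF ca(1) x]] e by simp
qed

lemma hlift_field_horizontal:
  assumes "c \<in> atlas Q" "x \<in> snd c ` fst c"
  shows "con_rep c x (local_rep Q c (hlift_field P H X) x) = 0"
  using from_components(1)[OF Q assms] hlift(1) connection_zero_iff by (simp add: local_rep_eq hlift_field_def)

text \<open>The lift of the bracket on the base is horizontal and killed by \<omega>. What remains
  is \<open>- d\<omega>\<close>, which involves only the values of the fields at \<open>q\<close>;
  this is the independence of the extensions that the description by \<open>THE\<close>
  requires.\<close>

lemma curvature_eq:
  assumes c_def: "c = chart_at Q q"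
  shows "curvature P H q X Y =
    dcon c (snd c q) (hlift P H q X) (hlift P H q Y) - dcon c (snd c q) (hlift P H q Y) (hlift P H q X)" (is "_ = ?r")
proof -
  have ca: "c \<in> atlas Q" "q \<in> fst c" using Q by (auto simp: c_def chart_at_atlas chart_at_mem)
  have val: "connection P H (q, lie_bracket Q (hlift_field P H X') (hlift_field P H Y') q
      - hlift_field P H (lie_bracket M X' Y') q) = ?r"
    if UX: "openin (mtop M) U" "proj P q \<in> U" "smooth_vector_field M U X'" "smooth_vector_field M U Y'"
      "X' (proj P q) = X" "Y' (proj P q) = Y" for U X' Y'
  proof -
    obtain N1 where N1: "open N1" "snd c q \<in> N1" "N1 \<subseteq> snd c ` (proj P -` U \<inter> fst c)" "smooth_on N1 (local_rep Q c (hlift_field P H X'))"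
      by (rule hlift_field_smooth[OF UX(3,1) ca UX(2)])
    obtain N2 where N2: "open N2" "snd c q \<in> N2" "N2 \<subseteq> snd c ` (proj P -` U \<inter> fst c)" "smooth_on N2 (local_rep Q c (hlift_field P H Y'))"
      by (rule hlift_field_smooth[OF UX(4,1) ca UX(2)])
    have N: "open (N1 \<inter> N2)" "snd c q \<in> N1 \<inter> N2" "N1 \<inter> N2 \<subseteq> snd c ` fst c" using N1 N2 by auto
    have th: "thick (N1 \<inter> N2)" using thick_open[OF N(1)] .
    have "connection P H (q, lie_bracket Q (hlift_field P H X') (hlift_field P H Y') q) =
      dcon c (snd c q) (hlift_field P H X' q) (hlift_field P H Y' q) - dcon c (snd c q) (hlift_field P H Y' q) (hlift_field P H X' q)"
    proof (rule connection_bracket[OF c_def N])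
      show "smooth_on (N1 \<inter> N2) (local_rep Q c (hlift_field P H X'))" by (rule smooth_on_subset[OF fdQ th N1(4)]) simp
      show "smooth_on (N1 \<inter> N2) (local_rep Q c (hlift_field P H Y'))" by (rule smooth_on_subset[OF fdQ th N2(4)]) simp
      show "con_rep c y (local_rep Q c (hlift_field P H X') y) = 0" if "y \<in> N1 \<inter> N2" for y
        by (rule hlift_field_horizontal[OF ca(1) subsetD[OF N(3) that]])
      show "con_rep c y (local_rep Q c (hlift_field P H Y') y) = 0" if "y \<in> N1 \<inter> N2" for y
        by (rule hlift_field_horizontal[OF ca(1) subsetD[OF N(3) that]])
    qed
    moreover have "connection P H (q, hlift_field P H (lie_bracket M X' Y') q) = 0"
      using connection_zero_iff hlift(1) by (simp add: hlift_field_def)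
    ultimately show ?thesis
      using linear_diff[OF connection_linear, of q] UX(5,6) by (simp add: hlift_field_def)
  qed
  obtain U X' where U: "openin (mtop M) U" "proj P q \<in> U" "smooth_vector_field M U X'" "X' (proj P q) = X"
    by (rule vector_field_extension[OF M])
  obtain V Y' where V: "openin (mtop M) V" "proj P q \<in> V" "smooth_vector_field M V Y'" "Y' (proj P q) = Y"
    by (rule vector_field_extension[OF M])
  have UV: "openin (mtop M) (U \<inter> V)" using U(1) V(1) by (rule openin_Int)
  note TM = premanifold_tangent_bundle[OF M]
  have "smooth_vector_field M (U \<inter> V) X'" "smooth_vector_field M (U \<inter> V) Y'"
    using smooth_map_subset[OF M TM openin_mthick[OF M UV] openin_mthick[OF M U(1)] U(3)[unfolded smooth_vector_field_def]]
      smooth_map_subset[OF M TM openin_mthick[OF M UV] openin_mthick[OF M V(1)] V(3)[unfolded smooth_vector_field_def]]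
    unfolding smooth_vector_field_def by blast+
  then have ex: "\<exists>U X' Y'. openin (mtop M) U \<and> proj P q \<in> U \<and>
        smooth_vector_field M U X' \<and> smooth_vector_field M U Y' \<and> X' (proj P q) = X \<and> Y' (proj P q) = Y"
    using UV U V by blast
  show ?thesis unfolding curvature_def
  proof (rule the_equality)
    show "\<forall>U X' Y'. openin (mtop M) U \<and> proj P q \<in> U \<and>
        smooth_vector_field M U X' \<and> smooth_vector_field M U Y' \<and>
        X' (proj P q) = X \<and> Y' (proj P q) = Y \<longrightarrow>
        ?r = connection P H (q, lie_bracket Q (hlift_field P H X') (hlift_field P H Y') q
                               - hlift_field P H (lie_bracket M X' Y') q)"
      by (intro allI impI, elim conjE) (rule val[symmetric])
    fix r assume r: "\<forall>U X' Y'. openin (mtop M) U \<and> proj P q \<in> U \<and>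
        smooth_vector_field M U X' \<and> smooth_vector_field M U Y' \<and>
        X' (proj P q) = X \<and> Y' (proj P q) = Y \<longrightarrow>
        r = connection P H (q, lie_bracket Q (hlift_field P H X') (hlift_field P H Y') q
                               - hlift_field P H (lie_bracket M X' Y') q)"
    from ex obtain U X' Y' where e: "openin (mtop M) U \<and> proj P q \<in> U \<and>
        smooth_vector_field M U X' \<and> smooth_vector_field M U Y' \<and> X' (proj P q) = X \<and> Y' (proj P q) = Y"
      by (elim exE)
    have "connection P H (q, lie_bracket Q (hlift_field P H X') (hlift_field P H Y') q
      - hlift_field P H (lie_bracket M X' Y') q) = ?r"
      by (rule val[of U X' Y']) (use e in simp_all)
    with r[THEN spec, THEN spec, THEN spec, THEN mp, OF e] show "r = ?r" by simp
  qed
qed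

end

section \<open>Invariant connections\<close>

locale invariant_horizontal = horizontal +
  assumes invariant: "G_invariant P H"
begin

lemma right_act_horizontal:
  assumes "(q, v) \<in> H"
  shows "differential Q Q (\<lambda>p. act P p g) q v = hlift P H (act P q g) (pi_star P q v)"
  using invariant hlift_eqI[OF assms refl] unfolding G_invariant_def by metis

text \<open>By invariance the lift along the orbit of \<open>q\<close> is the translate of its value
  at \<open>q\<close>. Differentiating its components along the orbit in two ways, by the chain rule
  and by the flow rule of \<open>fund_rep_smooth_and_flow\<close>, produces the two terms of the
  bracket, which therefore cancel.\<close>

lemma lie_bracket_hlift_fundamental:
  assumes U: "openin (mtop M) U" "proj P q \<in> U" and X: "smooth_vector_field M U X"
  shows "lie_bracket Q (hlift_field P H X) (fundamental P a) q = 0"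
proof -
  define c where "c = chart_at Q q"
  let ?x = "snd c q" and ?X = "local_rep Q c (hlift_field P H X)"
  have ca: "c \<in> atlas Q" "q \<in> fst c" using Q by (auto simp: c_def chart_at_atlas chart_at_mem)
  obtain N where N: "open N" "?x \<in> N" "N \<subseteq> snd c ` (proj P -` U \<inter> fst c)" "smooth_on N ?X"
    by (rule hlift_field_smooth[OF X U(1) ca U(2)])
  obtain \<gamma> where \<gamma>: "one_param_subgroup S G a \<gamma>" by (rule one_param_obtain)
  define v where "v = hlift_field P H X q"
  have v: "(q, v) \<in> H" "pi_star P q v = X (proj P q)" using hlift by (simp_all add: v_def hlift_field_def)
  have comp: "components Q c q v = v" for v using components_chart_at[OF Q] by (simp add: c_def)
  obtain d where d: "d > 0" "\<And>t. \<bar>t\<bar> < d \<Longrightarrow> act P q (\<gamma> t) \<in> fst c"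
    and f1: "((\<lambda>t. snd c (act P q (\<gamma> t))) has_vector_derivative fund_rep c a ?x) (at 0)"
    and f2: "((\<lambda>t. components Q c (act P q (\<gamma> t)) (differential Q Q (\<lambda>p. act P p (\<gamma> t)) q v)) has_vector_derivative
        frechet_derivative (fund_rep c a) (at ?x) v) (at 0)"
    using fund_rep_smooth_and_flow(2)[OF ca \<gamma>, of v] unfolding comp by blast
  have "((\<lambda>t. ?X (snd c (act P q (\<gamma> t)))) has_vector_derivative frechet_derivative ?X (at ?x) (fund_rep c a ?x)) (at 0)"
    by (rule has_vector_derivative_compose_has_derivative[OF f1])
      (use smooth_on_has_derivative[OF N(1,4,2)] one_param_0[OF \<gamma>] in simp)
  moreover have "?X (snd c (act P q (\<gamma> t))) = components Q c (act P q (\<gamma> t)) (differential Q Q (\<lambda>p. act P p (\<gamma> t)) q v)"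
    if "t \<in> ball 0 d" for t
    using d(2)[of t] that chart_inv_chart[OF Q ca(1)] right_act_horizontal[OF v(1)] v(2)
    by (simp add: local_rep_eq hlift_field_def)
  ultimately have "((\<lambda>t. components Q c (act P q (\<gamma> t)) (differential Q Q (\<lambda>p. act P p (\<gamma> t)) q v)) has_vector_derivative
      frechet_derivative ?X (at ?x) (fund_rep c a ?x)) (at 0)"
    by (rule has_vector_derivative_transform_within_open[OF _ open_ball centre_in_ball[THEN iffD2, OF d(1)]])
  then have "frechet_derivative ?X (at ?x) (fund_rep c a ?x) = frechet_derivative (fund_rep c a) (at ?x) v"
    using f2 vector_derivative_unique_at by blast
  moreover have "?X ?x = v" using chart_inv_chart[OF Q ca] comp by (simp add: local_rep_eq v_def)
  ultimately show ?thesis by (simp add: lie_bracket_def Let_def c_def[symmetric])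
qed

lemma tensor_B_zero: "tensor_B P H q X a = 0"
  unfolding tensor_B_def
proof (rule the_equality)
  have z: "connection P H (q, 0) = 0" using linear_0[OF connection_linear] .
  show "\<forall>U X'. openin (mtop M) U \<and> proj P q \<in> U \<and>
        smooth_vector_field M U X' \<and> X' (proj P q) = X \<longrightarrow>
        0 = connection P H (q, lie_bracket Q (hlift_field P H X') (fundamental P a) q)"
  proof (intro allI impI, elim conjE)
    fix U X' assume "openin (mtop M) U" "proj P q \<in> U" "smooth_vector_field M U X'"
    from lie_bracket_hlift_fundamental[OF this]
    show "0 = connection P H (q, lie_bracket Q (hlift_field P H X') (fundamental P a) q)" using z by simp
  qed
  fix r assume r: "\<forall>U X'. openin (mtop M) U \<and> proj P q \<in> U \<and>
        smooth_vector_field M U X' \<and> X' (proj P q) = X \<longrightarrow>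
        r = connection P H (q, lie_bracket Q (hlift_field P H X') (fundamental P a) q)"
  obtain U X' where "openin (mtop M) U" "proj P q \<in> U" "smooth_vector_field M U X'" "X' (proj P q) = X"
    by (rule vector_field_extension[OF M])
  then show "r = 0" using r[THEN spec, THEN spec, THEN mp, of U X'] lie_bracket_hlift_fundamental[of U q X' a] z by simp
qed

text \<open>This says that \<open>d\<omega>\<close> vanishes on a horizontal and a fundamental
  vector: it is \<omega> of the vanishing bracket of the corresponding fields. Vertical parts of
  generators drop out of the curvature term for this reason.\<close>

lemma dcon_fundamental:
  assumes c_def: "c = chart_at Q q" and v: "(q, v) \<in> H"
  shows "dcon c (snd c q) v (fundamental P a q) = dcon c (snd c q) (fundamental P a q) v"
proof -
  have ca: "c \<in> atlas Q" "q \<in> fst c" using Q by (auto simp: c_def chart_at_atlas chart_at_mem)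
  obtain U X where U: "openin (mtop M) U" "proj P q \<in> U" "smooth_vector_field M U X" "X (proj P q) = pi_star P q v"
    by (rule vector_field_extension[OF M])
  obtain N where N: "open N" "snd c q \<in> N" "N \<subseteq> snd c ` (proj P -` U \<inter> fst c)" "smooth_on N (local_rep Q c (hlift_field P H X))"
    by (rule hlift_field_smooth[OF U(3,1) ca U(2)])
  have Nc: "N \<subseteq> snd c ` fst c" using N(3) by blast
  have "hlift_field P H X q = v" using hlift_eqI[OF v refl] U(4) by (simp add: hlift_field_def)
  moreover have "connection P H (q, lie_bracket Q (hlift_field P H X) (fundamental P a) q) =
     dcon c (snd c q) (hlift_field P H X q) (fundamental P a q) - dcon c (snd c q) (fundamental P a q) (hlift_field P H X q)"
  proof (rule connection_bracket[OF c_def N(1,2) Nc N(4)])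
    show "smooth_on N (fund_rep c a)" by (rule smooth_on_subset[OF fdQ thick_open[OF N(1)] fund_rep_smooth[OF ca(1)] Nc])
    show "con_rep c y (local_rep Q c (hlift_field P H X) y) = 0" if "y \<in> N" for y
      by (rule hlift_field_horizontal[OF ca(1) subsetD[OF Nc that]])
    show "con_rep c y (fund_rep c a y) = a" if "y \<in> N" for y
      by (rule con_rep_fund_rep[OF ca(1) subsetD[OF Nc that]])
  qed
  moreover have "connection P H (q, lie_bracket Q (hlift_field P H X) (fundamental P a) q) = 0"
    using lie_bracket_hlift_fundamental[OF U(1-3)] linear_0[OF connection_linear] by simp
  ultimately show ?thesis by simp
qed

end

section \<open>Variations\<close>

text \<open>With the test function \<open>(t - t\<^sub>0) (t\<^sub>1 - t) u t\<close>, where \<open>u\<close> is the Euler-Lagrange expression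
  itself, no bump functions are needed.\<close>

lemma du_Bois_Reymond:
  fixes C A :: "real \<Rightarrow> 'h::real_normed_vector \<Rightarrow>\<^sub>L real"
  assumes fd: "finite_dim TYPE('h)" and t01: "t0 < t1"
    and C: "\<And>e. smooth_on {t0..t1} (\<lambda>t. blinfun_apply (C t) e)"
    and A: "\<And>e. smooth_on {t0..t1} (\<lambda>t. blinfun_apply (A t) e)"
    and int: "\<And>\<beta>. smooth_on {t0..t1} \<beta> \<Longrightarrow> \<beta> t0 = 0 \<Longrightarrow> \<beta> t1 = 0 \<Longrightarrow>
      integral {t0..t1} (\<lambda>t. blinfun_apply (A t) (\<beta> t) + blinfun_apply (C t) (vector_derivative \<beta> (at t within {t0..t1}))) = 0"
    and t: "t \<in> {t0..t1}"
  shows "(C has_vector_derivative A t) (at t within {t0..t1})"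
proof (rule blinfun_has_vector_derivativeI[OF fd])
  fix e :: 'h
  let ?I = "{t0..t1}"
  have th: "thick ?I" using thick_interval[OF t01] .
  define p where "p = (\<lambda>t. blinfun_apply (C t) e)"
  define a where "a = (\<lambda>t. blinfun_apply (A t) e)"
  define p' where "p' = (\<lambda>t. vector_derivative p (at t within ?I))"
  define u where "u = (\<lambda>t. a t - p' t)"
  define \<psi> where "\<psi> = (\<lambda>t. ((t - t0) * (t1 - t)) * u t)"
  define \<psi>' where "\<psi>' = (\<lambda>t. vector_derivative \<psi> (at t within ?I))"
  have psm: "smooth_on ?I p" and asm: "smooth_on ?I a" using C A unfolding p_def a_def by blast+
  have p'sm: "smooth_on ?I p'" unfolding p'_def by (rule smooth_on_vector_derivative[OF th psm])
  have usm: "smooth_on ?I u" unfolding u_def by (intro smooth_on_diff th asm p'sm)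
  have \<psi>sm: "smooth_on ?I \<psi>" unfolding \<psi>_def
    by (intro smooth_on_bilinear[OF th bounded_bilinear_mult] smooth_on_diff th smooth_on_id smooth_on_const usm)
  have pd: "(p has_vector_derivative p' t) (at t within ?I)" if "t \<in> ?I" for t
    unfolding p'_def using smooth_on_has_vector_derivative[OF psm that] .
  have \<psi>d: "(\<psi> has_vector_derivative \<psi>' t) (at t within ?I)" if "t \<in> ?I" for t
    unfolding \<psi>'_def using smooth_on_has_vector_derivative[OF \<psi>sm that] .
  have \<psi>'sm: "smooth_on ?I \<psi>'" unfolding \<psi>'_def by (rule smooth_on_vector_derivative[OF th \<psi>sm])
  have \<beta>sm: "smooth_on ?I (\<lambda>t. \<psi> t *\<^sub>R e)" by (rule smooth_on_bounded_linear[OF th bounded_linear_scaleR_left \<psi>sm])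
  have "((\<lambda>t. \<psi> t *\<^sub>R e) has_vector_derivative \<psi>' t *\<^sub>R e) (at t within ?I)" if "t \<in> ?I" for t
    by (rule bounded_linear.has_vector_derivative[OF bounded_linear_scaleR_left \<psi>d[OF that]])
  then have \<beta>d: "vector_derivative (\<lambda>t. \<psi> t *\<^sub>R e) (at t within ?I) = \<psi>' t *\<^sub>R e" if "t \<in> ?I" for t
    using thick_vector_derivative[OF th that] that by blast
  have "integral ?I (\<lambda>t. blinfun_apply (A t) (\<psi> t *\<^sub>R e) + blinfun_apply (C t) (vector_derivative (\<lambda>t. \<psi> t *\<^sub>R e) (at t within ?I))) = 0"
    by (rule int[OF \<beta>sm]) (simp_all add: \<psi>_def)
  then have i1: "integral ?I (\<lambda>t. \<psi> t * a t + \<psi>' t * p t) = 0"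
    by (subst (asm) integral_cong[where g = "\<lambda>t. \<psi> t * a t + \<psi>' t * p t"])
      (simp_all add: \<beta>d blinfun.scaleR_right a_def p_def)
  \<comment> \<open>Integration by parts without boundary terms, since \<open>\<psi>\<close>
    vanishes at both ends. Subtracting it from the hypothesis leaves the integral of
    \<open>\<psi> t * u t\<close>, a square with a nonnegative weight.\<close>
  have "((\<lambda>t. \<psi> t * p' t + \<psi>' t * p t) has_integral (\<psi> t1 * p t1 - \<psi> t0 * p t0)) ?I"
    by (rule fundamental_theorem_of_calculus[OF less_imp_le[OF t01]])
      (rule has_vector_derivative_mult[OF \<psi>d pd])
  then have i2: "((\<lambda>t. \<psi> t * p' t + \<psi>' t * p t) has_integral 0) ?I" by (simp add: \<psi>_def)
  note cont = smooth_on_imp_continuous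
  have "continuous_on ?I (\<lambda>t. \<psi> t * a t + \<psi>' t * p t)"
    by (intro continuous_intros cont \<psi>sm asm \<psi>'sm psm)
  then have "((\<lambda>t. \<psi> t * a t + \<psi>' t * p t) has_integral 0) ?I"
    using i1 integrable_continuous_interval integrable_integral by metis
  from has_integral_diff[OF this i2] have "((\<lambda>t. ((t - t0) * (t1 - t)) * (u t * u t)) has_integral 0) ?I"
    by (simp add: \<psi>_def u_def algebra_simps)
  then have "integral ?I (\<lambda>t. ((t - t0) * (t1 - t)) * (u t * u t)) = 0" by (rule integral_unique)
  moreover have "continuous_on ?I (\<lambda>t. ((t - t0) * (t1 - t)) * (u t * u t))" by (intro continuous_intros cont usm)
  ultimately have z: "\<forall>t\<in>?I. ((t - t0) * (t1 - t)) * (u t * u t) = 0"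
    by (subst (asm) integral_eq_0_iff[OF _ t01]) auto
  have uz: "u t = 0" if "t \<in> {t0<..<t1}" for t using bspec[OF z, of t] that by auto
  \<comment> \<open>The weight vanishes at the end points, so these are reached by continuity of
    \<open>u\<close>.\<close>
  have "u t = 0"
  proof (rule continuous_constant_on_closure[where f = u and S = "{t0<..<t1}" and a = 0 and x = t])
    show "continuous_on (closure {t0<..<t1}) u" using cont[OF usm] t01 by simp
    show "t \<in> closure {t0<..<t1}" using t t01 by simp
  qed (rule uz)
  then have "a t = p' t" by (simp add: u_def)
  then show "((\<lambda>s. blinfun_apply (C s) e) has_vector_derivative blinfun_apply (A t) e) (at t within ?I)"
    using pd[OF t] by (simp add: p_def a_def)
qed

text \<open>The integrand is the derivative of the pairing of \<open>C\<close> with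
  \<open>\<beta>\<close>, which vanishes at both ends.\<close>

lemma Euler_Lagrange_integral_zero:
  fixes C A :: "real \<Rightarrow> 'h::real_normed_vector \<Rightarrow>\<^sub>L real"
  assumes t01: "t0 < t1" and C: "\<And>t. t \<in> {t0..t1} \<Longrightarrow> (C has_vector_derivative A t) (at t within {t0..t1})"
    and \<beta>: "smooth_on {t0..t1} \<beta>" "\<beta> t0 = 0" "\<beta> t1 = 0"
  shows "((\<lambda>t. blinfun_apply (A t) (\<beta> t) + blinfun_apply (C t) (vector_derivative \<beta> (at t within {t0..t1}))) has_integral 0) {t0..t1}"
proof -
  have "((\<lambda>t. blinfun_apply (C t) (vector_derivative \<beta> (at t within {t0..t1})) + blinfun_apply (A t) (\<beta> t)) has_integral
      (blinfun_apply (C t1) (\<beta> t1) - blinfun_apply (C t0) (\<beta> t0))) {t0..t1}"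
    by (rule fundamental_theorem_of_calculus[OF less_imp_le[OF t01]])
      (rule bounded_bilinear.has_vector_derivative[OF bounded_bilinear_blinfun_apply C smooth_on_has_vector_derivative[OF \<beta>(1)]])
  then show ?thesis using \<beta> by (simp add: add.commute)
qed

section \<open>Fundamental fields along curves\<close>

context principal
begin

lemma fund_rep_derivative_add:
  assumes c: "c \<in> atlas Q" and x: "x \<in> snd c ` fst c"
  shows "linear (\<lambda>a. frechet_derivative (fund_rep c a) (at x) u)"
proof -
  note d = smooth_on_has_derivative[OF chart_open[OF Q c] fund_rep_smooth[OF c] x]
  note lin = fund_rep_linear[OF c]
  show ?thesis
  proof (rule linearI)
    fix a b r
    have 1: "(fund_rep c (a + b) has_derivative (\<lambda>u. frechet_derivative (fund_rep c a) (at x) u + frechet_derivative (fund_rep c b) (at x) u)) (at x)"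
      by (rule has_derivative_transform_within_open[OF has_derivative_add[OF d d] chart_open[OF Q c] x]) (simp add: linear_add[OF lin])
    from fun_cong[OF has_derivative_unique[OF d 1]]
    show "frechet_derivative (fund_rep c (a + b)) (at x) u = frechet_derivative (fund_rep c a) (at x) u + frechet_derivative (fund_rep c b) (at x) u" .
    have 2: "(fund_rep c (r *\<^sub>R a) has_derivative (\<lambda>u. r *\<^sub>R frechet_derivative (fund_rep c a) (at x) u)) (at x)"
      by (rule has_derivative_transform_within_open[OF has_derivative_scaleR_right[OF d] chart_open[OF Q c] x]) (simp add: linear_scale[OF lin])
    from fun_cong[OF has_derivative_unique[OF d 2]]
    show "frechet_derivative (fund_rep c (r *\<^sub>R a)) (at x) u = r *\<^sub>R frechet_derivative (fund_rep c a) (at x) u" .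
  qed
qed

lemma fund_rep_smooth_apply:
  assumes c: "c \<in> atlas Q" and T: "thick T" and x: "smooth_on T x" "x ` T \<subseteq> snd c ` fst c" and b: "smooth_on T b"
  shows "smooth_on T (\<lambda>t. fund_rep c (b t) (x t))"
proof (rule smooth_on_linear_apply[OF T fdS _ _ b, where A = "\<lambda>t a. fund_rep c a (x t)"])
  show "linear (\<lambda>a. fund_rep c a (x t))" if "t \<in> T" for t using fund_rep_linear[OF c] x(2) that by blast
  show "smooth_on T (\<lambda>t. fund_rep c a (x t))" for a by (rule smooth_on_compose[OF T fdQ x(1) fund_rep_smooth[OF c] x(2)])
qed

lemma fund_rep_product_rule:
  assumes c: "c \<in> atlas Q" and x: "(x has_vector_derivative x') (at t within I)" and b: "(b has_vector_derivative b') (at t within I)"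
    and xt: "x t \<in> snd c ` fst c"
  shows "((\<lambda>s. fund_rep c (b s) (x s)) has_vector_derivative
    (frechet_derivative (fund_rep c (b t)) (at (x t)) x' + fund_rep c b' (x t))) (at t within I)"
  by (rule linear_family_vector_product_rule[where A = "\<lambda>x a. fund_rep c a x",
        OF fdS chart_open[OF Q c] fund_rep_linear[OF c] fund_rep_smooth[OF c] x b xt])

lemma add_fundamental_smooth:
  fixes I :: "real set"
  assumes I: "thick I" and \<xi>: "smooth_map flat I (TQ P) \<xi>" and b: "smooth_on I b"
  shows "smooth_map flat I (TQ P) (\<lambda>t. (fst (\<xi> t), snd (\<xi> t) + fundamental P (b t) (fst (\<xi> t))))"
proof (rule smooth_tangent_curveI[OF Q I])
  fix t assume t: "t \<in> I"
  define c where "c = chart_at Q (fst (\<xi> t))"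
  have c: "c \<in> atlas Q" "fst (\<xi> t) \<in> fst c" unfolding c_def using Q by (auto simp: chart_at_atlas chart_at_mem)
  obtain W where W: "open W" "t \<in> W" "\<And>s. s \<in> I \<Longrightarrow> s \<in> W \<Longrightarrow> fst (\<xi> s) \<in> fst c"
    "smooth_on (I \<inter> W) (\<lambda>s. snd c (fst (\<xi> s)))" "smooth_on (I \<inter> W) (\<lambda>s. components Q c (fst (\<xi> s)) (snd (\<xi> s)))"
    using smooth_tangent_curve_chart[OF Q I \<xi> t c] by blast
  have th: "thick (I \<inter> W)" by (rule thick_Int_open[OF I W(1)])
  have bW: "smooth_on (I \<inter> W) b" by (rule smooth_on_subset[OF finite_dim_real th b]) simp
  have "smooth_on (I \<inter> W) (\<lambda>s. components Q c (fst (\<xi> s)) (snd (\<xi> s)) + fund_rep c (b s) (snd c (fst (\<xi> s))))"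
    by (intro smooth_on_add[OF th W(5)] fund_rep_smooth_apply[OF c(1) th W(4) _ bW]) (use W(3) in auto)
  then have "smooth_on (I \<inter> W) (\<lambda>s. components Q c (fst (\<xi> s)) (snd (\<xi> s) + fundamental P (b s) (fst (\<xi> s))))"
    by (rule smooth_on_transform)
      (use W(3) chart_inv_chart[OF Q c(1)] linear_add[OF components_linear[OF Q c(1)]] in \<open>auto simp: local_rep_eq\<close>)
  then show "\<exists>c\<in>atlas Q. \<exists>W. open W \<and> t \<in> W \<and>
      (\<forall>s\<in>I \<inter> W. fst (fst (\<xi> s), snd (\<xi> s) + fundamental P (b s) (fst (\<xi> s))) \<in> fst c) \<and>
      smooth_on (I \<inter> W) (\<lambda>s. snd c (fst (fst (\<xi> s), snd (\<xi> s) + fundamental P (b s) (fst (\<xi> s))))) \<and>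
      smooth_on (I \<inter> W) (\<lambda>s. components Q c (fst (fst (\<xi> s), snd (\<xi> s) + fundamental P (b s) (fst (\<xi> s))))
        (snd (fst (\<xi> s), snd (\<xi> s) + fundamental P (b s) (fst (\<xi> s)))))"
    using W by (intro bexI[OF _ c(1)] exI[of _ W]) auto
qed

lemma zero_section_smooth:
  fixes I :: "real set"
  assumes I: "thick I" and q: "smooth_map flat I Q q"
  shows "smooth_map flat I (TQ P) (\<lambda>t. (q t, 0))"
proof (rule smooth_tangent_curveI[OF Q I])
  fix t assume t: "t \<in> I"
  define c where "c = chart_at Q (q t)"
  have c: "c \<in> atlas Q" "q t \<in> fst c" unfolding c_def using Q by (auto simp: chart_at_atlas chart_at_mem)
  obtain W where W: "open W" "t \<in> W" "\<And>s. s \<in> I \<Longrightarrow> s \<in> W \<Longrightarrow> q s \<in> fst c" "smooth_on (I \<inter> W) (\<lambda>s. snd c (q s))"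
    using smooth_map_flat_chart[OF finite_dim_real Q I q t c] by blast
  have "smooth_on (I \<inter> W) (\<lambda>s. components Q c (q s) 0)"
    by (rule smooth_on_transform[OF smooth_on_const[OF thick_Int_open[OF I W(1)], of 0]])
      (use W(3) linear_0[OF components_linear[OF Q c(1)]] in auto)
  then show "\<exists>c\<in>atlas Q. \<exists>W. open W \<and> t \<in> W \<and> (\<forall>s\<in>I \<inter> W. fst (q s, 0) \<in> fst c) \<and>
      smooth_on (I \<inter> W) (\<lambda>s. snd c (fst (q s, 0))) \<and> smooth_on (I \<inter> W) (\<lambda>s. components Q c (fst (q s, 0)) (snd (q s, 0)))"
    using W by (intro bexI[OF _ c(1)] exI[of _ W]) auto
qed

end

section \<open>The connection along curves and the tangent spaces of the distribution\<close>

context horizontal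
begin

lemma connection_smooth_curve:
  fixes I :: "real set"
  assumes I: "thick I" and \<xi>: "smooth_map flat I (TQ P) \<xi>"
  shows "smooth_on I (\<lambda>t. connection P H (\<xi> t))"
proof (rule smooth_on_locally)
  fix t assume t: "t \<in> I"
  define c where "c = chart_at Q (fst (\<xi> t))"
  have c: "c \<in> atlas Q" "fst (\<xi> t) \<in> fst c" unfolding c_def using Q by (auto simp: chart_at_atlas chart_at_mem)
  obtain W where W: "open W" "t \<in> W" "\<And>s. s \<in> I \<Longrightarrow> s \<in> W \<Longrightarrow> fst (\<xi> s) \<in> fst c"
    "smooth_on (I \<inter> W) (\<lambda>s. snd c (fst (\<xi> s)))" "smooth_on (I \<inter> W) (\<lambda>s. components Q c (fst (\<xi> s)) (snd (\<xi> s)))"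
    using smooth_tangent_curve_chart[OF Q I \<xi> t c] by blast
  have "smooth_on (I \<inter> W) (\<lambda>s. con_rep c (snd c (fst (\<xi> s))) (components Q c (fst (\<xi> s)) (snd (\<xi> s))))"
    by (rule con_rep_smooth_apply[OF c(1) thick_Int_open[OF I W(1)] W(4) _ W(5)]) (use W(3) in auto)
  then have "smooth_on (I \<inter> W) (\<lambda>t. connection P H (\<xi> t))"
  proof (rule smooth_on_transform)
    fix s assume "s \<in> I \<inter> W"
    then show "con_rep c (snd c (fst (\<xi> s))) (components Q c (fst (\<xi> s)) (snd (\<xi> s))) = connection P H (\<xi> s)"
      using con_rep_components[OF c(1) W(3), of s "snd (\<xi> s)"] by simp
  qed
  then show "\<exists>U. open U \<and> t \<in> U \<and> smooth_on (I \<inter> U) (\<lambda>t. connection P H (\<xi> t))" using W by blast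
qed

lemma connection_curve_derivative:
  fixes I :: "real set"
  assumes I: "thick I" and \<xi>: "smooth_map flat I (TQ P) \<xi>" and t: "t \<in> I" and c: "c = chart_at Q (fst (\<xi> t))"
    and x: "((\<lambda>s. snd c (fst (\<xi> s))) has_vector_derivative x') (at t within I)"
    and y: "((\<lambda>s. components Q c (fst (\<xi> s)) (snd (\<xi> s))) has_vector_derivative y') (at t within I)"
  shows "((\<lambda>s. connection P H (\<xi> s)) has_vector_derivative
    (dcon c (snd c (fst (\<xi> t))) (snd (\<xi> t)) x' + con_rep c (snd c (fst (\<xi> t))) y')) (at t within I)"
proof -
  have ca: "c \<in> atlas Q" "fst (\<xi> t) \<in> fst c" unfolding c using Q by (auto simp: chart_at_atlas chart_at_mem)
  obtain W where W: "open W" "t \<in> W" "\<And>s. s \<in> I \<Longrightarrow> s \<in> W \<Longrightarrow> fst (\<xi> s) \<in> fst c"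
    using smooth_tangent_curve_chart[OF Q I \<xi> t ca] by blast
  have comp: "components Q c (fst (\<xi> t)) v = v" for v unfolding c by (rule components_chart_at[OF Q])
  have xt: "snd c (fst (\<xi> t)) \<in> snd c ` fst c" using ca(2) by blast
  have 1: "((\<lambda>s. con_rep c (snd c (fst (\<xi> s))) (components Q c (fst (\<xi> s)) (snd (\<xi> s)))) has_vector_derivative
    (dcon c (snd c (fst (\<xi> t))) (snd (\<xi> t)) x' + con_rep c (snd c (fst (\<xi> t))) y')) (at t within I)"
    using linear_family_vector_product_rule[where A = "con_rep c", OF fdQ chart_open[OF Q ca(1)] con_rep_linear[OF ca(1)] con_rep_smooth[OF ca(1)] x y xt]
    unfolding comp dcon_def .
  obtain \<delta> where \<delta>: "\<delta> > 0" "ball t \<delta> \<subseteq> W" using W open_contains_ball by blast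
  show ?thesis
  proof (rule has_vector_derivative_transform_within[OF 1 \<delta>(1) t])
    fix s assume "s \<in> I" "dist s t < \<delta>"
    then have "fst (\<xi> s) \<in> fst c" using W(3) \<delta>(2) by (auto simp: dist_commute subset_iff)
    from con_rep_components[OF ca(1) this, of "snd (\<xi> s)"]
    show "con_rep c (snd c (fst (\<xi> s))) (components Q c (fst (\<xi> s)) (snd (\<xi> s))) = connection P H (\<xi> s)" by simp
  qed
qed

text \<open>The distribution is the zero set of \<omega>, and the condition is the vanishing of the
  derivative of \<omega> in the direction \<open>(y, z)\<close>. Necessity differentiates \<omega>
  along a curve in \<open>H\<close>; sufficiency needs an actual curve in \<open>H\<close> with the
  prescribed velocity.\<close>

lemma tangent_space_horizontal:
  assumes v: "(q, v) \<in> H" and c: "c = chart_at Q q"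
  shows "((q, v), (y, z)) \<in> tangent_space_of (TQ P) H (q, v) \<longleftrightarrow>
    dcon c (snd c q) v y + con_rep c (snd c q) z = 0"
proof
  note thI = thick_open[OF open_greaterThanLessThan]
  have ca: "c \<in> atlas Q" "q \<in> fst c" unfolding c using Q by (auto simp: chart_at_atlas chart_at_mem)
  have comp: "components Q c q v = v" for v unfolding c by (rule components_chart_at[OF Q])
  let ?x = "snd c q"
  have xc: "?x \<in> snd c ` fst c" using ca(2) by blast
  {
    assume "((q, v), (y, z)) \<in> tangent_space_of (TQ P) H (q, v)"
    then obtain \<epsilon> k where k: "\<epsilon> > 0" "smooth_map flat {-\<epsilon><..<\<epsilon>} (TQ P) k" "k ` {-\<epsilon><..<\<epsilon>} \<subseteq> H" "k 0 = (q, v)"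
      "((q, v), (y, z)) = tangent_lift (TQ P) {-\<epsilon><..<\<epsilon>} k 0" unfolding tangent_space_of_def by blast
    let ?J = "{-\<epsilon><..<\<epsilon>}"
    have 0: "0 \<in> ?J" using k(1) by simp
    have th: "thick ?J" by (rule thI)
    obtain z' where z': "tangent_lift (TQ P) ?J k 0 = (k 0, (snd (tangent_lift Q ?J (\<lambda>t. fst (k t)) 0), z'))"
      "((\<lambda>s. components Q (chart_at Q (fst (k 0))) (fst (k s)) (snd (k s))) has_vector_derivative z') (at 0 within ?J)"
      by (rule tangent_lift_tangent_bundle[OF Q th k(2) 0])
    have yz: "y = snd (tangent_lift Q ?J (\<lambda>t. fst (k t)) 0)" "z' = z" using k(5) z'(1) by auto
    have q0: "fst (k 0) \<in> fst c" using k(4) ca by simp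
    have "((\<lambda>s. snd c (fst (k s))) has_vector_derivative y) (at 0 within ?J)"
      using tangent_lift_chart[OF Q th smooth_curve_proj[OF Q th k(2)] 0 ca(1) q0] comp k(4) yz(1) by simp
    moreover have "((\<lambda>s. components Q c (fst (k s)) (snd (k s))) has_vector_derivative z) (at 0 within ?J)"
      using z'(2) k(4) yz(2) by (simp add: c)
    ultimately have 1: "((\<lambda>s. connection P H (k s)) has_vector_derivative (dcon c ?x v y + con_rep c ?x z)) (at 0 within ?J)"
      using connection_curve_derivative[OF th k(2) 0, of c y z] k(4) c by simp
    have "connection P H (k s) = 0" if "s \<in> ?J" for s
      using connection_zero_iff[of "fst (k s)" "snd (k s)"] k(3) that by auto
    then have "((\<lambda>s. connection P H (k s)) has_vector_derivative 0) (at 0 within ?J)"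
      by (intro has_vector_derivative_transform[OF 0 _ has_vector_derivative_const[of 0]])
    then show "dcon c ?x v y + con_rep c ?x z = 0"
      by (rule thick_vector_derivative_unique[OF th 0 1])
  }
  assume d0: "dcon c ?x v y + con_rep c ?x z = 0"
  \<comment> \<open>The curve is a straight line in the coordinates of the tangent bundle, pushed
    back into the distribution by removing its vertical part \<open>b\<close>.\<close>
  define x where "x = (\<lambda>s::real. ?x + s *\<^sub>R y)"
  define b where "b = (\<lambda>s. con_rep c (x s) (v + s *\<^sub>R z))"
  define w where "w = (\<lambda>s. (v + s *\<^sub>R z) - fund_rep c (b s) (x s))"
  define k where "k = (\<lambda>s. (chart_inv c (x s), from_components Q c (x s) (w s)))"
  have "continuous_on UNIV x" unfolding x_def by (intro continuous_intros)
  then have "open (x -` (snd c ` fst c))" using chart_open[OF Q ca(1)] open_vimage by blast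
  moreover have "0 \<in> x -` (snd c ` fst c)" using xc by (simp add: x_def)
  ultimately obtain \<epsilon> where \<epsilon>: "\<epsilon> > 0" "ball 0 \<epsilon> \<subseteq> x -` (snd c ` fst c)" using open_contains_ball by blast
  let ?J = "{-\<epsilon><..<\<epsilon>}"
  have th: "thick ?J" by (rule thI)
  have 0: "0 \<in> ?J" using \<epsilon>(1) by simp
  have xJ: "x s \<in> snd c ` fst c" if "s \<in> ?J" for s using \<epsilon>(2) that by (force simp: dist_real_def)
  have xsm: "smooth_on ?J x" unfolding x_def
    by (intro smooth_on_add[OF th] smooth_on_const[OF th] smooth_on_bounded_linear[OF th bounded_linear_scaleR_left] smooth_on_id[OF th])
  have vsm: "smooth_on ?J (\<lambda>s. v + s *\<^sub>R z)"
    by (intro smooth_on_add[OF th] smooth_on_const[OF th] smooth_on_bounded_linear[OF th bounded_linear_scaleR_left] smooth_on_id[OF th])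
  have bsm: "smooth_on ?J b" unfolding b_def by (rule con_rep_smooth_apply[OF ca(1) th xsm _ vsm]) (use xJ in auto)
  have wsm: "smooth_on ?J w" unfolding w_def
    by (intro smooth_on_diff[OF th vsm] fund_rep_smooth_apply[OF ca(1) th xsm _ bsm]) (use xJ in auto)
  have kc: "fst (k s) \<in> fst c" "snd c (fst (k s)) = x s" "components Q c (fst (k s)) (snd (k s)) = w s" if "s \<in> ?J" for s
    using xJ[OF that] from_components(2)[OF Q ca(1) xJ[OF that]] by (auto simp: k_def inv_into_into f_inv_into_f)
  have ksm: "smooth_map flat ?J (TQ P) k"
  proof (rule smooth_tangent_curveI[OF Q th], intro bexI[OF _ ca(1)] exI[of _ UNIV] conjI ballI)
    show "smooth_on (?J \<inter> UNIV) (\<lambda>s. snd c (fst (k s)))"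
      using smooth_on_transform[OF xsm, of "\<lambda>s. snd c (fst (k s))"] kc(2) by simp
    show "smooth_on (?J \<inter> UNIV) (\<lambda>s. components Q c (fst (k s)) (snd (k s)))"
      using smooth_on_transform[OF wsm, of "\<lambda>s. components Q c (fst (k s)) (snd (k s))"] kc(3) by simp
  qed (use kc(1) in auto)
  have b0: "b 0 = 0" using con_rep_components[OF ca, of v] comp connection_zero_iff v by (simp add: b_def x_def)
  have k0: "k 0 = (q, v)"
    using from_components(1)[OF Q ca(1) xc, of v] chart_inv_chart[OF Q ca] comp b0 linear_0[OF fund_rep_linear[OF ca(1) xc]]
    by (simp add: k_def x_def w_def)
  have kH: "k s \<in> H" if s: "s \<in> ?J" for s
  proof -
    have "con_rep c (x s) (w s) = 0"
      unfolding w_def linear_diff[OF con_rep_linear[OF ca(1) xJ[OF s]]] con_rep_fund_rep[OF ca(1) xJ[OF s]] by (simp add: b_def)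
    then show ?thesis using connection_zero_iff by (simp add: k_def)
  qed
  have "((\<lambda>s. s *\<^sub>R y) has_vector_derivative y) (at 0 within ?J)" "((\<lambda>s. s *\<^sub>R z) has_vector_derivative z) (at 0 within ?J)"
    using bounded_linear.has_vector_derivative[OF bounded_linear_scaleR_left has_vector_derivative_id] by fastforce+
  then have xd: "(x has_vector_derivative y) (at 0 within ?J)" and vd: "((\<lambda>s. v + s *\<^sub>R z) has_vector_derivative z) (at 0 within ?J)"
    unfolding x_def using has_vector_derivative_add[OF has_vector_derivative_const] by fastforce+
  have x0: "x 0 = ?x" "x 0 \<in> snd c ` fst c" using xc by (simp_all add: x_def)
  \<comment> \<open>The hypothesis says exactly that \<open>b\<close> is stationary at
    \<open>0\<close>, where it also vanishes; removing the vertical part therefore does not change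
    the initial velocity.\<close>
  have bd: "(b has_vector_derivative 0) (at 0 within ?J)"
    using linear_family_vector_product_rule[where A = "con_rep c", OF fdQ chart_open[OF Q ca(1)] con_rep_linear[OF ca(1)] con_rep_smooth[OF ca(1)] xd vd x0(2)]
    unfolding b_def[symmetric] using d0 x0 by (simp add: dcon_def)
  have "((\<lambda>s. fund_rep c (b s) (x s)) has_vector_derivative 0) (at 0 within ?J)"
    using fund_rep_product_rule[OF ca(1) xd bd x0(2)] b0 linear_0[OF fund_rep_linear[OF ca(1) x0(2)]]
      linear_0[OF fund_rep_derivative_add[OF ca(1) x0(2)]] by simp
  then have wd: "(w has_vector_derivative z) (at 0 within ?J)"
    unfolding w_def using has_vector_derivative_diff[OF vd] by fastforce
  obtain z' where z': "tangent_lift (TQ P) ?J k 0 = (k 0, (snd (tangent_lift Q ?J (\<lambda>t. fst (k t)) 0), z'))"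
      "((\<lambda>s. components Q (chart_at Q (fst (k 0))) (fst (k s)) (snd (k s))) has_vector_derivative z') (at 0 within ?J)"
    by (rule tangent_lift_tangent_bundle[OF Q th ksm 0])
  have "((\<lambda>s. components Q c (fst (k s)) (snd (k s))) has_vector_derivative z) (at 0 within ?J)"
    by (rule has_vector_derivative_transform[OF 0 _ wd]) (rule kc(3))
  moreover have "((\<lambda>s. components Q c (fst (k s)) (snd (k s))) has_vector_derivative z') (at 0 within ?J)"
    using z'(2) k0 by (simp add: c)
  ultimately have zz: "z = z'" by (rule thick_vector_derivative_unique[OF th 0])
  have "((\<lambda>s. snd c (fst (k s))) has_vector_derivative y) (at 0 within ?J)"
    by (rule has_vector_derivative_transform[OF 0 _ xd]) (rule kc(2))
  then have "((\<lambda>s. snd c (fst (k s))) has_vector_derivative components Q c (fst (k 0)) y) (at 0 within ?J)"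
    using k0 comp by simp
  then have "tangent_lift Q ?J (\<lambda>s. fst (k s)) 0 = (fst (k 0), y)"
    by (rule tangent_lift_eqI[OF Q th smooth_curve_proj[OF Q th ksm] 0 ca(1) kc(1)[OF 0]])
  then have "tangent_lift (TQ P) ?J k 0 = ((q, v), (y, z))" using z'(1) zz k0 by simp
  moreover have "k ` ?J \<subseteq> H" using kH by blast
  ultimately show "((q, v), (y, z)) \<in> tangent_space_of (TQ P) H (q, v)"
    unfolding tangent_space_of_def using \<epsilon>(1) ksm k0 by (intro CollectI exI[of _ \<epsilon>] exI[of _ k]) simp
qed

end

section \<open>The Lagrangian along a horizontal path\<close>

locale variational = invariant_horizontal P H
  for P :: "('q, 'e::banach, 'm, 'f::banach, 'g, 'h::banach) bundle_data" and H :: "('q \<times> 'e) set" +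
  fixes L :: "'q \<times> 'e \<Rightarrow> real" and t0 t1 :: real and \<gamma> :: "real \<Rightarrow> 'q \<times> 'e"
  assumes L: "smooth_map (TQ P) UNIV flat L" and t01: "t0 < t1" and path: "horizontal_path P H {t0..t1} \<gamma>"
begin

abbreviation "I \<equiv> {t0..t1}"
abbreviation "L_rep c z \<equiv> L (chart_inv (tangent_chart Q c) z)"

lemma thI: "thick I" using thick_interval[OF t01] .

lemma L_rep_smooth:
  assumes c: "c \<in> atlas Q" shows "smooth_on (snd c ` fst c \<times> UNIV) (L_rep c)"
proof (rule smooth_on_locally)
  note TQ = premanifold_tangent_bundle[OF Q] and k = tangent_chart_atlas[OF c]
  let ?k = "tangent_chart Q c"
  fix z assume "z \<in> snd c ` fst c \<times> (UNIV :: 'e set)"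
  then have "z \<in> snd ?k ` fst ?k" using tangent_chart_image[OF Q c order_refl] by (simp add: tangent_chart_simps)
  then obtain w where w: "w \<in> fst ?k" "z = snd ?k w" by blast
  have img: "snd ?k ` (UNIV \<inter> fst ?k) = snd c ` fst c \<times> UNIV"
    using tangent_chart_image[OF Q c order_refl] by (simp add: tangent_chart_simps)
  obtain W where "open W" "snd ?k w \<in> W" "smooth_on (snd ?k ` (UNIV \<inter> fst ?k) \<inter> W) (snd (UNIV, id) \<circ> L \<circ> chart_inv ?k)"
    by (rule smooth_map_chart[OF TQ premanifold_flat[OF finite_dim_real] mthick_UNIV[OF TQ] L UNIV_I k w(1), of "(UNIV, id)"]) auto
  then show "\<exists>U. open U \<and> z \<in> U \<and> smooth_on (snd c ` fst c \<times> UNIV \<inter> U) (L_rep c)"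
    unfolding img using w(2) by (auto simp: comp_def)
qed

definition dL where "dL c z = frechet_derivative (L_rep c) (at z)"

lemma L_rep_dom_open: "c \<in> atlas Q \<Longrightarrow> open (snd c ` fst c \<times> (UNIV :: 'e set))"
  by (intro open_Times chart_open[OF Q] open_UNIV)

lemma L_rep_has_derivative:
  assumes "c \<in> atlas Q" "x \<in> snd c ` fst c" shows "(L_rep c has_derivative dL c (x, v)) (at (x, v))"
  unfolding dL_def
  using smooth_on_has_derivative[OF L_rep_dom_open[OF assms(1)] L_rep_smooth[OF assms(1)]] assms(2) by blast

lemma dL_linear: "c \<in> atlas Q \<Longrightarrow> x \<in> snd c ` fst c \<Longrightarrow> linear (dL c (x, v))"
  using L_rep_has_derivative has_derivative_linear by blast

lemma L_rep_components:
  assumes "c \<in> atlas Q" "q \<in> fst c" shows "L_rep c (snd c q, components Q c q v) = L (q, v)"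
  using tangent_chart_inv[OF Q assms(1), of "snd c q"] from_components(1)[OF Q assms(1), of "snd c q" v]
    chart_inv_chart[OF Q assms] assms(2) by simp

lemma dL_smooth_apply:
  assumes c: "c \<in> atlas Q" and T: "thick T" and x: "smooth_on T x" "x ` T \<subseteq> snd c ` fst c" and v: "smooth_on T v"
    and y: "smooth_on T y" and w: "smooth_on T w"
  shows "smooth_on T (\<lambda>t. dL c (x t, v t) (y t, w t))"
  unfolding dL_def
  by (rule smooth_on_frechet_apply[OF finite_dim_prod[OF fdQ fdQ] L_rep_dom_open[OF c] L_rep_smooth[OF c] T])
    (use x(2) in \<open>auto intro!: smooth_on_Pair T x(1) v y w\<close>)

text \<open>\<open>Blinfun\<close> returns the given map only if it is bounded and linear. The
  derivative is therefore first computed in a chart, where linearity in \<open>b\<close> becomes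
  visible; \<open>HL\<close> is treated in the same way.\<close>

lemma FL_apply:
  assumes c: "c \<in> atlas Q" "q \<in> fst c"
  shows "blinfun_apply (FL P L (q, v)) b = dL c (snd c q, components Q c q v) (0, fund_rep c b (snd c q))"
proof -
  let ?D = "dL c (snd c q, components Q c q v)"
  have xc: "snd c q \<in> snd c ` fst c" using c(2) by blast
  have fr: "components Q c q (fundamental P b q) = fund_rep c b (snd c q)" for b
    using chart_inv_chart[OF Q c] by (simp add: local_rep_eq)
  note lin = dL_linear[OF c(1) xc, of "components Q c q v"]
  have d: "deriv (\<lambda>t. L (q, v + t *\<^sub>R fundamental P b q)) 0 = ?D (0, fund_rep c b (snd c q))" for b
  proof (rule DERIV_imp_deriv)
    have "((\<lambda>t. (snd c q, components Q c q v + t *\<^sub>R fund_rep c b (snd c q))) has_vector_derivative (0, fund_rep c b (snd c q))) (at 0)"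
      unfolding has_vector_derivative_def by (auto intro!: derivative_eq_intros)
    from has_vector_derivative_compose_has_derivative[OF this, of "L_rep c" ?D]
    have "((\<lambda>t. L_rep c (snd c q, components Q c q v + t *\<^sub>R fund_rep c b (snd c q))) has_vector_derivative ?D (0, fund_rep c b (snd c q))) (at 0)"
      using L_rep_has_derivative[OF c(1) xc] by simp
    moreover have "L_rep c (snd c q, components Q c q v + t *\<^sub>R fund_rep c b (snd c q)) = L (q, v + t *\<^sub>R fundamental P b q)" for t
      using L_rep_components[OF c, of "v + t *\<^sub>R fundamental P b q"] components_linear[OF Q c]
      by (simp add: linear_add linear_scale fr)
    ultimately show "((\<lambda>t. L (q, v + t *\<^sub>R fundamental P b q)) has_real_derivative ?D (0, fund_rep c b (snd c q))) (at 0)"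
      by (simp add: has_real_derivative_iff_has_vector_derivative)
  qed
  have l: "linear (\<lambda>b. ?D (0, fund_rep c b (snd c q)))"
  proof (rule linearI)
    fix a b r
    show "?D (0, fund_rep c (a + b) (snd c q)) = ?D (0, fund_rep c a (snd c q)) + ?D (0, fund_rep c b (snd c q))"
      using linear_add[OF lin, of "(0, fund_rep c a (snd c q))" "(0, fund_rep c b (snd c q))"]
      by (simp add: linear_add[OF fund_rep_linear[OF c(1) xc]])
    show "?D (0, fund_rep c (r *\<^sub>R a) (snd c q)) = r *\<^sub>R ?D (0, fund_rep c a (snd c q))"
      using linear_scale[OF lin, of r "(0, fund_rep c a (snd c q))"]
      by (simp add: linear_scale[OF fund_rep_linear[OF c(1) xc]])
  qed
  show ?thesis
    unfolding FL_def prod.case d by (rule fun_cong[OF bounded_linear_Blinfun_apply[OF finite_dim_linear_bounded[OF fdS l]]])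
qed

text \<open>By invariance the horizontal lift at the moving point is the translate of
  \<open>v\<close>, so the coordinates of point and vector move with the velocities given by
  \<open>fund_rep_smooth_and_flow\<close>.\<close>

lemma HL_apply:
  assumes c: "c \<in> atlas Q" "q \<in> fst c" and v: "(q, v) \<in> H"
  shows "blinfun_apply (HL P H L (q, v)) b = dL c (snd c q, components Q c q v)
    (fund_rep c b (snd c q), frechet_derivative (fund_rep c b) (at (snd c q)) (components Q c q v))"
proof -
  let ?x = "snd c q" and ?w = "components Q c q v"
  let ?D = "dL c (?x, ?w)" and ?F = "\<lambda>b. frechet_derivative (fund_rep c b) (at ?x) ?w"
  have xc: "?x \<in> snd c ` fst c" using c(2) by blast
  note lin = dL_linear[OF c(1) xc, of ?w]
  have d: "deriv (\<lambda>t. let p = act P q (exponential P (t *\<^sub>R b)) in L (p, hlift P H p (pi_star P q v))) 0 = ?D (fund_rep c b ?x, ?F b)" for b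
  proof (rule DERIV_imp_deriv)
    obtain \<gamma>' where \<gamma>': "one_param_subgroup S G b \<gamma>'" by (rule one_param_obtain)
    let ?p = "\<lambda>t. act P q (\<gamma>' t)" and ?u = "\<lambda>t. differential Q Q (\<lambda>p. act P p (\<gamma>' t)) q v"
    obtain d where d: "d > 0" "\<And>t. \<bar>t\<bar> < d \<Longrightarrow> ?p t \<in> fst c"
      and f1: "((\<lambda>t. snd c (?p t)) has_vector_derivative fund_rep c b ?x) (at 0)"
      and f2: "((\<lambda>t. components Q c (?p t) (?u t)) has_vector_derivative ?F b) (at 0)"
      using fund_rep_smooth_and_flow(2)[OF c \<gamma>', of v] by blast
    have p0: "?p 0 = q" "?u 0 = v"
      using one_param_0[OF \<gamma>'] differential_id[OF Q] by simp_all
    have D: "(L_rep c has_derivative ?D) (at (snd c (?p 0), components Q c (?p 0) (?u 0)))"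
      unfolding p0 by (rule L_rep_has_derivative[OF c(1) xc])
    have "((\<lambda>t. L_rep c (snd c (?p t), components Q c (?p t) (?u t))) has_vector_derivative ?D (fund_rep c b ?x, ?F b)) (at 0)"
      by (rule has_vector_derivative_compose_has_derivative[OF has_vector_derivative_Pair[OF f1 f2] D])
    moreover have "L_rep c (snd c (?p t), components Q c (?p t) (?u t)) =
        (let p = act P q (exponential P (t *\<^sub>R b)) in L (p, hlift P H p (pi_star P q v)))" if "t \<in> ball 0 d" for t
      using L_rep_components[OF c(1) d(2), of t "?u t"] that right_act_horizontal[OF v]
      by (simp add: Let_def exponential_scaleR[OF \<gamma>'])
    ultimately have "((\<lambda>t. let p = act P q (exponential P (t *\<^sub>R b)) in L (p, hlift P H p (pi_star P q v)))
        has_vector_derivative ?D (fund_rep c b ?x, ?F b)) (at 0)"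
      by (rule has_vector_derivative_transform_within_open[OF _ open_ball centre_in_ball[THEN iffD2, OF d(1)]])
    then show "((\<lambda>t. let p = act P q (exponential P (t *\<^sub>R b)) in L (p, hlift P H p (pi_star P q v)))
        has_real_derivative ?D (fund_rep c b ?x, ?F b)) (at 0)"
      by (simp only: has_real_derivative_iff_has_vector_derivative)
  qed
  have l: "linear (\<lambda>b. ?D (fund_rep c b ?x, ?F b))"
  proof (rule linearI)
    note l1 = fund_rep_linear[OF c(1) xc] and l2 = fund_rep_derivative_add[OF c(1) xc, of ?w]
    fix a b r
    show "?D (fund_rep c (a + b) ?x, ?F (a + b)) = ?D (fund_rep c a ?x, ?F a) + ?D (fund_rep c b ?x, ?F b)"
      using linear_add[OF lin, of "(fund_rep c a ?x, ?F a)" "(fund_rep c b ?x, ?F b)"] by (simp add: linear_add[OF l1] linear_add[OF l2])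
    show "?D (fund_rep c (r *\<^sub>R a) ?x, ?F (r *\<^sub>R a)) = r *\<^sub>R ?D (fund_rep c a ?x, ?F a)"
      using linear_scale[OF lin, of r "(fund_rep c a ?x, ?F a)"] by (simp add: linear_scale[OF l1] linear_scale[OF l2])
  qed
  show ?thesis
    unfolding HL_def prod.case d by (rule fun_cong[OF bounded_linear_Blinfun_apply[OF finite_dim_linear_bounded[OF fdS l]]])
qed

lemma path_base: "smooth_map flat I Q (\<lambda>t. fst (\<gamma> t))" and path_lift: "t \<in> I \<Longrightarrow> tangent_lift Q I (\<lambda>t. fst (\<gamma> t)) t = \<gamma> t"
  and path_horizontal: "t \<in> I \<Longrightarrow> \<gamma> t \<in> H"
  using path unfolding horizontal_path_def admissible_path_def by (auto simp: comp_def)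

lemma path_smooth: "smooth_map flat I (TQ P) \<gamma>"
  using smooth_map_cong[OF premanifold_flat[OF finite_dim_real] _ smooth_map_tangent_lift[OF Q thI path_base]] path_lift by blast

lemma momentum_smooth:
  "smooth_on I (\<lambda>t. blinfun_apply (FL P L (\<gamma> t)) e)" "smooth_on I (\<lambda>t. blinfun_apply (HL P H L (\<gamma> t)) e)"
proof -
  have "\<exists>W. open W \<and> t \<in> W \<and> smooth_on (I \<inter> W) (\<lambda>t. blinfun_apply (FL P L (\<gamma> t)) e) \<and>
      smooth_on (I \<inter> W) (\<lambda>t. blinfun_apply (HL P H L (\<gamma> t)) e)" if t: "t \<in> I" for t
  proof -
    define c where "c = chart_at Q (fst (\<gamma> t))"
    have c: "c \<in> atlas Q" "fst (\<gamma> t) \<in> fst c" unfolding c_def using Q by (auto simp: chart_at_atlas chart_at_mem)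
    obtain W where W: "open W" "t \<in> W" "\<And>s. s \<in> I \<Longrightarrow> s \<in> W \<Longrightarrow> fst (\<gamma> s) \<in> fst c"
      "smooth_on (I \<inter> W) (\<lambda>s. snd c (fst (\<gamma> s)))" "smooth_on (I \<inter> W) (\<lambda>s. components Q c (fst (\<gamma> s)) (snd (\<gamma> s)))"
      using smooth_tangent_curve_chart[OF Q thI path_smooth t c] by blast
    have th: "thick (I \<inter> W)" by (rule thick_Int_open[OF thI W(1)])
    have img: "(\<lambda>s. snd c (fst (\<gamma> s))) ` (I \<inter> W) \<subseteq> snd c ` fst c" using W(3) by auto
    note fr = fund_rep_smooth_apply[OF c(1) th W(4) img smooth_on_const[OF th, of e]]
    have dfr: "smooth_on (I \<inter> W) (\<lambda>s. frechet_derivative (fund_rep c e) (at (snd c (fst (\<gamma> s)))) (components Q c (fst (\<gamma> s)) (snd (\<gamma> s))))"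
      by (rule smooth_on_frechet_apply[OF fdQ chart_open[OF Q c(1)] fund_rep_smooth[OF c(1)] th W(4) img W(5)])
    have "smooth_on (I \<inter> W) (\<lambda>t. blinfun_apply (FL P L (\<gamma> t)) e)"
      by (rule smooth_on_transform[OF dL_smooth_apply[OF c(1) th W(4) img W(5) smooth_on_const[OF th, of 0] fr]])
        (use FL_apply[OF c(1) W(3)] in \<open>metis IntD1 IntD2 prod.collapse\<close>)
    moreover have "smooth_on (I \<inter> W) (\<lambda>t. blinfun_apply (HL P H L (\<gamma> t)) e)"
      by (rule smooth_on_transform[OF dL_smooth_apply[OF c(1) th W(4) img W(5) fr dfr]])
        (use HL_apply[OF c(1) W(3)] path_horizontal in \<open>metis IntD1 IntD2 prod.collapse\<close>)
    ultimately show ?thesis using W(1,2) by blast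
  qed
  then show "smooth_on I (\<lambda>t. blinfun_apply (FL P L (\<gamma> t)) e)" "smooth_on I (\<lambda>t. blinfun_apply (HL P H L (\<gamma> t)) e)"
    using smooth_on_locally[of I "\<lambda>t. blinfun_apply (FL P L (\<gamma> t)) e"] smooth_on_locally[of I "\<lambda>t. blinfun_apply (HL P H L (\<gamma> t)) e"]
    by blast+
qed

text \<open>A generator in coordinates: \<open>(x, \<xi>)\<close> with velocity \<open>(x', y')\<close> yields the variation \<open>(\<xi>, y')\<close> of
  \<open>(x, x')\<close>.\<close>

lemma generator_variation:
  assumes \<xi>: "generator Q I (fst \<circ> \<gamma>) \<xi>" and t: "t \<in> I" and c: "c = chart_at Q (fst (\<gamma> t))"
  obtains y' where "variation Q I \<xi> t = (\<gamma> t, (snd (\<xi> t), y'))"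
    "((\<lambda>s. components Q c (fst (\<xi> s)) (snd (\<xi> s))) has_vector_derivative y') (at t within I)"
    "((\<lambda>s. snd c (fst (\<xi> s))) has_vector_derivative snd (\<gamma> t)) (at t within I)"
proof -
  have sm: "smooth_map flat I (TQ P) \<xi>" and base: "\<And>t. t \<in> I \<Longrightarrow> fst (\<xi> t) = fst (\<gamma> t)"
    using \<xi> unfolding generator_def by auto
  have ca: "c \<in> atlas Q" "fst (\<gamma> t) \<in> fst c" unfolding c using Q by (auto simp: chart_at_atlas chart_at_mem)
  obtain y' where y': "tangent_lift (TQ P) I \<xi> t = (\<xi> t, (snd (tangent_lift Q I (\<lambda>t. fst (\<xi> t)) t), y'))"
    "((\<lambda>s. components Q (chart_at Q (fst (\<xi> t))) (fst (\<xi> s)) (snd (\<xi> s))) has_vector_derivative y') (at t within I)"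
    by (rule tangent_lift_tangent_bundle[OF Q thI sm t])
  have "((\<lambda>s. snd c (fst (\<gamma> s))) has_vector_derivative components Q c (fst (\<gamma> t)) (snd (\<gamma> t))) (at t within I)"
    using tangent_lift_chart[OF Q thI path_base t ca] path_lift[OF t] by simp
  then have x: "((\<lambda>s. snd c (fst (\<xi> s))) has_vector_derivative components Q c (fst (\<xi> t)) (snd (\<gamma> t))) (at t within I)"
    unfolding base[OF t] by (rule has_vector_derivative_transform[OF t, rotated]) (simp add: base)
  have "fst (\<xi> t) \<in> fst c" using base[OF t] ca by simp
  from tangent_lift_eqI[OF Q thI smooth_curve_proj[OF Q thI sm] t ca(1) this x]
  have "tangent_lift (TQ P) I \<xi> t = (\<xi> t, (snd (\<gamma> t), y'))" using y'(1) by simp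
  then have "variation Q I \<xi> t = (\<gamma> t, (snd (\<xi> t), y'))"
    using base[OF t] by (cases "\<xi> t"; cases "\<gamma> t") (simp add: variation_def canonical_flip_def)
  moreover have "((\<lambda>s. components Q c (fst (\<xi> s)) (snd (\<xi> s))) has_vector_derivative y') (at t within I)"
    using y'(2) base[OF t] c by simp
  moreover have "components Q c (fst (\<xi> t)) (snd (\<gamma> t)) = snd (\<gamma> t)" unfolding base[OF t] c by (rule components_chart_at[OF Q])
  ultimately show ?thesis using that x by simp
qed

lemma generator_add_fundamental:
  assumes \<xi>: "generator Q I (fst \<circ> \<gamma>) \<xi>" and b: "smooth_on I b"
  shows "generator Q I (fst \<circ> \<gamma>) (\<lambda>t. (fst (\<xi> t), snd (\<xi> t) + fundamental P (b t) (fst (\<gamma> t))))"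
proof -
  have sm: "smooth_map flat I (TQ P) \<xi>" and base: "\<And>t. t \<in> I \<Longrightarrow> fst (\<xi> t) = fst (\<gamma> t)"
    using \<xi> unfolding generator_def by auto
  show ?thesis unfolding generator_def
    using smooth_map_cong[OF premanifold_flat[OF finite_dim_real] _ add_fundamental_smooth[OF thI sm b]] base by simp
qed

text \<open>The added vertical part has the components \<open>fund_rep c (b s) (x s)\<close>, and
  the product rule differentiates it in two ways: the derivative of the field along the path later
  pairs with the Lagrangian to \<open>HL\<close>, the derivative of \<open>b\<close> to
  \<open>FL\<close>.\<close>

lemma variation_add_fundamental:
  assumes \<xi>: "generator Q I (fst \<circ> \<gamma>) \<xi>" and b: "smooth_on I b" and t: "t \<in> I"
    and c: "c = chart_at Q (fst (\<gamma> t))" and var: "variation Q I \<xi> t = (\<gamma> t, (y, y'))"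
  shows "variation Q I (\<lambda>t. (fst (\<xi> t), snd (\<xi> t) + fundamental P (b t) (fst (\<gamma> t)))) t =
    (\<gamma> t, (y + fund_rep c (b t) (snd c (fst (\<gamma> t))),
      y' + (frechet_derivative (fund_rep c (b t)) (at (snd c (fst (\<gamma> t)))) (snd (\<gamma> t)) +
        fund_rep c (vector_derivative b (at t within I)) (snd c (fst (\<gamma> t))))))"
proof -
  let ?\<xi> = "\<lambda>t. (fst (\<xi> t), snd (\<xi> t) + fundamental P (b t) (fst (\<gamma> t)))" and ?x = "snd c (fst (\<gamma> t))"
  have base: "\<And>t. t \<in> I \<Longrightarrow> fst (\<xi> t) = fst (\<gamma> t)" using \<xi> unfolding generator_def by auto
  have ca: "c \<in> atlas Q" "fst (\<gamma> t) \<in> fst c" unfolding c using Q by (auto simp: chart_at_atlas chart_at_mem)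
  obtain z where z: "variation Q I \<xi> t = (\<gamma> t, (snd (\<xi> t), z))"
    "((\<lambda>s. components Q c (fst (\<xi> s)) (snd (\<xi> s))) has_vector_derivative z) (at t within I)"
    "((\<lambda>s. snd c (fst (\<xi> s))) has_vector_derivative snd (\<gamma> t)) (at t within I)"
    by (rule generator_variation[OF \<xi> t c])
  obtain z' where z': "variation Q I ?\<xi> t = (\<gamma> t, (snd (?\<xi> t), z'))"
    "((\<lambda>s. components Q c (fst (?\<xi> s)) (snd (?\<xi> s))) has_vector_derivative z') (at t within I)"
    by (rule generator_variation[OF generator_add_fundamental[OF \<xi> b] t c])
  have yz: "y = snd (\<xi> t)" "y' = z" using z(1) var by auto
  have xt: "snd c (fst (\<xi> t)) \<in> snd c ` fst c" using base[OF t] ca(2) by simp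
  have "((\<lambda>s. fund_rep c (b s) (snd c (fst (\<xi> s)))) has_vector_derivative
      (frechet_derivative (fund_rep c (b t)) (at ?x) (snd (\<gamma> t)) + fund_rep c (vector_derivative b (at t within I)) ?x)) (at t within I)"
    using fund_rep_product_rule[OF ca(1) z(3) smooth_on_has_vector_derivative[OF b t] xt] base[OF t] by simp
  from has_vector_derivative_add[OF z(2) this]
  have 1: "((\<lambda>s. components Q c (fst (\<xi> s)) (snd (\<xi> s)) + fund_rep c (b s) (snd c (fst (\<xi> s)))) has_vector_derivative
     z + (frechet_derivative (fund_rep c (b t)) (at ?x) (snd (\<gamma> t)) + fund_rep c (vector_derivative b (at t within I)) ?x)) (at t within I)" .
  have sm: "smooth_map flat I (TQ P) \<xi>" using \<xi> unfolding generator_def by blast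
  have ct: "fst (\<xi> t) \<in> fst c" using base[OF t] ca(2) by simp
  obtain W where W: "open W" "t \<in> W" "\<And>s. s \<in> I \<Longrightarrow> s \<in> W \<Longrightarrow> fst (\<xi> s) \<in> fst c"
    using smooth_tangent_curve_chart[OF Q thI sm t ca(1) ct] by blast
  obtain \<delta> where \<delta>: "\<delta> > 0" "ball t \<delta> \<subseteq> W" using W open_contains_ball by blast
  have "((\<lambda>s. components Q c (fst (?\<xi> s)) (snd (?\<xi> s))) has_vector_derivative
     z + (frechet_derivative (fund_rep c (b t)) (at ?x) (snd (\<gamma> t)) + fund_rep c (vector_derivative b (at t within I)) ?x)) (at t within I)"
  proof (rule has_vector_derivative_transform_within[OF 1 \<delta>(1) t])
    fix s assume s: "s \<in> I" "dist s t < \<delta>"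
    then have "s \<in> W" using \<delta>(2) by (auto simp: dist_commute subset_iff)
    then have m: "fst (\<xi> s) \<in> fst c" using W(3) s(1) by blast
    show "components Q c (fst (\<xi> s)) (snd (\<xi> s)) + fund_rep c (b s) (snd c (fst (\<xi> s))) = components Q c (fst (?\<xi> s)) (snd (?\<xi> s))"
    proof -
      have m': "fst (\<gamma> s) \<in> fst c" using m base[OF s(1)] by simp
      show ?thesis
        unfolding base[OF s(1)] local_rep_eq chart_inv_chart[OF Q ca(1) m'] fst_conv snd_conv
        by (rule linear_add[OF components_linear[OF Q ca(1) m'], symmetric])
    qed
  qed
  then have "z' = z + (frechet_derivative (fund_rep c (b t)) (at ?x) (snd (\<gamma> t)) + fund_rep c (vector_derivative b (at t within I)) ?x)"
    by (rule thick_vector_derivative_unique[OF thI t z'(2)])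
  moreover have "fundamental P (b t) (fst (\<gamma> t)) = fund_rep c (b t) ?x"
    using chart_inv_chart[OF Q ca] components_chart_at[OF Q] by (simp add: local_rep_eq c)
  ultimately show ?thesis using z'(1) yz by simp
qed

text \<open>Here \<omega> is differentiated along the generator, with base velocity
  \<open>snd (\<gamma> t)\<close> and argument \<open>y\<close>. The tangency condition of
  \<open>tangent_space_horizontal\<close> has these two vectors interchanged, because the variation
  has been flipped.\<close>

lemma connection_variation:
  assumes \<xi>: "generator Q I (fst \<circ> \<gamma>) \<xi>" and t: "t \<in> I" and c: "c = chart_at Q (fst (\<gamma> t))"
    and var: "variation Q I \<xi> t = (\<gamma> t, (y, y'))"
  shows "((\<lambda>s. connection P H (\<xi> s)) has_vector_derivative
    (dcon c (snd c (fst (\<gamma> t))) y (snd (\<gamma> t)) + con_rep c (snd c (fst (\<gamma> t))) y')) (at t within I)"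
proof -
  have sm: "smooth_map flat I (TQ P) \<xi>" and base: "fst (\<xi> t) = fst (\<gamma> t)" using \<xi> t unfolding generator_def by auto
  obtain z where z: "variation Q I \<xi> t = (\<gamma> t, (snd (\<xi> t), z))"
    "((\<lambda>s. components Q c (fst (\<xi> s)) (snd (\<xi> s))) has_vector_derivative z) (at t within I)"
    "((\<lambda>s. snd c (fst (\<xi> s))) has_vector_derivative snd (\<gamma> t)) (at t within I)"
    by (rule generator_variation[OF \<xi> t c])
  then show ?thesis using connection_curve_derivative[OF thI sm t _ z(3,2)] base c var by simp
qed

text \<open>Since \<omega> of the generator is \<open>b\<close>, its derivative along the generator
  is the derivative of \<open>b\<close>. Interchanging the two arguments of \<open>dcon\<close>
  turns this into the tangency condition and adds the curvature.\<close>

lemma vakonomic_iff: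
  assumes \<eta>: "generator Q I (fst \<circ> \<gamma>) \<eta>" and \<eta>H: "\<And>t. t \<in> I \<Longrightarrow> \<eta> t \<in> H" and b: "smooth_on I b" and t: "t \<in> I"
  shows "variation Q I (\<lambda>t. (fst (\<eta> t), snd (\<eta> t) + fundamental P (b t) (fst (\<gamma> t)))) t \<in> tangent_space_of (TQ P) H (\<gamma> t) \<longleftrightarrow>
    vector_derivative b (at t within I) + curvature P H (fst (\<gamma> t)) (pi_star P (fst (\<gamma> t)) (snd (\<gamma> t)))
      (pi_star P (fst (\<eta> t)) (snd (\<eta> t))) = 0"
proof -
  let ?\<xi> = "\<lambda>t. (fst (\<eta> t), snd (\<eta> t) + fundamental P (b t) (fst (\<gamma> t)))"
  obtain q v where \<gamma>t: "\<gamma> t = (q, v)" by (cases "\<gamma> t")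
  define c where "c = chart_at Q (fst (\<gamma> t))"
  have cq: "c = chart_at Q q" by (simp add: c_def \<gamma>t)
  have ca: "c \<in> atlas Q" "q \<in> fst c" unfolding cq using Q by (auto simp: chart_at_atlas chart_at_mem)
  have xc: "snd c q \<in> snd c ` fst c" using ca(2) by blast
  have base: "\<And>t. t \<in> I \<Longrightarrow> fst (\<eta> t) = fst (\<gamma> t)" using \<eta> unfolding generator_def by auto
  define Y where "Y = snd (\<eta> t)"
  have YH: "(q, Y) \<in> H" using \<eta>H[OF t] base[OF t] \<gamma>t by (cases "\<eta> t") (simp add: Y_def)
  have vH: "(q, v) \<in> H" using path_horizontal[OF t] \<gamma>t by simp
  note \<xi> = generator_add_fundamental[OF \<eta> b]
  obtain z where var: "variation Q I ?\<xi> t = (\<gamma> t, (snd (?\<xi> t), z))"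
    by (rule generator_variation[OF \<xi> t c_def])
  define y where "y = Y + fundamental P (b t) q"
  have y: "snd (?\<xi> t) = y" by (simp add: y_def Y_def \<gamma>t)
  have "connection P H (?\<xi> s) = b s" if "s \<in> I" for s
  proof -
    have "(fst (\<eta> s), snd (\<eta> s)) \<in> H" using \<eta>H[OF that] by simp
    then show ?thesis by (intro connection_eqI) (simp add: base[OF that])
  qed
  then have "((\<lambda>s. connection P H (?\<xi> s)) has_vector_derivative vector_derivative b (at t within I)) (at t within I)"
    by (intro has_vector_derivative_transform[OF t _ smooth_on_has_vector_derivative[OF b t]])
  from trans[OF sym[OF thick_vector_derivative[OF thI t connection_variation[OF \<xi> t c_def var]]] thick_vector_derivative[OF thI t this]]
  have 1: "dcon c (snd c q) y v + con_rep c (snd c q) z = vector_derivative b (at t within I)"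
    unfolding y unfolding \<gamma>t fst_conv snd_conv .
  \<comment> \<open>The vertical part of \<open>y\<close> cancels by
    \<open>dcon_fundamental\<close>; on the two horizontal vectors the antisymmetrised
    \<open>dcon\<close> is the curvature.\<close>
  have "dcon c (snd c q) v y - dcon c (snd c q) y v = dcon c (snd c q) v Y - dcon c (snd c q) Y v"
    unfolding y_def dcon_add[OF ca(1) xc] linear_add[OF dcon_linear[OF ca(1) xc]] using dcon_fundamental[OF cq vH, of "b t"] by simp
  also have "\<dots> = curvature P H q (pi_star P q v) (pi_star P q Y)"
    unfolding curvature_eq[OF cq] by (simp only: hlift_eqI[OF vH refl] hlift_eqI[OF YH refl])
  finally have "dcon c (snd c q) v y + con_rep c (snd c q) z =
      vector_derivative b (at t within I) + curvature P H q (pi_star P q v) (pi_star P q Y)"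
    using 1 by (simp add: algebra_simps)
  then show ?thesis
    unfolding var unfolding y unfolding \<gamma>t tangent_space_horizontal[OF vH cq] using base[OF t] \<gamma>t by (simp add: Y_def)
qed

lemma differential_L:
  assumes "c = chart_at Q (fst z)"
  shows "differential (TQ P) flat L z h = dL c (snd c (fst z), snd z) h"
proof -
  obtain q v where z: "z = (q, v)" by (cases z)
  show ?thesis
    using components_chart_at[OF Q, of q v] assms
    by (simp add: differential_def dL_def z tangent_bundle_simps tangent_chart_simps comp_def)
qed

text \<open>Linearity of the differential of \<open>L\<close> separates the increment of the
  variation into the pair for \<open>HL\<close>, where point and vector move together, and the pair
  for \<open>FL\<close>, which is purely along the fibre.\<close>

lemma differential_L_add_fundamental:
  assumes \<xi>: "generator Q I (fst \<circ> \<gamma>) \<xi>" and b: "smooth_on I b" and t: "t \<in> I"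
  defines "\<delta> \<equiv> variation Q I \<xi> t" and "\<delta>' \<equiv> variation Q I (\<lambda>t. (fst (\<xi> t), snd (\<xi> t) + fundamental P (b t) (fst (\<gamma> t)))) t"
  shows "differential (TQ P) flat L (fst \<delta>') (snd \<delta>') = differential (TQ P) flat L (fst \<delta>) (snd \<delta>) +
    (blinfun_apply (HL P H L (\<gamma> t)) (b t) + blinfun_apply (FL P L (\<gamma> t)) (vector_derivative b (at t within I)))"
proof -
  obtain q v where \<gamma>t: "\<gamma> t = (q, v)" by (cases "\<gamma> t")
  define c where "c = chart_at Q (fst (\<gamma> t))"
  have ca: "c \<in> atlas Q" "q \<in> fst c" unfolding c_def \<gamma>t using Q by (auto simp: chart_at_atlas chart_at_mem)
  have xc: "snd c q \<in> snd c ` fst c" using ca(2) by blast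
  have comp: "components Q c q v = v" unfolding c_def \<gamma>t using components_chart_at[OF Q] by simp
  have vH: "(q, v) \<in> H" using path_horizontal[OF t] \<gamma>t by simp
  obtain z where var: "variation Q I \<xi> t = (\<gamma> t, (snd (\<xi> t), z))"
    by (rule generator_variation[OF \<xi> t c_def])
  note var' = variation_add_fundamental[OF \<xi> b t c_def var]
  note lin = dL_linear[OF ca(1) xc, of v]
  let ?b' = "vector_derivative b (at t within I)" and ?x = "snd c q"
  have "dL c (?x, v) (snd (\<xi> t) + fund_rep c (b t) ?x, z + (frechet_derivative (fund_rep c (b t)) (at ?x) v + fund_rep c ?b' ?x)) =
      dL c (?x, v) (snd (\<xi> t), z) + (dL c (?x, v) (fund_rep c (b t) ?x, frechet_derivative (fund_rep c (b t)) (at ?x) v) +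
        dL c (?x, v) (0, fund_rep c ?b' ?x))"
    unfolding linear_add[OF lin, symmetric] by simp
  then show ?thesis
    unfolding \<delta>_def \<delta>'_def var var' fst_conv snd_conv differential_L[OF c_def]
    unfolding \<gamma>t fst_conv snd_conv HL_apply[OF ca vH] FL_apply[OF ca] comp .
qed

text \<open>\<open>l\<close> is the multiplier at a frozen time: a time-dependent Lagrangian is
  differentiated in its point of the tangent bundle only, so no derivative of the multiplier
  enters.\<close>

lemma differential_constrained_L:
  assumes c: "c = chart_at Q q"
  shows "differential (TQ P) flat (\<lambda>Z. L Z - blinfun_apply l (connection P H Z)) (q, v) (y, z) =
    differential (TQ P) flat L (q, v) (y, z) - blinfun_apply l (dcon c (snd c q) v y + con_rep c (snd c q) z)"
proof -
  let ?f = "\<lambda>Z. L Z - blinfun_apply l (connection P H Z)" and ?x = "snd c q" and ?k = "tangent_chart Q c"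
  have ca: "c \<in> atlas Q" "q \<in> fst c" unfolding c using Q by (auto simp: chart_at_atlas chart_at_mem)
  have xc: "?x \<in> snd c ` fst c" using ca(2) by blast
  have z0: "snd ?k (q, v) = (?x, v)" using components_chart_at[OF Q] by (simp add: tangent_chart_simps c)
  have 1: "((\<lambda>z. con_rep c (fst z) (snd z)) has_derivative (\<lambda>h. dcon c ?x v (fst h) + con_rep c ?x (snd h))) (at (?x, v))"
    using linear_family_product_rule[where A = "con_rep c" and x = fst and w = snd and t = "(?x, v)" and I = UNIV and x' = fst and w' = snd,
       OF fdQ chart_open[OF Q ca(1)] con_rep_linear[OF ca(1)] con_rep_smooth[OF ca(1)]] xc
    by (auto simp: dcon_def[abs_def] intro: derivative_intros bounded_linear_imp_has_derivative bounded_linear_fst bounded_linear_snd)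
  have 2: "((\<lambda>z. L_rep c z - blinfun_apply l (con_rep c (fst z) (snd z))) has_derivative
      (\<lambda>h. dL c (?x, v) h - blinfun_apply l (dcon c ?x v (fst h) + con_rep c ?x (snd h)))) (at (?x, v))"
    by (intro has_derivative_diff L_rep_has_derivative[OF ca(1) xc] bounded_linear.has_derivative[OF blinfun.bounded_linear_right] 1)
  have 3: "((\<lambda>w. ?f (chart_inv ?k w)) has_derivative
      (\<lambda>h. dL c (?x, v) h - blinfun_apply l (dcon c ?x v (fst h) + con_rep c ?x (snd h)))) (at (?x, v))"
  proof (rule has_derivative_transform_within_open[OF 2 L_rep_dom_open[OF ca(1)]])
    show "(?x, v) \<in> snd c ` fst c \<times> UNIV" using xc by simp
    fix w assume "w \<in> snd c ` fst c \<times> (UNIV :: 'e set)"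
    then show "L_rep c w - blinfun_apply l (con_rep c (fst w) (snd w)) = ?f (chart_inv ?k w)"
      using tangent_chart_inv[OF Q ca(1), of "fst w" "snd w"] by (cases w) auto
  qed
  have "differential (TQ P) flat ?f (q, v) (y, z) = frechet_derivative (\<lambda>w. ?f (chart_inv ?k w)) (at (?x, v)) (y, z)"
    unfolding differential_def using z0 by (simp add: tangent_bundle_simps c comp_def)
  also have "\<dots> = dL c (?x, v) (y, z) - blinfun_apply l (dcon c ?x v y + con_rep c ?x z)"
    using fun_cong[OF frechet_derivative_at[OF 3], of "(y, z)"] by simp
  finally show ?thesis using differential_L[of c "(q, v)"] c by simp
qed

text \<open>The summand \<open>0\<close> exhibits it as the zero generator with a vertical part
  added, so that the preceding lemmas apply literally.\<close>

abbreviation "vertical_generator b \<equiv> \<lambda>t. (fst (\<gamma> t), 0 + fundamental P (b t) (fst (\<gamma> t)))"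

lemma zero_generator: "generator Q I (fst \<circ> \<gamma>) (\<lambda>t. (fst (\<gamma> t), 0))"
  unfolding generator_def using zero_section_smooth[OF thI path_base] by simp

lemma vertical_generator:
  assumes "smooth_on I b" shows "generator Q I (fst \<circ> \<gamma>) (vertical_generator b)"
  using generator_add_fundamental[OF zero_generator assms] by simp

lemma zero_variation:
  assumes t: "t \<in> I" shows "variation Q I (\<lambda>t. (fst (\<gamma> t), 0)) t = (\<gamma> t, (0, 0))"
proof -
  define c where "c = chart_at Q (fst (\<gamma> t))"
  have ca: "c \<in> atlas Q" "fst (\<gamma> t) \<in> fst c" unfolding c_def using Q by (auto simp: chart_at_atlas chart_at_mem)
  obtain z where z: "variation Q I (\<lambda>t. (fst (\<gamma> t), 0)) t = (\<gamma> t, (0, z))"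
    "((\<lambda>s. components Q c (fst (\<gamma> s)) 0) has_vector_derivative z) (at t within I)"
    by (rule generator_variation[OF zero_generator t c_def], unfold fst_conv snd_conv) (rule that)
  obtain W where W: "open W" "t \<in> W" "\<And>s. s \<in> I \<Longrightarrow> s \<in> W \<Longrightarrow> fst (\<gamma> s) \<in> fst c"
    using smooth_map_flat_chart[OF finite_dim_real Q thI path_base t ca] by blast
  obtain \<delta> where \<delta>: "\<delta> > 0" "ball t \<delta> \<subseteq> W" using W open_contains_ball by blast
  have "((\<lambda>s. components Q c (fst (\<gamma> s)) 0) has_vector_derivative 0) (at t within I)"
    by (rule has_vector_derivative_transform_within[OF has_vector_derivative_const[of 0] \<delta>(1) t])
      (use W(3) \<delta>(2) linear_0[OF components_linear[OF Q ca(1)]] in \<open>auto simp: dist_commute subset_iff\<close>)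
  then have "z = 0" by (rule thick_vector_derivative_unique[OF thI t z(2)])
  then show ?thesis using z(1) by simp
qed

lemma vertical_differential_L:
  assumes b: "smooth_on I b" and t: "t \<in> I"
  defines "\<delta> \<equiv> variation Q I (vertical_generator b) t"
  shows "differential (TQ P) flat L (fst \<delta>) (snd \<delta>) =
    blinfun_apply (HL P H L (\<gamma> t)) (b t) + blinfun_apply (FL P L (\<gamma> t)) (vector_derivative b (at t within I))"
proof -
  define c where "c = chart_at Q (fst (\<gamma> t))"
  have ca: "c \<in> atlas Q" "fst (\<gamma> t) \<in> fst c" unfolding c_def using Q by (auto simp: chart_at_atlas chart_at_mem)
  have "linear (dL c (snd c (fst (\<gamma> t)), snd (\<gamma> t)))" using dL_linear[OF ca(1)] ca(2) by blast
  from linear_0[OF this] have "differential (TQ P) flat L (\<gamma> t) (0, 0) = 0"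
    unfolding differential_L[OF c_def] by (simp add: zero_prod_def)
  then show ?thesis
    using differential_L_add_fundamental[OF zero_generator b t] zero_variation[OF t] by (simp add: \<delta>_def)
qed

text \<open>For a vertical generator there is no curvature term, by \<open>dcon_fundamental\<close>:
  the derivative of \<omega> along the variation is the derivative of \<open>b\<close>. The
  multiplier thus merely shifts \<open>FL\<close> by \<open>l\<close>.\<close>

lemma vertical_differential_constrained_L:
  assumes b: "smooth_on I b" and t: "t \<in> I"
  defines "\<delta> \<equiv> variation Q I (vertical_generator b) t"
  shows "differential (TQ P) flat (\<lambda>Z. L Z - blinfun_apply l (connection P H Z)) (fst \<delta>) (snd \<delta>) =
    blinfun_apply (HL P H L (\<gamma> t)) (b t) + blinfun_apply (FL P L (\<gamma> t) - l) (vector_derivative b (at t within I))"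
proof -
  obtain q v where \<gamma>t: "\<gamma> t = (q, v)" by (cases "\<gamma> t")
  define c where "c = chart_at Q (fst (\<gamma> t))"
  have cq: "c = chart_at Q q" by (simp add: c_def \<gamma>t)
  have vH: "(q, v) \<in> H" using path_horizontal[OF t] \<gamma>t by simp
  obtain z where var: "variation Q I (vertical_generator b) t = (\<gamma> t, (snd (vertical_generator b t), z))"
    by (rule generator_variation[OF vertical_generator[OF b] t c_def])
  let ?y = "fundamental P (b t) q"
  have var': "variation Q I (vertical_generator b) t = ((q, v), (?y, z))" using var \<gamma>t by simp
  have "((\<lambda>s. connection P H (vertical_generator b s)) has_vector_derivative vector_derivative b (at t within I)) (at t within I)"
    using smooth_on_has_vector_derivative[OF b t] by (simp add: connection_fundamental)
  from thick_vector_derivative[OF thI t this] thick_vector_derivative[OF thI t connection_variation[OF vertical_generator[OF b] t c_def var]]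
  have "dcon c (snd c q) ?y v + con_rep c (snd c q) z = vector_derivative b (at t within I)" by (simp add: \<gamma>t)
  then have "dcon c (snd c q) v ?y + con_rep c (snd c q) z = vector_derivative b (at t within I)"
    using dcon_fundamental[OF cq vH] by simp
  then have "differential (TQ P) flat (\<lambda>Z. L Z - blinfun_apply l (connection P H Z)) (fst \<delta>) (snd \<delta>) =
     differential (TQ P) flat L (fst \<delta>) (snd \<delta>) - blinfun_apply l (vector_derivative b (at t within I))"
    unfolding \<delta>_def var' fst_conv snd_conv differential_constrained_L[OF cq] by simp
  then show ?thesis
    unfolding \<delta>_def vertical_differential_L[OF b t] by (simp add: blinfun.diff_left)
qed

lemma vertical_generator_ends:
  "b t0 = 0 \<Longrightarrow> b t1 = 0 \<Longrightarrow> snd (vertical_generator b t0) = 0 \<and> snd (vertical_generator b t1) = 0"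
  using linear_0[OF fundamental_linear] by simp

text \<open>One direction tests with vertical generators and extracts the equation by
  \<open>du_Bois_Reymond\<close>. For the other, a generator splits into a horizontal part, settled
  by the nonholonomic condition, and a vertical part, settled by the equation.\<close>

lemma nonholonomic_unconstrained_iff:
  assumes nh: "nonholonomic_extremal Q H t0 t1 (\<lambda>Z t. L Z) \<gamma>"
  shows "unconstrained_extremal Q t0 t1 (\<lambda>Z t. L Z) \<gamma> \<longleftrightarrow>
    (\<forall>t\<in>I. ((\<lambda>s. FL P L (\<gamma> s)) has_vector_derivative HL P H L (\<gamma> t)) (at t within I))"
proof
  assume un: "unconstrained_extremal Q t0 t1 (\<lambda>Z t. L Z) \<gamma>"
  show "\<forall>t\<in>I. ((\<lambda>s. FL P L (\<gamma> s)) has_vector_derivative HL P H L (\<gamma> t)) (at t within I)"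
  proof
    fix t assume t: "t \<in> I"
    show "((\<lambda>s. FL P L (\<gamma> s)) has_vector_derivative HL P H L (\<gamma> t)) (at t within I)"
    proof (rule du_Bois_Reymond[OF fdS t01 momentum_smooth _ t])
      fix \<beta> :: "real \<Rightarrow> 'h" assume \<beta>: "smooth_on I \<beta>" "\<beta> t0 = 0" "\<beta> t1 = 0"
      have 0: "action_variation Q I (\<lambda>Z t. L Z) (variation Q I (vertical_generator \<beta>)) = 0"
        using un vertical_generator[OF \<beta>(1)] vertical_generator_ends[OF \<beta>(2,3)] unfolding unconstrained_extremal_def by blast
      have "integral I (\<lambda>t. blinfun_apply (HL P H L (\<gamma> t)) (\<beta> t) +
          blinfun_apply (FL P L (\<gamma> t)) (vector_derivative \<beta> (at t within I))) =
        action_variation Q I (\<lambda>Z t. L Z) (variation Q I (vertical_generator \<beta>))"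
        unfolding action_variation_def by (rule integral_cong, rule vertical_differential_L[OF \<beta>(1), symmetric])
      then show "integral I (\<lambda>t. blinfun_apply (HL P H L (\<gamma> t)) (\<beta> t) +
          blinfun_apply (FL P L (\<gamma> t)) (vector_derivative \<beta> (at t within I))) = 0"
        unfolding 0 .
    qed
  qed
next
  assume EL: "\<forall>t\<in>I. ((\<lambda>s. FL P L (\<gamma> s)) has_vector_derivative HL P H L (\<gamma> t)) (at t within I)"
  show "unconstrained_extremal Q t0 t1 (\<lambda>Z t. L Z) \<gamma>"
    unfolding unconstrained_extremal_def
  proof (intro allI impI, elim conjE)
    fix \<xi> assume \<xi>: "generator Q I (fst \<circ> \<gamma>) \<xi>" and ends: "snd (\<xi> t0) = 0" "snd (\<xi> t1) = 0"
    have sm: "smooth_map flat I (TQ P) \<xi>" and base: "\<And>t. t \<in> I \<Longrightarrow> fst (\<xi> t) = fst (\<gamma> t)"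
      using \<xi> unfolding generator_def by auto
    define b where "b = (\<lambda>t. connection P H (\<xi> t))"
    have b: "smooth_on I b" unfolding b_def by (rule connection_smooth_curve[OF thI sm])
    have b0: "connection P H (\<xi> t) = 0" if "snd (\<xi> t) = 0" for t
      using linear_0[OF connection_linear, of "fst (\<xi> t)"] that by (metis prod.collapse)
    have bends: "b t0 = 0" "b t1 = 0" using b0 ends by (simp_all add: b_def)
    \<comment> \<open>The horizontal part of \<open>\<xi>\<close>. It is again an admissible test
      generator, because \<open>b = \<omega>(\<xi>)\<close> is smooth and vanishes at both
      ends.\<close>
    define \<eta> where "\<eta> = (\<lambda>t. (fst (\<xi> t), snd (\<xi> t) + fundamental P (- b t) (fst (\<gamma> t))))"
    have "smooth_on I (\<lambda>t. - b t)"
      by (rule smooth_on_bounded_linear[OF thI bounded_linear_minus[OF bounded_linear_ident] b])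
    then have \<eta>: "generator Q I (fst \<circ> \<gamma>) \<eta>" unfolding \<eta>_def by (rule generator_add_fundamental[OF \<xi>])
    have "\<eta> t \<in> H" if "t \<in> I" for t
      using connection_horizontal[of "snd (\<xi> t)" "fst (\<xi> t)"] base[OF that, symmetric]
      by (simp add: \<eta>_def b_def linear_neg[OF fundamental_linear])
    moreover have "snd (\<eta> t0) = 0" "snd (\<eta> t1) = 0"
      using ends bends linear_0[OF fundamental_linear] by (simp_all add: \<eta>_def)
    ultimately have 0: "action_variation Q I (\<lambda>Z t. L Z) (variation Q I \<eta>) = 0"
      using nh \<eta> unfolding nonholonomic_extremal_def by blast
    have \<xi>\<eta>: "\<xi> = (\<lambda>t. (fst (\<eta> t), snd (\<eta> t) + fundamental P (b t) (fst (\<gamma> t))))"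
      by (simp add: \<eta>_def linear_neg[OF fundamental_linear])
    let ?f = "\<lambda>t. differential (TQ P) flat L (fst (variation Q I \<eta> t)) (snd (variation Q I \<eta> t))"
    let ?g = "\<lambda>t. blinfun_apply (HL P H L (\<gamma> t)) (b t) + blinfun_apply (FL P L (\<gamma> t)) (vector_derivative b (at t within I))"
    have g: "(?g has_integral 0) I"
      by (rule Euler_Lagrange_integral_zero[OF t01 _ b bends]) (use EL in blast)
    have "action_variation Q I (\<lambda>Z t. L Z) (variation Q I \<xi>) = integral I (\<lambda>t. ?f t + ?g t)"
      unfolding action_variation_def
      by (rule integral_cong, subst (1 2) \<xi>\<eta>) (rule differential_L_add_fundamental[OF \<eta> b])
    also have "\<dots> = integral I ?f"
    \<comment> \<open>If \<open>?f\<close> is not integrable, neither is its sum with the integrable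
      \<open>?g\<close>, and both integrals take the default value \<open>0\<close>.\<close>
    proof (cases "?f integrable_on I")
      case True
      from integral_unique[OF has_integral_add[OF integrable_integral[OF True] g]] show ?thesis by simp
    next
      case False
      have "\<not> (\<lambda>t. ?f t + ?g t) integrable_on I"
      proof
        assume "(\<lambda>t. ?f t + ?g t) integrable_on I"
        from integrable_diff[OF this has_integral_integrable[OF g]] False show False by simp
      qed
      then show ?thesis using False by (simp add: not_integrable_integral)
    qed
    also have "\<dots> = 0" using 0 unfolding action_variation_def .
    finally show "action_variation Q I (\<lambda>Z t. L Z) (variation Q I \<xi>) = 0" .
  qed
qed

text \<open>A vakonomic extremal is unconstrained for the modified Lagrangian, so it may be tested
  with vertical generators; these see \<open>FL\<close> shifted by the multiplier. Differentiability
  of the shifted momentum is part of the conclusion of \<open>du_Bois_Reymond\<close>.\<close>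

lemma vakonomic_multiplier_equation:
  assumes lam: "smooth_on I lam" and vak: "vakonomic_extremal P H t0 t1 L lam \<gamma>" and t: "t \<in> I"
  shows "((\<lambda>s. FL P L (\<gamma> s) - lam s) has_vector_derivative HL P H L (\<gamma> t)) (at t within I)"
proof (rule du_Bois_Reymond[OF fdS t01 _ momentum_smooth(2) _ t])
  fix e
  have "smooth_on I (\<lambda>t. blinfun_apply (lam t) e)"
    by (rule smooth_on_bounded_linear[OF thI blinfun.bounded_linear_left lam])
  then show "smooth_on I (\<lambda>t. blinfun_apply (FL P L (\<gamma> t) - lam t) e)"
    unfolding blinfun.diff_left by (intro smooth_on_diff thI momentum_smooth)
next
  fix \<beta> :: "real \<Rightarrow> 'h" assume \<beta>: "smooth_on I \<beta>" "\<beta> t0 = 0" "\<beta> t1 = 0"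
  have 0: "action_variation Q I (\<lambda>Z t. L Z - blinfun_apply (lam t) (connection P H Z)) (variation Q I (vertical_generator \<beta>)) = 0"
    using vak vertical_generator[OF \<beta>(1)] vertical_generator_ends[OF \<beta>(2,3)]
    unfolding vakonomic_extremal_def unconstrained_extremal_def by blast
  have "integral I (\<lambda>t. blinfun_apply (HL P H L (\<gamma> t)) (\<beta> t) +
      blinfun_apply (FL P L (\<gamma> t) - lam t) (vector_derivative \<beta> (at t within I))) =
    action_variation Q I (\<lambda>Z t. L Z - blinfun_apply (lam t) (connection P H Z)) (variation Q I (vertical_generator \<beta>))"
    unfolding action_variation_def by (rule integral_cong, rule vertical_differential_constrained_L[OF \<beta>(1), symmetric])
  then show "integral I (\<lambda>t. blinfun_apply (HL P H L (\<gamma> t)) (\<beta> t) +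
      blinfun_apply (FL P L (\<gamma> t) - lam t) (vector_derivative \<beta> (at t within I))) = 0"
    unfolding 0 .
qed

end

theorem corollary4p11:
  fixes P :: "('q, 'e::banach, 'm, 'f::banach, 'g, 'h::banach) bundle_data"
    and H :: "('q \<times> 'e) set"
    and L :: "'q \<times> 'e \<Rightarrow> real"
    and t0 t1 :: real
  assumes "principal_bundle P"
    and "horizontal_distribution P H"
    and "smooth_map (TQ P) UNIV flat L"
    and "t0 < t1"
    and "G_invariant P H"
  shows "(\<forall>q X a. tensor_B P H q X a = 0) \<and>
    (\<forall>\<gamma>. horizontal_path P H {t0..t1} \<gamma> \<longrightarrow>
      (\<forall>\<eta> b. generator (total P) {t0..t1} (fst \<circ> \<gamma>) \<eta> \<and> (\<forall>t\<in>{t0..t1}. \<eta> t \<in> H) \<and>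
          smooth_on {t0..t1} b \<longrightarrow>
          (vakonomic_variation P H {t0..t1} \<gamma>
             (\<lambda>t. (fst (\<eta> t), snd (\<eta> t) + fundamental P (b t) (fst (\<gamma> t))))
           \<longleftrightarrow> (\<forall>t\<in>{t0..t1}. vector_derivative b (at t within {t0..t1}) +
                 curvature P H (fst (\<gamma> t)) (pi_star P (fst (\<gamma> t)) (snd (\<gamma> t)))
                   (pi_star P (fst (\<eta> t)) (snd (\<eta> t))) = 0))) \<and>
      (nonholonomic_extremal (total P) H t0 t1 (\<lambda>Z t. L Z) \<gamma> \<longrightarrow>
        (unconstrained_extremal (total P) t0 t1 (\<lambda>Z t. L Z) \<gamma> \<longleftrightarrow>
          (\<forall>t\<in>{t0..t1}. ((\<lambda>s. FL P L (\<gamma> s)) has_vector_derivative HL P H L (\<gamma> t))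
                          (at t within {t0..t1})))) \<and>
      (\<forall>lam. smooth_on {t0..t1} lam \<and> vakonomic_extremal P H t0 t1 L lam \<gamma> \<longrightarrow>
        (\<forall>t\<in>{t0..t1}. ((\<lambda>s. FL P L (\<gamma> s) - lam s) has_vector_derivative HL P H L (\<gamma> t))
                        (at t within {t0..t1}))))"
proof -
  interpret invariant_horizontal P H
    using assms(1,2,5) by unfold_locales
  show ?thesis
  proof (intro conjI allI impI)
    show "tensor_B P H q X a = 0" for q X a by (rule tensor_B_zero)
  next
    fix \<gamma> \<eta> :: "real \<Rightarrow> 'q \<times> 'e" and b :: "real \<Rightarrow> 'h"
    assume "horizontal_path P H {t0..t1} \<gamma>"
      and \<eta>: "generator (total P) {t0..t1} (fst \<circ> \<gamma>) \<eta> \<and> (\<forall>t\<in>{t0..t1}. \<eta> t \<in> H) \<and> smooth_on {t0..t1} b"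
    then interpret variational P H L t0 t1 \<gamma> using assms(3,4) by unfold_locales
    show "vakonomic_variation P H {t0..t1} \<gamma> (\<lambda>t. (fst (\<eta> t), snd (\<eta> t) + fundamental P (b t) (fst (\<gamma> t))))
           \<longleftrightarrow> (\<forall>t\<in>{t0..t1}. vector_derivative b (at t within {t0..t1}) +
                 curvature P H (fst (\<gamma> t)) (pi_star P (fst (\<gamma> t)) (snd (\<gamma> t)))
                   (pi_star P (fst (\<eta> t)) (snd (\<eta> t))) = 0)"
      unfolding vakonomic_variation_def using vakonomic_iff[of \<eta> b] \<eta> by simp
  next
    fix \<gamma> :: "real \<Rightarrow> 'q \<times> 'e"
    assume "horizontal_path P H {t0..t1} \<gamma>" and nh: "nonholonomic_extremal (total P) H t0 t1 (\<lambda>Z t. L Z) \<gamma>"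
    then interpret variational P H L t0 t1 \<gamma> using assms(3,4) by unfold_locales
    show "unconstrained_extremal (total P) t0 t1 (\<lambda>Z t. L Z) \<gamma> \<longleftrightarrow>
        (\<forall>t\<in>{t0..t1}. ((\<lambda>s. FL P L (\<gamma> s)) has_vector_derivative HL P H L (\<gamma> t)) (at t within {t0..t1}))"
      by (rule nonholonomic_unconstrained_iff[OF nh])
  next
    fix \<gamma> :: "real \<Rightarrow> 'q \<times> 'e" and lam :: "real \<Rightarrow> 'h \<Rightarrow>\<^sub>L real"
    assume "horizontal_path P H {t0..t1} \<gamma>"
      and lam: "smooth_on {t0..t1} lam \<and> vakonomic_extremal P H t0 t1 L lam \<gamma>"
    then interpret variational P H L t0 t1 \<gamma> using assms(3,4) by unfold_locales
    show "\<forall>t\<in>{t0..t1}. ((\<lambda>s. FL P L (\<gamma> s) - lam s) has_vector_derivative HL P H L (\<gamma> t)) (at t within {t0..t1})"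
      using vakonomic_multiplier_equation lam by blast
  qed
qed

end
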